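(* Let $(N^n,g)$ be a complete Riemannian manifold. Assume that: (1) $(N,g)$ has finite volume and the integral $\int_{SN}\mathrm{Ric}^-(p,\theta)\,d\mu_{SN}(p,\theta)$ is finite, where $\mathrm{Ric}^-(p,\theta)=\max\{-\mathrm{Ric}(p,\theta),0\}$ denotes the negative part of the Ricci curvature; (2) the average of the scalar curvature is at least $n(n-1)k$, where $k\in(0,\infty]$. Then either $\mathrm{conj}(N)=0$, or the average $\frac1{|N|}\int_N R\,d\mu_N$ (and hence $k$) is finite and $0<\mathrm{conj}(N)\le\frac{\pi}{\sqrt k}$. Moreover, for finite $k$, the conjugate radius equals $\frac{\pi}{\sqrt k}$ if and only if $N$ has constant sectional curvature $k$.
   Context: All Riemannian manifolds are complete, smooth and oriented, with smooth metric. $SN=\{(p,\theta):p\in N,\ \theta\in T_pN,\ |\theta|=1\}$ is the unit sphere bundle, with canonical measure $d\mu_{SN}=d\theta\,d\mu_N$, where $d\theta$ is the standard measure on $S_pN\cong\mathbb S^{n-1}$. $\mathrm{Ric}(p,\theta)=\mathrm{Ric}_p(\theta,\theta)$ for $\theta\in S_pN$. $R$ is the scalar curvature and $|N|$ the volume of $N$; the average of the scalar curvature is $\frac1{|N|}\int_N R\,d\mu_N$, which under hypothesis (1) exists in $(-\infty,\infty]$. The conjugate radius $\mathrm{conj}(N)$ is the supremum of all $r$ such that for any unit speed geodesic, any two conjugate points along it are at least $r$ units apart; equivalently, the supremum of all $r$ such that for every $p\in N$ the exponential map $\exp_p$ has nonsingular derivative at every point of the ball $B_0(r)\subset T_pN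$.
   Formalization: The dimension n is assumed to be at least 2; for n = 1 the claim fails, since a circle satisfies (1) and (2) for every finite k but has no conjugate points, so its conjugate radius is infinite. *)

theory Defs
  imports "HOL-Analysis.Analysis"
begin

section \<open>Smooth maps between open subsets of Euclidean spaces\<close>

text \<open>All sets \<open>U\<close> below are open whenever these predicates are used.\<close>

primrec Ck_on :: "nat \<Rightarrow> 'a::euclidean_space set \<Rightarrow> ('a \<Rightarrow> 'b::real_normed_vector) \<Rightarrow> bool" where
  "Ck_on 0 U f = continuous_on U f"
| "Ck_on (Suc k) U f =
     ((\<forall>x\<in>U. f differentiable (at x)) \<and>
      (\<forall>b\<in>Basis. Ck_on k U (\<lambda>x. frechet_derivative f (at x) b)))"

definition smooth_on :: "'a::euclidean_space set \<Rightarrow> ('a \<Rightarrow> 'b::real_normed_vector) \<Rightarrow> bool" where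
  "smooth_on U f \<longleftrightarrow> (\<forall>k. Ck_on k U f)"

section \<open>Oriented smooth manifolds\<close>

text \<open>
  A manifold of dimension \<open>CARD('n)\<close> is given by an oriented smooth atlas \<open>A\<close>; its underlying space
  is the union of the chart domains, with the topology induced from the ambient type, which makes
  it Hausdorff and second countable. A chart is a pair of a domain and a coordinate map; the
  values of the coordinate map outside the domain are irrelevant.
\<close>

type_synonym ('a, 'n) chart = "'a set \<times> ('a \<Rightarrow> real ^ 'n)"

abbreviation cdom :: "('a, 'n) chart \<Rightarrow> 'a set" where
  "cdom c \<equiv> fst c"

abbreviation cmap :: "('a, 'n) chart \<Rightarrow> 'a \<Rightarrow> real ^ 'n" where
  "cmap c \<equiv> snd c"

abbreviation cinv :: "('a, 'n) chart \<Rightarrow> real ^ 'n \<Rightarrow> 'a" where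
  "cinv c \<equiv> inv_into (cdom c) (cmap c)"

definition carrier :: "('a, 'n) chart set \<Rightarrow> 'a set" where
  "carrier A = (\<Union>c\<in>A. cdom c)"

definition transition :: "('a, 'n) chart \<Rightarrow> ('a, 'n) chart \<Rightarrow> real ^ 'n \<Rightarrow> real ^ 'n" where
  "transition c d = cmap d \<circ> cinv c"

definition oriented_smooth_atlas ::
  "('a::{t2_space, second_countable_topology}, 'n::finite) chart set \<Rightarrow> bool" where
  "oriented_smooth_atlas A \<longleftrightarrow>
     carrier A \<noteq> {} \<and>
     (\<forall>c\<in>A. openin (top_of_set (carrier A)) (cdom c) \<and> open (cmap c ` cdom c) \<and>
        homeomorphism (cdom c) (cmap c ` cdom c) (cmap c) (cinv c)) \<and>
     (\<forall>c\<in>A. \<forall>d\<in>A. smooth_on (cmap c ` (cdom c \<inter> cdom d)) (transition c d) \<and>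
        (\<forall>x\<in>cmap c ` (cdom c \<inter> cdom d).
           0 < det (matrix (frechet_derivative (transition c d) (at x)))))"

section \<open>Tangent vectors\<close>

text \<open>
  A tangent vector at \<open>p\<close> is the family of its coordinate vectors in all charts around \<open>p\<close>, related
  by the derivatives of the transition maps. The entries for all other charts are set to 0, so
  that the zero vector is \<open>\<lambda>_. 0\<close>.
\<close>

type_synonym ('a, 'n) tangent = "('a, 'n) chart \<Rightarrow> real ^ 'n"

definition tangent_space ::
  "('a, 'n::finite) chart set \<Rightarrow> 'a \<Rightarrow> ('a, 'n) tangent set" where
  "tangent_space A p = {v.
     (\<forall>c\<in>A. \<forall>d\<in>A. p \<in> cdom c \<inter> cdom d \<longrightarrow>
        v d = frechet_derivative (transition c d) (at (cmap c p)) (v c)) \<and>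
     (\<forall>c. \<not> (c \<in> A \<and> p \<in> cdom c) \<longrightarrow> v c = 0)}"

text \<open>The tangent vector at \<open>p\<close> whose coordinate vector in the chart \<open>c\<close> is \<open>\<xi>\<close>.\<close>

definition tvec ::
  "('a, 'n::finite) chart set \<Rightarrow> ('a, 'n) chart \<Rightarrow> 'a \<Rightarrow> real ^ 'n \<Rightarrow> ('a, 'n) tangent" where
  "tvec A c p \<xi> = (\<lambda>d. if d \<in> A \<and> p \<in> cdom d
     then frechet_derivative (transition c d) (at (cmap c p)) \<xi> else 0)"

section \<open>Riemannian metrics\<close>

type_synonym ('a, 'n) metric = "'a \<Rightarrow> ('a, 'n) tangent \<Rightarrow> ('a, 'n) tangent \<Rightarrow> real"

definition gram ::
  "('a, 'n::finite) chart set \<Rightarrow> ('a, 'n) metric \<Rightarrow> ('a, 'n) chart \<Rightarrow> real ^ 'n \<Rightarrow> real ^ 'n ^ 'n" where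
  "gram A g c x = (\<chi> i j. g (cinv c x)
     (tvec A c (cinv c x) (axis i 1)) (tvec A c (cinv c x) (axis j 1)))"

definition riemannian_metric ::
  "('a, 'n::finite) chart set \<Rightarrow> ('a, 'n) metric \<Rightarrow> bool" where
  "riemannian_metric A g \<longleftrightarrow>
     (\<forall>c\<in>A. \<forall>p\<in>cdom c. bilinear (\<lambda>\<xi> \<eta>. g p (tvec A c p \<xi>) (tvec A c p \<eta>))) \<and>
     (\<forall>p\<in>carrier A. \<forall>v\<in>tangent_space A p.
        (\<forall>w\<in>tangent_space A p. g p v w = g p w v) \<and> (v \<noteq> (\<lambda>_. 0) \<longrightarrow> 0 < g p v v)) \<and>
     (\<forall>c\<in>A. smooth_on (cmap c ` cdom c) (gram A g c))"

text \<open>A linear isometry from Euclidean space onto the tangent space at \<open>p\<close>.\<close>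

definition frame ::
  "('a, 'n::finite) chart set \<Rightarrow> ('a, 'n) metric \<Rightarrow> 'a \<Rightarrow> real ^ 'n \<Rightarrow> ('a, 'n) tangent" where
  "frame A g p = (SOME L. range L \<subseteq> tangent_space A p \<and>
     (\<forall>c. linear (\<lambda>\<xi>. L \<xi> c)) \<and> (\<forall>\<xi> \<eta>. g p (L \<xi>) (L \<eta>) = \<xi> \<bullet> \<eta>))"

section \<open>Levi-Civita connection and curvature\<close>

text \<open>
  In a chart, \<open>christoffel A g c x \<xi> \<eta>\<close> is the vector with components
  \<open>\<Sum>i j. \<Gamma>\<^sup>k\<^sub>i\<^sub>j \<xi>\<^sub>i \<eta>\<^sub>j\<close>, where
  \<open>\<Gamma>\<^sup>k\<^sub>i\<^sub>j = 1/2 \<Sum>l. g\<^sup>k\<^sup>l (\<partial>\<^sub>i g\<^sub>j\<^sub>l + \<partial>\<^sub>j g\<^sub>i\<^sub>l - \<partial>\<^sub>l g\<^sub>i\<^sub>j)\<close>.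
\<close>

definition christoffel ::
  "('a, 'n::finite) chart set \<Rightarrow> ('a, 'n) metric \<Rightarrow> ('a, 'n) chart \<Rightarrow>
    real ^ 'n \<Rightarrow> real ^ 'n \<Rightarrow> real ^ 'n \<Rightarrow> real ^ 'n" where
  "christoffel A g c x \<xi> \<eta> =
     (let dG = frechet_derivative (gram A g c) (at x) in
      matrix_inv (gram A g c x) *v
        (\<chi> l. (\<eta> \<bullet> (dG \<xi> *v axis l 1) + \<xi> \<bullet> (dG \<eta> *v axis l 1) - \<xi> \<bullet> (dG (axis l 1) *v \<eta>)) / 2))"

text \<open>
  The coordinate vector of \<open>R(\<xi>,\<eta>)\<zeta> = \<nabla>\<^sub>\<xi>\<nabla>\<^sub>\<eta>\<zeta> - \<nabla>\<^sub>\<eta>\<nabla>\<^sub>\<xi>\<zeta>\<close>, where the arguments are extended to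
  vector fields with constant coefficients (so that their Lie brackets vanish).
\<close>

definition curv_coord ::
  "('a, 'n::finite) chart set \<Rightarrow> ('a, 'n) metric \<Rightarrow> ('a, 'n) chart \<Rightarrow>
    real ^ 'n \<Rightarrow> real ^ 'n \<Rightarrow> real ^ 'n \<Rightarrow> real ^ 'n \<Rightarrow> real ^ 'n" where
  "curv_coord A g c x \<xi> \<eta> \<zeta> =
     frechet_derivative (\<lambda>y. christoffel A g c y \<eta> \<zeta>) (at x) \<xi>
     - frechet_derivative (\<lambda>y. christoffel A g c y \<xi> \<zeta>) (at x) \<eta>
     + christoffel A g c x \<xi> (christoffel A g c x \<eta> \<zeta>)
     - christoffel A g c x \<eta> (christoffel A g c x \<xi> \<zeta>)"

definition curvature ::
  "('a, 'n::finite) chart set \<Rightarrow> ('a, 'n) metric \<Rightarrow> 'a \<Rightarrow>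
    ('a, 'n) tangent \<Rightarrow> ('a, 'n) tangent \<Rightarrow> ('a, 'n) tangent \<Rightarrow> ('a, 'n) tangent" where
  "curvature A g p u v w = (\<lambda>c. if c \<in> A \<and> p \<in> cdom c
     then curv_coord A g c (cmap c p) (u c) (v c) (w c) else 0)"

definition sectional_curvature ::
  "('a, 'n::finite) chart set \<Rightarrow> ('a, 'n) metric \<Rightarrow> 'a \<Rightarrow>
    ('a, 'n) tangent \<Rightarrow> ('a, 'n) tangent \<Rightarrow> real" where
  "sectional_curvature A g p u v =
     g p (curvature A g p u v v) u / (g p u u * g p v v - (g p u v)\<^sup>2)"

text \<open>The Gram determinant is nonzero if and only if \<open>u\<close> and \<open>v\<close> span a plane.\<close>

definition constant_sectional_curvature ::
  "('a, 'n::finite) chart set \<Rightarrow> ('a, 'n) metric \<Rightarrow> real \<Rightarrow> bool" where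
  "constant_sectional_curvature A g \<kappa> \<longleftrightarrow>
     (\<forall>p\<in>carrier A. \<forall>u\<in>tangent_space A p. \<forall>v\<in>tangent_space A p.
        g p u u * g p v v - (g p u v)\<^sup>2 \<noteq> 0 \<longrightarrow> sectional_curvature A g p u v = \<kappa>)"

definition ricci ::
  "('a, 'n::finite) chart set \<Rightarrow> ('a, 'n) metric \<Rightarrow> 'a \<Rightarrow>
    ('a, 'n) tangent \<Rightarrow> ('a, 'n) tangent \<Rightarrow> real" where
  "ricci A g p v w =
     (\<Sum>i\<in>UNIV. g p (curvature A g p (frame A g p (axis i 1)) v w) (frame A g p (axis i 1)))"

definition scalar_curvature ::
  "('a, 'n::finite) chart set \<Rightarrow> ('a, 'n) metric \<Rightarrow> 'a \<Rightarrow> real" where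
  "scalar_curvature A g p =
     (\<Sum>i\<in>UNIV. ricci A g p (frame A g p (axis i 1)) (frame A g p (axis i 1)))"

section \<open>Geodesics, completeness and conjugate points\<close>

definition smooth_curve ::
  "('a::topological_space, 'n::finite) chart set \<Rightarrow> (real \<Rightarrow> 'a) \<Rightarrow> bool" where
  "smooth_curve A \<gamma> \<longleftrightarrow> range \<gamma> \<subseteq> carrier A \<and> continuous_on UNIV \<gamma> \<and>
     (\<forall>c\<in>A. smooth_on (\<gamma> -` cdom c) (cmap c \<circ> \<gamma>))"

definition velocity ::
  "('a, 'n::finite) chart set \<Rightarrow> (real \<Rightarrow> 'a) \<Rightarrow> real \<Rightarrow> ('a, 'n) tangent" where
  "velocity A \<gamma> t = (\<lambda>c. if c \<in> A \<and> \<gamma> t \<in> cdom c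
     then vector_derivative (cmap c \<circ> \<gamma>) (at t) else 0)"

definition smooth_field_along ::
  "('a, 'n::finite) chart set \<Rightarrow> (real \<Rightarrow> 'a) \<Rightarrow> (real \<Rightarrow> ('a, 'n) tangent) \<Rightarrow> bool" where
  "smooth_field_along A \<gamma> J \<longleftrightarrow> (\<forall>t. J t \<in> tangent_space A (\<gamma> t)) \<and>
     (\<forall>c\<in>A. smooth_on (\<gamma> -` cdom c) (\<lambda>t. J t c))"

definition cov_deriv ::
  "('a, 'n::finite) chart set \<Rightarrow> ('a, 'n) metric \<Rightarrow> (real \<Rightarrow> 'a) \<Rightarrow>
    (real \<Rightarrow> ('a, 'n) tangent) \<Rightarrow> real \<Rightarrow> ('a, 'n) tangent" where
  "cov_deriv A g \<gamma> J t = (\<lambda>c. if c \<in> A \<and> \<gamma> t \<in> cdom c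
     then vector_derivative (\<lambda>s. J s c) (at t)
        + christoffel A g c (cmap c (\<gamma> t)) (velocity A \<gamma> t c) (J t c)
     else 0)"

definition geodesic ::
  "('a::topological_space, 'n::finite) chart set \<Rightarrow> ('a, 'n) metric \<Rightarrow> (real \<Rightarrow> 'a) \<Rightarrow> bool" where
  "geodesic A g \<gamma> \<longleftrightarrow> smooth_curve A \<gamma> \<and> (\<forall>t. cov_deriv A g \<gamma> (velocity A \<gamma>) t = (\<lambda>_. 0))"

definition unit_speed ::
  "('a, 'n::finite) chart set \<Rightarrow> ('a, 'n) metric \<Rightarrow> (real \<Rightarrow> 'a) \<Rightarrow> bool" where
  "unit_speed A g \<gamma> \<longleftrightarrow> (\<forall>t. g (\<gamma> t) (velocity A \<gamma> t) (velocity A \<gamma> t) = 1)"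

definition geodesically_complete ::
  "('a::topological_space, 'n::finite) chart set \<Rightarrow> ('a, 'n) metric \<Rightarrow> bool" where
  "geodesically_complete A g \<longleftrightarrow> (\<forall>p\<in>carrier A. \<forall>v\<in>tangent_space A p.
     \<exists>\<gamma>. geodesic A g \<gamma> \<and> \<gamma> 0 = p \<and> velocity A \<gamma> 0 = v)"

definition jacobi_field ::
  "('a, 'n::finite) chart set \<Rightarrow> ('a, 'n) metric \<Rightarrow> (real \<Rightarrow> 'a) \<Rightarrow>
    (real \<Rightarrow> ('a, 'n) tangent) \<Rightarrow> bool" where
  "jacobi_field A g \<gamma> J \<longleftrightarrow> smooth_field_along A \<gamma> J \<and>
     (\<forall>t c. cov_deriv A g \<gamma> (cov_deriv A g \<gamma> J) t c
        + curvature A g (\<gamma> t) (J t) (velocity A \<gamma> t) (velocity A \<gamma> t) c = 0)"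

definition conjugate_along ::
  "('a, 'n::finite) chart set \<Rightarrow> ('a, 'n) metric \<Rightarrow> (real \<Rightarrow> 'a) \<Rightarrow> real \<Rightarrow> real \<Rightarrow> bool" where
  "conjugate_along A g \<gamma> a b \<longleftrightarrow> a \<noteq> b \<and>
     (\<exists>J. jacobi_field A g \<gamma> J \<and> J a = (\<lambda>_. 0) \<and> J b = (\<lambda>_. 0) \<and> (\<exists>t. J t \<noteq> (\<lambda>_. 0)))"

text \<open>
  Geodesics are parametrised by the whole real line, so this is the usual conjugate radius for
  complete metrics. The value is \<open>\<infinity>\<close> if there are no conjugate points.
\<close>

definition conjugate_radius ::
  "('a::topological_space, 'n::finite) chart set \<Rightarrow> ('a, 'n) metric \<Rightarrow> ereal" where
  "conjugate_radius A g = Sup {ereal r | r.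
     \<forall>\<gamma> a b. geodesic A g \<gamma> \<and> unit_speed A g \<gamma> \<and> conjugate_along A g \<gamma> a b \<longrightarrow> r \<le> \<bar>a - b\<bar>}"

section \<open>Volume, the unit sphere bundle and averages\<close>

text \<open>
  The volume measure is the unique Borel measure given in every chart by the density
  \<open>sqrt (det (g\<^sub>i\<^sub>j))\<close>.
\<close>

definition riemannian_volume ::
  "('a::topological_space, 'n::finite) chart set \<Rightarrow> ('a, 'n) metric \<Rightarrow> 'a measure" where
  "riemannian_volume A g = (THE \<mu>. sets \<mu> = sets (restrict_space borel (carrier A)) \<and>
     (\<forall>c\<in>A. \<forall>B\<in>sets \<mu>. B \<subseteq> cdom c \<longrightarrow>
        emeasure \<mu> B =
          (\<integral>\<^sup>+x. ennreal (sqrt (det (gram A g c x))) * indicator (cmap c ` B) x \<partial>lborel)))"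

text \<open>
  The standard surface measure of the Euclidean unit sphere: by polar coordinates, the surface
  measure of \<open>B\<close> is \<open>CARD('n)\<close> times the Lebesgue measure of the cone over \<open>B\<close> in the unit ball.
\<close>

definition sphere_measure :: "(real ^ 'n::finite) measure" where
  "sphere_measure = scale_measure (of_nat CARD('n))
     (distr (restrict_space lborel (cball 0 1 - {0})) (restrict_space borel (sphere 0 1)) sgn)"

definition unit_sphere_bundle ::
  "('a, 'n::finite) chart set \<Rightarrow> ('a, 'n) metric \<Rightarrow> ('a \<times> ('a, 'n) tangent) set" where
  "unit_sphere_bundle A g = {(p, v). p \<in> carrier A \<and> v \<in> tangent_space A p \<and> g p v v = 1}"

text \<open>
  The measure \<open>d\<theta> d\<mu>\<close> on the unit sphere bundle: the fibre over \<open>p\<close> is identified with the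
  Euclidean unit sphere by a linear isometry (the choice of which is immaterial by rotation
  invariance), and the \<open>\<sigma>\<close>-algebra is generated by the sets that are open in the bundle
  coordinates induced by a chart.
\<close>

definition sphere_bundle_measure ::
  "('a::topological_space, 'n::finite) chart set \<Rightarrow> ('a, 'n) metric \<Rightarrow>
    ('a \<times> ('a, 'n) tangent) measure" where
  "sphere_bundle_measure A g = measure_of (unit_sphere_bundle A g)
     {{(p, v) \<in> unit_sphere_bundle A g. p \<in> cdom c \<and> (cmap c p, v c) \<in> W} | c W. c \<in> A \<and> open W}
     (\<lambda>B. \<integral>\<^sup>+p. emeasure sphere_measure {\<xi> \<in> sphere 0 1. (p, frame A g p \<xi>) \<in> B} \<partial>riemannian_volume A g)"

definition ricci_neg ::
  "('a, 'n::finite) chart set \<Rightarrow> ('a, 'n) metric \<Rightarrow> 'a \<times> ('a, 'n) tangent \<Rightarrow> real" where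
  "ricci_neg A g = (\<lambda>(p, v). max (- ricci A g p v v) 0)"

text \<open>
  The integral of a real function whose negative part has finite integral, as a value in
  \<open>(-\<infinity>,\<infinity>]\<close>. It is meaningful only under that proviso.
\<close>

definition extended_integral :: "'a measure \<Rightarrow> ('a \<Rightarrow> real) \<Rightarrow> ereal" where
  "extended_integral M f =
     enn2ereal (\<integral>\<^sup>+x. ennreal (max (f x) 0) \<partial>M) - enn2ereal (\<integral>\<^sup>+x. ennreal (max (- f x) 0) \<partial>M)"

definition average_scalar_curvature ::
  "('a::topological_space, 'n::finite) chart set \<Rightarrow> ('a, 'n) metric \<Rightarrow> ereal" where
  "average_scalar_curvature A g =
     extended_integral (riemannian_volume A g) (scalar_curvature A g)
       / enn2ereal (emeasure (riemannian_volume A g) (carrier A))"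

end

theory Submission
 imports Defs
begin

text \<open>
 On a geodesic of length \<open>r\<close> without conjugate points, the index form of \<open>sin (pi t / r) E\<close> is nonnegative
 for every parallel \<open>E\<close> (Riccati comparison). Summing over a parallel frame orthogonal to the velocity bounds
 the average of \<open>Ric\<close> with weight \<open>sin\<^sup>2\<close>. The geodesic flow preserves the Liouville measure, so
 integrating over the unit ball bundle removes the weight and leaves the mean of \<open>Ric\<close>, which is
 a multiple of the scalar curvature integral. In the equality case every index form vanishes,
 so the sine fields are Jacobi fields and the curvature is constant.
\<close>

text \<open>Invariance under the flow is proved on the whole tangent bundle: in bundle coordinates
  the Liouville measure has density \<open>det (gr c x)\<close>, and the divergence of the geodesic
  field cancels the logarithmic derivative of this density. Orbits leave charts, so invariance is
  shown for vectors that stay in one chart for a short time and is then iterated with ever finer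
  time steps. The unit ball is preferred to the unit sphere because it is an invariant set of full
  dimension; after division by the squared speed \<open>Ric\<close> is homogeneous of degree 0, so
  that ball and sphere integrals are proportional.

  The positive part of \<open>Ric\<close> might have infinite integral. Both parts are therefore
  averaged separately as nonnegative functions, and finiteness of the positive one is a consequence
  of the bound.

  The comparison argument needs an interval shorter than \<open>r\<close>; the interval of length
  \<open>r\<close> itself, which the equality case requires, is reached by rescaling time. Equality
  holds only for almost every vector and gives the curvature only at positive times, so that
  continuity has to finish the argument.\<close>

abbreviation (input) hvd (infix "hvd" 50) where "(f hvd f') F \<equiv> (f has_vector_derivative f') F"
abbreviation (input) hfd (infix "hfd" 50) where "(f hfd f') F \<equiv> (f has_derivative f') F"
abbreviation (input) smul :: "real => 'a::real_vector => 'a" (infixr "*R" 75) where "a *R v \<equiv> a *\<^sub>R v"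
abbreviation (input) dot :: "'a::real_inner => 'a => real" (infix "dot" 70) where "x dot y \<equiv> inner x y"
abbreviation (input) em0 :: "'a measure => 'a set => ennreal" where "em0 \<equiv> emeasure"
abbreviation (input) rsp :: "'a measure => 'a set => 'a measure" where "rsp \<equiv> restrict_space"
abbreviation (input) chi :: "'a set => 'a => 'b::zero_neq_one" where "chi \<equiv> indicator"
abbreviation (input) cts :: "'a::topological_space set => ('a => 'b::topological_space) => bool" where "cts \<equiv> continuous_on"
abbreviation (input) Fd :: "('a::real_normed_vector => 'b::real_normed_vector) => 'a filter => 'a => 'b" where "Fd \<equiv> frechet_derivative"
abbreviation (input) bm :: "'a measure => ('a => 'b::topological_space) set" where "bm M \<equiv> borel_measurable M"
abbreviation (input) lbint :: "('a::euclidean_space => ennreal) => ennreal" (binder "LB " 10) where "lbint f \<equiv> nn_integral lborel f"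

section \<open>Calculus of \<open>k\<close> times continuously differentiable maps\<close>

lemma Ck_on_cong:
 fixes f g :: "'a::euclidean_space => 'b::real_normed_vector"
 assumes "open U"
 shows "Ck_on k U f ==> (!!x. x : U ==> f x = g x) ==> Ck_on k U g"
proof(induction k arbitrary: f g)
 case 0
 thus ?case
  by(simp add: continuous_on_cong[OF refl, of U f g])
next
 case (Suc k)
 have D: "(g hfd Fd f (at x)) (at x)" if "x : U" for x
  using Suc.prems that assms
  by(intro has_derivative_transform_within_open[of f _ x UNIV U g])
   (auto simp: frechet_derivative_works[symmetric])
 have "Fd g (at x) = Fd f (at x)" if "x : U" for x
  using frechet_derivative_at[OF D[OF that]] by simp
 hence "Ck_on k U (%x. Fd g (at x) b)" if "b : Basis" for b
  using Suc.IH[of "%x. Fd f (at x) b"] Suc.prems(1) that by simp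
 thus ?case
  using D unfolding Ck_on.simps differentiable_def by blast
qed

text \<open>\<open>Ck_on\<close> speaks of the chosen derivative \<open>frechet_derivative\<close>.
  This rule accepts any explicit derivative \<open>f'\<close> instead; uniqueness of derivatives on
  the open set \<open>U\<close> identifies the two.\<close>

lemma Ck_on_SucI:
 fixes f :: "'a::euclidean_space => 'b::real_normed_vector"
 assumes "open U" and D: "!!x. x : U ==> (f hfd f' x) (at x)"
  and "!!b. b : Basis ==> Ck_on k U (%x. f' x b)"
 shows "Ck_on (Suc k) U f"
proof -
 have "Fd f (at x) = f' x" if "x : U" for x
  using frechet_derivative_at[OF D[OF that]] by simp
 hence "Ck_on k U (%x. Fd f (at x) b)" if "b : Basis" for b
  using Ck_on_cong[OF assms(1) assms(3)[OF that]] by simp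
 thus ?thesis
  using D unfolding Ck_on.simps differentiable_def by blast
qed

lemma Ck_on_has_derivative:
 "Ck_on (Suc k) U f ==> x : U ==> (f hfd Fd f (at x)) (at x)"
 by(simp add: frechet_derivative_works)

lemma Ck_on_continuous: "Ck_on k U f ==> cts U f"
proof(cases k)
 case (Suc m)
 assume "Ck_on k U f"
 thus ?thesis
  using Suc by(auto intro!: continuous_at_imp_continuous_on differentiable_imp_continuous_within)
qed auto

lemma Ck_on_lower: "Ck_on (Suc k) U f ==> Ck_on k U f"
proof(induction k arbitrary: f)
 case 0
 thus ?case using Ck_on_continuous[OF 0] by simp
next
 case (Suc k)
 thus ?case by(metis Ck_on.simps(2))
qed

lemma Ck_on_subset: "Ck_on k U f ==> V <= U ==> Ck_on k V f"
proof(induction k arbitrary: f)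
 case 0
 thus ?case using continuous_on_subset by auto
qed auto

lemma Ck_on_const: "Ck_on k U (%_. c)"
 by(induction k arbitrary: c) auto

lemma Ck_on_bounded_linear_id:
 assumes "bounded_linear L" shows "Ck_on k U L"
proof(cases k)
 case 0
 thus ?thesis by(simp add: assms linear_continuous_on)
next
 case (Suc m)
 have "Fd L (at x) = L" for x
  using frechet_derivative_at[OF bounded_linear_imp_has_derivative[OF assms], of x] by simp
 thus ?thesis
  using Suc assms by(auto simp: Ck_on_const bounded_linear_imp_differentiable)
qed

lemma Ck_on_linear:
 assumes "bounded_linear L" and U: "open U"
 shows "Ck_on k U f ==> Ck_on k U (%x. L (f x))"
proof(induction k arbitrary: f)
 case 0
 thus ?case by(simp add: assms(1) bounded_linear.continuous_on)
next
 case (Suc k)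
 show ?case
  by(rule Ck_on_SucI[OF U bounded_linear.has_derivative[OF assms(1) Ck_on_has_derivative[OF Suc.prems]]])
   (use Suc in auto)
qed

lemma Ck_on_add:
 assumes U: "open U"
 shows "Ck_on k U f ==> Ck_on k U g ==> Ck_on k U (%x. f x + g x)"
proof(induction k arbitrary: f g)
 case 0
 thus ?case by(simp add: continuous_on_add)
next
 case (Suc k)
 show ?case
  by(rule Ck_on_SucI[OF U has_derivative_add[OF Ck_on_has_derivative[OF Suc.prems(1)]
   Ck_on_has_derivative[OF Suc.prems(2)]]]) (use Suc in auto)
qed

lemma Ck_on_minus: "open U ==> Ck_on k U f ==> Ck_on k U (%x. - f x)"
 by(rule Ck_on_linear[OF bounded_linear_minus[OF bounded_linear_ident]])

lemma Ck_on_diff: "open U ==> Ck_on k U f ==> Ck_on k U g ==> Ck_on k U (%x. f x - g x)"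
 using Ck_on_add[OF _ _ Ck_on_minus, of U k f g] by simp

lemma Ck_on_sum:
 "open U ==> (!!i. i : I ==> Ck_on k U (f i)) ==> Ck_on k U (%x. \<Sum>i\<in>I. f i x)"
 by(induction I rule: infinite_finite_induct) (auto simp: Ck_on_const Ck_on_add)

lemma Ck_on_bilinear:
 assumes "bounded_bilinear B" and U: "open U"
 shows "Ck_on k U f ==> Ck_on k U g ==> Ck_on k U (%x. B (f x) (g x))"
proof(induction k arbitrary: f g)
 case 0
 thus ?case by(simp add: bounded_bilinear.continuous_on[OF assms(1)])
next
 case (Suc k)
 have "Ck_on k U f" "Ck_on k U g" using Suc.prems Ck_on_lower by blast+
 thus ?case
  using Suc
  by(intro Ck_on_SucI[OF U bounded_bilinear.FDERIV[OF assms(1)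
     Ck_on_has_derivative[OF Suc.prems(1)] Ck_on_has_derivative[OF Suc.prems(2)]]]
     Ck_on_add[OF U]) auto
qed

lemmas Ck_on_mult = Ck_on_bilinear[OF bounded_bilinear_mult]
lemmas Ck_on_inner = Ck_on_bilinear[OF bounded_bilinear_inner]
lemmas Ck_on_scaleR = Ck_on_bilinear[OF bounded_bilinear_scaleR]

lemma Ck_on_prod:
 fixes f :: "'i => 'a::euclidean_space => real"
 shows "open U ==> (!!i. i : I ==> Ck_on k U (f i)) ==> Ck_on k U (%x. \<Prod>i\<in>I. f i x)"
 by(induction I rule: infinite_finite_induct) (auto simp: Ck_on_const Ck_on_mult)

lemma linear_sum_Basis:
 assumes "linear D" shows "D v = (\<Sum>b\<in>Basis. (v dot b) *R D b)"
proof -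
 have "D v = D (\<Sum>b\<in>Basis. (v dot b) *R b)" by(simp add: euclidean_representation)
 also have "... = (\<Sum>b\<in>Basis. (v dot b) *R D b)"
  using assms by(simp add: linear_sum linear_scale)
 finally show ?thesis .
qed

text \<open>In the chain rule the argument of the derivative of \<open>f\<close> varies with the
  point. Expanding it over the basis leaves derivatives of \<open>f\<close> in fixed directions
  only, to which the induction hypothesis applies.\<close>

lemma Ck_on_compose:
 fixes f :: "'b::euclidean_space => 'c::real_normed_vector" and h :: "'a::euclidean_space => 'b"
 assumes U: "open U" and V: "open V" and hU: "!!x. x : U ==> h x : V"
 shows "Ck_on k V f ==> Ck_on k U h ==> Ck_on k U (%x. f (h x))"
proof(induction k arbitrary: f)
 case 0
 thus ?case using continuous_on_compose2[of V f U h] hU by auto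
next
 case (Suc k)
 have D: "((%x. f (h x)) hfd
  (%v. Fd f (at (h x)) (Fd h (at x) v))) (at x)" if "x : U" for x
  using has_derivative_compose[OF Ck_on_has_derivative[OF Suc.prems(2) that], of f]
   Ck_on_has_derivative[OF Suc.prems(1) hU[OF that]] by simp
 have "Ck_on k U (%x. Fd f (at (h x)) (Fd h (at x) b))"
  if b: "b : Basis" for b
 proof -
  have S: "Ck_on k U (%x. \<Sum>b'\<in>Basis. (Fd h (at x) b dot b') *R Fd f (at (h x)) b')"
  proof(intro Ck_on_sum[OF U] Ck_on_scaleR[OF U] Ck_on_inner[OF U] Ck_on_const)
   show "Ck_on k U (%x. Fd h (at x) b)" using Suc.prems b by simp
   show "Ck_on k U (%x. Fd f (at (h x)) b')" if "b' : Basis" for b'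
    using Suc.IH[of "%y. Fd f (at y) b'"] Suc.prems that Ck_on_lower by auto
  qed
  have lin: "linear (Fd f (at (h x)))" if "x : U" for x
   using Suc.prems(1) hU[OF that] linear_frechet_derivative by auto
  show ?thesis
   by(rule Ck_on_cong[OF U S]) (simp add: linear_sum_Basis[OF lin, symmetric])
 qed
 thus ?case using Ck_on_SucI[OF U D] by blast
qed

text \<open>The derivative is a smooth function of point and direction jointly, at the cost of one
  order of differentiability of \<open>f\<close>. This is the form in which tangent maps of
  transition maps and derivatives of the metric occur.\<close>

lemma Ck_on_frechet:
 fixes f :: "'b::euclidean_space => 'c::real_normed_vector" and h :: "'a::euclidean_space => 'b"
 assumes U: "open U" and V: "open V" and hU: "!!x. x : U ==> h x : V"
  and "Ck_on (Suc k) V f" "Ck_on k U h" "Ck_on k U w"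
 shows "Ck_on k U (%x. Fd f (at (h x)) (w x))"
proof -
 have S: "Ck_on k U (%x. \<Sum>b\<in>Basis. (w x dot b) *R Fd f (at (h x)) b)"
 proof(intro Ck_on_sum[OF U] Ck_on_scaleR[OF U] Ck_on_inner[OF U] Ck_on_const)
  show "Ck_on k U (%x. Fd f (at (h x)) b)" if "b : Basis" for b
   using Ck_on_compose[OF U V hU, where k=k and f="%y. Fd f (at y) b"] assms that by auto
 qed (use assms in auto)
 have lin: "linear (Fd f (at (h x)))" if "x : U" for x
  using assms(4) hU[OF that] linear_frechet_derivative by auto
 show ?thesis
  by(rule Ck_on_cong[OF U S]) (simp add: linear_sum_Basis[OF lin, symmetric])
qed

lemma Ck_on_inverse:
 fixes f :: "'a::euclidean_space => real"
 assumes U: "open U" and nz: "!!x. x : U ==> f x ~= 0"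
 shows "Ck_on k U f ==> Ck_on k U (%x. inverse (f x))"
proof(induction k)
 case 0
 thus ?case using nz by(auto intro: continuous_on_inverse)
next
 case (Suc k)
 show ?case
 proof(rule Ck_on_SucI[OF U Deriv.has_derivative_inverse[OF _ Ck_on_has_derivative[OF Suc.prems]]])
  fix b :: 'a assume b: "b : Basis"
  have "Ck_on k U (%x. Fd f (at x) b)" using Suc.prems b by simp
  moreover have "Ck_on k U (%x. inverse (f x))" using Suc Ck_on_lower by blast
  ultimately show "Ck_on k U (%x. - (inverse (f x)*Fd f (at x) b*inverse (f x)))"
   by(intro Ck_on_minus Ck_on_mult U)
 qed (use nz in auto)
qed

lemma Ck_on_divide:
 fixes f g :: "'a::euclidean_space => real"
 assumes "open U" "!!x. x : U ==> g x ~= 0" "Ck_on k U f" "Ck_on k U g"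
 shows "Ck_on k U (%x. f x/g x)"
 unfolding divide_inverse using assms by(intro Ck_on_mult Ck_on_inverse)

lemma Ck_on_nth:
 fixes f :: "'a::euclidean_space => ('b::euclidean_space)^'n"
 shows "open U ==> Ck_on k U f ==> Ck_on k U (%x. f x $ i)"
 by(rule Ck_on_linear[OF bounded_linear_vec_nth])

lemma Ck_on_vec:
 fixes f :: "'n::finite => 'a::euclidean_space => 'b::euclidean_space"
 assumes U: "open U" and "!!i. Ck_on k U (f i)"
 shows "Ck_on k U (%x. \<chi> i. f i x)"
proof -
 have bl: "bounded_linear (axis i :: 'b => 'b ^ 'n)" for i
  by(auto intro!: linearI simp: linear_conv_bounded_linear[symmetric] axis_def vec_eq_iff)
 have "(\<chi> i. f i x) = (\<Sum>i\<in>UNIV. axis i (f i x))" for x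
  by(simp add: vec_eq_iff axis_def if_distrib cong: if_cong)
 thus ?thesis
  using assms by(simp add: Ck_on_sum Ck_on_linear[OF bl])
qed

lemma Ck_on_det:
 fixes M :: "'a::euclidean_space => real^'n^'n"
 assumes U: "open U" and "Ck_on k U M"
 shows "Ck_on k U (%x. det (M x))"
 unfolding det_def using assms
 by(intro Ck_on_sum Ck_on_mult Ck_on_const Ck_on_prod Ck_on_nth)

lemma bounded_bilinear_mvmult: "bounded_bilinear ((*v) :: real^'n^'m => _)"
 unfolding bilinear_conv_bounded_bilinear[symmetric] bilinear_def
 by(auto intro!: linearI simp: matrix_vector_mult_def vec_eq_iff algebra_simps sum.distrib sum_distrib_left)

lemmas Ck_on_mvmult = Ck_on_bilinear[OF bounded_bilinear_mvmult]

lemma matrix_inv_inverse: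
 fixes M :: "real^'n^'n"
 assumes "det M ~= 0"
 shows "M ** matrix_inv M = mat 1" "matrix_inv M ** M = mat 1"
proof -
 have "EX B. M ** B = mat 1 & B ** M = mat 1"
  using assms by(simp add: invertible_det_nz[symmetric] invertible_def)
 from someI_ex[OF this] show "M ** matrix_inv M = mat 1" "matrix_inv M ** M = mat 1"
  by(simp_all add: matrix_inv_def)
qed

text \<open>Cramer's rule writes the solution as a quotient of determinants, so that smoothness of
  matrix inversion reduces to that of polynomials and of a nonvanishing denominator.\<close>

lemma matrix_inv_mult_cramer:
 fixes M :: "real^'n^'n"
 assumes "det M ~= 0"
 shows "matrix_inv M *v b = (\<chi> k. det (\<chi> i j. if j = k then b $ i else M $ i $ j)/det M)"
proof -
 have "M *v (matrix_inv M *v b) = b"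
  using assms by(simp add: matrix_vector_mul_assoc matrix_inv_inverse)
 thus ?thesis using cramer[OF assms] by blast
qed

lemma Ck_on_matrix_inv_mult:
 fixes M :: "'a::euclidean_space => real^'n^'n"
 assumes U: "open U" and "Ck_on k U M" "Ck_on k U b" and nz: "!!x. x : U ==> det (M x) ~= 0"
 shows "Ck_on k U (%x. matrix_inv (M x) *v b x)"
proof -
 have "Ck_on k U (%x. if j = l then b x $ i else M x $ i $ j)" for i j l
  using Ck_on_nth[OF U assms(3)] Ck_on_nth[OF U Ck_on_nth[OF U assms(2)]] by(cases "j = l") simp_all
 hence "Ck_on k U (%x. (\<chi> l. det (\<chi> i j. if j = l then b x $ i else M x $ i $ j)/det (M x)))"
  using assms by(intro Ck_on_vec Ck_on_divide Ck_on_det) auto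
 thus ?thesis
  by(rule Ck_on_cong[OF U]) (simp add: matrix_inv_mult_cramer nz)
qed

lemma Ck_on_vector_derivative:
 fixes f :: "real => 'b::real_normed_vector"
 assumes "open U" "!!t. t : U ==> (f hvd f' t) (at t)" "Ck_on k U f'"
 shows "Ck_on (Suc k) U f"
 by(rule Ck_on_SucI[OF assms(1) assms(2)[unfolded has_vector_derivative_def]])
  (use assms(3) in auto)

lemma Ck_on_vector_derivativeD:
 fixes f :: "real => 'b::real_normed_vector"
 assumes "Ck_on (Suc k) U f"
 shows "t : U ==> (f hvd vector_derivative f (at t)) (at t)"
  and "open U ==> Ck_on k U (%t. vector_derivative f (at t))"
proof -
 show D: "(f hvd vector_derivative f (at t)) (at t)" if "t : U" for t
  using assms that vector_derivative_works by auto
 have eq: "Fd f (at t) 1 = vector_derivative f (at t)" if "t : U" for t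
  using D[OF that] frechet_derivative_at[of f "%h. h *R vector_derivative f (at t)" t]
  by(metis has_vector_derivative_def scaleR_one)
 assume U: "open U"
 have "Ck_on k U (%t. Fd f (at t) 1)" using assms by simp
 thus "Ck_on k U (%t. vector_derivative f (at t))"
  by(rule Ck_on_cong[OF U]) (simp add: eq)
qed

lemma Ck_on_local:
 fixes f :: "'a::euclidean_space => 'b::real_normed_vector"
 assumes "!!x. x : U ==> EX V. open V & x : V & Ck_on k V f"
 shows "Ck_on k U f"
 using assms
proof(induction k arbitrary: f)
 case 0
 hence "continuous (at x) f" if "x : U" for x
  using that continuous_on_eq_continuous_at Ck_on_continuous by blast
 thus ?case by(simp add: continuous_at_imp_continuous_on)
next
 case (Suc k)
 have "f differentiable at x" if "x : U" for x
  using Suc.prems[OF that] by auto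
 moreover have "Ck_on k U (%x. Fd f (at x) b)" if b: "b : Basis" for b
  using Suc.IH[of "%x. Fd f (at x) b"] Suc.prems b by(metis Ck_on.simps(2))
 ultimately show ?case by simp
qed

section \<open>Gronwall's inequality and linear differential equations\<close>

text \<open>The norm is not differentiable where \<open>y\<close> vanishes. The estimate is
  therefore proved for the smooth function \<open>sqrt (y t dot y t + d\<^sup>2)\<close> with
  \<open>d > 0\<close>, and \<open>d\<close> tends to 0 at the end.\<close>

lemma gronwall:
 fixes y :: "real => 'a::real_inner"
 assumes ab: "a <= b" and L: "0 <= L" and e: "0 <= e"
  and y: "!!t. t : {a..b} ==> (y hvd y' t) (at t within {a..b})"
  and bd: "!!t. t : {a..b} ==> norm (y' t) <= L*norm (y t) + e"
 shows "norm (y b) <= (norm (y a) + e*(b - a))*exp (L*(b - a))"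
proof -
 have main: "norm (y b) <= (sqrt ((norm (y a))\<^sup>2 + d\<^sup>2) + e*(b - a))*exp (L*(b - a))" if d: "d > 0" for d
 proof -
  define u where "u = (%t. sqrt (y t dot y t + d\<^sup>2))"
  have pos: "0 < y t dot y t + d\<^sup>2" for t
   using d by(simp add: add_nonneg_pos)
  have u: "u t = sqrt ((norm (y t))\<^sup>2 + d\<^sup>2)" for t by(simp add: u_def power2_norm_eq_inner)
  have upos: "u t > 0" and un: "norm (y t) <= u t" for t
   using pos[of t] real_sqrt_sum_squares_ge1[of "norm (y t)" d] by(auto simp: u_def power2_norm_eq_inner)
  \<comment> \<open>With \<open>L = 0\<close> or \<open>e = 0\<close> this is the usual monotone
    quantity; the factor \<open>exp (- L*(t - a))\<close> is at most 1, so that subtracting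
    \<open>e*(t - a)\<close> absorbs the inhomogeneous term.\<close>
  define p where "p = (%t. u t*exp (- L*(t - a)) - e*(t - a))"
  have "p b <= p a"
  proof(cases "a = b")
   case False
   have cy: "cts {a..b} y"
    using y by(meson continuous_on_eq_continuous_within has_vector_derivative_continuous)
   have "EX q. (p has_real_derivative q) (at t) & q <= 0" if t: "a < t" "t < b" for t
   proof -
    have yt: "(y hvd y' t) (at t)"
     using y[of t] t at_within_Icc_at[of a t b] by auto
    have "((%t. y t dot y t + d\<^sup>2) has_real_derivative (y t dot y' t + y' t dot y t) + 0) (at t)"
     unfolding has_real_derivative_iff_has_vector_derivative
     by(intro has_vector_derivative_add has_vector_derivative_const
       bounded_bilinear.has_vector_derivative[OF bounded_bilinear_inner yt yt])
    from DERIV_chain2[OF DERIV_real_sqrt[OF pos] this]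
    have du: "(u has_real_derivative (y t dot y' t)/u t) (at t)"
     using upos[of t] by(simp add: u_def inner_commute field_simps)
    have "(p has_real_derivative
      ((y t dot y' t)/u t*exp (- L*(t - a)) - u t*L*exp (- L*(t - a)) - e)) (at t)"
     unfolding p_def by(auto intro!: derivative_eq_intros du)
    moreover have "(y t dot y' t)/u t*exp (- L*(t - a)) - u t*L*exp (- L*(t - a)) - e <= 0"
    proof -
     have "y t dot y' t <= norm (y t)*(L*norm (y t) + e)"
      using norm_cauchy_schwarz[of "y t" "y' t"] bd[of t] t
      by(smt (verit) atLeastAtMost_iff mult_left_mono norm_ge_zero)
     also have "... <= u t*(L*u t + e)"
      using un[of t] upos[of t] L e by(intro mult_mono add_mono mult_left_mono) auto
     finally have "(y t dot y' t)/u t <= L*u t + e"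
      using upos[of t] by(simp add: divide_le_eq mult.commute)
     hence "((y t dot y' t)/u t - u t*L)*exp (- L*(t - a)) <= e*exp (- L*(t - a))"
      by(intro mult_right_mono) (auto simp: algebra_simps)
     also have "... <= e*1"
      using L t e by(intro mult_left_mono) auto
     finally show ?thesis by(simp add: algebra_simps)
    qed
    ultimately show ?thesis by blast
   qed
   moreover have "cts {a..b} p"
    unfolding p_def u_def by(intro continuous_intros cy)
   ultimately show ?thesis
    using DERIV_nonpos_imp_decreasing_open[of a b p] ab by blast
  qed simp
  hence "u b*exp (- L*(b - a)) <= u a + e*(b - a)"
   by(simp add: p_def)
  hence "u b*exp (- L*(b - a))*exp (L*(b - a)) <= (u a + e*(b - a))*exp (L*(b - a))"
   by(intro mult_right_mono) auto
  hence "u b <= (u a + e*(b - a))*exp (L*(b - a))"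
   by(simp add: mult.assoc exp_add[symmetric])
  thus ?thesis using un[of b] u[of a] by simp
 qed
 have "((%d. (sqrt ((norm (y a))\<^sup>2 + d\<^sup>2) + e*(b - a))*exp (L*(b - a))) \<longlongrightarrow>
  (sqrt ((norm (y a))\<^sup>2 + 0\<^sup>2) + e*(b - a))*exp (L*(b - a))) (at_right 0)"
  by(intro tendsto_intros)
 moreover have "\<forall>\<^sub>F d in at_right 0. norm (y b) <= (sqrt ((norm (y a))\<^sup>2 + d\<^sup>2) + e*(b - a))*exp (L*(b - a))"
  by(rule eventually_mono[OF eventually_at_right_less]) (rule main)
 ultimately show ?thesis
  using tendsto_lowerbound[OF _ _ trivial_limit_at_right_real] by fastforce
qed

lemma linear_Basis_norm_le:
 assumes "linear (D :: 'a::euclidean_space => 'b::real_normed_vector)"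
 shows "norm (D x) <= (\<Sum>b\<in>Basis. norm (D b))*norm x"
proof -
 have "norm (D x) <= (\<Sum>b\<in>Basis. norm ((x dot b) *R D b))"
  unfolding linear_sum_Basis[OF assms, of x] by(rule norm_sum)
 also have "... <= (\<Sum>b\<in>Basis. norm x*norm (D b))"
  by(intro sum_mono) (auto intro!: mult_right_mono Basis_le_norm)
 finally show ?thesis by(simp add: sum_distrib_left mult.commute)
qed

lemma linear_family_bound:
 fixes B :: "real => 'a::euclidean_space => 'b::real_normed_vector"
 assumes "!!t. t : K ==> linear (B t)" "compact K" "!!b. b : Basis ==> cts K (%t. B t b)"
 obtains C where "C > 0" "!!t x. t : K ==> norm (B t x) <= C*norm x"
proof -
 have "cts K (%t. \<Sum>b\<in>Basis. norm (B t b))"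
  using assms by(intro continuous_intros) auto
 hence "bounded ((%t. \<Sum>b\<in>Basis. norm (B t b)) ` K)"
  using assms compact_continuous_image compact_imp_bounded by blast
 then obtain C where C: "C > 0" "!!t. t : K ==> norm (\<Sum>b\<in>Basis. norm (B t b)) <= C"
  unfolding bounded_pos by auto
 have "norm (B t x) <= C*norm x" if "t : K" for t x
  using linear_Basis_norm_le[OF assms(1)[OF that], of x] C(2)[OF that] mult_right_mono[of _ C "norm x"]
  by(smt (verit) norm_ge_zero real_norm_def)
 thus ?thesis using C that by blast
qed

lemma linear_family_continuous:
 fixes B :: "real => 'a::euclidean_space => 'b::real_normed_vector"
 assumes "!!t. t : K ==> linear (B t)" "!!b. b : Basis ==> cts K (%t. B t b)" "cts K y"
 shows "cts K (%t. B t (y t))"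
proof -
 have "cts K (%t. \<Sum>b\<in>Basis. (y t dot b) *R B t b)"
  using assms by(intro continuous_intros) auto
 thus ?thesis
  by(rule continuous_on_eq) (use assms(1) linear_sum_Basis in metis)
qed

lemma antiderivative_exists:
 fixes f :: "real => 'a::euclidean_space"
 assumes "cts UNIV f"
 shows "EX F. F s = 0 & (ALL t. (F hvd f t) (at t))"
proof -
 obtain F where F: "!!t. (F hvd f t) (at t)"
  using einterval_antiderivative[of "-\<infinity>" \<infinity> f] assms by(auto simp: continuous_on_eq_continuous_at)
 hence "((%t. F t - F s) hvd f t) (at t)" for t
  using has_vector_derivative_diff[OF F has_vector_derivative_const] by simp
 thus ?thesis by(intro exI[of _ "%t. F t - F s"]) auto
qed

text \<open>In the norm weighted by \<open>exp (2*C*\<bar>t\<bar>)\<close>, integration gains the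
  factor \<open>1/(2*C)\<close>. An operator of norm at most \<open>C\<close> followed by
  integration thus halves this norm, which makes the Picard series below geometric on every bounded
  interval, however long.\<close>

lemma antiderivative_bound:
 fixes F :: "real => 'a::euclidean_space"
 assumes F: "!!t. (F hvd f t) (at t)" "F 0 = 0"
  and b: "!!t. \<bar>t\<bar> <= T ==> norm (f t) <= c*exp (2*C*\<bar>t\<bar>)" and C: "C > 0" and t: "\<bar>t\<bar> <= T"
 shows "norm (F t) <= c/(2*C)*exp (2*C*\<bar>t\<bar>)"
proof -
 have c: "0 <= c" using order_trans[OF norm_ge_zero b[of 0]] t by simp
 have cF: "cts S F" for S
  using F(1) by(meson continuous_at_imp_continuous_on has_vector_derivative_continuous)
 have phi: "((%t. c/(2*C)*exp (2*C*t)) hvd c*exp (2*C * s)) (at s)" for s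
  unfolding has_real_derivative_iff_has_vector_derivative[symmetric]
  using C by(auto intro!: derivative_eq_intros)
 have cphi: "cts S (%t. c/(2*C)*exp (2*C*t))" for S
  by(intro continuous_intros)
 consider "t = 0" | "t > 0" | "t < 0" by linarith
 hence "norm (F t) <= c/(2*C)*exp (2*C*\<bar>t\<bar>) - c/(2*C)"
 proof cases
  case 1
  thus ?thesis using F by simp
 next
  case 2
  have "norm (F t - F 0) <= c/(2*C)*exp (2*C*t) - c/(2*C)*exp (2*C*0)"
  proof(rule differentiable_bound_general[OF 2 cF cphi F(1) phi])
   show "norm (f x) <= c*exp (2*C*x)" if "0 < x" "x < t" for x
    using b[of x] that t by simp
  qed
  thus ?thesis using 2 F by simp
 next
  case 3
  have G: "((%s. F (- s)) hvd - f (- s)) (at s)" for s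
   using vector_diff_chain_at[of uminus "-1" s F "f (- s)"] F(1)[of "-s"]
   by(simp add: o_def has_vector_derivative_minus has_vector_derivative_id)
  have cG: "cts S (%s. F (- s))" for S
   using G by(meson continuous_at_imp_continuous_on has_vector_derivative_continuous)
  have "norm (F (- (- t)) - F (- 0)) <= c/(2*C)*exp (2*C * - t) - c/(2*C)*exp (2*C*0)"
  proof(rule differentiable_bound_general[OF _ cG cphi G phi])
   show "norm (- f (- x)) <= c*exp (2*C*x)" if "0 < x" "x < - t" for x
    using b[of "- x"] that t by simp
  qed (use 3 in simp)
  thus ?thesis using 3 F by simp
 qed
 thus ?thesis using c C by(smt (verit) divide_nonneg_pos)
qed

text \<open>Picard iteration as a series: \<open>d 0\<close> is the constant initial value, and
  \<open>d (Suc n)\<close> is the antiderivative of \<open>B t (d n t)\<close> that vanishes at 0.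
  By linearity the sum is a fixed point of the integral equation.\<close>

lemma linear_ode_exists_0:
 fixes B :: "real => 'a::euclidean_space => 'a"
 assumes lin: "!!t. linear (B t)" and cont: "!!b. b : Basis ==> cts UNIV (%t. B t b)"
 shows "EX y. y 0 = v & (ALL t. (y hvd B t (y t)) (at t))"
proof -
 define P where "P = (%d F. F (0::real) = 0 & (ALL t. (F hvd B t (d t)) (at t)))"
 define d where "d = rec_nat (%_::real. v) (%_ d. SOME F. P d F)"
 have d0: "d 0 = (%_. v)" by(simp add: d_def)
 have dcS: "cts UNIV (d n) & P (d n) (d (Suc n))" for n
 proof(induction n)
  have ex: "P (d n) (d (Suc n))" if "cts UNIV (d n)" for n
   using antiderivative_exists[OF linear_family_continuous[OF lin cont that], of 0] someI_ex[of "P (d n)"]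
   by(simp add: d_def P_def)
  case 0
  show ?case using ex[of 0] by(simp add: d0)
  case (Suc n)
  hence "cts UNIV (d (Suc n))"
   unfolding P_def by(meson continuous_at_imp_continuous_on has_vector_derivative_continuous)
  thus ?case using ex by blast
 qed
 hence dS: "d (Suc n) 0 = 0" "(d (Suc n) hvd B t (d n t)) (at t)" for n t
  by(auto simp: P_def)
 \<comment> \<open>The termwise derivatives. The one of the constant term is 0, so the remaining
   ones are shifted by one index against \<open>d\<close>.\<close>
 define D where "D = (%n t. case n of 0 => 0 | Suc m => B t (d m t))"
 have dD: "(d n hvd D n t) (at t)" for n t
  by(cases n) (auto simp: d0 D_def dS)
 define y where "y = (%t. \<Sum>n. d n t)"
 have sol: "(y hvd B t (y t)) (at t)" for t
 proof -
  define T where "T = \<bar>t\<bar> + 1"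
  obtain C where C: "C > 0" "!!s x. s : {-T..T} ==> norm (B s x) <= C*norm x"
   using linear_family_bound[of "{-T..T}" B] lin cont continuous_on_subset by(metis compact_Icc subset_UNIV)
  have dn: "norm (d n s) <= norm v * (1/2)^n*exp (2*C*\<bar>s\<bar>)" if "\<bar>s\<bar> <= T" for n s
   using that
  proof(induction n arbitrary: s)
   case 0
   thus ?case using C(1) mult_left_mono[of 1 "exp (2*C*\<bar>s\<bar>)" "norm v"] by(simp add: d0)
  next
   case (Suc n)
   have "norm (B u (d n u)) <= (C*(norm v * (1/2)^n))*exp (2*C*\<bar>u\<bar>)" if "\<bar>u\<bar> <= T" for u
   proof -
    have "u : {- T..T}" using that by auto
    hence "norm (B u (d n u)) <= C*norm (d n u)" by(rule C(2))
    also have "... <= C*(norm v * (1/2)^n*exp (2*C*\<bar>u\<bar>))"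
     using Suc.IH[OF that] C(1) by(intro mult_left_mono) auto
    finally show ?thesis by(simp add: mult_ac)
   qed
   from antiderivative_bound[OF dS(2,1) this C(1) Suc.prems] show ?case using C(1) by simp
  qed
  define M where "M = norm v * exp (2*C*T)"
  have dM: "norm (d n s) <= M*(1/2)^n" if "\<bar>s\<bar> <= T" for n s
  proof -
   have "norm v * (1/2)^n*exp (2*C*\<bar>s\<bar>) <= norm v * (1/2)^n*exp (2*C*T)"
    using that C(1) by(intro mult_left_mono) auto
   thus ?thesis using dn[OF that, of n] by(simp add: M_def mult_ac)
  qed
  have sm: "summable (%n. d n s)" if "\<bar>s\<bar> <= T" for s
   by(rule summable_comparison_test'[OF summable_mult[OF summable_geometric[of "1/2"], of M], of 0])
    (use dM[OF that] in auto)
  have tail: "norm (y s - (\<Sum>i<n. d i s)) <= 2*M*(1/2)^n" if s: "\<bar>s\<bar> <= T" for s n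
  proof -
   have "y s - (\<Sum>i<n. d i s) = (\<Sum>i. d (i + n) s)"
    using suminf_minus_initial_segment[OF sm[OF s], of n] by(simp add: y_def)
   also have "norm \<dots> <= (\<Sum>i. M*(1/2)^n*(1/2)^i)"
   proof(rule norm_suminf_le)
    show "norm (d (i + n) s) <= M*(1/2)^n*(1/2)^i" for i
     using dM[OF s, of "i + n"] by(simp add: power_add mult_ac)
   qed (intro summable_mult summable_geometric, simp)
   also have "... = 2*M*(1/2)^n"
    using suminf_mult[OF summable_geometric[of "1/2::real"], of "M*(1/2)^n"]
    by(simp add: suminf_geometric)
   finally show ?thesis .
  qed
  have "EX g. ALL x:{-T<..<T}. (%n. d n x) sums (g x) &
    (g hfd (%h. h *R B x (y x))) (at x within {-T<..<T})"
  proof(rule has_derivative_series[of _ _ "%n x h. h *R D n x" _ 0])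
   show "(d n hfd (%h. h *R D n x)) (at x within {-T<..<T})" for n x
    using has_derivative_at_withinI[OF dD[of n x, unfolded has_vector_derivative_def]] .
   show "(%n. d n 0) sums (y 0)" unfolding y_def using sm[of 0] by(simp add: T_def summable_sums)
   fix e :: real assume e: "e > 0"
   have "(%n. C*(2*M*(1/2)^n)) \<longlonglongrightarrow> C*(2*M*0)"
    by(intro tendsto_intros LIMSEQ_realpow_zero) auto
   hence "\<forall>\<^sub>F n in sequentially. C*(2*M*(1/2)^n) < e"
    using e by(auto dest!: order_tendstoD(2))
   then obtain N where N: "!!n. n \<ge> N ==> C*(2*M*(1/2)^n) < e"
    unfolding eventually_sequentially by blast
   show "\<forall>\<^sub>F n in sequentially. ALL x:{-T<..<T}. ALL h. norm ((\<Sum>i<n. h *R D i x) - h *R B x (y x)) <= e*norm h"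
    unfolding eventually_sequentially
   \<comment> \<open>By the shift of index, \<open>Suc m\<close> derivatives sum to
     \<open>B x\<close> applied to the sum of the first \<open>m\<close> terms; hence the threshold
     \<open>Suc N\<close> instead of \<open>N\<close>.\<close>
   proof(intro exI[of _ "Suc N"] allI impI ballI)
    fix n x h assume n: "Suc N <= n" and x: "x : {-T<..<T}"
    then obtain m where m: "n = Suc m" "m \<ge> N" by(cases n) auto
    have "(\<Sum>i<n. D i x) = (\<Sum>i<m. B x (d i x))"
     unfolding m sum.lessThan_Suc_shift by(simp add: D_def)
    also have "... = B x (\<Sum>i<m. d i x)" using lin by(simp add: linear_sum)
    finally have "(\<Sum>i<n. h *R D i x) - h *R B x (y x) = - (h *R B x (y x - (\<Sum>i<m. d i x)))"
     using lin by(simp add: scaleR_sum_right[symmetric] linear_diff algebra_simps)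
    hence "norm ((\<Sum>i<n. h *R D i x) - h *R B x (y x)) = norm (B x (y x - (\<Sum>i<m. d i x)))*\<bar>h\<bar>"
     by simp
    also have "... <= (C*(2*M*(1/2)^m))*\<bar>h\<bar>"
     using C(2)[of x "y x - (\<Sum>i<m. d i x)"] tail[of x m] x C(1)
     by(intro mult_right_mono) (auto elim!: order_trans intro!: mult_left_mono)
    also have "... <= e*norm h" using N[OF m(2)] e by(intro mult_mono) auto
    finally show "norm ((\<Sum>i<n. h *R D i x) - h *R B x (y x)) <= e*norm h" .
   qed
  qed (auto simp: T_def)
  then obtain g where g: "!!x. x : {-T<..<T} ==> (%n. d n x) sums (g x)"
   "!!x. x : {-T<..<T} ==> (g hfd (%h. h *R B x (y x))) (at x within {-T<..<T})" by blast
  have tT: "t : {-T<..<T}" by(auto simp: T_def)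
  have "(g hfd (%h. h *R B t (y t))) (at t)"
   using g(2)[OF tT] tT at_within_open[of t "{-T<..<T}"] by auto
  thus ?thesis
   unfolding has_vector_derivative_def
   by(rule has_derivative_transform_within_open[OF _ _ tT]) (use g(1) in \<open>auto simp: y_def sums_iff\<close>)
 qed
 have "d n 0 = (if n = 0 then v else 0)" for n by(cases n) (auto simp: d0 dS)
 hence "(%n. d n 0) sums v" using sums_single[of 0 "%_. v"] by simp
 hence "y 0 = v" by(simp add: y_def sums_iff)
 thus ?thesis using sol by blast
qed

lemma has_vector_derivative_shift:
 assumes "(y hvd y') (at (a*t + b))"
 shows "((%t. y (a*t + b)) hvd a *R y') (at t)"
proof -
 have "((%t. a*t + b) hvd a) (at t)"
  unfolding has_real_derivative_iff_has_vector_derivative[symmetric] by(auto intro!: derivative_eq_intros)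
 from vector_diff_chain_at[OF this assms] show ?thesis by(simp add: o_def)
qed

lemma linear_ode_exists:
 fixes B :: "real => 'a::euclidean_space => 'a"
 assumes lin: "!!t. linear (B t)" and cont: "!!b. b : Basis ==> cts UNIV (%t. B t b)"
 shows "EX y. y s = v & (ALL t. (y hvd B t (y t)) (at t))"
proof -
 have "cts UNIV (%t. B (t + s) b)" if "b : Basis" for b
  by(rule continuous_on_compose2[OF cont[OF that]]) (auto intro!: continuous_intros)
 from linear_ode_exists_0[of "%t. B (t + s)", OF lin this] obtain y
  where y: "y 0 = v" "!!t. (y hvd B (t + s) (y t)) (at t)" by blast
 have "((%t. y (t - s)) hvd B t (y (t - s))) (at t)" for t
  using has_vector_derivative_shift[of y "B t (y (t - s))" 1 t "- s"] y(2)[of "t - s"] by simp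
 thus ?thesis using y(1) by(intro exI[of _ "%t. y (t - s)"]) auto
qed

section \<open>Derivatives of determinants and the change of variables formula\<close>

lemma det_row_derivative_sum:
 fixes A H :: "real^'n^'n"
 shows "(\<Sum>p | p permutes UNIV. of_int (sign p)*(\<Sum>i\<in>UNIV. H $ i $ p i*(\<Prod>j\<in>UNIV - {i}. A $ j $ p j)))
  = (\<Sum>i\<in>UNIV. det (\<chi> j. if j = i then H $ j else A $ j))"
proof -
 have "H $ i $ p i*(\<Prod>j\<in>UNIV - {i}. A $ j $ p j) = (\<Prod>j\<in>UNIV. (\<chi> j. if j = i then H $ j else A $ j) $ j $ p j)"
  for i and p :: "'n => 'n"
  by(subst prod.remove[of _ i]) (auto intro!: prod.cong)
 thus ?thesis
  by(simp add: det_def sum_distrib_left) (subst sum.swap, simp)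
qed

text \<open>Row \<open>k\<close> of \<open>Q ** A\<close> is a combination of the rows of
  \<open>A\<close>. In the determinant only the multiple of row \<open>k\<close> itself survives,
  with coefficient \<open>Q $ k $ k\<close>; these coefficients add up to the trace.\<close>

lemma det_rows_mult_sum:
 fixes A Q :: "real^'n^'n"
 shows "(\<Sum>i\<in>UNIV. det (\<chi> j. if j = i then (Q ** A) $ j else A $ j)) = trace Q*det A"
proof -
 have "(\<chi> j. if j = k then (Q ** A) $ j else A $ j) =
  (\<chi> i. if i = k then sum (%i. (Q $ k) $ i *s row i A) UNIV else row i A)" for k
  by(auto simp: vec_eq_iff matrix_matrix_mult_def row_def)
 thus ?thesis
  by(simp add: cramer_lemma_transpose trace_def sum_distrib_right)
qed

text \<open>Jacobi's formula. It is applied twice in the proof of invariance: to the derivative of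
  the flow and to the Gram matrix along an orbit.\<close>

lemma has_vector_derivative_det:
 fixes M :: "real => real^'n^'n"
 assumes "(M hvd (Q ** M t)) (at t within S)"
 shows "((%t. det (M t)) hvd (trace Q*det (M t))) (at t within S)"
proof -
 have c: "((%t. M t $ i $ j) hfd (%h. h*(Q ** M t) $ i $ j)) (at t within S)" for i j
  using has_derivative_compose[OF assms[unfolded has_vector_derivative_def]
    bounded_linear_imp_has_derivative[OF bounded_linear_compose[OF bounded_linear_vec_nth bounded_linear_vec_nth]], of i j]
  by simp
 have "((%t. det (M t)) hfd (%h. \<Sum>p | p permutes UNIV. of_int (sign p) *
   (\<Sum>i\<in>UNIV. h*(Q ** M t) $ i $ p i*(\<Prod>j\<in>UNIV - {i}. M t $ j $ p j)))) (at t within S)"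
  unfolding det_def by(intro has_derivative_sum has_derivative_mult_right has_derivative_prod c)
 also have "(%h. \<Sum>p | p permutes UNIV. of_int (sign p) *
   (\<Sum>i\<in>UNIV. h*(Q ** M t) $ i $ p i*(\<Prod>j\<in>UNIV - {i}. M t $ j $ p j))) =
   (%h. h *R (trace Q*det (M t)))"
  unfolding det_rows_mult_sum[symmetric] det_row_derivative_sum[symmetric]
  by(auto simp: sum_distrib_left mult_ac intro!: sum.cong)
 finally show ?thesis by(simp add: has_vector_derivative_def)
qed

text \<open>The change of variables theorem used below is stated for well-ordered index types. This
  copy of \<open>'n\<close> carries the order of its representing numbers, and results are
  transported along a bijection.\<close>

typedef 'n idx = "{..<CARD('n::finite)}"
 by(rule exI[of _ 0]) simp

instantiation idx :: (finite) wellorder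
begin

definition "i <= j \<longleftrightarrow> Rep_idx i <= Rep_idx (j :: 'a idx)"
definition "i < j \<longleftrightarrow> Rep_idx i < Rep_idx (j :: 'a idx)"

instance
proof
 fix x y z :: "'a idx"
 show "(x < y) = (x <= y & ~ y <= x)" by(simp add: less_eq_idx_def less_idx_def less_le_not_le)
 show "x <= x" by(simp add: less_eq_idx_def)
 show "x <= y ==> y <= z ==> x <= z" by(simp add: less_eq_idx_def)
 show "x <= y ==> y <= x ==> x = y" by(simp add: less_eq_idx_def Rep_idx_inject[symmetric])
 show "x <= y \<or> y <= x" by(simp add: less_eq_idx_def linear)
next
 fix P :: "'a idx => bool" and a
 assume step: "!!x. (!!y. y < x ==> P y) ==> P x"
 show "P a"
 proof(induction "Rep_idx a" arbitrary: a rule: less_induct)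
  case less
  show ?case by(rule step) (use less in \<open>simp add: less_idx_def\<close>)
 qed
qed

end

lemma bij_Rep_idx: "bij_betw (Rep_idx :: 'n::finite idx => nat) UNIV {..<CARD('n)}"
 unfolding bij_betw_def
 by(simp add: inj_on_def Rep_idx_inject type_definition.Rep_range[OF type_definition_idx])

instance idx :: (finite) finite
 by standard (simp add: bij_betw_finite[OF bij_Rep_idx])

lemma ex_bij_idx: "EX e :: 'n::finite idx => 'n. bij e"
proof -
 obtain h where "bij_betw h {0..<CARD('n)} (UNIV :: 'n set)"
  using ex_bij_betw_nat_finite[of "UNIV :: 'n set"] by auto
 thus ?thesis
  using bij_betw_trans[OF bij_Rep_idx, of h UNIV] by(auto simp: lessThan_atLeast0)
qed

text \<open>A bijection conjugates transpositions into transpositions, so the sign is unchanged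
  along the induction over products of transpositions.\<close>

lemma sign_conj:
 fixes e :: "'m::finite => 'n::finite" and p :: "'n => 'n"
 assumes e: "bij e" and p: "p permutes UNIV"
 shows "inv e o p o e permutes UNIV" "sign (inv e o p o e) = sign p"
proof -
 have inj: "inv e x = inv e y \<longleftrightarrow> x = y" for x y
  using bij_imp_bij_inv[OF e] by(simp add: bij_is_inj inj_eq)
 have "inv e o p o e permutes UNIV & sign (inv e o p o e) = sign p"
  using p finite_class.finite_UNIV
 proof(induction p rule: permutes_induct)
  case id
  have "inv e o id o e = id" using e by(simp add: bij_is_inj)
  thus ?case by(simp only: permutes_id sign_id simp_thms)
 next
  case (swap a b p)
  define q where "q = inv e o p o e"
  have q: "q permutes UNIV" "sign q = sign p" using swap(5) unfolding q_def by blast+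
  have eq: "inv e o (Transposition.transpose a b o p) o e = Transposition.transpose (inv e a) (inv e b) o q"
   by(rule ext) (simp add: q_def Transposition.transpose_def inj)
  have "permutation p" "permutation q"
   using permutes_imp_permutation[OF finite swap(4)] permutes_imp_permutation[OF finite q(1)] .
  moreover have "inv e a ~= inv e b" using swap(3) inj by simp
  moreover have "Transposition.transpose (inv e a) (inv e b) o q permutes UNIV"
   by(intro permutes_compose[OF q(1)] permutes_swap_id) auto
  ultimately show ?case
   unfolding eq using swap(3) q(2) by(simp add: sign_compose permutation_swap_id sign_swap_id del: o_apply)
 qed
 thus "inv e o p o e permutes UNIV" "sign (inv e o p o e) = sign p" by auto
qed

lemma det_reindex:
 fixes e :: "'m::finite => 'n::finite" and A :: "real^'n^'n"
 assumes e: "bij e"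
 shows "det (\<chi> i j. A $ e i $ e j :: real^'m^'m) = det A"
proof -
 have b: "bij_betw (%p. inv e o p o e) {p. p permutes UNIV} {p. p permutes UNIV}"
 proof(rule bij_betwI[of _ _ _ "%q. e o q o inv e"])
  show "(%p. inv e o p o e) : {p. p permutes UNIV} \<rightarrow> {p. p permutes UNIV}"
   using sign_conj(1)[OF e] by simp
  show "(%q. e o q o inv e) : {p. p permutes UNIV} \<rightarrow> {p. p permutes UNIV}"
   using sign_conj(1)[OF bij_imp_bij_inv[OF e]] inv_inv_eq[OF e] by simp
 qed (use e in \<open>simp_all add: fun_eq_iff bij_is_surj surj_f_inv_f inv_f_f bij_is_inj\<close>)
 have "det (\<chi> i j. A $ e i $ e j :: real^'m^'m)
   = (\<Sum>p | p permutes UNIV. of_int (sign (inv e o p o e))*(\<Prod>i\<in>UNIV. A $ e i $ e ((inv e o p o e) i)))"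
  unfolding det_def by(subst sum.reindex_bij_betw[OF b, symmetric]) simp
 also have "... = (\<Sum>p | p permutes UNIV. of_int (sign p)*(\<Prod>i\<in>UNIV. A $ i $ p i))"
 proof(rule sum.cong[OF refl])
  fix p :: "'n => 'n" assume p: "p : {p. p permutes UNIV}"
  have "(\<Prod>i\<in>UNIV. A $ e i $ e ((inv e o p o e) i)) = (\<Prod>i\<in>UNIV. A $ e i $ p (e i))"
   using e by(simp add: bij_is_surj surj_f_inv_f)
  also have "... = (\<Prod>i\<in>UNIV. A $ i $ p i)"
   using prod.reindex_bij_betw[of e UNIV UNIV "%i. A $ i $ p i"] e by simp
  finally show "of_int (sign (inv e o p o e))*(\<Prod>i\<in>UNIV. A $ e i $ e ((inv e o p o e) i)) =
    of_int (sign p)*(\<Prod>i\<in>UNIV. A $ i $ p i)"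
   using sign_conj(2)[OF e] p by simp
 qed
 finally show ?thesis by(simp add: det_def)
qed

definition reindex :: "('m::finite => 'n::finite) => real^'n => real^'m" where
 "reindex e x = (\<chi> i. x $ e i)"

lemma reindex_linear: "linear (reindex e)"
 by(auto intro!: linearI simp: reindex_def vec_eq_iff)

lemma reindex_inverse:
 assumes "bij e"
 shows "reindex (inv e) (reindex e x) = x" "reindex e (reindex (inv e) y) = y"
 using assms by(auto simp: reindex_def vec_eq_iff bij_is_surj surj_f_inv_f inv_f_f bij_is_inj)

lemma reindex_measurable: "reindex e : bm borel"
 by(intro borel_measurable_continuous_onI linear_continuous_on)
  (simp add: linear_conv_bounded_linear[symmetric] reindex_linear)

lemma distr_reindex:
 fixes e :: "'m::finite => 'n::finite"
 assumes e: "bij e"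
 shows "distr lborel borel (reindex e) = lborel"
proof(rule lborel_eqI[symmetric])
 fix l u :: "real^'m" assume lu: "!!b. b : Basis ==> l dot b <= u dot b"
 have box: "reindex e -` box l u = box (reindex (inv e) l) (reindex (inv e) u)"
  using e by(auto simp: mem_box_cart reindex_def)
   (metis bij_inv_eq_iff, metis bij_inv_eq_iff, metis inv_f_f bij_is_inj, metis inv_f_f bij_is_inj)
 have pr: "(\<Prod>b\<in>Basis. x dot b) = (\<Prod>i\<in>UNIV. x $ i)" for x :: "real^'k::finite"
 proof -
  have "bij_betw (%i. axis i (1::real)) (UNIV :: 'k set) Basis"
   by(auto simp: bij_betw_def inj_on_def axis_eq_axis Basis_vec_def)
  from prod.reindex_bij_betw[OF this, of "%b. x dot b"] show ?thesis
   by(simp add: cart_eq_inner_axis)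
 qed
 have le: "reindex (inv e) l dot b <= reindex (inv e) u dot b" if "b : Basis" for b
 proof -
  obtain i where i: "b = axis i 1" using \<open>b : Basis\<close> by(auto simp: Basis_vec_def)
  show ?thesis using lu[of "axis (inv e i) 1"] by(simp add: i cart_eq_inner_axis[symmetric] reindex_def)
 qed
 have "em0 (distr lborel borel (reindex e)) (box l u) = em0 lborel (box (reindex (inv e) l) (reindex (inv e) u))"
  by(simp add: emeasure_distr reindex_measurable box)
 also have "... = (\<Prod>b\<in>Basis. (reindex (inv e) u - reindex (inv e) l) dot b)"
  using le by(simp add: emeasure_lborel_box_eq)
 also have "(\<Prod>b\<in>Basis. (reindex (inv e) u - reindex (inv e) l) dot b) = (\<Prod>i\<in>UNIV. (u - l) $ inv e i)"
  unfolding pr by(simp add: reindex_def)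
 also have "... = (\<Prod>i\<in>UNIV. (u - l) $ i)"
  using prod.reindex_bij_betw[of "inv e" UNIV UNIV "%i. (u - l) $ i"] e bij_imp_bij_inv by blast
 finally show "em0 (distr lborel borel (reindex e)) (box l u) = (\<Prod>b\<in>Basis. (u - l) dot b)"
  by(simp only: pr)
qed simp

text \<open>\<open>has_measure_differentiable_image\<close> is about finite measures. Either both
  sides are infinite, or one of them is finite; in that case the integral of the Jacobian exists and
  the finite theorem gives equality.\<close>

lemma emeasure_differentiable_image_wellorder:
 fixes g :: "real^'m::{finite,wellorder} => real^'m::_"
 assumes S: "S : sets borel" "g ` S : sets borel"
  and der: "!!x. x : S ==> (g hfd g' x) (at x within S)" and inj: "inj_on g S"
  and meas: "(%x. chi S x*\<bar>det (matrix (g' x))\<bar>) : bm borel"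
 shows "em0 lborel (g ` S) = (LB x. ennreal (chi S x*\<bar>det (matrix (g' x))\<bar>))" (is "?L = ?R")
proof -
 have Sl: "S : sets lebesgue" using S(1) by simp
 have fin: "?L = ?R" if "((%x. \<bar>det (matrix (g' x))\<bar>) has_integral m) S" for m
 proof -
  have "g ` S : lmeasurable" "measure lebesgue (g ` S) = m"
   using has_measure_differentiable_image[OF Sl der inj] that by auto
  hence "em0 lebesgue (g ` S) = ennreal m" by(simp add: emeasure_eq_measure2)
  hence "?L = ennreal m" using S(2) by simp
  moreover have "?R = ennreal m"
   using nn_integral_has_integral_lebesgue[OF _ that] by simp
  ultimately show ?thesis by simp
 qed
 show ?thesis
 proof(cases "?R = \<infinity> & ?L = \<infinity>")
  case False
  have "EX m. ((%x. \<bar>det (matrix (g' x))\<bar>) has_integral m) S"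
  proof(cases "?L = \<infinity>")
   case True
   hence "integrable lborel (%x. chi S x*\<bar>det (matrix (g' x))\<bar>)"
    using False meas by(intro integrableI_bounded) (auto simp: abs_mult less_top)
   hence "(%x. chi S x*\<bar>det (matrix (g' x))\<bar>) integrable_on UNIV"
    by(rule integrable_on_lborel)
   hence "(%x. \<bar>det (matrix (g' x))\<bar>) integrable_on S"
    by(subst integrable_restrict_UNIV[symmetric])
     (auto simp: indicator_def if_distrib cong: if_cong elim!: integrable_eq)
   thus ?thesis by(auto simp: integrable_on_def)
  next
   case L: False
   hence "g ` S : lmeasurable"
    using S(2) by(intro fmeasurableI) (auto simp: less_top)
   thus ?thesis using has_measure_differentiable_image[OF Sl der inj] by blast
  qed
  thus ?thesis using fin by blast
 qed simp
qed

lemma matrix_reindex_conj: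
 fixes e :: "'m::finite => 'n::finite" and D :: "real^'n => real^'n"
 assumes e: "bij e"
 shows "det (matrix (%y. reindex e (D (reindex (inv e) y)))) = det (matrix D)"
proof -
 have "reindex (inv e) (axis j 1) = axis (e j) 1" for j
  using e by(auto simp: reindex_def axis_def vec_eq_iff) (metis bij_inv_eq_iff)+
 hence "matrix (%y. reindex e (D (reindex (inv e) y))) = (\<chi> i j. matrix D $ e i $ e j)"
  by(simp add: matrix_def reindex_def vec_eq_iff)
 thus ?thesis using det_reindex[OF e] by simp
qed

text \<open>Relabelling the coordinates preserves Lebesgue measure and the determinant of a
  conjugated endomorphism, so the well-ordered case carries over to every finite index type.\<close>

lemma emeasure_differentiable_image:
 fixes g :: "real^'n::finite => real^'n"
 assumes S: "S : sets borel" "g ` S : sets borel"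
  and der: "!!x. x : S ==> (g hfd g' x) (at x within S)" and inj: "inj_on g S"
  and meas: "(%x. chi S x*\<bar>det (matrix (g' x))\<bar>) : bm borel"
 shows "em0 lborel (g ` S) = (LB x. ennreal (chi S x*\<bar>det (matrix (g' x))\<bar>))"
proof -
 obtain e :: "'n idx => 'n" where e: "bij e" using ex_bij_idx by blast
 define P where "P = reindex e"
 define Q where "Q = reindex (inv e)"
 have PQ[simp]: "P (Q y) = y" "Q (P x) = x" for x y using reindex_inverse[OF e] by(auto simp: P_def Q_def)
 have bl: "bounded_linear P" "bounded_linear Q"
  unfolding P_def Q_def using reindex_linear linear_conv_bounded_linear by blast+
 have Pm[measurable]: "P : bm borel" "Q : bm borel"
  by(auto simp: P_def Q_def reindex_measurable)
 have img: "P ` X = Q -` X" for X by(auto simp: image_iff) (metis PQ(1))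
 have PX: "P ` X : sets borel" if "X : sets borel" for X
  unfolding img using measurable_sets[OF Pm(2) that] by simp
 have eP: "em0 lborel (P ` X) = em0 lborel X" if "X : sets borel" for X
 proof -
  have "em0 lborel (P ` X) = em0 (distr lborel borel P) (P ` X)"
   using distr_reindex[OF e] by(simp add: P_def)
  also have "... = em0 lborel (P -` (P ` X))" using PX[OF that] by(simp add: emeasure_distr)
  also have "P -` (P ` X) = X" by(auto simp: image_iff) (metis PQ(2))
  finally show ?thesis .
 qed
 define h where "h = (%y. P (g (Q y)))"
 define h' where "h' = (%y v. P (g' (Q y) (Q v)))"
 have himg: "h ` (P ` S) = P ` (g ` S)" by(auto simp: h_def image_iff)
 have deth: "det (matrix (h' y)) = det (matrix (g' (Q y)))" for y
  using matrix_reindex_conj[OF e] unfolding h'_def P_def Q_def .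
 have ind: "chi (P ` S) y = (chi S (Q y) :: real)" for y
  by(auto simp: indicator_def img)
 have "em0 lborel (h ` (P ` S)) = (LB y. ennreal (chi (P ` S) y*\<bar>det (matrix (h' y))\<bar>))"
 proof(rule emeasure_differentiable_image_wellorder)
  show "P ` S : sets borel" "h ` (P ` S) : sets borel" using S PX himg by auto
  show "(h hfd h' y) (at y within P ` S)" if y: "y : P ` S" for y
  proof -
   have "(g hfd g' (Q y)) (at (Q y) within Q ` (P ` S))"
    using der y by(auto simp: image_image)
   from has_derivative_in_compose[OF bounded_linear_imp_has_derivative[OF bl(2)] this]
   have "((%y. g (Q y)) hfd (%v. g' (Q y) (Q v))) (at y within P ` S)" .
   from bounded_linear.has_derivative[OF bl(1) this] show ?thesis by(simp add: h_def h'_def)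
  qed
  show "inj_on h (P ` S)"
   using inj by(auto simp: inj_on_def h_def) (metis PQ(2))
  have "(%y. (%x. chi S x*\<bar>det (matrix (g' x))\<bar>) (Q y)) : bm borel"
   using measurable_compose[OF Pm(2) meas] by simp
  thus "(%y. chi (P ` S) y*\<bar>det (matrix (h' y))\<bar>) : bm borel"
   by(simp add: deth ind)
 qed
 also have "... = (\<integral>\<^sup>+y. ennreal (chi (P ` S) y*\<bar>det (matrix (h' y))\<bar>) \<partial>distr lborel borel P)"
  using distr_reindex[OF e] by(simp add: P_def)
 also have "... = (LB x. ennreal (chi S x*\<bar>det (matrix (g' x))\<bar>))"
  using measurable_compose[OF Pm(2) meas] by(subst nn_integral_distr) (simp_all add: deth ind)
 finally show ?thesis using eP[OF S(2)] himg by simp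
qed

lemma nn_integral_change_of_variables:
 fixes g :: "real^'n::finite => real^'n"
 assumes U: "open U" and der: "!!x. x : U ==> (g hfd g' x) (at x)" and inj: "inj_on g U"
  and meas: "(%x. det (matrix (g' x))) : bm (rsp borel U)"
  and img: "!!B. B : sets borel ==> B <= U ==> g ` B : sets borel"
  and F: "F : bm borel"
 shows "(LB y. F y*chi (g ` U) y)
  = (LB x. F (g x)*ennreal \<bar>det (matrix (g' x))\<bar> * chi U x)"
proof -
 have Ub[measurable]: "U : sets borel" using U by simp
 have gU[measurable]: "g ` U : sets borel" using img[OF Ub order_refl] .
 define d where "d = (%x. chi U x*\<bar>det (matrix (g' x))\<bar>)"
 \<comment> \<open>\<open>g\<close> is only controlled on \<open>U\<close>. Its extension by 0 is
   Borel on the whole space, and the density \<open>d\<close> vanishes where the extension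
   matters.\<close>
 define h where "h = (%x. if x : U then g x else 0)"
 have "(%x. chi U x *R det (matrix (g' x))) : bm borel"
  using meas by(subst (asm) borel_measurable_restrict_space_iff) simp_all
 from borel_measurable_abs[OF this] have dm[measurable]: "d : bm borel"
  by(simp add: d_def abs_mult)
 have "cts U g"
  using der by(meson continuous_at_imp_continuous_on has_derivative_continuous)
 hence hm[measurable]: "h : bm borel"
  unfolding h_def using borel_measurable_continuous_on_if[OF Ub, of g "%_. 0"] by simp
 have eq: "distr (density lborel d) borel h = density lborel (chi (g ` U))"
 proof(rule measure_eqI)
  fix B assume "B : sets (distr (density lborel d) borel h)"
  hence B[measurable]: "B : sets borel" by simp
  define S where "S = U Int h -` B"
  have S[measurable]: "S : sets borel" unfolding S_def using measurable_sets[OF hm B] by simp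
  have SU: "S <= U" by(auto simp: S_def)
  have gS: "g ` S = B Int g ` U" by(auto simp: S_def h_def)
  have "em0 (distr (density lborel d) borel h) B = (LB x. d x*chi (h -` B) x)"
   by(simp add: emeasure_distr emeasure_density measurable_sets_borel[OF hm])
    (auto intro!: nn_integral_cong simp: indicator_def)
  also have "... = (LB x. ennreal (chi S x*\<bar>det (matrix (g' x))\<bar>))"
   by(intro nn_integral_cong) (auto simp: S_def d_def indicator_def)
  also have "... = em0 lborel (g ` S)"
  proof(rule emeasure_differentiable_image[symmetric])
   show "(g hfd g' x) (at x within S)" if "x : S" for x
    using der SU that has_derivative_at_withinI by blast
   have "(%x. chi S x*d x) : bm borel" by measurable
   also have "(%x. chi S x*d x) = (%x. chi S x*\<bar>det (matrix (g' x))\<bar>)"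
    using SU by(auto simp: d_def fun_eq_iff indicator_def)
   finally show "(%x. chi S x*\<bar>det (matrix (g' x))\<bar>) : bm borel" .
  qed (use img SU inj in \<open>auto intro: inj_on_subset\<close>)
  also have "... = (LB x. chi (B Int g ` U) x)" unfolding gS by simp
  also have "... = (LB x. chi (g ` U) x*chi B x)"
   by(intro nn_integral_cong) (auto simp: indicator_def)
  also have "... = em0 (density lborel (chi (g ` U))) B"
   by(simp add: emeasure_density)
  finally show "em0 (distr (density lborel d) borel h) B = em0 (density lborel (chi (g ` U))) B" .
 qed simp
 have "(LB y. F y*chi (g ` U) y) = (\<integral>\<^sup>+y. F y \<partial>density lborel (chi (g ` U)))"
  using F by(subst nn_integral_density) (auto simp: mult.commute)
 also have "... = (LB x. d x*F (h x))"
  unfolding eq[symmetric] using F by(subst nn_integral_distr) (auto simp: nn_integral_density)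
 also have "... = (LB x. F (g x)*ennreal \<bar>det (matrix (g' x))\<bar> * chi U x)"
  by(intro nn_integral_cong) (auto simp: d_def h_def indicator_def mult.commute)
 finally show ?thesis .
qed

section \<open>Dependence of solutions on their initial values\<close>

text \<open>Compactness of the arc makes all estimates uniform in time: one radius, one Lipschitz
  constant, and one modulus for the linearisation error. Increments are always measured from a point
  of the arc, so convexity of the single balls is enough for the mean value inequality.\<close>

lemma flow_tube:
 fixes X :: "'a::euclidean_space => 'a" and DX :: "'a => 'a \<Rightarrow>\<^sub>L 'a" and z :: "real => 'a"
 assumes Om: "open Om" and X: "!!x. x : Om ==> (X hfd DX x) (at x)"
  and DX: "cts Om DX" and z: "cts {0..T} z" "z ` {0..T} <= Om" and T: "0 <= T"
 obtains r L where "r > 0" "L > 0" "compact (\<Union>s\<in>{0..T}. cball (z s) r)" "(\<Union>s\<in>{0..T}. cball (z s) r) <= Om"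
  "ALL s:{0..T}. ALL u:cball (z s) r. norm (X u - X (z s)) <= L*norm (u - z s)"
  "ALL s:{0..T}. norm (DX (z s)) <= L"
  "ALL e>0. EX d>0. ALL s:{0..T}. ALL u:cball (z s) d. norm (X u - X (z s) - DX (z s) (u - z s)) <= e*norm (u - z s)"
proof -
 have K: "compact (z ` {0..T})" using z(1) by(intro compact_continuous_image) auto
 obtain r0 where r0: "r0 > 0" "(\<Union>x\<in>z ` {0..T}. ball x r0) <= Om"
  using compact_subset_open_imp_ball_epsilon_subset[OF K Om z(2)] by blast
 define r where "r = r0/2"
 have r: "r > 0" "!!s. cball (z s) r <= ball (z s) r0" using r0(1) by(auto simp: r_def)
 define N where "N = (\<Union>s\<in>{0..T}. cball (z s) r)"
 \<comment> \<open>A sum of two compact sets; this form yields compactness of the tube.\<close>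
 have N1: "N = {x + y | x y. x : z ` {0..T} & y : cball 0 r}"
 proof(intro set_eqI iffI)
  fix x assume "x : N"
  then obtain s where s: "s : {0..T}" "dist (z s) x <= r" by(auto simp: N_def)
  hence "x = z s + (x - z s)" "x - z s : cball 0 r" by(auto simp: dist_norm norm_minus_commute)
  thus "x : {x + y | x y. x : z ` {0..T} & y : cball 0 r}" using s by blast
 next
  fix x assume "x : {x + y | x y. x : z ` {0..T} & y : cball 0 r}"
  then obtain s y where "s : {0..T}" "y : cball 0 r" "x = z s + y" by auto
  thus "x : N" unfolding N_def by(intro UN_I[of s]) (auto simp: dist_norm)
 qed
 have Nc: "compact N" unfolding N1 by(intro compact_sums K compact_cball)
 have NO: "N <= Om" using r0(2) r(2) by(auto simp: N_def)
 have DN: "cts N DX" using DX NO continuous_on_subset by blast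
 have "bounded (DX ` N)" using compact_continuous_image[OF DN Nc] compact_imp_bounded by blast
 then obtain L where L: "L > 0" "!!x. x : N ==> norm (DX x) <= L"
  unfolding bounded_pos by auto
 have zN: "cball (z s) r <= N" if "s : {0..T}" for s using that by(auto simp: N_def)
 have zN': "z s : N" if "s : {0..T}" for s using zN[OF that] r(1) by auto
 have lip: "norm (X u - X (z s)) <= L*norm (u - z s)" if s: "s : {0..T}" and u: "u : cball (z s) r" for s u
 proof(rule differentiable_bound[of "cball (z s) r" X "%x. blinfun_apply (DX x)"])
  show "(X hfd DX x) (at x within cball (z s) r)" if "x : cball (z s) r" for x
   by(rule has_derivative_at_withinI[OF X]) (use that zN[OF s] NO in blast)
  show "onorm (DX x) <= L" if "x : cball (z s) r" for x
   using L(2)[of x] that zN[OF s] by(auto simp: norm_blinfun.rep_eq)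
 qed (use u r in auto)
 have lin: "EX d>0. ALL s:{0..T}. ALL u:cball (z s) d. norm (X u - X (z s) - DX (z s) (u - z s)) <= e*norm (u - z s)"
  if e: "e > 0" for e
 proof -
  have "uniformly_continuous_on N DX" using compact_uniformly_continuous[OF DN Nc] .
  hence "EX d>0. ALL x:N. ALL y:N. dist y x < d --> dist (DX y) (DX x) < e"
   unfolding uniformly_continuous_on_def using e by simp
  then obtain d where d: "d > 0" "!!x y. x : N ==> y : N ==> dist y x < d ==> dist (DX y) (DX x) < e"
   by auto
  define d' where "d' = min r (d/2)"
  have d': "d' > 0" "d' <= r" "d' < d" using d(1) r(1) by(auto simp: d'_def)
  show ?thesis
  proof(intro exI[of _ d'] conjI ballI)
   fix s u assume s: "s : {0..T}" and u: "u : cball (z s) d'"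
   have sub: "cball (z s) d' <= N" using zN[OF s] d'(2) by(auto simp: subset_iff)
   have "norm (X u - X (z s) - DX (z s) (u - z s)) <= norm (u - z s)*e"
   proof(rule differentiable_bound_linearization[of "z s" u "cball (z s) d'" X "%x. blinfun_apply (DX x)" "z s" e])
    show "z s + t *R (u - z s) : cball (z s) d'" if "t : {0..1}" for t
    proof -
     have "\<bar>t\<bar> * norm (u - z s) <= 1*norm (u - z s)" using that by(intro mult_right_mono) auto
     thus ?thesis using u by(simp add: dist_norm norm_minus_commute)
    qed
    show "(X hfd DX x) (at x within cball (z s) d')" if "x : cball (z s) d'" for x
     by(rule has_derivative_at_withinI[OF X]) (use that sub NO in blast)
    show "onorm (blinfun_apply (DX x) - blinfun_apply (DX (z s))) <= e" if "x : cball (z s) d'" for x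
    proof -
     have "dist x (z s) < d" using that d'(3) by(simp add: dist_commute)
     hence "norm (DX x - DX (z s)) <= e"
      using d(2)[OF zN'[OF s] subsetD[OF sub that]] by(simp add: dist_norm)
     thus ?thesis by(simp add: norm_blinfun.rep_eq minus_blinfun.rep_eq fun_diff_def)
    qed
   qed (use d' in auto)
   thus "norm (X u - X (z s) - DX (z s) (u - z s)) <= e*norm (u - z s)" by(simp add: mult.commute)
  qed (use d' in auto)
 qed
 show ?thesis
  by(rule that[OF r(1) L(1), folded N_def, OF Nc NO]) (use lip L(2)[OF zN'] lin in simp_all)
qed

text \<open>A continuity argument. While \<open>y\<close> is in the tube, Gronwall bounds its
  distance from \<open>z\<close> by a quantity below \<open>r\<close>, so it cannot reach the
  boundary. \<open>G\<close> is the set of times at which \<open>y\<close> satisfies the equation.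
  For geodesics it consists of the times spent in a chart, and the hypothesis on limits says that
  the curve cannot leave the chart before it leaves the tube.\<close>

lemma flow_stay:
 fixes X :: "'a::euclidean_space => 'a" and y z :: "real => 'a"
 assumes L: "L > 0"
  and z: "!!s. s : {0..T} ==> (z hvd X (z s)) (at s within {0..T})"
  and lip: "!!s u. s : {0..T} ==> u : cball (z s) r ==> norm (X u - X (z s)) <= L*norm (u - z s)"
  and G: "open G" "0 : G" "!!s. s : G ==> (y hvd X (y s)) (at s)"
  and lim: "!!t. t : {0<..T} ==> (!!s. s : {0..<t} ==> s : G & y s : cball (z s) r) ==> t : G"
  and close: "norm (y 0 - z 0)*exp (L*T) < r" and t: "t : {0..T}"
 shows "t : G & norm (y t - z t) <= norm (y 0 - z 0)*exp (L*t)"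
proof -
 define good where "good = (%t. t : G & norm (y t - z t) < r)"
 have est: "norm (y t - z t) <= norm (y 0 - z 0)*exp (L*t)"
  if t: "t : {0..T}" and g: "!!s. s : {0..t} ==> s : G & norm (y s - z s) <= r" for t
 proof -
  have "norm (y t - z t) <= (norm (y 0 - z 0) + 0*(t - 0))*exp (L*(t - 0))"
  proof(rule gronwall[where y = "%s. y s - z s" and y' = "%s. X (y s) - X (z s)"])
   fix s assume s: "s : {0..t}"
   have "(z hvd X (z s)) (at s within {0..t})"
    by(rule has_vector_derivative_within_subset[OF z]) (use s t in auto)
   thus "((%s. y s - z s) hvd X (y s) - X (z s)) (at s within {0..t})"
    using g[OF s] by(intro has_vector_derivative_diff has_vector_derivative_at_within[OF G(3)]) auto
   show "norm (X (y s) - X (z s)) <= L*norm (y s - z s) + 0"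
    using lip[of s "y s"] s t g[OF s] by(auto simp: dist_norm norm_minus_commute)
  qed (use L t in auto)
  thus ?thesis by simp
 qed
 have expT: "norm (y 0 - z 0)*exp (L*t) < r" if "t : {0..T}" for t
 proof -
  have "norm (y 0 - z 0)*exp (L*t) <= norm (y 0 - z 0)*exp (L*T)"
   using that L by(intro mult_left_mono) auto
  thus ?thesis using close by linarith
 qed
 have cy: "continuous (at s) y" if "s : G" for s
  using G(3)[OF that] has_vector_derivative_continuous by blast
 have cz: "continuous (at s within {0..T}) z" if "s : {0..T}" for s
  using z[OF that] has_vector_derivative_continuous by blast
 have all: "good t" if "t : {0..T}" for t
 proof(rule ccontr)
  assume bad: "~ good t"
  define B where "B = {s : {0..T}. ~ good s}"
  \<comment> \<open>The first time at which the claim could fail. Before \<open>b\<close> all is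
    well, at \<open>b\<close> a limit gives the bound with \<open>r\<close> included, and Gronwall
    improves it to a strict one. That persists a little beyond \<open>b\<close>, which contradicts
    the choice of \<open>b\<close>.\<close>
  define b where "b = Inf B"
  have Bne: "B ~= {}" "bdd_below B" using bad that by(auto simp: B_def intro!: bdd_belowI[of _ 0])
  have b: "b : {0..T}"
  proof -
   have "0 <= b" unfolding b_def by(rule cInf_greatest[OF Bne(1)]) (simp add: B_def)
   moreover have "b <= t" unfolding b_def by(rule cInf_lower[OF _ Bne(2)]) (use bad that in \<open>simp add: B_def\<close>)
   ultimately show ?thesis using that by simp
  qed
  have before: "good s" if "s : {0..<b}" for s
  proof(rule ccontr)
   assume "~ good s"
   hence "s : B" using that b by(auto simp: B_def)
   hence "b <= s" unfolding b_def using Bne(2) by(rule cInf_lower)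
   thus False using that by simp
  qed
  have bG: "b : G"
  proof(cases "b = 0")
   case False
   hence "b : {0<..T}" using b by simp
   thus ?thesis
   proof(rule lim)
    show "s : G & y s : cball (z s) r" if "s : {0..<b}" for s
     using before[OF that] by(simp add: good_def dist_norm norm_minus_commute)
   qed
  qed (use G in simp)
  have nb: "norm (y b - z b) <= r"
  proof(cases "b = 0")
   case False
   have "continuous (at b within {0..T}) (%s. norm (y s - z s))"
    by(rule continuous_norm[OF continuous_diff[OF continuous_at_imp_continuous_within[OF cy[OF bG]] cz[OF b]]])
   hence "continuous (at b within {0..<b}) (%s. norm (y s - z s))"
    by(rule continuous_within_subset) (use b in auto)
   hence "((%s. norm (y s - z s)) \<longlongrightarrow> norm (y b - z b)) (at b within {0..<b})"
    by(simp add: continuous_within)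
   moreover have "at b within {0..<b} ~= bot"
    using False b by(simp add: trivial_limit_within islimpt_greaterThanLessThan2 islimpt_Ico)
   moreover have "\<forall>\<^sub>F s in at b within {0..<b}. norm (y s - z s) <= r"
    unfolding eventually_at_filter
   proof(rule always_eventually, intro allI impI)
    show "norm (y s - z s) <= r" if "s : {0..<b}" for s
     using before[OF that] by(simp add: good_def)
   qed
   ultimately show ?thesis using tendsto_upperbound by fast
  qed (use expT[of 0] b in auto)
  have gb: "s : G & norm (y s - z s) <= r" if "s : {0..b}" for s
   using before[of s] bG nb that by(cases "s = b") (auto simp: good_def)
  have nb2: "norm (y b - z b) < r" using est[OF b gb] expT[OF b] by linarith
  have "continuous (at b within {0..T}) (%s. norm (y s - z s))"
   by(rule continuous_norm[OF continuous_diff[OF continuous_at_imp_continuous_within[OF cy[OF bG]] cz[OF b]]])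
  hence "\<forall>\<^sub>F s in at b within {0..T}. norm (y s - z s) < r"
   using nb2 by(auto simp: continuous_within dest: order_tendstoD(2))
  moreover have "\<forall>\<^sub>F s in at b within {0..T}. s : G"
   using G(1) bG by(auto simp: eventually_at_topological)
  ultimately have "\<forall>\<^sub>F s in at b within {0..T}. good s"
   by eventually_elim (simp add: good_def)
  then obtain d where d: "d > 0" "!!s. s : {0..T} ==> s ~= b ==> dist s b < d ==> good s"
   unfolding eventually_at by auto
  have goodb: "good b" using bG nb2 by(simp add: good_def)
  have "b + d <= s" if "s : B" for s
  proof(rule ccontr)
   assume "~ b + d <= s"
   moreover have "b <= s" unfolding b_def using that Bne(2) by(rule cInf_lower)
   ultimately have "good s" using d(2)[of s] goodb that by(cases "s = b") (auto simp: B_def dist_real_def)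
   thus False using that by(simp add: B_def)
  qed
  hence "b + d <= b" unfolding b_def using cInf_greatest[OF Bne(1)] by blast
  thus False using d(1) by simp
 qed
 have "s : G & norm (y s - z s) <= r" if "s : {0..t}" for s
  using all[of s] that t by(auto simp: good_def)
 thus ?thesis using est[OF t] t by auto
qed

lemma bounded_bilinear_mmult: "bounded_bilinear ((**) :: real^'n^'m => real^'k^'n => _)"
 unfolding bilinear_conv_bounded_bilinear[symmetric] bilinear_def
 by(auto intro!: linearI simp: matrix_matrix_mult_def vec_eq_iff algebra_simps sum.distrib sum_distrib_left)

text \<open>The candidate \<open>Y\<close> solves the variational equation along the orbit of
  \<open>a\<close>. The error \<open>Z w s - Z a s - Y s *v (w - a)\<close> satisfies the same
  linear equation up to a source of order \<open>e' * norm (w - a)\<close>, and Gronwall keeps it of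
  that order.\<close>

lemma flow_has_derivative:
 fixes X :: "real^'m::finite => real^'m" and DX :: "real^'m => (real^'m) \<Rightarrow>\<^sub>L (real^'m)"
  and Z :: "real^'m => real => real^'m"
 assumes Om: "open Om" and X: "!!x. x : Om ==> (X hfd DX x) (at x)"
  and DX: "cts Om DX" and T: "0 <= T"
  and a: "Z a ` {0..T} <= Om" and d0: "d0 > 0"
  and sol: "!!w s. w : ball a d0 ==> s : {0..T} ==> (Z w hvd X (Z w s)) (at s within {0..T})"
  and init: "!!w. w : ball a d0 ==> Z w 0 = w"
  and close: "!!w s. w : ball a d0 ==> s : {0..T} ==> norm (Z w s - Z a s) <= norm (w - a)*exp (L * s)" and L: "L > 0"
 obtains Y where "Y 0 = mat 1"
  "!!s. s : {0..T} ==> (Y hvd matrix (DX (Z a s)) ** Y s) (at s within {0..T})"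
  "((%w. Z w T) hfd (%h. Y T *v h)) (at a)"
proof -
 have a0: "a : ball a d0" using d0 by simp
 have cz: "cts {0..T} (Z a)"
  unfolding continuous_on_eq_continuous_within by(intro ballI has_vector_derivative_continuous[OF sol[OF a0]])
 obtain r C where tube: "r > 0" "C > 0" "compact (\<Union>s\<in>{0..T}. cball (Z a s) r)" "(\<Union>s\<in>{0..T}. cball (Z a s) r) <= Om"
  "ALL s:{0..T}. ALL u:cball (Z a s) r. norm (X u - X (Z a s)) <= C*norm (u - Z a s)"
  "ALL s:{0..T}. norm (DX (Z a s)) <= C"
  "ALL e>0. EX d>0. ALL s:{0..T}. ALL u:cball (Z a s) d. norm (X u - X (Z a s) - DX (Z a s) (u - Z a s)) <= e*norm (u - Z a s)"
  by(rule flow_tube[OF Om X DX cz a T])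
 \<comment> \<open>Clamping the time to \<open>{0..T}\<close> gives coefficients on the whole line,
   as the existence theorem for linear equations requires, without changing them on the interval of
   interest.\<close>
 define A where "A = (%s. matrix (DX (Z a (max 0 (min T s)))))"
 have Acont: "cts UNIV A"
 proof -
  have "cts UNIV (%s. Z a (max 0 (min T s)))"
   by(rule continuous_on_compose2[OF cz]) (use T in \<open>auto intro!: continuous_intros\<close>)
  hence "cts UNIV (%s. DX (Z a (max 0 (min T s))))"
   by(rule continuous_on_compose2[OF DX]) (use T a in auto)
  thus ?thesis
   unfolding A_def matrix_def by(intro continuous_on_vec_lambda continuous_intros)
 qed
 have "EX Y. Y 0 = mat 1 & (ALL t. (Y hvd A t ** Y t) (at t))"
 proof(rule linear_ode_exists)
  show "linear ((**) (A t))" for t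
   using bounded_bilinear.bounded_linear_right[OF bounded_bilinear_mmult] linear_conv_bounded_linear by blast
  show "cts UNIV (%t. A t ** b)" for b
   by(rule bounded_bilinear.continuous_on[OF bounded_bilinear_mmult Acont continuous_on_const])
 qed
 then obtain Y where Y: "Y 0 = mat 1" "!!t. (Y hvd A t ** Y t) (at t)" by blast
 have As: "A s *v v = DX (Z a s) v" if "s : {0..T}" for s v
  using that by(simp add: A_def matrix_works linear_conv_bounded_linear blinfun.bounded_linear_right)
 have "((%w. Z w T) hfd (%h. Y T *v h)) (at a)"
  unfolding has_derivative_at_alt
 proof(intro conjI allI impI)
  show "bounded_linear ((*v) (Y T))" by simp
  fix e :: real assume e: "e > 0"
  \<comment> \<open>The growth factor collected from the two Gronwall estimates.
    \<open>T + 1\<close> instead of \<open>T\<close> keeps it positive when \<open>T = 0\<close>, so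
    that it can be divided by.\<close>
  define c where "c = exp (L*T)*(T + 1)*exp (C*T)"
  have c: "c > 0" using T by(simp add: c_def)
  define e' where "e' = e/c"
  have e': "e' > 0" using e c by(simp add: e'_def)
  obtain d where d: "d > 0" "!!s u. s : {0..T} ==> u : cball (Z a s) d ==>
    norm (X u - X (Z a s) - DX (Z a s) (u - Z a s)) <= e'*norm (u - Z a s)"
   using tube(7)[rule_format, OF e'] by auto
  define d1 where "d1 = min d0 (d/exp (L*T))"
  show "EX d>0. ALL w. norm (w - a) < d --> norm (Z w T - Z a T - Y T *v (w - a)) <= e*norm (w - a)"
  proof(intro exI[of _ d1] conjI allI impI)
   show "d1 > 0" using d0 d by(simp add: d1_def)
   fix w assume w: "norm (w - a) < d1"
   have w0: "w : ball a d0" using w by(simp add: d1_def dist_norm norm_minus_commute)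
   have near: "norm (Z w s - Z a s) <= norm (w - a)*exp (L*T)" if "s : {0..T}" for s
   proof -
    have "norm (w - a)*exp (L * s) <= norm (w - a)*exp (L*T)"
     using that L by(intro mult_left_mono) auto
    thus ?thesis using close[OF w0 that] by linarith
   qed
   have wd: "norm (w - a)*exp (L*T) <= d" using w by(simp add: d1_def field_simps)
   define u where "u = (%s. Z w s - Z a s - Y s *v (w - a))"
   have u0: "u 0 = 0" by(simp add: u_def init[OF w0] init[OF a0] Y(1))
   have "norm (u T) <= (norm (u 0) + e'*(norm (w - a)*exp (L*T))*(T - 0))*exp (C*(T - 0))"
   proof(rule gronwall[where y = u and a = 0 and b = T and y' = "%s. X (Z w s) - X (Z a s) - (A s ** Y s) *v (w - a)"])
    fix s assume s: "s : {0..T}"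
    have "((%s. Y s *v (w - a)) hvd Y s *v 0 + (A s ** Y s) *v (w - a)) (at s within {0..T})"
     by(rule bounded_bilinear.has_vector_derivative[OF bounded_bilinear_mvmult
        has_vector_derivative_at_within[OF Y(2)] has_vector_derivative_const])
    thus "(u hvd X (Z w s) - X (Z a s) - (A s ** Y s) *v (w - a)) (at s within {0..T})"
     unfolding u_def using sol[OF w0 s] sol[OF a0 s]
     by(intro has_vector_derivative_diff) simp_all
    have "X (Z w s) - X (Z a s) - (A s ** Y s) *v (w - a) =
      DX (Z a s) (u s) + (X (Z w s) - X (Z a s) - DX (Z a s) (Z w s - Z a s))"
     using As[OF s] by(simp add: u_def matrix_vector_mul_assoc[symmetric] blinfun.diff_right)
    hence "norm (X (Z w s) - X (Z a s) - (A s ** Y s) *v (w - a)) <=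
      norm (DX (Z a s) (u s)) + norm (X (Z w s) - X (Z a s) - DX (Z a s) (Z w s - Z a s))"
     by(simp only: norm_triangle_ineq)
    also have "... <= C*norm (u s) + e'*(norm (w - a)*exp (L*T))"
    proof(rule add_mono)
     have "norm (DX (Z a s) (u s)) <= norm (DX (Z a s))*norm (u s)" by(rule norm_blinfun)
     also have "... <= C*norm (u s)" using tube(6)[rule_format, OF s] by(intro mult_right_mono) auto
     finally show "norm (DX (Z a s) (u s)) <= C*norm (u s)" .
     have "Z w s : cball (Z a s) d" using near[OF s] wd by(simp add: dist_norm norm_minus_commute)
     from d(2)[OF s this] have "norm (X (Z w s) - X (Z a s) - DX (Z a s) (Z w s - Z a s)) <= e'*norm (Z w s - Z a s)" .
     also have "... <= e'*(norm (w - a)*exp (L*T))" using near[OF s] e' by(intro mult_left_mono) auto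
     finally show "norm (X (Z w s) - X (Z a s) - DX (Z a s) (Z w s - Z a s)) <= e'*(norm (w - a)*exp (L*T))" .
    qed
    finally show "norm (X (Z w s) - X (Z a s) - (A s ** Y s) *v (w - a)) <= C*norm (u s) + e'*(norm (w - a)*exp (L*T))" .
   next
    show "0 <= T" "0 <= C" using T tube(2) by simp_all
    show "0 <= e'*(norm (w - a)*exp (L*T))" using e' by simp
   qed
   hence "norm (u T) <= (e'*norm (w - a))*(exp (L*T)*T*exp (C*T))"
    by(simp add: u0 mult_ac)
   also have "... <= (e'*norm (w - a))*c"
   proof(rule mult_left_mono)
    show "exp (L*T)*T*exp (C*T) <= c"
     unfolding c_def by(intro mult_right_mono mult_left_mono) simp_all
   qed (use e' in simp)
   also have "... = e*norm (w - a)" using c by(simp add: e'_def)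
   finally show "norm (Z w T - Z a T - Y T *v (w - a)) <= e*norm (w - a)" by(simp add: u_def)
  qed
 qed
 moreover have "(Y hvd matrix (DX (Z a s)) ** Y s) (at s within {0..T})" if "s : {0..T}" for s
  using has_vector_derivative_at_within[OF Y(2)[of s]] that by(simp add: A_def)
 ultimately show ?thesis using that Y(1) by blast
qed

section \<open>Symmetry of second derivatives\<close>

text \<open>The mean value theorem is applied once in each direction: first to the difference in
  direction \<open>w\<close> as a function of the step along \<open>v\<close>, then to the
  derivative along \<open>v\<close>. Equality at an intermediate point restricts this to real
  values.\<close>

lemma mixed_second_difference:
 fixes f :: "'a::euclidean_space => real"
 assumes U: "open U" and f: "Ck_on 2 U f" and h: "h > 0"
  and sub: "!!s t. s : {0..h} ==> t : {0..h} ==> x + s *R v + t *R w : U"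
 shows "EX s:{0..h}. EX t:{0..h}. f (x + h *R v + h *R w) - f (x + h *R v) - f (x + h *R w) + f x
  = h*h*Fd (%y. Fd f (at y) v) (at (x + s *R v + t *R w)) w"
proof -
 have f2: "Ck_on (Suc (Suc 0)) U f" using f by(simp add: numeral_2_eq_2)
 have D1: "(f hfd Fd f (at y)) (at y)" if "y : U" for y
  using Ck_on_has_derivative[OF f2 that] .
 have C1: "Ck_on (Suc 0) U (%y. Fd f (at y) v)"
  using Ck_on_frechet[OF U U, where h="%y. y" and f=f and w="%_. v" and k="Suc 0"] f2
  by(simp add: Ck_on_const Ck_on_bounded_linear_id[OF bounded_linear_ident] del: Ck_on.simps)
 have D2: "((%y. Fd f (at y) v) hfd
   Fd (%y. Fd f (at y) v) (at y)) (at y)" if "y : U" for y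
  using Ck_on_has_derivative[OF C1 that] .
 define p where "p = (%s. f (x + s *R v + h *R w) - f (x + s *R v))"
 define p' where "p' = (%s. Fd f (at (x + s *R v + h *R w)) v - Fd f (at (x + s *R v)) v)"
 have line: "((%s. f (y + s *R u)) has_real_derivative Fd f (at (y + s *R u)) u) (at s)"
  if "y + s *R u : U" for y u s
 proof -
  have "((%s. y + s *R u) hfd (%r. r *R u)) (at s)"
   by(auto intro!: derivative_eq_intros)
  from has_derivative_compose[OF this D1[OF that]]
  have "((%s. f (y + s *R u)) hfd (%r. Fd f (at (y + s *R u)) (r *R u))) (at s)" .
  moreover have "Fd f (at (y + s *R u)) (r *R u) = Fd f (at (y + s *R u)) u*r" for r
   using linear_frechet_derivative[OF differentiableI[OF D1[OF that]]] by(simp add: linear_scale)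
  ultimately show ?thesis by(simp add: has_field_derivative_def)
 qed
 have dp: "(p has_real_derivative p' s) (at s)" if "s : {0..h}" for s
 proof -
  have m: "x + h *R w + s *R v : U" "x + s *R v : U"
   using sub[OF that, of h] sub[OF that, of 0] h by(simp_all add: algebra_simps)
  from DERIV_diff[OF line[OF m(1)] line[OF m(2)]] show ?thesis
   by(simp add: p_def p'_def algebra_simps)
 qed
 have "EX s. 0 < s & s < h & p h - p 0 = (h - 0)*p' s"
  by(rule MVT2[OF h]) (use dp in auto)
 then obtain s where s: "0 < s" "s < h" "p h - p 0 = h*p' s" by auto
 define q where "q = (%t. Fd f (at (x + s *R v + t *R w)) v)"
 define q' where "q' = (%t. Fd (%y. Fd f (at y) v) (at (x + s *R v + t *R w)) w)"
 have dq: "(q has_real_derivative q' t) (at t)" if "t : {0..h}" for t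
 proof -
  have m: "x + s *R v + t *R w : U" using sub[OF _ that, of s] s by simp
  have "((%t. x + s *R v + t *R w) hfd (%r. r *R w)) (at t)"
   by(auto intro!: derivative_eq_intros)
  from has_derivative_compose[OF this D2[OF m]]
  have "(q hfd (%r. Fd (%y. Fd f (at y) v) (at (x + s *R v + t *R w)) (r *R w))) (at t)"
   by(simp add: q_def)
  moreover have "Fd (%y. Fd f (at y) v) (at (x + s *R v + t *R w)) (r *R w) = q' t*r" for r
   using linear_frechet_derivative[OF differentiableI[OF D2[OF m]]] by(simp add: linear_scale q'_def)
  ultimately show ?thesis by(simp add: has_field_derivative_def)
 qed
 have "EX t. 0 < t & t < h & q h - q 0 = (h - 0)*q' t"
  by(rule MVT2[OF h]) (use dq in auto)
 then obtain t where t: "0 < t" "t < h" "q h - q 0 = h*q' t" by auto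
 have "p' s = q h - q 0" by(simp add: p'_def q_def)
 hence "p h - p 0 = h*h*q' t" using s t by simp
 moreover have "p h - p 0 = f (x + h *R v + h *R w) - f (x + h *R v) - f (x + h *R w) + f x"
  by(simp add: p_def)
 ultimately show ?thesis using s t unfolding q'_def by(intro bexI[of _ s] bexI[of _ t]) auto
qed

text \<open>The second difference does not change when \<open>v\<close> and \<open>w\<close> are
  exchanged. Hence both mixed derivatives take a common value at points arbitrarily close to
  \<open>x\<close>, and continuity gives equality at \<open>x\<close>.\<close>

lemma second_derivative_symmetric_real:
 fixes f :: "'a::euclidean_space => real"
 assumes U: "open U" and f: "Ck_on 2 U f" and x: "x : U"
 shows "Fd (%y. Fd f (at y) v) (at x) w =
  Fd (%y. Fd f (at y) w) (at x) v"
proof -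
 define S where "S = (%v w y. Fd (%y. Fd f (at y) v) (at y) w)"
 have cS: "cts U (S v w)" for v w
 proof -
  have f2: "Ck_on (Suc (Suc 0)) U f" using f by(simp add: numeral_2_eq_2)
  have id: "Ck_on k U (%y. y)" for k by(rule Ck_on_bounded_linear_id[OF bounded_linear_ident])
  have "Ck_on (Suc 0) U (%y. Fd f (at y) v)"
   by(rule Ck_on_frechet[OF U U _ f2 id Ck_on_const])
  from Ck_on_frechet[OF U U _ this id Ck_on_const] have "Ck_on 0 U (S v w)" by(simp add: S_def)
  thus ?thesis by simp
 qed
 obtain r where r: "r > 0" "ball x r <= U" using U x openE by blast
 have "\<bar>S v w x - S w v x\<bar> <= e" if e: "e > 0" for e
 proof -
  have c: "continuous (at x) (S v w)" "continuous (at x) (S w v)"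
   using cS U x by(auto simp: continuous_on_eq_continuous_at)
  obtain d1 where d1: "d1 > 0" "!!y. dist y x < d1 ==> dist (S v w y) (S v w x) < e/2"
   using c(1)[unfolded continuous_at_eps_delta, rule_format, of "e/2"] e by auto
  obtain d2 where d2: "d2 > 0" "!!y. dist y x < d2 ==> dist (S w v y) (S w v x) < e/2"
   using c(2)[unfolded continuous_at_eps_delta, rule_format, of "e/2"] e by auto
  define m where "m = min r (min d1 d2)"
  have m: "m > 0" "m <= r" "m <= d1" "m <= d2" using r d1 d2 by(auto simp: m_def)
  \<comment> \<open>Small enough that the whole parallelogram spanned by \<open>h *R v\<close> and
    \<open>h *R w\<close> lies within distance \<open>m\<close> of \<open>x\<close>; the summand 1
    covers the case of zero vectors.\<close>
  define h where "h = m/(2*(norm v + norm w + 1))"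
  have h: "h > 0" using m by(simp add: h_def add_nonneg_pos)
  have hm: "h*(norm v + norm w) < m"
  proof -
   have "h*(norm v + norm w) <= h*(norm v + norm w + 1)" using h by(intro mult_left_mono) auto
   also have "... = m/2"
   proof -
    define N where "N = norm v + norm w + 1"
    have "N ~= 0" using norm_ge_zero[of v] norm_ge_zero[of w] by(simp add: N_def add_nonneg_eq_0_iff)
    hence "m/(2*N)*N = m/2" by simp
    thus ?thesis by(simp only: h_def N_def)
   qed
   finally show ?thesis using m by simp
  qed
  have near: "dist (x + s *R v + t *R w) x < m" "dist (x + s *R w + t *R v) x < m"
   if "s : {0..h}" "t : {0..h}" for s t
  proof -
   have b: "norm (s *R a + t *R b) <= h*(norm a + norm b)" for a b :: 'a
   proof -
    have "norm (s *R a + t *R b) <= \<bar>s\<bar> * norm a + \<bar>t\<bar> * norm b"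
     using norm_triangle_ineq[of "s *R a" "t *R b"] by simp
    also have "... <= h*norm a + h*norm b"
     using that by(intro add_mono mult_right_mono) auto
    finally show ?thesis by(simp add: algebra_simps)
   qed
   show "dist (x + s *R v + t *R w) x < m"
    using b[of v w] hm by(simp add: dist_norm add.assoc)
   show "dist (x + s *R w + t *R v) x < m"
    using b[of w v] hm by(simp add: dist_norm add.assoc add.commute[of "norm w"])
  qed
  have inU: "x + s *R v + t *R w : U" "x + s *R w + t *R v : U" if "s : {0..h}" "t : {0..h}" for s t
   using near[OF that] m(2) r(2) by(auto simp: subset_iff dist_commute)
  obtain s t where st: "s : {0..h}" "t : {0..h}"
   "f (x + h *R v + h *R w) - f (x + h *R v) - f (x + h *R w) + f x = h*h*S v w (x + s *R v + t *R w)"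
   using mixed_second_difference[OF U f h inU(1)] unfolding S_def by blast
  obtain s' t' where st': "s' : {0..h}" "t' : {0..h}"
   "f (x + h *R w + h *R v) - f (x + h *R w) - f (x + h *R v) + f x = h*h*S w v (x + s' *R w + t' *R v)"
   using mixed_second_difference[OF U f h inU(2)] unfolding S_def by blast
  have "h*h*S v w (x + s *R v + t *R w) = h*h*S w v (x + s' *R w + t' *R v)"
   using st(3) st'(3) by(simp add: algebra_simps)
  hence "S v w (x + s *R v + t *R w) = S w v (x + s' *R w + t' *R v)" using h by simp
  moreover have "dist (S v w (x + s *R v + t *R w)) (S v w x) < e/2"
   using d1(2) near(1)[OF st(1,2)] m(3) by simp
  moreover have "dist (S w v (x + s' *R w + t' *R v)) (S w v x) < e/2"
   using d2(2) near(2)[OF st'(1,2)] m(4) by simp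
  ultimately show ?thesis unfolding dist_real_def by linarith
 qed
 hence "\<bar>S v w x - S w v x\<bar> <= 0" by(rule field_le_epsilon) simp
 thus ?thesis by(simp add: S_def)
qed

lemma frechet_derivative_inner:
 assumes "f differentiable (at x)"
 shows "Fd (%y. f y dot b) (at x) v = Fd f (at x) v dot b"
proof -
 have "(f hfd Fd f (at x)) (at x)" using assms frechet_derivative_works by blast
 from frechet_derivative_at[OF has_derivative_inner_left[OF this]] show ?thesis by metis
qed

lemma second_derivative_symmetric:
 fixes f :: "'a::euclidean_space => 'b::euclidean_space"
 assumes U: "open U" and f: "Ck_on 2 U f" and x: "x : U"
 shows "Fd (%y. Fd f (at y) v) (at x) w =
  Fd (%y. Fd f (at y) w) (at x) v"
proof(rule euclidean_eqI)
 fix b :: 'b assume "b : Basis"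
 have f2: "Ck_on (Suc (Suc 0)) U f" using f by(simp add: numeral_2_eq_2)
 have id: "Ck_on k U (%y. y)" for k by(rule Ck_on_bounded_linear_id[OF bounded_linear_ident])
 have d: "f differentiable (at y)" "(%y. Fd f (at y) v) differentiable (at y)" if "y : U" for y v
 proof -
  show "f differentiable (at y)" using f2 that by simp
  have "Ck_on (Suc 0) U (%y. Fd f (at y) v)"
   by(rule Ck_on_frechet[OF U U _ f2 id Ck_on_const])
  thus "(%y. Fd f (at y) v) differentiable (at y)" using that by simp
 qed
 have eq: "Fd (%y. Fd f (at y) v) (at x) w dot b =
   Fd (%y. Fd (%y. f y dot b) (at y) v) (at x) w" for v w
 proof -
  have "((%y. Fd f (at y) v dot b) hfd
    (%w. Fd (%y. Fd f (at y) v) (at x) w dot b)) (at x)"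
   by(intro has_derivative_inner_left) (use d(2)[OF x] frechet_derivative_works in blast)
  hence "((%y. Fd (%y. f y dot b) (at y) v) hfd
    (%w. Fd (%y. Fd f (at y) v) (at x) w dot b)) (at x)"
   by(rule has_derivative_transform_within_open[OF _ U x]) (simp add: frechet_derivative_inner d(1))
  from frechet_derivative_at[OF this] show ?thesis by metis
 qed
 have "Ck_on 2 U (%y. f y dot b)" by(rule Ck_on_inner[OF U f Ck_on_const])
 from second_derivative_symmetric_real[OF U this x]
 show "Fd (%y. Fd f (at y) v) (at x) w dot b =
   Fd (%y. Fd f (at y) w) (at x) v dot b"
  unfolding eq .
qed

section \<open>Orthonormal families and families of bilinear forms\<close>

text \<open>Gram-Schmidt for the inner product \<open>B\<close>, one index at a time; a vector
  outside the span of the previous ones exists by dimension. The member with index \<open>k\<close>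
  is prescribed, so that later a frame can contain the velocity of a geodesic.\<close>

lemma orthonormal_family_exists:
 fixes B :: "real^'n::finite => real^'n => real" and k :: 'n
 assumes bil: "bilinear B" and sym: "!!x y. B x y = B y x" and pos: "!!x. x ~= 0 ==> 0 < B x x"
  and u: "B u u = 1"
 shows "EX e. e k = u & (ALL i. ALL j. B (e i) (e j) = (if i = j then 1 else 0))"
proof -
 have lin: "linear (%x. B x y)" "linear (%x. B y x)" for y using bil by(auto simp: bilinear_def)
 have "EX e. e k = u & (ALL i:insert k S. ALL j:insert k S. B (e i) (e j) = (if i = j then 1 else 0))" for S :: "'n set"
  using finite[of S]
 proof(induction S rule: finite_induct)
  case empty
  thus ?case using u by(intro exI[of _ "%_. u"]) simp
 next
  case (insert l S)
  then obtain e where e0: "e k = u" "ALL i:insert k S. ALL j:insert k S. B (e i) (e j) = (if i = j then 1 else 0)" by blast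
  have e: "e k = u" "!!i j. i : insert k S ==> j : insert k S ==> B (e i) (e j) = (if i = j then 1 else 0)"
   by(rule e0(1), rule bspec[OF bspec[OF e0(2)]])
  show ?case
  proof(cases "l = k")
   case True
   thus ?thesis using e by(intro exI[of _ e]) auto
  next
   case False
   define S' where "S' = insert k S"
   have lS: "l \<notin> S'" using insert False by(simp add: S'_def)
   have fin: "finite S'" using insert by(simp add: S'_def)
   have e': "B (e i) (e j) = (if i = j then 1 else 0)" if "i : S'" "j : S'" for i j using e(2) that by(simp add: S'_def)
   have "dim (e ` S') <= card (e ` S')" using fin by(intro dim_le_card') auto
   also have "... <= card S'" using fin by(rule card_image_le)
   also have "... < CARD('n)" using lS by(intro psubset_card_mono) auto
   finally have d: "dim (e ` S') < CARD('n)" .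
   have "span (e ` S') ~= (UNIV :: (real^'n) set)"
   proof
    assume "span (e ` S') = UNIV"
    hence "dim (e ` S') = dim (UNIV :: (real^'n) set)" using dim_span[of "e ` S'"] by simp
    thus False using d by simp
   qed
   then obtain v where v: "v \<notin> span (e ` S')" by blast
   define w where "w = v - (\<Sum>i\<in>S'. B v (e i) *R e i)"
   have "(\<Sum>i\<in>S'. B v (e i) *R e i) : span (e ` S')"
    by(intro span_sum span_scale span_base) auto
   hence w0: "w ~= 0" using v by(auto simp: w_def)
   have we: "B w (e j) = 0" if j: "j : S'" for j
   proof -
    have "B w (e j) = B v (e j) - (\<Sum>i\<in>S'. B v (e i)*B (e i) (e j))"
     by(simp add: w_def linear_diff[OF lin(1)] linear_sum[OF lin(1)] linear_scale[OF lin(1)])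
    also have "(\<Sum>i\<in>S'. B v (e i)*B (e i) (e j)) = (\<Sum>i\<in>S'. if i = j then B v (e j) else 0)"
     using e' j by(intro sum.cong) auto
    also have "... = B v (e j)" using j fin by simp
    finally show ?thesis by simp
   qed
   define z where "z = (1/sqrt (B w w)) *R w"
   have zj: "B z (e j) = 0" "B (e j) z = 0" if "j : S'" for j
    using we[OF that] sym[of "e j" w] by(simp_all add: z_def linear_scale[OF lin(1)] linear_scale[OF lin(2)])
   have zz: "B z z = 1" using pos[OF w0] by(simp add: z_def linear_scale[OF lin(1)] linear_scale[OF lin(2)])
   have ins: "insert k (insert l S) = insert l S'" by(auto simp: S'_def)
   show ?thesis
    unfolding ins by(rule exI[of _ "e(l := z)"]) (use e(1) e' zj zz lS False in auto)
  qed
 qed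
 from this[of UNIV] show ?thesis by simp
qed

lemma bilinear_expand:
 fixes B :: "'a::euclidean_space => 'b::euclidean_space => 'c::real_vector"
 assumes "bilinear B"
 shows "B u w = (\<Sum>i\<in>Basis. \<Sum>j\<in>Basis. ((u dot i)*(w dot j)) *R B i j)"
proof -
 have l: "linear (%x. B x y)" "linear (%y. B x y)" for x y using assms by(auto simp: bilinear_def)
 have "B u w = (\<Sum>i\<in>Basis. (u dot i) *R B i w)" 
  by(rule linear_sum_Basis[OF l(1)])
 moreover have "B i w = (\<Sum>j\<in>Basis. (w dot j) *R B i j)" for i
  by(rule linear_sum_Basis[OF l(2)])
 ultimately show ?thesis by(simp add: scaleR_sum_right)
qed

text \<open>A Leibniz rule for a bilinear form that itself depends on a point. Expansion over the
  bases reduces it to products of finitely many differentiable coefficients. It serves for the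
  metric, the Christoffel symbols and the derivatives of transition maps.\<close>

lemma bilinear_family_derivative:
 fixes B :: "'x::real_normed_vector => 'a::euclidean_space => 'b::euclidean_space => 'c::real_normed_vector"
  and h :: "'y::real_normed_vector => 'x"
 assumes bil: "!!y. y : U ==> bilinear (B y)" and U: "open U" "h x : U"
  and dB: "!!i j. ((%y. B y i j) hfd (%ze. dB ze i j)) (at (h x))" and dbil: "!!ze. bilinear (dB ze)"
  and h: "(h hfd h') (at x)" and a: "(a hfd a') (at x)" and b: "(b hfd b') (at x)"
 shows "((%y. B (h y) (a y) (b y)) hfd
  (%ze. dB (h' ze) (a x) (b x) + B (h x) (a' ze) (b x) + B (h x) (a x) (b' ze))) (at x)"
proof -
 have near: "\<forall>\<^sub>F y in at x. h y : U"
  using has_derivative_continuous[OF h] U by(auto simp: continuous_at intro: topological_tendstoD)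
 have dBh: "((%y. B (h y) i j) hfd (%ze. dB (h' ze) i j)) (at x)" for i j
  by(rule has_derivative_compose[OF h dB])
 have "((%y. \<Sum>i\<in>Basis. \<Sum>j\<in>Basis. ((a y dot i)*(b y dot j)) *R B (h y) i j) hfd
   (%ze. \<Sum>i\<in>Basis. \<Sum>j\<in>Basis. ((a x dot i)*(b x dot j)) *R dB (h' ze) i j
    + ((a x dot i)*(b' ze dot j) + (a' ze dot i)*(b x dot j)) *R B (h x) i j)) (at x)"
  by(intro has_derivative_sum has_derivative_scaleR has_derivative_mult has_derivative_inner_left a b dBh)
 also have "(%ze. \<Sum>i\<in>Basis. \<Sum>j\<in>Basis. ((a x dot i)*(b x dot j)) *R dB (h' ze) i j
    + ((a x dot i)*(b' ze dot j) + (a' ze dot i)*(b x dot j)) *R B (h x) i j) =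
  (%ze. dB (h' ze) (a x) (b x) + B (h x) (a' ze) (b x) + B (h x) (a x) (b' ze))"
  unfolding bilinear_expand[OF dbil, of _ "a x"] bilinear_expand[OF bil[OF U(2)], of _ "b x"]
   bilinear_expand[OF bil[OF U(2)], of "a x"]
  by(simp add: sum.distrib scaleR_add_left add_ac fun_eq_iff)
 finally show ?thesis
  by(rule has_derivative_transform_eventually)
   (use near U(2) bilinear_expand[OF bil] in \<open>auto elim!: eventually_mono\<close>)
qed

section \<open>Charts, tangent vectors and the metric in coordinates\<close>

locale riemannian =
 fixes A :: "('a::{t2_space, second_countable_topology}, 'n::finite) chart set" and g :: "('a, 'n) metric"
 assumes atlas: "oriented_smooth_atlas A" and metric: "riemannian_metric A g"
begin

abbreviation "TS \<equiv> tangent_space A"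
abbreviation "vel \<equiv> velocity A"
abbreviation "curv \<equiv> curvature A g"
abbreviation "cc \<equiv> curv_coord A g"
abbreviation "gr \<equiv> gram A g"
abbreviation "fr \<equiv> frame A g"
abbreviation "car \<equiv> carrier A"
abbreviation V :: "('a, 'n) chart => (real^'n) set" where "V c \<equiv> cmap c ` cdom c"
abbreviation W :: "('a, 'n) chart => ('a, 'n) chart => (real^'n) set" where
 "W c d \<equiv> cmap c ` (cdom c Int cdom d)"

definition T1 :: "('a, 'n) chart => ('a, 'n) chart => real^'n => real^'n => real^'n" where
 "T1 c d x = Fd (transition c d) (at x)"

text \<open>The first vector argument is the direction of differentiation. \<open>T2\<close> is the
  inhomogeneous term in the transformation law of the Christoffel symbols.\<close>

definition T2 :: "('a, 'n) chart => ('a, 'n) chart => real^'n => real^'n => real^'n => real^'n" where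
 "T2 c d x xi eta = Fd (%y. T1 c d y eta) (at x) xi"

definition Gm :: "('a, 'n) chart => real^'n => real^'n => real^'n => real" where
 "Gm c x xi eta = xi dot (gr c x *v eta)"

text \<open>The derivative of \<open>Gm\<close> at \<open>x\<close> in direction \<open>ze\<close>,
  with \<open>xi\<close> and \<open>eta\<close> fixed; \<open>dGam\<close> below has the same order
  of arguments.\<close>

definition dGm :: "('a, 'n) chart => real^'n => real^'n => real^'n => real^'n => real" where
 "dGm c x ze xi eta = xi dot (Fd (gr c) (at x) ze *v eta)"

abbreviation Gam :: "('a, 'n) chart => real^'n => real^'n => real^'n => real^'n" where
 "Gam \<equiv> christoffel A g"

definition dGam :: "('a, 'n) chart => real^'n => real^'n => real^'n => real^'n => real^'n" where
 "dGam c x ze xi eta = Fd (%y. Gam c y xi eta) (at x) ze"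

lemma cdom_openin: "c : A ==> openin (top_of_set (car)) (cdom c)"
 and open_V: "c : A ==> open (V c)"
 and chart_homeo: "c : A ==> homeomorphism (cdom c) (V c) (cmap c) (cinv c)"
 using atlas by(auto simp: oriented_smooth_atlas_def)

lemma cdom_carrier: "c : A ==> cdom c <= car"
 by(auto simp: carrier_def)

lemma cinv_cmap: "c : A ==> p : cdom c ==> cinv c (cmap c p) = p"
 using homeomorphism_apply1[OF chart_homeo] .

lemma cmap_cinv: "c : A ==> x : V c ==> cmap c (cinv c x) = x"
 using homeomorphism_apply2[OF chart_homeo] .

lemma cinv_cdom: "c : A ==> x : V c ==> cinv c x : cdom c"
 using cinv_cmap by auto

lemma cmap_inj: "c : A ==> inj_on (cmap c) (cdom c)"
 by(rule inj_on_inverseI[of _ "cinv c"]) (rule cinv_cmap)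

lemma cont_cmap: "c : A ==> cts (cdom c) (cmap c)"
 and cont_cinv: "c : A ==> cts (V c) (cinv c)"
 using chart_homeo by(auto simp: homeomorphism_def)

lemma W_iff: "c : A ==> x : W c d \<longleftrightarrow> x : V c & cinv c x : cdom d"
 using cinv_cmap by auto

lemma open_W:
 assumes c: "c : A" and d: "d : A" shows "open (W c d)"
proof -
 obtain O' where O: "open O'" "cdom d = car Int O'"
  using cdom_openin[OF d] by(auto simp: openin_open)
 have "W c d = V c Int cinv c -` O'"
  using cdom_carrier[OF c] cinv_cmap[OF c] by(auto simp: O(2))
 thus ?thesis
  using continuous_open_preimage[OF cont_cinv[OF c] open_V[OF c] O(1)] by simp
qed

lemma transition_cmap: "c : A ==> p : cdom c ==> transition c d (cmap c p) = cmap d p"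
 by(simp add: transition_def cinv_cmap)

lemma transition_smooth: "c : A ==> d : A ==> Ck_on k (W c d) (transition c d)"
 using atlas by(auto simp: oriented_smooth_atlas_def smooth_on_def)

lemma transition_V: "c : A ==> x : W c d ==> transition c d x : V d"
 by(auto simp: transition_cmap)

lemma transition_W: "c : A ==> x : W c d ==> transition c d x : W d c"
 by(auto simp: transition_cmap)

lemma transition_deriv:
 "c : A ==> d : A ==> x : W c d ==> (transition c d hfd T1 c d x) (at x)"
 unfolding T1_def by(rule Ck_on_has_derivative[OF transition_smooth[of c d "Suc 0"]])

lemma T1_linear: "c : A ==> d : A ==> x : W c d ==> linear (T1 c d x)"
 using transition_deriv has_derivative_linear by blast

lemma Ck_on_id: "Ck_on k U (%x. x)"
 by(rule Ck_on_bounded_linear_id[OF bounded_linear_ident])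

lemma T1_smooth: "c : A ==> d : A ==> Ck_on k (W c d) (%x. T1 c d x xi)"
 unfolding T1_def
 by(rule Ck_on_frechet[OF open_W open_W _ transition_smooth Ck_on_id Ck_on_const]) auto

lemma T1_deriv:
 "c : A ==> d : A ==> x : W c d ==> ((%y. T1 c d y xi) hfd (%ze. T2 c d x ze xi)) (at x)"
 unfolding T2_def by(rule Ck_on_has_derivative[OF T1_smooth[of c d "Suc 0"]])

lemma T2_sym: "c : A ==> d : A ==> x : W c d ==> T2 c d x xi eta = T2 c d x eta xi"
 unfolding T2_def T1_def by(rule second_derivative_symmetric[OF open_W transition_smooth])

lemma T1_chain:
 assumes c: "c : A" and d: "d : A" and e: "e : A" and p: "p : cdom c" "p : cdom d" "p : cdom e"
 shows "T1 d e (cmap d p) (T1 c d (cmap c p) xi) = T1 c e (cmap c p) xi"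
proof -
 have x: "cmap c p : W c d" "cmap c p : W c e" "cmap d p : W d e" using p by auto
 have tp: "transition c d (cmap c p) = cmap d p" using c p transition_cmap by simp
 have "((%x. transition d e (transition c d x)) hfd (%xi. T1 d e (cmap d p) (T1 c d (cmap c p) xi))) (at (cmap c p))"
  by(rule has_derivative_compose[OF transition_deriv[OF c d x(1)]])
   (use transition_deriv[OF d e x(3)] in \<open>simp add: tp\<close>)
 hence "(transition c e hfd (%xi. T1 d e (cmap d p) (T1 c d (cmap c p) xi))) (at (cmap c p))"
 proof(rule has_derivative_transform_within_open)
  show "open (W c d Int W c e)" using open_W c d e by blast
  show "cmap c p : W c d Int W c e" using x by simp
  fix y assume y: "y : W c d Int W c e"
  then obtain q where q: "y = cmap c q" "q : cdom c" "q : cdom d" by auto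
  thus "transition d e (transition c d y) = transition c e y"
   using transition_cmap[OF c q(2)] transition_cmap[OF d q(3)] by simp
 qed
 from has_derivative_unique[OF this transition_deriv[OF c e x(2)]] show ?thesis by metis
qed

lemma T1_id:
 assumes c: "c : A" and x: "x : V c"
 shows "T1 c c x xi = xi"
proof -
 have "(transition c c hfd (%xi. xi)) (at x)"
 proof(rule has_derivative_transform_within_open[OF has_derivative_ident open_V[OF c] x])
  show "y = transition c c y" if y: "y : V c" for y
  proof -
   obtain p where "p : cdom c" "y = cmap c p" using y by auto
   thus ?thesis using transition_cmap[OF c, of p c] by simp
  qed
 qed
 moreover have "x : W c c" using x by simp
 ultimately show ?thesis
  using has_derivative_unique[OF _ transition_deriv[OF c c]] by metis
qed

lemma T1_inverse:
 assumes c: "c : A" and d: "d : A" and p: "p : cdom c" "p : cdom d"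
 shows "T1 d c (cmap d p) (T1 c d (cmap c p) xi) = xi"
 using T1_chain[OF c d c p(1,2,1)] T1_id[OF c, of "cmap c p"] p(1) by simp

lemma tvec_T1: "tvec A c p xi = (%d. if d : A & p : cdom d then T1 c d (cmap c p) xi else 0)"
 unfolding tvec_def T1_def ..

lemma tangent_space_iff: "v : TS p \<longleftrightarrow>
 (ALL c:A. ALL d:A. p : cdom c Int cdom d --> v d = T1 c d (cmap c p) (v c)) & (ALL c. ~ (c : A & p : cdom c) --> v c = 0)"
 by(simp add: tangent_space_def T1_def)

lemma tvec_tangent:
 assumes c: "c : A" "p : cdom c" shows "tvec A c p xi : TS p"
 unfolding tangent_space_iff
proof(intro conjI ballI impI allI)
 fix d e assume de: "d : A" "e : A" "p : cdom d Int cdom e"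
 show "tvec A c p xi e = T1 d e (cmap d p) (tvec A c p xi d)"
  using T1_chain[OF c(1) de(1,2) c(2), of xi] de by(simp add: tvec_T1)
qed (auto simp: tvec_T1)

lemma tvec_coord: "c : A ==> p : cdom c ==> tvec A c p xi c = xi"
 by(simp add: tvec_T1 T1_id)

lemma tangent_T1: "v : TS p ==> c : A ==> d : A ==> p : cdom c ==> p : cdom d ==>
 v d = T1 c d (cmap c p) (v c)"
 unfolding tangent_space_iff by blast

lemma tangent_zero: "v : TS p ==> ~ (c : A & p : cdom c) ==> v c = 0"
 unfolding tangent_space_iff by blast

lemma tangent_eq:
 assumes v: "v : TS p" and c: "c : A" "p : cdom c" shows "tvec A c p (v c) = v"
proof(rule ext)
 fix d
 show "tvec A c p (v c) d = v d"
 proof(cases "d : A & p : cdom d")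
  case True
  thus ?thesis using tangent_T1[OF v c(1) _ c(2), of d] by(simp add: tvec_T1)
 next
  case False
  thus ?thesis using tangent_zero[OF v False] by(auto simp: tvec_T1)
 qed
qed

lemma tangent_eqI: "v : TS p ==> w : TS p ==> c : A ==> p : cdom c ==>
 v c = w c ==> v = w"
 using tangent_eq by metis

lemma tangentI:
 assumes "c : A" "p : cdom c" "!!d. d : A ==> p : cdom d ==> v d = T1 c d (cmap c p) (v c)"
  and "!!d. ~ (d : A & p : cdom d) ==> v d = 0"
 shows "v : TS p"
proof -
 have e: "tvec A c p (v c) = v"
 proof(rule ext)
  show "tvec A c p (v c) d = v d" for d
   using assms(3)[of d] assms(4)[of d] by(cases "d : A & p : cdom d") (auto simp: tvec_T1)
 qed
 from tvec_tangent[OF assms(1,2), of "v c"] show ?thesis unfolding e .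
qed

lemma carrierE:
 assumes "p : car" obtains c where "c : A" "p : cdom c"
 using assms by(auto simp: carrier_def)

lemma g_bilinear: "c : A ==> p : cdom c ==> bilinear (%xi eta. g p (tvec A c p xi) (tvec A c p eta))"
 using metric by(simp add: riemannian_metric_def)

lemma g_sym: "p : car ==> v : TS p ==> w : TS p ==> g p v w = g p w v"
 and g_pos: "p : car ==> v : TS p ==> v ~= (%_. 0) ==> 0 < g p v v"
 using metric by(auto simp: riemannian_metric_def)

lemma gram_smooth: "c : A ==> Ck_on k (V c) (gr c)"
 using metric by(simp add: riemannian_metric_def smooth_on_def)

lemma Gm_bilinear: "bilinear (Gm c x)"
 by(auto simp: bilinear_def Gm_def inner_left_distrib inner_right_distrib matrix_vector_right_distrib
   matrix_vector_mult_scaleR intro!: linearI)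

lemma dGm_bilinear: "bilinear (dGm c x ze)"
 by(auto simp: bilinear_def dGm_def inner_left_distrib inner_right_distrib matrix_vector_right_distrib
   matrix_vector_mult_scaleR intro!: linearI)

lemma Gm_tvec:
 assumes c: "c : A" and p: "p : cdom c"
 shows "g p (tvec A c p xi) (tvec A c p eta) = Gm c (cmap c p) xi eta"
proof -
 have "(%xi eta. g p (tvec A c p xi) (tvec A c p eta)) = Gm c (cmap c p)"
 proof(rule bilinear_eq_stdbasis[OF g_bilinear[OF c p] Gm_bilinear])
  fix i j :: "real^'n" assume "i : Basis" "j : Basis"
  then obtain k l where "i = axis k 1" "j = axis l 1" by(auto simp: Basis_vec_def)
  thus "g p (tvec A c p i) (tvec A c p j) = Gm c (cmap c p) i j"
   by(simp add: Gm_def gram_def cinv_cmap[OF c p] inner_axis' matrix_vector_mult_basis column_def)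
 qed
 thus ?thesis by metis
qed

lemma g_coord:
 assumes c: "c : A" and p: "p : cdom c" and v: "v : TS p" and w: "w : TS p"
 shows "g p v w = Gm c (cmap c p) (v c) (w c)"
 using Gm_tvec[OF c p, of "v c" "w c"] tangent_eq[OF v c p] tangent_eq[OF w c p] by simp

lemma Gm_sym: 
 assumes c: "c : A" and x: "x : V c" shows "Gm c x xi eta = Gm c x eta xi"
proof -
 obtain p where p: "p : cdom c" "x = cmap c p" using x by auto
 thus ?thesis
  using g_sym[OF _ tvec_tangent[OF c p(1)] tvec_tangent[OF c p(1)], of xi eta] Gm_tvec[OF c p(1)] cdom_carrier[OF c] by auto
qed

lemma Gm_pos: 
 assumes c: "c : A" and x: "x : V c" and nz: "xi ~= 0" shows "0 < Gm c x xi xi"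
proof -
 obtain p where p: "p : cdom c" "x = cmap c p" using x by auto
 have "tvec A c p xi ~= (%_. 0)" using tvec_coord[OF c p(1), of xi] nz by metis
 thus ?thesis
  using g_pos[OF _ tvec_tangent[OF c p(1)], of xi] Gm_tvec[OF c p(1)] cdom_carrier[OF c] p by auto
qed

lemma Gm_trans:
 assumes c: "c : A" and d: "d : A" and x: "x : W c d"
 shows "Gm c x xi eta = Gm d (transition c d x) (T1 c d x xi) (T1 c d x eta)"
proof -
 obtain p where p: "p : cdom c" "p : cdom d" "x = cmap c p" using x by auto
 have e: "tvec A c p xi = tvec A d p (T1 c d x xi)" for xi
  using tangent_eq[OF tvec_tangent[OF c p(1)] d p(2), of xi] d p by(simp add: tvec_T1)
 show ?thesis
  using Gm_tvec[OF c p(1), of xi eta] Gm_tvec[OF d p(2)] transition_cmap[OF c p(1)] p by(simp add: e)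
qed

lemma gram_deriv: "c : A ==> x : V c ==> (gr c hfd Fd (gr c) (at x)) (at x)"
 by(rule Ck_on_has_derivative[OF gram_smooth])

lemma Gm_deriv0: 
 assumes "c : A" "x : V c" 
 shows "((%y. Gm c y xi eta) hfd (%ze. dGm c x ze xi eta)) (at x)"
 unfolding Gm_def dGm_def
 by(intro has_derivative_inner_right bounded_linear.has_derivative[OF bounded_bilinear.bounded_linear_left[OF bounded_bilinear_mvmult]] gram_deriv assms)

lemma dGm_linear: 
 assumes "c : A" "x : V c" shows "linear (%ze. dGm c x ze xi eta)"
 using has_derivative_linear[OF Gm_deriv0[OF assms]] .

lemma Gm_deriv:
 assumes c: "c : A" and x: "h x : V c"
  and "(h hfd h') (at x)" "(a hfd a') (at x)" "(b hfd b') (at x)"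
 shows "((%y. Gm c (h y) (a y) (b y)) hfd
  (%ze. dGm c (h x) (h' ze) (a x) (b x) + Gm c (h x) (a' ze) (b x) + Gm c (h x) (a x) (b' ze))) (at x)"
 by(rule bilinear_family_derivative[OF Gm_bilinear open_V[OF c] x Gm_deriv0[OF c x] dGm_bilinear assms(3-)])

lemma dGm_sym:
 assumes c: "c : A" and x: "x : V c" shows "dGm c x ze xi eta = dGm c x ze eta xi"
proof -
 have "((%y. Gm c y xi eta) hfd (%ze. dGm c x ze eta xi)) (at x)"
  by(rule has_derivative_transform_within_open[OF Gm_deriv0[OF c x] open_V[OF c] x]) (rule Gm_sym[OF c])
 from fun_cong[OF has_derivative_unique[OF this Gm_deriv0[OF c x]], of ze] show ?thesis by simp
qed

lemma gram_det: 
 assumes c: "c : A" and x: "x : V c" shows "det (gr c x) ~= 0"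
proof
 assume "det (gr c x) = 0"
 then obtain v where "v ~= 0" "gr c x *v v = 0"
  using invertible_det_nz[of "gr c x"] matrix_left_invertible_ker[of "gr c x"]
  by(auto simp: invertible_left_inverse)
 thus False using Gm_pos[OF c x, of v] by(simp add: Gm_def)
qed

text \<open>The Koszul formula for coordinate fields. Symmetry, bilinearity, metric compatibility
  and the transformation law of the Christoffel symbols are all read off from it by testing against
  every \<open>ze\<close> and using nondegeneracy (\<open>Gm_eqI\<close>).\<close>

lemma koszul:
 assumes c: "c : A" and x: "x : V c"
 shows "2*Gm c x (Gam c x xi eta) ze = dGm c x xi eta ze + dGm c x eta xi ze - dGm c x ze xi eta"
proof -
 let ?dG = "Fd (gr c) (at x)"
 define b where "b = (\<chi> l. (eta dot (?dG xi *v axis l 1) + xi dot (?dG eta *v axis l 1) - xi dot (?dG (axis l 1) *v eta))/2)"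
 have Gb: "Gam c x xi eta = matrix_inv (gr c x) *v b"
  by(simp add: christoffel_def b_def Let_def)
 have "gr c x *v Gam c x xi eta = b"
  unfolding Gb by(simp add: matrix_vector_mul_assoc matrix_inv_inverse gram_det[OF c x])
 hence "Gm c x (Gam c x xi eta) ze = ze dot b"
  unfolding Gm_sym[OF c x, of _ ze] by(simp add: Gm_def)
 also have "2*(ze dot b) = dGm c x xi eta ze + dGm c x eta xi ze - dGm c x ze xi eta"
 proof -
  \<comment> \<open>The right-hand side is linear in \<open>ze\<close>, so its values on the axis
    vectors, which are the entries of \<open>2*b\<close>, determine it.\<close>
  define F where "F = (%ze. dGm c x xi eta ze + dGm c x eta xi ze - dGm c x ze xi eta)"
  have Fl: "F (axis l 1) = 2*b $ l" for l
   by(simp add: F_def b_def dGm_def)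
  have "linear F"
   unfolding F_def using dGm_bilinear[of c x] dGm_linear[OF c x]
   by(intro linear_compose_add linear_compose_sub) (auto simp: bilinear_def)
  hence "F ze = (\<Sum>l\<in>Basis. (ze dot l) *R F l)" by(rule linear_sum_Basis)
  also have "... = (\<Sum>l\<in>UNIV. ze $ l*F (axis l 1))"
  proof -
   have "bij_betw (%i. axis i (1::real)) (UNIV :: 'n set) Basis"
    by(auto simp: bij_betw_def inj_on_def axis_eq_axis Basis_vec_def)
   from sum.reindex_bij_betw[OF this, of "%l. (ze dot l) *R F l"] show ?thesis
    by(simp add: cart_eq_inner_axis)
  qed
  finally have "F ze = (\<Sum>l\<in>UNIV. ze $ l*(2*b $ l))" unfolding Fl .
  thus ?thesis by(simp add: F_def inner_vec_def sum_distrib_left mult_ac)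
 qed
 finally show ?thesis .
qed

lemma Gm_eqI:
 assumes c: "c : A" and x: "x : V c" and eq: "!!ze. Gm c x xi ze = Gm c x eta ze" shows "xi = eta"
proof(rule ccontr)
 assume "xi ~= eta"
 hence "0 < Gm c x (xi - eta) (xi - eta)" by(intro Gm_pos[OF c x]) simp
 moreover have "Gm c x (xi - eta) (xi - eta) = Gm c x xi (xi - eta) - Gm c x eta (xi - eta)"
  by(simp add: Gm_def inner_diff_left)
 ultimately show False using eq by simp
qed

lemma Gam_sym:
 assumes c: "c : A" and x: "x : V c" shows "Gam c x xi eta = Gam c x eta xi"
proof(rule Gm_eqI[OF c x])
 show "Gm c x (Gam c x xi eta) ze = Gm c x (Gam c x eta xi) ze" for ze
  using koszul[OF c x, of xi eta ze] koszul[OF c x, of eta xi ze] dGm_sym[OF c x, of ze xi eta] by linarith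
qed

lemma Gam_bilinear:
 assumes c: "c : A" and x: "x : V c" shows "bilinear (Gam c x)"
proof -
 have bl: "linear (%xi. Gm c x xi eta)" "linear (%eta. Gm c x xi eta)" for xi eta using Gm_bilinear[of c x] by(auto simp: bilinear_def)
 have dl: "linear (%xi. dGm c x ze xi eta)" "linear (%eta. dGm c x ze xi eta)" "linear (%ze. dGm c x ze xi eta)" for xi eta ze
  using dGm_bilinear[of c x ze] dGm_linear[OF c x] by(auto simp: bilinear_def)
 have l: "linear (%xi. Gam c x xi eta)" for eta
 proof(rule linearI)
  show "Gam c x (u + v) eta = Gam c x u eta + Gam c x v eta" for u v
  proof(rule Gm_eqI[OF c x])
   fix ze
   have "2*Gm c x (Gam c x (u + v) eta) ze = 2*Gm c x (Gam c x u eta) ze + 2*Gm c x (Gam c x v eta) ze"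
    unfolding koszul[OF c x] linear_add[OF dl(1)] linear_add[OF dl(3)] by simp
   thus "Gm c x (Gam c x (u + v) eta) ze = Gm c x (Gam c x u eta + Gam c x v eta) ze"
    unfolding linear_add[OF bl(1)] by simp
  qed
  show "Gam c x (r *R u) eta = r *R Gam c x u eta" for r u
  proof(rule Gm_eqI[OF c x])
   fix ze
   have "2*Gm c x (Gam c x (r *R u) eta) ze = r*(2*Gm c x (Gam c x u eta) ze)"
    unfolding koszul[OF c x] linear_scale[OF dl(1)] linear_scale[OF dl(3)] by(simp add: algebra_simps)
   thus "Gm c x (Gam c x (r *R u) eta) ze = Gm c x (r *R Gam c x u eta) ze"
    unfolding linear_scale[OF bl(1)] by simp
  qed
 qed
 thus ?thesis using Gam_sym[OF c x] by(simp add: bilinear_def)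
qed

text \<open>In the sum of two Koszul formulas the other two derivatives of the metric cancel by
  symmetry and \<open>dGm c x ze xi eta\<close> appears twice.\<close>

lemma metric_compat:
 assumes c: "c : A" and x: "x : V c"
 shows "dGm c x ze xi eta = Gm c x (Gam c x ze xi) eta + Gm c x xi (Gam c x ze eta)"
 using koszul[OF c x, of ze xi eta] koszul[OF c x, of ze eta xi] Gm_sym[OF c x, of xi "Gam c x ze eta"]
  dGm_sym[OF c x, of ze xi eta] dGm_sym[OF c x, of xi ze eta] dGm_sym[OF c x, of eta ze xi]
 by linarith

end

section \<open>Transformation law of the connection and symmetries of the curvature\<close>

context riemannian
begin

lemma Gam_smooth:
 fixes h :: "'b::euclidean_space => real^'n"
 assumes c: "c : A" and U: "open U" and h: "!!z. z : U ==> h z : V c" "Ck_on k U h"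
  and a: "Ck_on k U a" and b: "Ck_on k U b"
 shows "Ck_on k U (%z. Gam c (h z) (a z) (b z))"
 unfolding christoffel_def Let_def
proof(rule Ck_on_matrix_inv_mult[OF U])
 show "Ck_on k U (%z. gr c (h z))"
  by(rule Ck_on_compose[OF U open_V[OF c] h(1) gram_smooth[OF c] h(2)])
 have fr: "Ck_on k U (%z. Fd (gr c) (at (h z)) (w z))" if "Ck_on k U w" for w
  by(rule Ck_on_frechet[OF U open_V[OF c] h(1) gram_smooth[OF c] h(2) that])
 show "Ck_on k U (%z. \<chi> l. (b z dot (Fd (gr c) (at (h z)) (a z) *v axis l 1)
   + a z dot (Fd (gr c) (at (h z)) (b z) *v axis l 1)
   - a z dot (Fd (gr c) (at (h z)) (axis l 1) *v b z))/2)"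
  by(intro Ck_on_vec U Ck_on_divide Ck_on_diff Ck_on_add Ck_on_inner Ck_on_mvmult Ck_on_const a b fr) simp
qed (use gram_det[OF c] h(1) in auto)

lemma Gam_smooth': "c : A ==> Ck_on k (V c) (%y. Gam c y xi eta)"
 by(rule Gam_smooth[OF _ open_V _ Ck_on_id Ck_on_const Ck_on_const]) auto

lemma Gam_deriv0: "c : A ==> x : V c ==>
 ((%y. Gam c y xi eta) hfd (%ze. dGam c x ze xi eta)) (at x)"
 unfolding dGam_def by(rule Ck_on_has_derivative[OF Gam_smooth'])

lemma dGam_linear: "c : A ==> x : V c ==> linear (%ze. dGam c x ze xi eta)"
 by(rule has_derivative_linear[OF Gam_deriv0])

lemma dGam_sym:
 assumes c: "c : A" and x: "x : V c" shows "dGam c x ze xi eta = dGam c x ze eta xi"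
proof -
 have "((%y. Gam c y xi eta) hfd (%ze. dGam c x ze eta xi)) (at x)"
  by(rule has_derivative_transform_within_open[OF Gam_deriv0[OF c x] open_V[OF c] x]) (rule Gam_sym[OF c])
 from fun_cong[OF has_derivative_unique[OF this Gam_deriv0[OF c x]], of ze] show ?thesis by simp
qed

lemma Gam_l:
 assumes c: "c : A" and x: "x : V c"
 shows "linear (%xi. Gam c x xi eta)" "linear (%eta. Gam c x xi eta)"
 using Gam_bilinear[OF c x] by(auto simp: bilinear_def)

lemma dGam_bilinear:
 assumes c: "c : A" and x: "x : V c" shows "bilinear (dGam c x ze)"
proof -
 have "linear (%xi. dGam c x ze xi eta)" for eta
 proof(rule linearI)
  fix u v
  have "((%y. Gam c y (u + v) eta) hfd (%ze. dGam c x ze u eta + dGam c x ze v eta)) (at x)"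
   by(rule has_derivative_transform_within_open[OF has_derivative_add[OF Gam_deriv0[OF c x] Gam_deriv0[OF c x]] open_V[OF c] x])
    (simp add: linear_add[OF Gam_l(1)[OF c]])
  from fun_cong[OF has_derivative_unique[OF this Gam_deriv0[OF c x]], of ze]
  show "dGam c x ze (u + v) eta = dGam c x ze u eta + dGam c x ze v eta" by simp
 next
  fix r u
  have "((%y. Gam c y (r *R u) eta) hfd (%ze. r *R dGam c x ze u eta)) (at x)"
   by(rule has_derivative_transform_within_open[OF has_derivative_scaleR_right[OF Gam_deriv0[OF c x]] open_V[OF c] x])
    (simp add: linear_scale[OF Gam_l(1)[OF c]])
  from fun_cong[OF has_derivative_unique[OF this Gam_deriv0[OF c x]], of ze]
  show "dGam c x ze (r *R u) eta = r *R dGam c x ze u eta" by simp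
 qed
 thus ?thesis using dGam_sym[OF c x] by(simp add: bilinear_def)
qed

lemma dGam_l:
 assumes c: "c : A" and x: "x : V c"
 shows "linear (%xi. dGam c x ze xi eta)" "linear (%eta. dGam c x ze xi eta)"
 using dGam_bilinear[OF c x, of ze] by(auto simp: bilinear_def)

lemma Gam_deriv:
 assumes c: "c : A" and x: "h x : V c"
  and "(h hfd h') (at x)" "(a hfd a') (at x)" "(b hfd b') (at x)"
 shows "((%y. Gam c (h y) (a y) (b y)) hfd
  (%ze. dGam c (h x) (h' ze) (a x) (b x) + Gam c (h x) (a' ze) (b x) + Gam c (h x) (a x) (b' ze))) (at x)"
 by(rule bilinear_family_derivative[OF Gam_bilinear[OF c] open_V[OF c] x Gam_deriv0[OF c x] dGam_bilinear[OF c x] assms(3-)])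

lemma dGam_smooth:
 fixes h :: "'b::euclidean_space => real^'n"
 assumes c: "c : A" and U: "open U" and h: "!!z. z : U ==> h z : V c" "Ck_on k U h"
  and e: "Ck_on k U e" and a: "Ck_on k U a" and b: "Ck_on k U b"
 shows "Ck_on k U (%z. dGam c (h z) (e z) (a z) (b z))"
proof -
 have "Ck_on k U (%z. \<Sum>i\<in>Basis. \<Sum>j\<in>Basis. ((a z dot i)*(b z dot j)) *R dGam c (h z) (e z) i j)"
  unfolding dGam_def
  by(intro Ck_on_sum U Ck_on_scaleR Ck_on_mult Ck_on_inner Ck_on_const a b
    Ck_on_frechet[OF U open_V[OF c] h(1) Gam_smooth'[OF c] h(2) e])
 thus ?thesis
  by(rule Ck_on_cong[OF U]) (use bilinear_expand[OF dGam_bilinear[OF c h(1)]] in simp)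
qed

lemma T1_family_deriv:
 assumes c: "c : A" and d: "d : A" and x: "h x : W c d"
  and h: "(h hfd h') (at x)" and a: "(a hfd a') (at x)"
 shows "((%y. T1 c d (h y) (a y)) hfd (%ze. T2 c d (h x) (h' ze) (a x) + T1 c d (h x) (a' ze))) (at x)"
proof -
 have lin: "linear (%xi. T2 c d y ze xi)" if y: "y : W c d" for y ze
 proof -
  have "linear (%xi. T2 c d y xi ze)" by(rule has_derivative_linear[OF T1_deriv[OF c d y]])
  thus ?thesis using T2_sym[OF c d y] by simp
 qed
 \<comment> \<open>The linear family \<open>T1\<close> becomes bilinear through a scalar second
   argument, held at the constant 1, so that the Leibniz rule for bilinear families applies.\<close>
 have "((%y. (%y u w. w *R T1 c d y u) (h y) (a y) ((%_. 1::real) y)) hfd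
  (%ze. (%ze u w. w *R T2 c d (h x) ze u) (h' ze) (a x) ((%_. 1) x) + (%y u w. w *R T1 c d y u) (h x) (a' ze) ((%_. 1) x)
   + (%y u w. w *R T1 c d y u) (h x) (a x) ((%_. 0) ze))) (at x)"
 proof(rule bilinear_family_derivative[OF _ open_W[OF c d] x _ _ h a])
  show "bilinear (%u w. w *R T1 c d y u)" if "y : W c d" for y
   using T1_linear[OF c d that] by(auto simp: bilinear_def linear_add linear_scale algebra_simps intro!: linearI)
  show "((%y. j *R T1 c d y i) hfd (%ze. j *R T2 c d (h x) ze i)) (at (h x))" for i j
   by(rule has_derivative_scaleR_right[OF T1_deriv[OF c d x]])
  show "bilinear (%u w. w *R T2 c d (h x) ze u)" for ze
   using lin[OF x, of ze] by(auto simp: bilinear_def linear_add linear_scale algebra_simps intro!: linearI)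
 qed (rule has_derivative_const)
 thus ?thesis by simp
qed

lemma T2_linear:
 assumes "c : A" "d : A" "x : W c d"
 shows "linear (%xi. T2 c d x xi ze)"
 by(rule has_derivative_linear[OF T1_deriv[OF assms]])

lemma transition_in: 
 assumes "c : A" "x : W c d" shows "x : V c" "transition c d x : V d" "transition c d x : W d c"
 using assms transition_V transition_W by auto

lemma T1_surj:
 assumes c: "c : A" and d: "d : A" and x: "x : W c d"
 shows "T1 c d x (T1 d c (transition c d x) omg) = omg"
proof -
 obtain p where p: "p : cdom c" "p : cdom d" "x = cmap c p" using x by auto
 thus ?thesis using T1_inverse[OF d c p(2,1), of omg] transition_cmap[OF c p(1), of d] by simp
qed

lemma dGm_trans:
 assumes c: "c : A" and d: "d : A" and x: "x : W c d"
 shows "dGm c x ze xi eta = dGm d (transition c d x) (T1 c d x ze) (T1 c d x xi) (T1 c d x eta)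
  + Gm d (transition c d x) (T2 c d x ze xi) (T1 c d x eta) + Gm d (transition c d x) (T1 c d x xi) (T2 c d x ze eta)"
proof -
 have "((%y. Gm d (transition c d y) (T1 c d y xi) (T1 c d y eta)) hfd
  (%ze. dGm d (transition c d x) (T1 c d x ze) (T1 c d x xi) (T1 c d x eta)
   + Gm d (transition c d x) (T2 c d x ze xi) (T1 c d x eta) + Gm d (transition c d x) (T1 c d x xi) (T2 c d x ze eta))) (at x)"
  by(rule Gm_deriv[OF d transition_in(2)[OF c x] transition_deriv[OF c d x] T1_deriv[OF c d x] T1_deriv[OF c d x]])
 hence "((%y. Gm c y xi eta) hfd
  (%ze. dGm d (transition c d x) (T1 c d x ze) (T1 c d x xi) (T1 c d x eta)
   + Gm d (transition c d x) (T2 c d x ze xi) (T1 c d x eta) + Gm d (transition c d x) (T1 c d x xi) (T2 c d x ze eta))) (at x)"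
  by(rule has_derivative_transform_within_open[OF _ open_W[OF c d] x]) (simp add: Gm_trans[OF c d])
 from fun_cong[OF has_derivative_unique[OF this Gm_deriv0[OF c transition_in(1)[OF c x]]], of ze] show ?thesis by simp
qed

text \<open>The differentiated transformation law of the metric is inserted into the Koszul formula.
  By symmetry of \<open>T2\<close> four of the six second-order terms cancel, and the other two are
  equal.\<close>

lemma Gam_trans:
 assumes c: "c : A" and d: "d : A" and x: "x : W c d"
 shows "T1 c d x (Gam c x xi eta) = Gam d (transition c d x) (T1 c d x xi) (T1 c d x eta) + T2 c d x xi eta"
proof(rule Gm_eqI[OF d transition_in(2)[OF c x]])
 fix omg
 define ze where "ze = T1 d c (transition c d x) omg"
 have om: "omg = T1 c d x ze" using T1_surj[OF c d x] by(simp add: ze_def)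
 note xV = transition_in(1)[OF c x] and yV = transition_in(2)[OF c x]
 have "2*Gm d (transition c d x) (T1 c d x (Gam c x xi eta)) omg = 2*Gm c x (Gam c x xi eta) ze"
  by(simp add: om Gm_trans[OF c d x])
 also have "... = 2*Gm d (transition c d x) (Gam d (transition c d x) (T1 c d x xi) (T1 c d x eta)) omg
  + 2*Gm d (transition c d x) (T2 c d x xi eta) omg"
  unfolding koszul[OF c xV] koszul[OF d yV] om dGm_trans[OF c d x]
  using T2_sym[OF c d x, of eta xi] T2_sym[OF c d x, of ze xi] T2_sym[OF c d x, of ze eta]
   Gm_sym[OF d yV, of "T1 c d x eta" "T2 c d x xi ze"] Gm_sym[OF d yV, of "T1 c d x xi" "T2 c d x eta ze"]
   by simp
 finally show "Gm d (transition c d x) (T1 c d x (Gam c x xi eta)) omg =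
   Gm d (transition c d x) (Gam d (transition c d x) (T1 c d x xi) (T1 c d x eta) + T2 c d x xi eta) omg"
  using Gm_bilinear[of d "transition c d x"] by(simp add: bilinear_ladd)
qed

lemma curv_coord_eq: "cc c x xi eta ze =
 dGam c x xi eta ze - dGam c x eta xi ze + Gam c x xi (Gam c x eta ze) - Gam c x eta (Gam c x xi ze)"
 by(simp add: curv_coord_def dGam_def)

text \<open>The derivative of \<open>Gam_trans\<close>. The last term contains a third derivative of
  the transition map; it is kept explicit because it will cancel in the curvature.\<close>

lemma dGam_trans:
 assumes c: "c : A" and d: "d : A" and x: "x : W c d"
 shows "T2 c d x xi (Gam c x eta ze) + T1 c d x (dGam c x xi eta ze) =
  dGam d (transition c d x) (T1 c d x xi) (T1 c d x eta) (T1 c d x ze)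
  + Gam d (transition c d x) (T2 c d x xi eta) (T1 c d x ze) + Gam d (transition c d x) (T1 c d x eta) (T2 c d x xi ze)
  + Fd (%y. T2 c d y eta ze) (at x) xi"
proof -
 note xV = transition_in(1)[OF c x] and yV = transition_in(2)[OF c x]
 have "Ck_on (Suc 0) (W c d) (%y. T2 c d y eta ze)"
  unfolding T2_def by(rule Ck_on_frechet[OF open_W open_W _ T1_smooth Ck_on_id Ck_on_const]) (use c d in auto)
 from Ck_on_has_derivative[OF this x]
 have T3: "((%y. T2 c d y eta ze) hfd Fd (%y. T2 c d y eta ze) (at x)) (at x)" .
 have "((%y. T1 c d y (Gam c y eta ze)) hfd (%xi. T2 c d x xi (Gam c x eta ze) + T1 c d x (dGam c x xi eta ze))) (at x)"
  by(rule T1_family_deriv[OF c d x has_derivative_ident Gam_deriv0[OF c xV]])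
 hence L: "((%y. Gam d (transition c d y) (T1 c d y eta) (T1 c d y ze) + T2 c d y eta ze) hfd
   (%xi. T2 c d x xi (Gam c x eta ze) + T1 c d x (dGam c x xi eta ze))) (at x)"
  by(rule has_derivative_transform_within_open[OF _ open_W[OF c d] x]) (rule Gam_trans[OF c d])
 have R: "((%y. Gam d (transition c d y) (T1 c d y eta) (T1 c d y ze) + T2 c d y eta ze) hfd
   (%xi. dGam d (transition c d x) (T1 c d x xi) (T1 c d x eta) (T1 c d x ze)
  + Gam d (transition c d x) (T2 c d x xi eta) (T1 c d x ze) + Gam d (transition c d x) (T1 c d x eta) (T2 c d x xi ze)
  + Fd (%y. T2 c d y eta ze) (at x) xi)) (at x)"
  by(rule has_derivative_add[OF Gam_deriv[OF d yV transition_deriv[OF c d x] T1_deriv[OF c d x] T1_deriv[OF c d x]] T3])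
 from fun_cong[OF has_derivative_unique[OF L R], of xi] show ?thesis .
qed

text \<open>The coordinate curvature is a tensor: in the difference of two instances of
  \<open>dGam_trans\<close> the third derivatives cancel by symmetry, and the terms with
  \<open>T2\<close> are compensated by the quadratic part of the curvature.\<close>

lemma curv_trans:
 assumes c: "c : A" and d: "d : A" and x: "x : W c d"
 shows "T1 c d x (cc c x xi eta ze) =
  cc d (transition c d x) (T1 c d x xi) (T1 c d x eta) (T1 c d x ze)"
proof -
 note xV = transition_in(1)[OF c x] and yV = transition_in(2)[OF c x]
 define y T where "y = transition c d x" and "T = T1 c d x"
 have T3: "Fd (%y. T2 c d y eta ze) (at x) xi = Fd (%y. T2 c d y xi ze) (at x) eta"
  unfolding T2_def by(rule second_derivative_symmetric[OF open_W[OF c d] T1_smooth[OF c d] x])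
 have lin: "linear T" unfolding T_def by(rule T1_linear[OF c d x])
 have q: "Gam d y (T xi) (Gam d y (T eta) (T ze)) =
   T (Gam c x xi (Gam c x eta ze)) - T2 c d x xi (Gam c x eta ze) - Gam d y (T xi) (T2 c d x eta ze)" for xi eta
 proof -
  have "Gam d y (T eta) (T ze) = T (Gam c x eta ze) - T2 c d x eta ze"
   using Gam_trans[OF c d x, of eta ze] by(simp add: y_def T_def)
  moreover have "Gam d y (T xi) (T (Gam c x eta ze)) = T (Gam c x xi (Gam c x eta ze)) - T2 c d x xi (Gam c x eta ze)"
   using Gam_trans[OF c d x, of xi "Gam c x eta ze"] by(simp add: y_def T_def)
  ultimately show ?thesis
   using linear_diff[OF Gam_l(2)[OF d yV]] by(simp add: y_def)
 qed
 have p: "dGam d y (T xi) (T eta) (T ze) = T2 c d x xi (Gam c x eta ze) + T (dGam c x xi eta ze)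
  - Gam d y (T2 c d x xi eta) (T ze) - Gam d y (T eta) (T2 c d x xi ze)
  - Fd (%y. T2 c d y eta ze) (at x) xi" for xi eta
  using dGam_trans[OF c d x, of xi eta ze] by(simp add: y_def T_def algebra_simps)
 show ?thesis
  unfolding curv_coord_eq y_def[symmetric] T_def[symmetric] p q
  using T3 T2_sym[OF c d x, of eta xi] by(simp add: linear_add[OF lin] linear_diff[OF lin])
qed

lemma curv_smooth:
 fixes h :: "'b::euclidean_space => real^'n"
 assumes c: "c : A" and U: "open U" and h: "!!z. z : U ==> h z : V c" "Ck_on k U h"
  and "Ck_on k U u" "Ck_on k U v" "Ck_on k U w"
 shows "Ck_on k U (%z. cc c (h z) (u z) (v z) (w z))"
 unfolding curv_coord_eq
 by(intro Ck_on_diff Ck_on_add dGam_smooth Gam_smooth assms)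

lemma curv_linear:
 assumes c: "c : A" and x: "x : V c"
 shows "linear (%xi. cc c x xi eta ze)" "linear (%eta. cc c x xi eta ze)"
  "linear (%ze. cc c x xi eta ze)"
proof -
 note l = Gam_l[OF c x] dGam_l[OF c x] dGam_linear[OF c x]
 show "linear (%xi. cc c x xi eta ze)" "linear (%eta. cc c x xi eta ze)"
  "linear (%ze. cc c x xi eta ze)"
  unfolding curv_coord_eq
  by(auto intro!: linearI simp: linear_add[OF l(1)] linear_add[OF l(2)] linear_add[OF l(3)] linear_add[OF l(4)] linear_add[OF l(5)]
   linear_scale[OF l(1)] linear_scale[OF l(2)] linear_scale[OF l(3)] linear_scale[OF l(4)] linear_scale[OF l(5)] algebra_simps)
qed

lemma curv_skew12: "cc c x xi eta ze = - cc c x eta xi ze"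
 by(simp add: curv_coord_eq)

lemma curv_bianchi:
 assumes "c : A" "x : V c"
 shows "cc c x xi eta ze + cc c x eta ze xi + cc c x ze xi eta = 0"
 unfolding curv_coord_eq
 using Gam_sym[OF assms, of eta xi] Gam_sym[OF assms, of ze xi] Gam_sym[OF assms, of ze eta]
  dGam_sym[OF assms, of xi ze eta] dGam_sym[OF assms, of eta ze xi] dGam_sym[OF assms, of ze eta xi]
 by simp

text \<open>Second derivatives of the function \<open>Gm c y eta ze\<close> of \<open>y\<close>
  commute. If all derivatives of the metric are expressed by metric compatibility, the commutator
  becomes the sum of the two curvature terms.\<close>

lemma curv_skew34:
 assumes c: "c : A" and x: "x : V c"
 shows "Gm c x (cc c x omg xi eta) ze = - Gm c x (cc c x omg xi ze) eta"
proof -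
 \<comment> \<open>The second derivative of \<open>Gm c y eta ze\<close>, first in direction
   \<open>xi\<close>, then in direction \<open>omg\<close>.\<close>
 define S where "S = (%omg xi. dGm c x omg (Gam c x xi eta) ze + Gm c x (dGam c x omg xi eta) ze
   + (dGm c x omg eta (Gam c x xi ze) + Gm c x eta (dGam c x omg xi ze)))"
 have fr: "Fd (%y. Gm c y eta ze) (at y) xi = dGm c y xi eta ze" if "y : V c" for y xi
  using frechet_derivative_at[OF Gm_deriv0[OF c that]] by metis
 have D: "((%y. Fd (%y. Gm c y eta ze) (at y) xi) hfd (%omg. S omg xi)) (at x)" for xi
 proof -
  note g0 = Gam_deriv0[OF c x, of xi]
  have z: "Gm c x 0 w = 0" "Gm c x w 0 = 0" for w by(simp_all add: Gm_def)
  have "((%y. Gm c y (Gam c y xi eta) ze + Gm c y eta (Gam c y xi ze)) hfd (%omg. S omg xi)) (at x)"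
   using has_derivative_add[OF Gm_deriv[OF c x has_derivative_ident g0 has_derivative_const]
    Gm_deriv[OF c x has_derivative_ident has_derivative_const g0]]
   by(simp add: S_def z)
  thus ?thesis
   by(rule has_derivative_transform_within_open[OF _ open_V[OF c] x]) (simp add: fr metric_compat[OF c])
 qed
 have "Ck_on 2 (V c) (%y. Gm c y eta ze)"
  unfolding Gm_def by(intro Ck_on_inner Ck_on_mvmult gram_smooth[OF c] open_V[OF c] Ck_on_const)
 from second_derivative_symmetric[OF open_V[OF c] this x]
 have "S omg xi = S xi omg"
  using fun_cong[OF frechet_derivative_at[OF D]] by metis
 thus ?thesis
  unfolding S_def metric_compat[OF c x] curv_coord_eq
  using Gm_sym[OF c x, of eta] Gm_sym[OF c x, of "Gam c x xi eta" "Gam c x omg ze"] Gm_sym[OF c x, of "Gam c x omg eta" "Gam c x xi ze"]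
  by(simp add: bilinear_ladd[OF Gm_bilinear] bilinear_lsub[OF Gm_bilinear])
qed

text \<open>The classical consequence of the two skew symmetries and the Bianchi identity, in the
  case of a repeated argument: the operator \<open>xi \<mapsto> cc c x xi eta eta\<close> of the
  Jacobi equation is self-adjoint.\<close>

lemma curv_pair:
 assumes c: "c : A" and x: "x : V c"
 shows "Gm c x (cc c x xi eta eta) ze = Gm c x (cc c x ze eta eta) xi"
proof -
 define R where "R = (%a b d e. Gm c x (cc c x a b d) e)"
 have s1: "R a b d e = - R b a d e" for a b d e
  unfolding R_def by(subst curv_skew12) (simp add: bilinear_lneg[OF Gm_bilinear])
 have s2: "R a b d e = - R a b e d" for a b d e
  unfolding R_def by(rule curv_skew34[OF c x])
 have b: "R a b d e + R b d a e + R d a b e = 0" for a b d e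
  using curv_bianchi[OF c x, of a b d]
  unfolding R_def bilinear_ladd[OF Gm_bilinear, symmetric] by(simp add: Gm_def)
 have "R xi eta eta ze = R ze eta eta xi"
  using b[of xi eta eta ze] b[of eta eta ze xi] b[of eta ze xi eta] b[of ze xi eta eta]
   s1[of eta eta] s1[of xi eta eta ze] s1[of ze eta eta xi] s1[of eta ze eta xi] s1[of xi eta ze eta] s1[of ze eta xi eta] s1[of eta eta xi ze] s1[of eta eta ze xi]
   s2[of xi eta eta ze] s2[of ze eta eta xi] s2[of eta xi eta ze] s2[of eta ze eta xi] s2[of ze xi eta eta] s2[of xi ze eta eta]
   s1[of eta xi ze eta] s1[of eta ze xi eta]
  by linarith
 thus ?thesis by(simp add: R_def)
qed

lemma curvature_coord: "c : A ==> p : cdom c ==>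
 curv p u v w c = cc c (cmap c p) (u c) (v c) (w c)"
 by(simp add: curvature_def)

lemma curvature_tangent:
 assumes p: "p : car" and u: "u : TS p" and v: "v : TS p" and w: "w : TS p"
 shows "curv p u v w : TS p"
proof -
 obtain c where c: "c : A" "p : cdom c" using p by(rule carrierE)
 show ?thesis
 proof(rule tangentI[OF c])
  fix d assume d: "d : A" "p : cdom d"
  have x: "cmap c p : W c d" using c d by auto
  show "curv p u v w d = T1 c d (cmap c p) (curv p u v w c)"
   using curv_trans[OF c(1) d(1) x, of "u c" "v c" "w c"] transition_cmap[OF c, of d]
    tangent_T1[OF u c(1) d(1) c(2) d(2)] tangent_T1[OF v c(1) d(1) c(2) d(2)] tangent_T1[OF w c(1) d(1) c(2) d(2)]
   by(simp add: curvature_coord c d)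
 qed (auto simp: curvature_def)
qed

lemma curvature_pair:
 assumes p: "p : car" and u: "u : TS p" and v: "v : TS p" and w: "w : TS p"
 shows "g p (curv p u v v) w = g p (curv p w v v) u"
proof -
 obtain c where c: "c : A" "p : cdom c" using p by(rule carrierE)
 hence x: "cmap c p : V c" by simp
 show ?thesis
  using curv_pair[OF c(1) x, of "u c" "v c" "w c"]
  by(simp add: g_coord[OF c curvature_tangent[OF p u v v] w] g_coord[OF c curvature_tangent[OF p w v v] u] curvature_coord c)
qed

end

section \<open>Global solutions from local ones\<close>

text \<open>\<open>Q t y\<close> stands for: \<open>y\<close> solves the equation at time
  \<open>t\<close>; \<open>S t\<close> is the set of admissible values at time \<open>t\<close>.
  Local solvability is assumed for every initial time near \<open>t0\<close> on a common interval
  around \<open>t0\<close>. This uniformity lets a solution on an almost maximal interval be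
  continued past both of its ends.\<close>

lemma extend_to_real_line:
 fixes Q :: "real => (real => 'v) => bool" and S :: "real => 'v set"
 assumes cong: "!!t y z. Q t y ==> (EX d>0. ALL s. \<bar>s - t\<bar> < d --> y s = z s) ==> Q t z"
  and ex: "!!t0. EX e>0. ALL s. \<bar>s - t0\<bar> < e --> (ALL v:S s. EX y. y s = v & (ALL t. \<bar>t - t0\<bar> < e --> Q t y))"
  and QS: "!!t y. Q t y ==> y t : S t"
  and uniq: "!!a b s y z t. (!!t. t : {a<..<b} ==> Q t y & Q t z) ==> s : {a<..<b} ==> y s = z s ==> t : {a<..<b} ==> y t = z t"
  and v: "v : S s"
 shows "EX y. y s = v & (ALL t. Q t y)"
proof -
 define sol where "sol = (%a b y. y s = v & (ALL t:{a<..<b}. Q t y))"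
 have glue: "EX u. (ALL t:{a<..<d}. Q t u) & (ALL t:{a<..<b}. u t = y t) & (ALL t:{c<..<d}. u t = z t)"
  if y: "!!t. t : {a<..<b} ==> Q t y" and z: "!!t. t : {c<..<d} ==> Q t z"
   and o: "a <= c" "c < ta" "ta < b" "b <= d" "y ta = z ta" for a b c d ta y z
 proof -
  define u where "u = (%t. if t < ta then y t else z t)"
  have yz: "y t = z t" if "t : {c<..<b}" for t
  proof(rule uniq[of c b y z ta])
   show "Q t y & Q t z" if "t : {c<..<b}" for t using y[of t] z[of t] that o by auto
  qed (use that o in auto)
  have uy: "u t = y t" if "t : {a<..<b}" for t using that yz[of t] o by(auto simp: u_def)
  have uz: "u t = z t" if "t : {c<..<d}" for t using that yz[of t] o by(auto simp: u_def)
  have "Q t u" if t: "t : {a<..<d}" for t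
  proof(cases "t < b")
   case True
   show ?thesis
   proof(rule cong[of t y])
    show "Q t y" using y t True by simp
    show "EX d>0. ALL s. \<bar>s - t\<bar> < d --> y s = u s"
     using uy t True by(intro exI[of _ "min (b - t) (t - a)"]) (auto simp: abs_less_iff)
   qed
  next
   case False
   show ?thesis
   proof(rule cong[of t z])
    show "Q t z" using z t False o by simp
    show "EX d>0. ALL s. \<bar>s - t\<bar> < d --> z s = u s"
     using uz t False o by(intro exI[of _ "min (d - t) (t - c)"]) (auto simp: abs_less_iff)
   qed
  qed
  thus ?thesis using uy uz by(intro exI[of _ u]) auto
 qed
 \<comment> \<open>Radii of symmetric intervals around \<open>s\<close> that carry a solution. They
   will be shown to be unbounded.\<close>
 define R where "R = {r. r > 0 & (EX y. sol (s - r) (s + r) y)}"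
 obtain e0 where e0: "e0 > 0" "ALL r. \<bar>r - s\<bar> < e0 --> (ALL v:S r. EX y. y r = v & (ALL t. \<bar>t - s\<bar> < e0 --> Q t y))"
  using ex[of s] by auto
 then obtain y0 where "y0 s = v" "!!t. \<bar>t - s\<bar> < e0 ==> Q t y0" using v by force
 hence Rne: "e0 : R" using e0(1) by(auto simp: R_def sol_def abs_less_iff intro!: exI[of _ y0])
 have unb: "~ bdd_above R"
 proof
  assume bdd: "bdd_above R"
  define q where "q = Sup R"
  have qR: "r <= q" if "r : R" for r unfolding q_def by(rule cSup_upper[OF that bdd])
  have q0: "q > 0" using qR[OF Rne] e0(1) by simp
  obtain e1 where e1: "e1 > 0" "!!r v. \<bar>r - (s + q)\<bar> < e1 ==> v : S r ==> EX y. y r = v & (ALL t. \<bar>t - (s + q)\<bar> < e1 --> Q t y)"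
   using ex[of "s + q"] by auto
  obtain e2 where e2: "e2 > 0" "!!r v. \<bar>r - (s - q)\<bar> < e2 ==> v : S r ==> EX y. y r = v & (ALL t. \<bar>t - (s - q)\<bar> < e2 --> Q t y)"
   using ex[of "s - q"] by auto
  \<comment> \<open>A common length for the local solutions around \<open>s + q\<close> and
    \<open>s - q\<close>. The bound by \<open>q\<close> keeps the two gluing points on either side
    of \<open>s\<close>, so the value at \<open>s\<close> survives.\<close>
  define e where "e = min q (min e1 e2)"
  have e: "e > 0" "e <= q" "e <= e1" "e <= e2" using q0 e1 e2 by(auto simp: e_def)
  have "q - e/4 < q" using e by simp
  then obtain r where r: "r : R" "q - e/4 < r"
   unfolding q_def using less_cSup_iff[OF _ bdd, of "Sup R - e/4"] Rne by auto
  then obtain y where y: "y s = v" "!!t. t : {s - r<..<s + r} ==> Q t y" by(auto simp: R_def sol_def)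
  have rq: "r <= q" using qR[OF r(1)] .
  define ta where "ta = s + q - e/2"
  have t1: "ta : {s - r<..<s + r}" "\<bar>ta - (s + q)\<bar> < e1" "s < ta" using e r rq q0 by(auto simp: ta_def)
  obtain z where z: "z ta = y ta" "!!t. \<bar>t - (s + q)\<bar> < e1 ==> Q t z"
   using e1(2)[OF t1(2) QS[OF y(2)[OF t1(1)]]] by auto
  have zI: "Q t z" if "t : {s + q - e<..<s + q + e}" for t using z(2)[of t] that e by auto
  have "EX u. (ALL t:{s - r<..<s + q + e}. Q t u) & (ALL t:{s - r<..<s + r}. u t = y t) & (ALL t:{s + q - e<..<s + q + e}. u t = z t)"
   by(rule glue[where ta = ta and b = "s + r" and c = "s + q - e"], erule y(2), erule zI)
    (use e r rq q0 z(1) in \<open>simp_all add: ta_def\<close>)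
  then obtain u where u: "!!t. t : {s - r<..<s + q + e} ==> Q t u" "!!t. t : {s - r<..<s + r} ==> u t = y t"
   by blast
  define sg where "sg = s - q + e/2"
  have t2: "sg : {s - r<..<s + q + e}" "\<bar>sg - (s - q)\<bar> < e2" "sg < s" using e r rq q0 by(auto simp: sg_def)
  obtain w where w: "w sg = u sg" "!!t. \<bar>t - (s - q)\<bar> < e2 ==> Q t w"
   using e2(2)[OF t2(2) QS[OF u(1)[OF t2(1)]]] by auto
  have wI: "Q t w" if "t : {s - q - e<..<s - q + e}" for t using w(2)[of t] that e by auto
  have "EX x. (ALL t:{s - q - e<..<s + q + e}. Q t x) & (ALL t:{s - q - e<..<s - q + e}. x t = w t) & (ALL t:{s - r<..<s + q + e}. x t = u t)"
   by(rule glue[where ta = sg and b = "s - q + e" and c = "s - r"], erule wI, erule u(1))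
    (use e r rq q0 w(1) in \<open>simp_all add: sg_def\<close>)
  then obtain x where x: "!!t. t : {s - q - e<..<s + q + e} ==> Q t x" "!!t. t : {s - r<..<s + q + e} ==> x t = u t"
   by blast
  have "x s = v" using x(2)[of s] u(2)[of s] y(1) r rq e q0 by auto
  hence "q + e : R" using x(1) q0 e by(auto simp: R_def sol_def algebra_simps intro!: exI[of _ x])
  thus False using qR[of "q + e"] e by simp
 qed
 have "EX y. sol (s - r) (s + r) y" if r: "r > 0" for r
 proof -
  obtain r' where "r' : R" "r' > r" using unb unfolding bdd_above_def by(meson not_le)
  thus ?thesis by(auto simp: R_def sol_def)
 qed
 then obtain Y where Y: "!!r. r > 0 ==> sol (s - r) (s + r) (Y r)" by metis
 have agree: "Y r t = Y r' t" if "t : {s - r<..<s + r}" "r <= r'" for r r' t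
 proof(rule uniq[of "s - r" "s + r" _ _ s])
  show "Q t (Y r) & Q t (Y r')" if "t : {s - r<..<s + r}" for t
   using Y[of r] Y[of r'] that \<open>r <= r'\<close> by(auto simp: sol_def)
  show "Y r s = Y r' s" using Y[of r] Y[of r'] that by(auto simp: sol_def)
 qed (use that in auto)
 define y where "y = (%t. Y (\<bar>t - s\<bar> + 1) t)"
 have "Q t y" for t
 proof(rule cong[of t "Y (\<bar>t - s\<bar> + 2)"])
  have "t : {s - (\<bar>t - s\<bar> + 2)<..<s + (\<bar>t - s\<bar> + 2)}" by(auto simp: abs_if)
  thus "Q t (Y (\<bar>t - s\<bar> + 2))" using Y[of "\<bar>t - s\<bar> + 2"] unfolding sol_def by simp
  show "EX d>0. ALL r. \<bar>r - t\<bar> < d --> Y (\<bar>t - s\<bar> + 2) r = y r"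
  proof(intro exI[of _ 1] conjI allI impI)
   fix r assume "\<bar>r - t\<bar> < 1"
   hence "\<bar>r - s\<bar> + 1 <= \<bar>t - s\<bar> + 2" by linarith
   thus "Y (\<bar>t - s\<bar> + 2) r = y r"
    unfolding y_def by(intro agree[symmetric]) auto
  qed simp
 qed
 moreover have "y s = v" using Y[of 1] by(simp add: y_def sol_def)
 ultimately show ?thesis by blast
qed

section \<open>Covariant differentiation along curves and parallel transport\<close>

context riemannian
begin

text \<open>A relational form of \<open>cov_deriv\<close> at a single time. Unlike the function, it
  asserts that the coordinate functions are differentiable, and it can be used before the field is
  known to be smooth.\<close>

definition cov_diff :: "(real => 'a) => (real => ('a, 'n) tangent) => real => ('a, 'n) tangent => bool" where
 "cov_diff ga J t J' \<longleftrightarrow> (ALL c:A. ga t : cdom c -->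
  ((%s. J s c) hvd J' c - Gam c (cmap c (ga t)) (vel ga t c) (J t c)) (at t))"

lemma curve_open:
 assumes "smooth_curve A ga" "c : A" shows "open (ga -` cdom c)"
proof -
 obtain O' where O: "open O'" "cdom c = car Int O'"
  using cdom_openin[OF assms(2)] by(auto simp: openin_open)
 have "ga -` cdom c = ga -` O'" using assms(1) by(auto simp: O(2) smooth_curve_def)
 thus ?thesis
  using assms(1) O(1) open_vimage by(auto simp: smooth_curve_def)
qed

lemma curve_carrier: "smooth_curve A ga ==> ga t : car"
 by(auto simp: smooth_curve_def)

lemma curve_smooth: "smooth_curve A ga ==> c : A ==> Ck_on k (ga -` cdom c) (%t. cmap c (ga t))"
 by(auto simp: smooth_curve_def smooth_on_def o_def)

lemma velocity_coord: "c : A ==> ga t : cdom c ==> vel ga t c = vector_derivative (%s. cmap c (ga s)) (at t)"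
 by(simp add: velocity_def o_def)

lemma curve_deriv: "smooth_curve A ga ==> c : A ==> ga t : cdom c ==>
 ((%s. cmap c (ga s)) hvd vel ga t c) (at t)"
 unfolding velocity_coord using Ck_on_vector_derivativeD(1)[OF curve_smooth, of ga c t] by simp

lemma velocity_smooth: 
 assumes s: "smooth_curve A ga" and c: "c : A" shows "Ck_on k (ga -` cdom c) (%t. vel ga t c)"
 by(rule Ck_on_cong[OF curve_open[OF s c] Ck_on_vector_derivativeD(2)[OF curve_smooth[OF s c] curve_open[OF s c]]])
  (simp add: velocity_coord c)

lemma has_vector_derivative_T1:
 assumes c: "c : A" and d: "d : A" and x: "h t : W c d"
  and h: "(h hvd h') (at t)" and a: "(a hvd a') (at t)"
 shows "((%s. T1 c d (h s) (a s)) hvd T2 c d (h t) h' (a t) + T1 c d (h t) a') (at t)"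
 using T1_family_deriv[OF c d x h[unfolded has_vector_derivative_def] a[unfolded has_vector_derivative_def]]
 by(simp add: has_vector_derivative_def linear_scale[OF T2_linear[OF c d x]] linear_scale[OF T1_linear[OF c d x]] scaleR_add_right)

lemma velocity_tangent:
 assumes s: "smooth_curve A ga" shows "vel ga t : TS (ga t)"
proof -
 obtain c where c: "c : A" "ga t : cdom c" using curve_carrier[OF s] by(rule carrierE)
 show ?thesis
 proof(rule tangentI[OF c])
  fix d assume d: "d : A" "ga t : cdom d"
  have x: "cmap c (ga t) : W c d" using c d by auto
  have "((%s. transition c d (cmap c (ga s))) hvd T1 c d (cmap c (ga t)) (vel ga t c)) (at t)"
   using has_derivative_compose[OF curve_deriv[OF s c, unfolded has_vector_derivative_def] transition_deriv[OF c(1) d(1) x]]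
   by(simp add: has_vector_derivative_def linear_scale[OF T1_linear[OF c(1) d(1) x]])
  hence "((%s. cmap d (ga s)) hvd T1 c d (cmap c (ga t)) (vel ga t c)) (at t)"
   by(rule has_vector_derivative_transform_within_open[OF _ curve_open[OF s c(1)]])
    (use c transition_cmap in auto)
  from vector_derivative_unique_at[OF curve_deriv[OF s d] this]
  show "vel ga t d = T1 c d (cmap c (ga t)) (vel ga t c)" .
 qed (auto simp: velocity_def)
qed

text \<open>One chart suffices: on changing to another one, the derivative of \<open>T1\<close>
  along the curve is exactly the inhomogeneous term of \<open>Gam_trans\<close>.\<close>

lemma cov_diffI:
 assumes s: "smooth_curve A ga" and c: "c : A" "ga t : cdom c"
  and J: "EX e>0. ALL r. \<bar>r - t\<bar> < e --> J r : TS (ga r)" and J': "J' : TS (ga t)"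
  and D: "((%s. J s c) hvd J' c - Gam c (cmap c (ga t)) (vel ga t c) (J t c)) (at t)"
 shows "cov_diff ga J t J'"
 unfolding cov_diff_def
proof(intro ballI impI)
 fix d assume d: "d : A" "ga t : cdom d"
 obtain e where e: "e > 0" "!!r. \<bar>r - t\<bar> < e ==> J r : TS (ga r)" using J by auto
 have x: "cmap c (ga t) : W c d" using c d by auto
 define y where "y = cmap c (ga t)"
 define v where "v = vel ga t"
 have vd: "v d = T1 c d y (v c)" "J t d = T1 c d y (J t c)" "J' d = T1 c d y (J' c)"
  using tangent_T1[OF velocity_tangent[OF s] c(1) d(1) c(2) d(2)] tangent_T1[OF e(2)[of t] c(1) d(1) c(2) d(2)]
   tangent_T1[OF J' c(1) d(1) c(2) d(2)] e(1) by(simp_all add: y_def v_def)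
 have "((%s. T1 c d (cmap c (ga s)) (J s c)) hvd
   T2 c d y (v c) (J t c) + T1 c d y (J' c - Gam c y (v c) (J t c))) (at t)"
  using has_vector_derivative_T1[OF c(1) d(1) x curve_deriv[OF s c] D] by(simp add: y_def v_def)
 also have "T2 c d y (v c) (J t c) + T1 c d y (J' c - Gam c y (v c) (J t c)) =
   T1 c d y (J' c) - Gam d (transition c d y) (T1 c d y (v c)) (T1 c d y (J t c))"
  using Gam_trans[OF c(1) d(1) x, of "v c" "J t c"] by(simp add: linear_diff[OF T1_linear[OF c(1) d(1) x]] y_def)
 also have "... = J' d - Gam d (cmap d (ga t)) (v d) (J t d)"
  using transition_cmap[OF c, of d] by(simp add: vd y_def)
 finally have E: "((%s. T1 c d (cmap c (ga s)) (J s c)) hvd J' d - Gam d (cmap d (ga t)) (v d) (J t d)) (at t)" .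
 have o: "open (ga -` cdom c Int ga -` cdom d Int {t - e<..<t + e})"
  by(intro open_Int curve_open[OF s] c d open_greaterThanLessThan)
 show "((%s. J s d) hvd J' d - Gam d (cmap d (ga t)) (vel ga t d) (J t d)) (at t)"
 proof(rule has_vector_derivative_transform_within_open[OF E[unfolded v_def] o])
  show "t : ga -` cdom c Int ga -` cdom d Int {t - e<..<t + e}" using c d e by simp
  show "T1 c d (cmap c (ga r)) (J r c) = J r d" if "r : ga -` cdom c Int ga -` cdom d Int {t - e<..<t + e}" for r
   using tangent_T1[OF e(2)[of r] c(1) d(1)] that by auto
 qed
qed

text \<open>The product rule in coordinates has a third term from the variation of the metric;
  metric compatibility turns it into the two Christoffel terms of the covariant derivatives.\<close>

lemma cov_diff_metric:
 assumes s: "smooth_curve A ga"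
  and J: "EX e>0. ALL r. \<bar>r - t\<bar> < e --> J r : TS (ga r) & K r : TS (ga r)"
  and J': "J' : TS (ga t)" "K' : TS (ga t)" and "cov_diff ga J t J'" "cov_diff ga K t K'"
 shows "((%s. g (ga s) (J s) (K s)) has_real_derivative g (ga t) J' (K t) + g (ga t) (J t) K') (at t)"
proof -
 obtain c where c: "c : A" "ga t : cdom c" using curve_carrier[OF s] by(rule carrierE)
 obtain e where e: "e > 0" "!!r. \<bar>r - t\<bar> < e ==> J r : TS (ga r) & K r : TS (ga r)" using J by auto
 define y where "y = cmap c (ga t)"
 define v where "v = vel ga t c"
 have y: "y : V c" using c by(simp add: y_def)
 have D: "((%s. J s c) hvd J' c - Gam c y v (J t c)) (at t)"
  "((%s. K s c) hvd K' c - Gam c y v (K t c)) (at t)"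
  using assms(5,6) c by(auto simp: cov_diff_def y_def v_def)
 have "((%s. Gm c (cmap c (ga s)) (J s c) (K s c)) hfd
  (%h. dGm c y (h *R v) (J t c) (K t c) + Gm c y (h *R (J' c - Gam c y v (J t c))) (K t c)
   + Gm c y (J t c) (h *R (K' c - Gam c y v (K t c))))) (at t)"
  using Gm_deriv[OF c(1), of "%s. cmap c (ga s)" t, OF _ curve_deriv[OF s c, unfolded has_vector_derivative_def]
    D(1)[unfolded has_vector_derivative_def] D(2)[unfolded has_vector_derivative_def]] y
  by(simp add: y_def v_def)
 moreover have "dGm c y (h *R v) (J t c) (K t c) + Gm c y (h *R (J' c - Gam c y v (J t c))) (K t c)
   + Gm c y (J t c) (h *R (K' c - Gam c y v (K t c))) = (Gm c y (J' c) (K t c) + Gm c y (J t c) (K' c))*h" for h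
  using metric_compat[OF c(1) y, of v "J t c" "K t c"]
  by(simp add: linear_scale[OF dGm_linear[OF c(1) y]] bilinear_lmul[OF Gm_bilinear] bilinear_rmul[OF Gm_bilinear]
    bilinear_lsub[OF Gm_bilinear] bilinear_rsub[OF Gm_bilinear] algebra_simps)
 ultimately have D: "((%s. Gm c (cmap c (ga s)) (J s c) (K s c)) has_real_derivative Gm c y (J' c) (K t c) + Gm c y (J t c) (K' c)) (at t)"
  by(simp add: has_field_derivative_def)
 have "((%s. g (ga s) (J s) (K s)) has_real_derivative Gm c y (J' c) (K t c) + Gm c y (J t c) (K' c)) (at t)"
 proof(rule has_field_derivative_transform_within_open[OF D])
  show "open (ga -` cdom c Int {t - e<..<t + e})" by(intro open_Int curve_open[OF s] c open_greaterThanLessThan)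
  show "t : ga -` cdom c Int {t - e<..<t + e}" using c e by simp
  show "Gm c (cmap c (ga r)) (J r c) (K r c) = g (ga r) (J r) (K r)" if "r : ga -` cdom c Int {t - e<..<t + e}" for r
   using g_coord[OF c(1), of "ga r" "J r" "K r"] e(2)[of r] that by auto
 qed
 thus ?thesis
  using g_coord[OF c J'(1), of "K t"] g_coord[OF c _ J'(2), of "J t"] e(2)[of t] e(1) by(simp add: y_def)
qed

end

context riemannian
begin

lemma zero_tangent: "(%_. 0) : TS p"
 unfolding tangent_space_iff
proof(intro conjI ballI impI allI)
 fix c d assume "c : A" "d : A" "p : cdom c Int cdom d"
 thus "0 = T1 c d (cmap c p) 0" using linear_0[OF T1_linear[of c d "cmap c p"]] by auto
qed simp

lemma tangent_comb:
 assumes "!!i. i : I ==> w i : TS p"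
 shows "(%c. \<Sum>i\<in>I. a i *R w i c) : TS p"
 unfolding tangent_space_iff
proof(intro conjI ballI impI allI)
 fix c d assume cd: "c : A" "d : A" "p : cdom c Int cdom d"
 hence l: "linear (T1 c d (cmap c p))" by(intro T1_linear) auto
 have "w i d = T1 c d (cmap c p) (w i c)" if "i : I" for i
  using tangent_T1[OF assms[OF that], of c d] cd by simp
 thus "(\<Sum>i\<in>I. a i *R w i d) = T1 c d (cmap c p) (\<Sum>i\<in>I. a i *R w i c)"
  by(simp add: linear_sum[OF l] linear_scale[OF l])
next
 fix c assume "~ (c : A & p : cdom c)"
 hence "w i c = 0" if "i : I" for i using tangent_zero[OF assms[OF that]] by blast
 thus "(\<Sum>i\<in>I. a i *R w i c) = 0" by simp
qed

lemma tangent_scale: "w : TS p ==> (%c. a *R w c) : TS p"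
 using tangent_comb[of "{0::nat}" "%_. w" p "%_. a"] by simp

lemma tangent_diff: 
 assumes "u : TS p" "w : TS p" shows "(%c. u c - w c) : TS p"
 using tangent_comb[of "{0::nat,1}" "%i. if i = 0 then u else w" p "%i. if i = 0 then 1 else -1"] assms by simp

lemma g_comb:
 assumes p: "p : car" and w: "!!i. i : I ==> w i : TS p" and v: "v : TS p"
 shows "g p (%c. \<Sum>i\<in>I. a i *R w i c) v = (\<Sum>i\<in>I. a i*g p (w i) v)"
proof -
 obtain c where c: "c : A" "p : cdom c" using p by(rule carrierE)
 have l: "linear (%x. Gm c (cmap c p) x (v c))" using Gm_bilinear by(auto simp: bilinear_def)
 have "g p (w i) v = Gm c (cmap c p) (w i c) (v c)" if "i : I" for i using g_coord[OF c w[OF that] v] .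
 moreover have "(%c. \<Sum>i\<in>I. a i *R w i c) : TS p" by(rule tangent_comb) (rule w)
 ultimately show ?thesis
  using g_coord[OF c _ v] by(simp add: linear_sum[OF l] linear_scale[OF l])
qed

lemma g_scale:
 assumes p: "p : car" and w: "w : TS p" and v: "v : TS p"
 shows "g p (%c. a *R w c) v = a*g p w v"
 using g_comb[OF p, of "{0::nat}" "%_. w" v "%_. a"] assms by simp

lemma g_zero: "p : car ==> v : TS p ==> g p (%_. 0) v = 0"
 using g_comb[of p "{}" "%_. v" v "%_. 0"] by simp

lemma cov_diff_comb:
 assumes f: "!!i. i : I ==> (f i has_real_derivative f' i) (at t)" and J: "!!i. i : I ==> cov_diff ga (J i) t (J' i)"
 shows "cov_diff ga (%s c. \<Sum>i\<in>I. f i s *R J i s c) t (%c. \<Sum>i\<in>I. f' i *R J i t c + f i t *R J' i c)"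
 unfolding cov_diff_def
proof(intro ballI impI)
 fix c assume c: "c : A" "ga t : cdom c"
 let ?G = "Gam c (cmap c (ga t)) (vel ga t c)"
 have l: "linear ?G" using Gam_l(2)[OF c(1), of "cmap c (ga t)"] c(2) by simp
 have "((%s. \<Sum>i\<in>I. f i s *R J i s c) hvd
  (\<Sum>i\<in>I. f i t *R (J' i c - ?G (J i t c)) + f' i *R J i t c)) (at t)"
 proof(rule has_vector_derivative_sum)
  fix i assume i: "i : I"
  have "((%s. J i s c) hvd J' i c - ?G (J i t c)) (at t)"
   using J[OF i] c by(simp add: cov_diff_def)
  from has_vector_derivative_scaleR[OF f[OF i] this]
  show "((%s. f i s *R J i s c) hvd f i t *R (J' i c - ?G (J i t c)) + f' i *R J i t c) (at t)" .
 qed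
 also have "(\<Sum>i\<in>I. f i t *R (J' i c - ?G (J i t c)) + f' i *R J i t c) =
   (\<Sum>i\<in>I. f' i *R J i t c + f i t *R J' i c) - ?G (\<Sum>i\<in>I. f i t *R J i t c)"
  by(simp add: linear_sum[OF l] linear_scale[OF l] sum.distrib sum_subtractf scaleR_diff_right algebra_simps)
 finally show "((%s. \<Sum>i\<in>I. f i s *R J i s c) hvd
   (\<Sum>i\<in>I. f' i *R J i t c + f i t *R J' i c) - ?G (\<Sum>i\<in>I. f i t *R J i t c)) (at t)" .
qed

lemma cov_diff_minus:
 assumes "cov_diff ga J t J'" "cov_diff ga K t K'"
 shows "cov_diff ga (%s c. J s c - K s c) t (%c. J' c - K' c)"
 using cov_diff_comb[of "{0::nat,1}" "%i _. if i = 0 then 1 else -1" "%_. 0" t ga "%i. if i = 0 then J else K" "%i. if i = 0 then J' else K'"]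
  assms by simp

text \<open>Tangency is required near \<open>t\<close> and not only at \<open>t\<close>, since a
  derivative in another chart depends on the nearby values being related by the transition
  maps.\<close>

definition par_at :: "(real => 'a) => real => (real => ('a, 'n) tangent) => bool" where
 "par_at ga t y \<longleftrightarrow> (EX d>0. ALL r. \<bar>r - t\<bar> < d --> y r : TS (ga r)) & cov_diff ga y t (%_. 0)"

lemma par_at_tangent: "par_at ga t y ==> y t : TS (ga t)"
 by(auto simp: par_at_def)

lemma par_at_cong:
 assumes y: "par_at ga t y" and eq: "EX d>0. ALL s. \<bar>s - t\<bar> < d --> y s = z s"
 shows "par_at ga t z"
proof -
 obtain d where d: "d > 0" "!!r. \<bar>r - t\<bar> < d ==> y r : TS (ga r)" using y by(auto simp: par_at_def)
 obtain e where e: "e > 0" "!!r. \<bar>r - t\<bar> < e ==> y r = z r" using eq by auto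
 have "EX d>0. ALL r. \<bar>r - t\<bar> < d --> z r : TS (ga r)"
  using d e by(intro exI[of _ "min d e"]) (metis min_less_iff_conj)
 moreover have "cov_diff ga z t (%_. 0)"
  unfolding cov_diff_def
 proof(intro ballI impI)
  fix c assume c: "c : A" "ga t : cdom c"
  have "((%s. y s c) hvd 0 - Gam c (cmap c (ga t)) (vel ga t c) (y t c)) (at t)"
   using y c by(simp add: par_at_def cov_diff_def)
  thus "((%s. z s c) hvd 0 - Gam c (cmap c (ga t)) (vel ga t c) (z t c)) (at t)"
   unfolding e(2)[of t, simplified, OF e(1)]
   by(rule has_vector_derivative_transform_within_open[of _ _ _ "{t - e<..<t + e}"]) (use e in auto)
 qed
 ultimately show ?thesis by(simp add: par_at_def)
qed

text \<open>The difference of two parallel fields has constant length, and it vanishes at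
  \<open>r\<close>.\<close>

lemma par_unique:
 assumes s: "smooth_curve A ga" and yz: "!!t. t : {a<..<b} ==> par_at ga t y & par_at ga t z"
  and r: "r : {a<..<b}" "y r = z r" and t: "t : {a<..<b}"
 shows "y t = z t"
proof -
 define w where "w = (%s c. y s c - z s c)"
 have wt: "w t : TS (ga t)" if "t : {a<..<b}" for t
  unfolding w_def using yz[OF that] by(intro tangent_diff par_at_tangent) auto
 have D: "((%s. g (ga s) (w s) (w s)) has_real_derivative 0) (at t)" if t: "t : {a<..<b}" for t
 proof -
  have c: "cov_diff ga w t (%_. 0)"
   using cov_diff_minus[of ga y t "%_. 0" z "%_. 0"] yz[OF t] by(simp add: par_at_def w_def)
  have "EX e>0. ALL r. \<bar>r - t\<bar> < e --> w r : TS (ga r) & w r : TS (ga r)"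
   using t wt by(intro exI[of _ "min (b - t) (t - a)"]) (auto simp: abs_less_iff)
  from cov_diff_metric[OF s this zero_tangent zero_tangent c c] show ?thesis
   using g_zero[OF curve_carrier[OF s] wt[OF t]] g_sym[OF curve_carrier[OF s] zero_tangent wt[OF t]] by simp
 qed
 have "EX c. ALL t:{a<..<b}. g (ga t) (w t) (w t) = c"
  by(rule has_field_derivative_zero_constant) (auto intro: has_field_derivative_at_within[OF D])
 hence "g (ga t) (w t) (w t) = g (ga r) (w r) (w r)" using r t by auto
 also have "w r = (%_. 0)" using r by(simp add: w_def)
 finally have "g (ga t) (w t) (w t) = 0" using g_zero[OF curve_carrier[OF s] zero_tangent] by simp
 hence "w t = (%_. 0)" using g_pos[OF curve_carrier[OF s] wt[OF t]] by auto
 hence w0: "w t c = 0" for c by simp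
 show ?thesis by(rule ext) (use w0 in \<open>simp add: w_def\<close>)
qed

lemma par_local:
 assumes s: "smooth_curve A ga"
 shows "EX e>0. ALL s. \<bar>s - t0\<bar> < e --> (ALL v:TS (ga s). EX y. y s = v & (ALL t. \<bar>t - t0\<bar> < e --> par_at ga t y))"
proof -
 obtain c where c: "c : A" "ga t0 : cdom c" using curve_carrier[OF s] by(rule carrierE)
 have "t0 : ga -` cdom c" using c by simp
 then obtain d where d: "d > 0" "ball t0 d <= ga -` cdom c" using curve_open[OF s c(1)] openE by blast
 define e where "e = d/2"
 have e: "e > 0" "e < d" using d by(auto simp: e_def)
 \<comment> \<open>Clamps the time to an interval on which the curve stays in the chart, so that the
   linear equation has coefficients on the whole line.\<close>
 define kap where "kap = (%t. max (t0 - e) (min (t0 + e) t))"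
 have k: "kap t : ga -` cdom c" for t
 proof -
  have "kap t : ball t0 d" using e by(auto simp: kap_def dist_real_def)
  thus ?thesis using d by blast
 qed
 define B where "B = (%t w. - Gam c (cmap c (ga (kap t))) (vel ga (kap t) c) w)"
 have lin: "linear (B t)" for t
  unfolding B_def using Gam_l(2)[OF c(1), of "cmap c (ga (kap t))"] k[of t] by(intro linear_compose_neg) auto
 have cont: "cts UNIV (%t. B t b)" for b
 proof -
  have o: "open (ga -` cdom c)" by(rule curve_open[OF s c(1)])
  have "Ck_on 0 (ga -` cdom c) (%t. Gam c (cmap c (ga t)) (vel ga t c) b)"
   by(rule Gam_smooth[OF c(1) o _ curve_smooth[OF s c(1)] velocity_smooth[OF s c(1)] Ck_on_const]) auto
  hence "cts (ga -` cdom c) (%t. Gam c (cmap c (ga t)) (vel ga t c) b)" by simp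
  moreover have "cts UNIV kap" unfolding kap_def by(intro continuous_intros)
  ultimately have "cts UNIV (%t. Gam c (cmap c (ga (kap t))) (vel ga (kap t) c) b)"
   by(rule continuous_on_compose2) (use k in auto)
  thus ?thesis unfolding B_def by(rule continuous_on_minus)
 qed
 show ?thesis
 proof(intro exI[of _ e] conjI allI impI ballI)
  fix r v assume r: "\<bar>r - t0\<bar> < e" and v: "v : TS (ga r)"
  obtain Y where Y: "Y r = v c" "!!t. (Y hvd B t (Y t)) (at t)"
   using linear_ode_exists[of B r "v c", OF lin cont] by blast
  have inc: "ga t : cdom c" if "\<bar>t - t0\<bar> < d" for t
  proof -
   have "t : ball t0 d" using that by(simp add: dist_real_def abs_minus_commute)
   thus ?thesis using d by blast
  qed
  define y where "y = (%t. tvec A c (ga t) (Y t))"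
  have yt: "y t : TS (ga t)" "y t c = Y t" if "\<bar>t - t0\<bar> < d" for t
   using inc[OF that] c(1) by(auto simp: y_def tvec_tangent tvec_coord)
  have "par_at ga t y" if t: "\<bar>t - t0\<bar> < e" for t
  proof -
   have ex: "EX d>0. ALL r. \<bar>r - t\<bar> < d --> y r : TS (ga r)"
   proof(intro exI[of _ "d - e"] conjI allI impI)
    fix r assume "\<bar>r - t\<bar> < d - e"
    hence "\<bar>r - t0\<bar> < d" using t by linarith
    thus "y r : TS (ga r)" by(rule yt)
   qed (use e in simp)
   have td: "\<bar>t - t0\<bar> < d" using t e by linarith
   have kt: "kap t = t" using t by(auto simp: kap_def)
   have "cov_diff ga y t (%_. 0)"
   proof(rule cov_diffI[OF s c(1) inc[OF td] ex zero_tangent])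
    have "(Y hvd 0 - Gam c (cmap c (ga t)) (vel ga t c) (y t c)) (at t)"
     using Y(2)[of t] by(simp add: B_def kt yt(2)[OF td])
    thus "((%s. y s c) hvd 0 - Gam c (cmap c (ga t)) (vel ga t c) (y t c)) (at t)"
     by(rule has_vector_derivative_transform_within_open[of _ _ _ "{t0 - d<..<t0 + d}"])
      (use td yt(2) in \<open>auto simp: abs_less_iff\<close>)
   qed
   thus ?thesis using ex by(simp add: par_at_def)
  qed
  moreover have "y r = v" using tangent_eq[OF v c(1) inc] r e by(simp add: y_def Y(1))
  ultimately show "EX y. y r = v & (ALL t. \<bar>t - t0\<bar> < e --> par_at ga t y)" by blast
 qed (rule e)
qed

lemma parallel_transport:
 assumes s: "smooth_curve A ga" and v: "v : TS (ga s)"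
 shows "EX y. y s = v & (ALL t. par_at ga t y)"
proof(rule extend_to_real_line[where S = "%t. TS (ga t)"])
 show "par_at ga t z" if "par_at ga t y" "EX d>0. ALL s. \<bar>s - t\<bar> < d --> y s = z s" for t y z
  using par_at_cong that by blast
 show "y t = z t" if "!!t. t : {a<..<b} ==> par_at ga t y & par_at ga t z" "s : {a<..<b}" "y s = z s" "t : {a<..<b}" for a b s y z t
  by(rule par_unique[OF s that])
qed (use par_local[OF s] par_at_tangent v in auto)

definition orthonormal :: "'a => ('n => ('a, 'n) tangent) => bool" where
 "orthonormal p e \<longleftrightarrow> (ALL i. e i : TS p) & (ALL i j. g p (e i) (e j) = (if i = j then 1 else 0))"

lemma orthonormal_exists:
 assumes p: "p : car" and u: "u : TS p" "g p u u = 1"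
 shows "EX e. e k = u & orthonormal p e"
proof -
 obtain c where c: "c : A" "p : cdom c" using p by(rule carrierE)
 hence x: "cmap c p : V c" by simp
 have "Gm c (cmap c p) (u c) (u c) = 1" using g_coord[OF c u(1) u(1)] u(2) by simp
 from orthonormal_family_exists[OF Gm_bilinear Gm_sym[OF c(1) x] Gm_pos[OF c(1) x] this, of k]
 obtain e where e: "e k = u c" "!!i j. Gm c (cmap c p) (e i) (e j) = (if i = j then 1 else 0)" by auto
 show ?thesis
  by(rule exI[of _ "%i. tvec A c p (e i)"])
   (use e c tangent_eq[OF u(1) c] in \<open>auto simp: orthonormal_def tvec_tangent Gm_tvec\<close>)
qed

lemma orthonormal_coords:
 assumes p: "p : car" and e: "orthonormal p e" and c: "c : A" "p : cdom c"
 shows "(\<Sum>i\<in>UNIV. Gm c (cmap c p) w (e i c) *R e i c) = w"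
proof -
 define x where "x = cmap c p"
 have et: "e i : TS p" for i using e by(simp add: orthonormal_def)
 have eo: "Gm c x (e i c) (e j c) = (if i = j then 1 else 0)" for i j
  using e g_coord[OF c et et, of i j] by(simp add: orthonormal_def x_def)
 define L where "L = (%xi::real^'n. \<Sum>i\<in>UNIV. xi $ i *R e i c)"
 have lL: "linear L" by(auto intro!: linearI simp: L_def sum.distrib scaleR_add_left scaleR_sum_right)
 have l: "linear (%u. Gm c x u v)" for v using Gm_bilinear by(auto simp: bilinear_def)
 have Lc: "Gm c x (L xi) (e j c) = xi $ j" for xi j
 proof -
  have "Gm c x (L xi) (e j c) = (\<Sum>i\<in>UNIV. xi $ i*(if i = j then 1 else 0))"
   unfolding L_def by(simp add: linear_sum[OF l] linear_scale[OF l] eo)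
  also have "... = (\<Sum>i\<in>UNIV. if i = j then xi $ i else 0)" by(rule sum.cong) auto
  finally show ?thesis by simp
 qed
 have "inj L" by(rule injI) (metis Lc vec_eq_iff)
 hence "surj L" using lL linear_injective_imp_surjective by blast
 then obtain xi where "w = L xi" by(metis surjD)
 thus ?thesis using Lc by(simp add: L_def x_def)
qed

lemma orthonormal_expand:
 assumes p: "p : car" and e: "orthonormal p e" and w: "w : TS p"
 shows "(%c. \<Sum>i\<in>UNIV. g p w (e i) *R e i c) = w"
proof -
 obtain c where c: "c : A" "p : cdom c" using p by(rule carrierE)
 have et: "e i : TS p" for i using e by(simp add: orthonormal_def)
 have "(%c. \<Sum>i\<in>UNIV. g p w (e i) *R e i c) : TS p" by(rule tangent_comb[OF et])
 from tangent_eqI[OF this w c] show ?thesis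
  using orthonormal_coords[OF p e c, of "w c"] g_coord[OF c w et] by simp
qed

definition par_frame :: "(real => 'a) => ('n => real => ('a, 'n) tangent) => bool" where
 "par_frame ga E \<longleftrightarrow> (ALL i t. E i t : TS (ga t) & cov_diff ga (E i) t (%_. 0)) &
  (ALL t. orthonormal (ga t) (%i. E i t))"

lemma par_product_const:
 assumes s: "smooth_curve A ga" and J: "!!t. J t : TS (ga t)" "!!t. cov_diff ga J t (%_. 0)"
  and K: "!!t. K t : TS (ga t)" "!!t. cov_diff ga K t (%_. 0)"
 shows "g (ga t) (J t) (K t) = g (ga 0) (J 0) (K 0)"
proof -
 have "((%s. g (ga s) (J s) (K s)) has_real_derivative 0) (at t)" for t
 proof -
  have "EX e>0. ALL r. \<bar>r - t\<bar> < e --> J r : TS (ga r) & K r : TS (ga r)"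
   using J K by(intro exI[of _ 1]) auto
  from cov_diff_metric[OF s this zero_tangent zero_tangent J(2) K(2)] show ?thesis
   using g_zero[OF curve_carrier[OF s] K(1)[of t]] g_zero[OF curve_carrier[OF s] J(1)[of t]]
    g_sym[OF curve_carrier[OF s] zero_tangent J(1)[of t]] by simp
 qed
 thus ?thesis by(intro DERIV_isconst_all) blast
qed

lemma par_frame_exists:
 assumes s: "smooth_curve A ga" and e: "orthonormal (ga 0) e"
 shows "EX E. par_frame ga E & (ALL i. E i 0 = e i)"
proof -
 have "ALL i. EX y. y 0 = e i & (ALL t. par_at ga t y)"
  using e by(intro allI parallel_transport[OF s]) (simp add: orthonormal_def)
 then obtain E where E: "!!i. E i 0 = e i" "!!i t. par_at ga t (E i)" by metis
 have E': "E i t : TS (ga t)" "cov_diff ga (E i) t (%_. 0)" for i t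
  using E(2)[of t i] par_at_tangent by(auto simp: par_at_def)
 have "g (ga t) (E i t) (E j t) = (if i = j then 1 else 0)" for i j t
  using par_product_const[OF s E'(1)[of i] E'(2)[of i] E'(1)[of j] E'(2)[of j], of t] e by(simp add: E(1) orthonormal_def)
 thus ?thesis using E(1) E' by(intro exI[of _ E]) (auto simp: par_frame_def orthonormal_def)
qed

end

section \<open>Position and velocity as one vector; uniqueness for autonomous equations\<close>

text \<open>Bundle coordinates: \<open>x\<close> is the position, \<open>v\<close> the velocity. The
  pair is encoded as a vector over the index type \<open>'n + 'n\<close> instead of a product
  because determinants and the change of variables are used for it.\<close>

definition join :: "real^'n => real^'n => real^('n::finite + 'n)" where
 "join x v = (\<chi> i. case i of Inl a => x $ a | Inr a => v $ a)"
definition lft :: "real^('n::finite + 'n) => real^'n" where "lft z = (\<chi> a. z $ Inl a)"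
definition rgt :: "real^('n::finite + 'n) => real^'n" where "rgt z = (\<chi> a. z $ Inr a)"

lemma join_nth: "join x v $ Inl a = x $ a" "join x v $ Inr a = v $ a"
 by(simp_all add: join_def)

lemma lft_nth: "lft z $ a = z $ Inl a" by(simp add: lft_def)

lemma rgt_nth: "rgt z $ a = z $ Inr a" by(simp add: rgt_def)

lemma vec_sum_eqI:
 assumes "!!a. z $ Inl a = w $ Inl a" "!!a. z $ Inr a = w $ Inr a" shows "(z :: real^('n::finite + 'n)) = w"
 unfolding vec_eq_iff
proof
 show "z $ i = w $ i" for i using assms by(cases i) auto
qed

lemma lft_join[simp]: "lft (join x v) = x" by(simp add: vec_eq_iff lft_nth join_nth)

lemma rgt_join[simp]: "rgt (join x v) = v" by(simp add: vec_eq_iff rgt_nth join_nth)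

lemma join_lft_rgt[simp]: "join (lft z) (rgt z) = z"
 by(rule vec_sum_eqI) (simp_all add: join_nth lft_nth rgt_nth)

lemma bounded_linear_lft: "bounded_linear lft" 
 unfolding linear_conv_bounded_linear[symmetric]
 by(rule linearI) (simp_all add: vec_eq_iff lft_nth)

lemma bounded_linear_rgt: "bounded_linear rgt" 
 unfolding linear_conv_bounded_linear[symmetric]
 by(rule linearI) (simp_all add: vec_eq_iff rgt_nth)

lemma join_add: "join x v = join x 0 + join 0 v"
 by(rule vec_sum_eqI) (simp_all add: join_nth)

lemma bounded_linear_join: "bounded_linear (%x. join x 0)" "bounded_linear (%v. join 0 v)"
 unfolding linear_conv_bounded_linear[symmetric]
 by(auto intro!: linearI vec_sum_eqI simp: join_nth)

lemma Ck_on_join: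
 assumes "open U" "Ck_on k U f" "Ck_on k U h" shows "Ck_on k U (%x. join (f x) (h x))"
proof -
 have "(%x. join (f x) (h x)) = (%x. join (f x) 0 + join 0 (h x))" by(rule ext) (rule join_add)
 moreover have "Ck_on k U (%x. join (f x) 0 + join 0 (h x))"
  by(intro Ck_on_add Ck_on_linear[OF bounded_linear_join(1)] Ck_on_linear[OF bounded_linear_join(2)] assms)
 ultimately show ?thesis by simp
qed

lemma has_vector_derivative_join:
 assumes "(f hvd f') F" "(h hvd h') F"
 shows "((%t. join (f t) (h t)) hvd join f' h') F"
proof -
 have "(%t. join (f t) (h t)) = (%t. join (f t) 0 + join 0 (h t))" by(rule ext) (rule join_add)
 moreover have "((%t. join (f t) 0 + join 0 (h t)) hvd join f' 0 + join 0 h') F"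
  by(intro has_vector_derivative_add bounded_linear.has_vector_derivative[OF bounded_linear_join(1)]
   bounded_linear.has_vector_derivative[OF bounded_linear_join(2)] assms)
 moreover have "join f' h' = join f' 0 + join 0 h'" by(rule join_add)
 ultimately show ?thesis by simp
qed

lemma Ck_on_blinfun_derivative:
 fixes X :: "'a::euclidean_space => 'b::euclidean_space"
 assumes U: "open U" and X: "Ck_on 1 U X"
 obtains DX where "ALL x:U. (X hfd blinfun_apply (DX x)) (at x)" "cts U DX"
proof -
 define DX where "DX = (%x. Blinfun (Fd X (at x)))"
 have X1: "Ck_on (Suc 0) U X" using X by simp
 have app: "blinfun_apply (DX x) = Fd X (at x)" if "x : U" for x
  unfolding DX_def
  by(rule bounded_linear_Blinfun_apply[OF has_derivative_bounded_linear[OF Ck_on_has_derivative[OF X1 that]]])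
 have D: "(X hfd blinfun_apply (DX x)) (at x)" if "x : U" for x
  unfolding app[OF that] by(rule Ck_on_has_derivative[OF X1 that])
 have "cts U DX"
 proof(rule continuous_on_blinfun_componentwise)
  fix i :: 'a assume "i : Basis"
  hence "cts U (%x. Fd X (at x) i)" using X1 by simp
  thus "cts U (%x. blinfun_apply (DX x) i)"
   by(rule continuous_on_eq) (simp add: app)
 qed
 thus ?thesis using that D by blast
qed

text \<open>\<open>flow_stay\<close> with initial distance 0.\<close>

lemma ode_unique_forward:
 fixes X :: "'a::euclidean_space => 'a" and y z :: "real => 'a"
 assumes Om: "open Om" and X: "Ck_on 1 Om X" and T: "0 <= T"
  and G: "open G" "{0..T} <= G"
  and y: "!!s. s : G ==> (y hvd X (y s)) (at s)"
  and z: "!!s. s : G ==> (z hvd X (z s)) (at s)" "z ` {0..T} <= Om"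
  and init: "y 0 = z 0" and t: "t : {0..T}"
 shows "y t = z t"
proof -
 obtain DX where DX: "ALL x:Om. (X hfd blinfun_apply (DX x)) (at x)" "cts Om DX"
  by(rule Ck_on_blinfun_derivative[OF Om X])
 have zw: "(z hvd X (z s)) (at s within {0..T})" if "s : {0..T}" for s
  using z(1)[of s] G(2) that has_vector_derivative_at_within by blast
 have cz: "cts {0..T} z"
  unfolding continuous_on_eq_continuous_within by(intro ballI has_vector_derivative_continuous[OF zw])
 obtain r L where tube: "r > 0" "L > 0" "compact (\<Union>s\<in>{0..T}. cball (z s) r)" "(\<Union>s\<in>{0..T}. cball (z s) r) <= Om"
  "ALL s:{0..T}. ALL u:cball (z s) r. norm (X u - X (z s)) <= L*norm (u - z s)"
  "ALL s:{0..T}. norm (DX (z s)) <= L"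
  "ALL e>0. EX d>0. ALL s:{0..T}. ALL u:cball (z s) d. norm (X u - X (z s) - DX (z s) (u - z s)) <= e*norm (u - z s)"
  by(rule flow_tube[OF Om DX(1)[rule_format] DX(2) cz z(2) T])
 have "t : G & norm (y t - z t) <= norm (y 0 - z 0)*exp (L*t)"
 proof(rule flow_stay[OF tube(2) zw tube(5)[rule_format] G(1) _ y _ _ t])
  show "0 : G" using G T by auto
  show "t : G" if "t : {0<..T}" for t using G that by auto
  show "norm (y 0 - z 0)*exp (L*T) < r" using init tube by simp
 qed
 thus ?thesis using init by simp
qed

section \<open>Jacobi fields in a parallel frame\<close>

context riemannian
begin

text \<open>The equation of parallel transport expresses the derivative through the field itself, so
  each order of differentiability yields the next.\<close>

lemma par_frame_smooth:
 assumes s: "smooth_curve A ga" and E: "par_frame ga E" and c: "c : A"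
 shows "Ck_on k (ga -` cdom c) (%t. E i t c)"
proof(induction k)
 have D: "((%s. E i s c) hvd 0 - Gam c (cmap c (ga t)) (vel ga t c) (E i t c)) (at t)"
  if "t : ga -` cdom c" for t using E c that by(auto simp: par_frame_def cov_diff_def)
 have o: "open (ga -` cdom c)" by(rule curve_open[OF s c])
 case 0
 have "cts (ga -` cdom c) (%t. E i t c)"
  by(intro continuous_at_imp_continuous_on ballI has_vector_derivative_continuous[OF D])
 thus ?case by simp
 case (Suc k)
 have "Ck_on k (ga -` cdom c) (%t. 0 - Gam c (cmap c (ga t)) (vel ga t c) (E i t c))"
  by(intro Ck_on_diff o Ck_on_const Gam_smooth[OF c o] curve_smooth[OF s c] velocity_smooth[OF s c] Suc) auto
 from Ck_on_vector_derivative[OF o D this] show ?case .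
qed

text \<open>The matrix of the Jacobi operator in the frame: column \<open>j\<close> holds the
  components of the curvature applied to \<open>E j t\<close>. With it the Jacobi equation reads
  \<open>y'' = - Rm y\<close>.\<close>

definition Rm :: "(real => 'a) => ('n => real => ('a, 'n) tangent) => real => real^'n^'n" where
 "Rm ga E t = (\<chi> i j. g (ga t) (curv (ga t) (E j t) (vel ga t) (vel ga t)) (E i t))"

lemma Rm_sym:
 assumes s: "smooth_curve A ga" and E: "par_frame ga E" shows "transpose (Rm ga E t) = Rm ga E t"
 using curvature_pair[OF curve_carrier[OF s] _ velocity_tangent[OF s]] E
 by(simp add: transpose_def Rm_def vec_eq_iff par_frame_def)

lemma Rm_smooth:
 assumes s: "smooth_curve A ga" and E: "par_frame ga E" shows "Ck_on k UNIV (Rm ga E)"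
proof(rule Ck_on_local)
 fix t :: real
 obtain c where c: "c : A" "ga t : cdom c" using curve_carrier[OF s] by(rule carrierE)
 have o: "open (ga -` cdom c)" by(rule curve_open[OF s c(1)])
 have Et: "E i t : TS (ga t)" for i t using E by(simp add: par_frame_def)
 have "Ck_on k (ga -` cdom c) (%t. \<chi> i. \<chi> j. cc c (cmap c (ga t)) (E j t c) (vel ga t c) (vel ga t c)
   dot (gr c (cmap c (ga t)) *v E i t c))"
  by(intro Ck_on_vec o Ck_on_inner Ck_on_mvmult curv_smooth[OF c(1) o] Ck_on_compose[OF o open_V[OF c(1)] _ gram_smooth[OF c(1)]]
    curve_smooth[OF s c(1)] velocity_smooth[OF s c(1)] par_frame_smooth[OF s E c(1)]) auto
 hence "Ck_on k (ga -` cdom c) (Rm ga E)"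
 proof(rule Ck_on_cong[OF o])
  fix t assume t: "t : ga -` cdom c"
  hence t': "ga t : cdom c" by simp
  note ct = curvature_tangent[OF curve_carrier[OF s] Et velocity_tangent[OF s] velocity_tangent[OF s]]
  show "(\<chi> i. \<chi> j. cc c (cmap c (ga t)) (E j t c) (vel ga t c) (vel ga t c)
   dot (gr c (cmap c (ga t)) *v E i t c)) = Rm ga E t"
   by(simp add: Rm_def vec_eq_iff g_coord[OF c(1) t' ct Et] Gm_def curvature_coord[OF c(1) t'])
 qed
 thus "EX V. open V & t : V & Ck_on k V (Rm ga E)" using o c by(intro exI[of _ "ga -` cdom c"]) auto
qed

lemma curvature_comb:
 assumes p: "p : car"
 shows "curv p (%c. \<Sum>i\<in>I. a i *R w i c) v v c = (\<Sum>i\<in>I. a i *R curv p (w i) v v c)"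
proof(cases "c : A & p : cdom c")
 case True
 hence l: "linear (%xi. cc c (cmap c p) xi (v c) (v c))" by(intro curv_linear) auto
 show ?thesis using True by(simp add: curvature_coord linear_sum[OF l] linear_scale[OF l])
next
 case False
 thus ?thesis by(auto simp: curvature_def)
qed

lemma cov_deriv_eq:
 assumes "!!t. cov_diff ga J t (J' t)" "!!t. J' t : TS (ga t)"
 shows "cov_deriv A g ga J = J'"
proof(intro ext)
 fix t c
 show "cov_deriv A g ga J t c = J' t c"
 proof(cases "c : A & ga t : cdom c")
  case True
  hence "((%s. J s c) hvd J' t c - Gam c (cmap c (ga t)) (vel ga t c) (J t c)) (at t)"
   using assms(1)[of t] by(simp add: cov_diff_def)
  from vector_derivative_at[OF this] show ?thesis using True by(simp add: cov_deriv_def)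
 next
  case False
  thus ?thesis using tangent_zero[OF assms(2) False] by(auto simp: cov_deriv_def)
 qed
qed

lemma frame_system_smooth:
 assumes s: "smooth_curve A ga" and E: "par_frame ga E"
  and y: "!!t. (y hvd y1 t) (at t)" "!!t. (y1 hvd - (Rm ga E t *v y t)) (at t)"
 shows "Ck_on k UNIV y & Ck_on k UNIV y1"
proof(induction k)
 case 0
 have "cts UNIV y" "cts UNIV y1"
  by(intro continuous_at_imp_continuous_on ballI has_vector_derivative_continuous[OF y(1)] has_vector_derivative_continuous[OF y(2)])+
 thus ?case by simp
next
 case (Suc k)
 have "Ck_on k UNIV (%t. - (Rm ga E t *v y t))"
  by(intro Ck_on_minus Ck_on_mvmult Rm_smooth[OF s E] open_UNIV) (use Suc in blast)
 from Ck_on_vector_derivative[OF open_UNIV y(2) this] Ck_on_vector_derivative[OF open_UNIV y(1), of k] Suc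
 show ?case by blast
qed

text \<open>In a parallel frame covariant differentiation acts on the components alone. Two
  differentiations give the components of \<open>- Rm y\<close>, which is minus the curvature term;
  \<open>frame_of_jacobi\<close> is the converse.\<close>

lemma jacobi_of_frame:
 assumes s: "smooth_curve A ga" and E: "par_frame ga E"
  and y: "!!t. (y hvd y1 t) (at t)" "!!t. (y1 hvd - (Rm ga E t *v y t)) (at t)"
 shows "jacobi_field A g ga (%t c. \<Sum>i\<in>UNIV. y t $ i *R E i t c)"
proof -
 define J where "J = (%y t c. \<Sum>i\<in>UNIV. (y t :: real^'n) $ i *R E i t c)"
 have Et: "E i t : TS (ga t)" "cov_diff ga (E i) t (%_. 0)" for i t using E by(auto simp: par_frame_def)
 have Jt: "J y t : TS (ga t)" for y t unfolding J_def by(rule tangent_comb[OF Et(1)])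
 have comp: "((%t. y t $ i) has_real_derivative y' $ i) (at t)" if "(y hvd y') (at t)" for y y' i and t :: real
  unfolding has_real_derivative_iff_has_vector_derivative
  using bounded_linear.has_vector_derivative[OF bounded_linear_vec_nth that] .
 have cov: "cov_diff ga (J y) t (J y' t)" if "(y hvd y' t) (at t)" for y y' t
  using cov_diff_comb[where I = UNIV and f = "%i t. y t $ i" and J = E and J' = "%_ _. 0", OF comp[OF that] Et(2)]
  unfolding J_def by simp
 have d1: "cov_deriv A g ga (J y) = J y1" 
 proof(rule cov_deriv_eq)
  show "cov_diff ga (J y) t (J y1 t)" for t by(rule cov[OF y(1)])
 qed (rule Jt)
 define y2 where "y2 = (%t. - (Rm ga E t *v y t))"
 have d2: "cov_deriv A g ga (J y1) = J y2"
 proof(rule cov_deriv_eq)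
  show "cov_diff ga (J y1) t (J y2 t)" for t by(rule cov) (simp add: y2_def y(2))
 qed (rule Jt)
 have "cov_deriv A g ga (cov_deriv A g ga (J y)) t c
    + curv (ga t) (J y t) (vel ga t) (vel ga t) c = 0" for t c
 proof -
  let ?v = "vel ga t"
  note p = curve_carrier[OF s, of t] and v = velocity_tangent[OF s, of t]
  have o: "orthonormal (ga t) (%i. E i t)" using E by(simp add: par_frame_def)
  have ex: "curv (ga t) (E j t) ?v ?v c = (\<Sum>i\<in>UNIV. Rm ga E t $ i $ j *R E i t c)" for j
   using fun_cong[OF orthonormal_expand[OF p o curvature_tangent[OF p Et(1) v v]], of j c] by(simp add: Rm_def)
  have "curv (ga t) (J y t) ?v ?v c = (\<Sum>j\<in>UNIV. y t $ j *R (\<Sum>i\<in>UNIV. Rm ga E t $ i $ j *R E i t c))"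
   unfolding J_def curvature_comb[OF p] ex ..
  also have "... = (\<Sum>i\<in>UNIV. \<Sum>j\<in>UNIV. (Rm ga E t $ i $ j*y t $ j) *R E i t c)"
   by(subst sum.swap) (simp add: scaleR_sum_right mult.commute)
  also have "... = - J y2 t c"
   by(simp add: J_def y2_def matrix_vector_mult_def scaleR_sum_left sum_negf)
  finally show ?thesis unfolding d1 d2 by simp
 qed
 moreover have "smooth_field_along A ga (J y)"
  unfolding smooth_field_along_def smooth_on_def
 proof(intro conjI allI ballI)
  fix c k assume c: "c : A"
  have o: "open (ga -` cdom c)" by(rule curve_open[OF s c])
  have "Ck_on k (ga -` cdom c) y" using frame_system_smooth[OF s E y, of k] Ck_on_subset by blast
  thus "Ck_on k (ga -` cdom c) (%t. J y t c)"
   unfolding J_def by(intro Ck_on_sum o Ck_on_scaleR Ck_on_nth par_frame_smooth[OF s E c])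
 qed (rule Jt)
 ultimately show ?thesis by(simp add: jacobi_field_def J_def)
qed

text \<open>That the covariant derivative is tangent is not visible from its definition chart by
  chart. The tangent vector built from one chart is a covariant derivative in all charts by
  \<open>cov_diffI\<close>, and uniqueness of derivatives identifies it with
  \<open>cov_deriv\<close>.\<close>

lemma field_cov_diff:
 assumes s: "smooth_curve A ga" and J: "smooth_field_along A ga J"
 shows "cov_diff ga J t (cov_deriv A g ga J t)" "cov_deriv A g ga J t : TS (ga t)"
  "smooth_field_along A ga (cov_deriv A g ga J)"
proof -
 have Jt: "J t : TS (ga t)" for t using J by(simp add: smooth_field_along_def)
 have Js: "Ck_on k (ga -` cdom c) (%t. J t c)" if "c : A" for c k using J that by(simp add: smooth_field_along_def smooth_on_def)
 have D: "((%s. J s c) hvd vector_derivative (%s. J s c) (at t)) (at t)" if "c : A" "ga t : cdom c" for c t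
  using Ck_on_vector_derivativeD(1)[OF Js[OF that(1), of "Suc 0"]] that by simp
 show cd: "cov_diff ga J t (cov_deriv A g ga J t)" for t
  unfolding cov_diff_def using D by(auto simp: cov_deriv_def)
 show ct: "cov_deriv A g ga J t : TS (ga t)" for t
 proof -
  obtain c where c: "c : A" "ga t : cdom c" using curve_carrier[OF s] by(rule carrierE)
  define J' where "J' = tvec A c (ga t) (cov_deriv A g ga J t c)"
  have J': "J' : TS (ga t)" "J' c = cov_deriv A g ga J t c"
   using c by(simp_all add: J'_def tvec_tangent tvec_coord)
  have cd': "cov_diff ga J t J'"
  proof(rule cov_diffI[OF s c _ J'(1)])
   show "EX e>0. ALL r. \<bar>r - t\<bar> < e --> J r : TS (ga r)" using Jt by(intro exI[of _ 1]) auto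
   show "((%s. J s c) hvd J' c - Gam c (cmap c (ga t)) (vel ga t c) (J t c)) (at t)"
    using cd[of t] c by(simp add: J'(2) cov_diff_def)
  qed
  have "cov_deriv A g ga J t d = J' d" for d
  proof(cases "d : A & ga t : cdom d")
   case True
   hence "((%s. J s d) hvd J' d - Gam d (cmap d (ga t)) (vel ga t d) (J t d)) (at t)"
    using cd' by(simp add: cov_diff_def)
   from vector_derivative_at[OF this] show ?thesis using True by(simp add: cov_deriv_def)
  next
   case False
   thus ?thesis using tangent_zero[OF J'(1) False] by(auto simp: cov_deriv_def)
  qed
  hence "cov_deriv A g ga J t = J'" by(rule ext)
  thus ?thesis using J' by simp
 qed
 show "smooth_field_along A ga (cov_deriv A g ga J)"
  unfolding smooth_field_along_def smooth_on_def
 proof(intro conjI allI ballI ct)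
  fix c k assume c: "c : A"
  have o: "open (ga -` cdom c)" by(rule curve_open[OF s c])
  have "Ck_on k (ga -` cdom c) (%t. vector_derivative (%s. J s c) (at t) + Gam c (cmap c (ga t)) (vel ga t c) (J t c))"
   by(intro Ck_on_add o Ck_on_vector_derivativeD(2)[OF Js[OF c] o] Gam_smooth[OF c o] curve_smooth[OF s c] velocity_smooth[OF s c] Js[OF c]) auto
  thus "Ck_on k (ga -` cdom c) (%t. cov_deriv A g ga J t c)"
   by(rule Ck_on_cong[OF o]) (simp add: cov_deriv_def c)
 qed
qed

lemma frame_of_jacobi:
 assumes s: "smooth_curve A ga" and E: "par_frame ga E" and J: "jacobi_field A g ga J"
 shows "EX y1. (ALL t. ((%t. \<chi> i. g (ga t) (J t) (E i t)) hvd y1 t) (at t)) &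
  (ALL t. (y1 hvd - (Rm ga E t *v (\<chi> i. g (ga t) (J t) (E i t)))) (at t))"
proof -
 have Et: "E i t : TS (ga t)" "cov_diff ga (E i) t (%_. 0)" for i t using E by(auto simp: par_frame_def)
 have Js: "smooth_field_along A ga J" using J by(simp add: jacobi_field_def)
 define K where "K = cov_deriv A g ga J"
 have Ks: "smooth_field_along A ga K" using field_cov_diff[OF s Js] by(simp add: K_def)
 have Jt: "J t : TS (ga t)" "K t : TS (ga t)" for t
  using Js Ks by(auto simp: smooth_field_along_def)
 have gen: "((%t. \<chi> i. g (ga t) (F t) (E i t)) hvd (\<chi> i. g (ga t) (cov_deriv A g ga F t) (E i t))) (at t)"
  if F: "smooth_field_along A ga F" for F t
 proof -
  have Ft: "F t : TS (ga t)" for t using F by(simp add: smooth_field_along_def)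
  have "((%t. g (ga t) (F t) (E i t)) has_real_derivative g (ga t) (cov_deriv A g ga F t) (E i t)) (at t)" for i
  proof -
   have "EX e>0. ALL r. \<bar>r - t\<bar> < e --> F r : TS (ga r) & E i r : TS (ga r)"
    using Ft Et by(intro exI[of _ 1]) auto
   from cov_diff_metric[OF s this field_cov_diff(2)[OF s F] zero_tangent field_cov_diff(1)[OF s F] Et(2)]
   show ?thesis using g_sym[OF curve_carrier[OF s] Ft[of t] zero_tangent] g_zero[OF curve_carrier[OF s] Ft[of t]] by simp
  qed
  hence "((%t. \<Sum>i\<in>UNIV. g (ga t) (F t) (E i t) *R axis i (1::real)) hvd
    (\<Sum>i\<in>UNIV. g (ga t) (F t) (E i t) *R 0 + g (ga t) (cov_deriv A g ga F t) (E i t) *R axis i 1)) (at t)"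
   by(intro has_vector_derivative_sum has_vector_derivative_scaleR has_vector_derivative_const) auto
  moreover have "(\<Sum>i\<in>UNIV. f i *R axis i (1::real)) = (\<chi> i. f i)" for f :: "'n => real"
   by(simp add: vec_eq_iff axis_def if_distrib cong: if_cong)
  ultimately show ?thesis by simp
 qed
 define y1 where "y1 = (%t. \<chi> i. g (ga t) (K t) (E i t))"
 have "(y1 hvd - (Rm ga E t *v (\<chi> i. g (ga t) (J t) (E i t)))) (at t)" for t
 proof -
  let ?v = "vel ga t"
  note p = curve_carrier[OF s, of t] and v = velocity_tangent[OF s, of t]
  have o: "orthonormal (ga t) (%i. E i t)" using E by(simp add: par_frame_def)
  have ct: "curv (ga t) (E j t) ?v ?v : TS (ga t)" for j by(rule curvature_tangent[OF p Et(1) v v])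
  have "cov_deriv A g ga K t = (%c. - curv (ga t) (J t) ?v ?v c)"
   using J by(auto simp: jacobi_field_def K_def eq_neg_iff_add_eq_0)
  also have "curv (ga t) (J t) ?v ?v = (%c. \<Sum>j\<in>UNIV. g (ga t) (J t) (E j t) *R curv (ga t) (E j t) ?v ?v c)"
   by(subst orthonormal_expand[OF p o Jt(1), symmetric]) (rule ext, rule curvature_comb[OF p])
  finally have cK: "cov_deriv A g ga K t = (%c. \<Sum>j\<in>UNIV. (- g (ga t) (J t) (E j t)) *R curv (ga t) (E j t) ?v ?v c)"
   by(simp add: sum_negf)
  have "g (ga t) (cov_deriv A g ga K t) (E i t) = (\<Sum>j\<in>UNIV. (- g (ga t) (J t) (E j t))*g (ga t) (curv (ga t) (E j t) ?v ?v) (E i t))" for i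
   unfolding cK by(rule g_comb[OF p ct Et(1)])
  hence "(\<chi> i. g (ga t) (cov_deriv A g ga K t) (E i t)) = - (Rm ga E t *v (\<chi> i. g (ga t) (J t) (E i t)))"
   by(simp add: vec_eq_iff matrix_vector_mult_def Rm_def mult.commute sum_negf)
  thus ?thesis using gen[OF Ks, of t] by(simp add: y1_def)
 qed
 moreover have "((%t. \<chi> i. g (ga t) (J t) (E i t)) hvd y1 t) (at t)" for t
  using gen[OF Js] by(simp add: y1_def K_def)
 ultimately show ?thesis by blast
qed

end

section \<open>Uniqueness of geodesics and the geodesic flow\<close>

context riemannian
begin

lemma velocity_field: "smooth_curve A ga ==> smooth_field_along A ga (vel ga)"
 by(simp add: smooth_field_along_def smooth_on_def velocity_tangent velocity_smooth)

lemma geodesic_curve: "geodesic A g ga ==> smooth_curve A ga"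
 by(simp add: geodesic_def)

lemma geodesic_cov: "geodesic A g ga ==> cov_diff ga (vel ga) t (%_. 0)"
 using field_cov_diff(1)[OF geodesic_curve velocity_field[OF geodesic_curve], of ga t] by(simp add: geodesic_def)

lemma geodesic_speed:
 assumes "geodesic A g ga"
 shows "g (ga t) (vel ga t) (vel ga t) = g (ga 0) (vel ga 0) (vel ga 0)"
 using par_product_const[OF geodesic_curve velocity_tangent[OF geodesic_curve] geodesic_cov velocity_tangent[OF geodesic_curve] geodesic_cov] assms
 by blast

lemma curve_affine:
 assumes s: "smooth_curve A ga"
 shows "smooth_curve A (%t. ga (a*t + b))"
  and "vel (%t. ga (a*t + b)) t = (%c. a *R vel ga (a*t + b) c)"
proof -
 have ca: "cts UNIV (%t. a*t + b)" by(intro continuous_intros)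
 show "smooth_curve A (%t. ga (a*t + b))"
  unfolding smooth_curve_def
 proof(intro conjI ballI)
  show "range (%t. ga (a*t + b)) <= car" using curve_carrier[OF s] by auto
  show "cts UNIV (%t. ga (a*t + b))"
   by(rule continuous_on_compose2[OF _ ca, of UNIV]) (use s in \<open>auto simp: smooth_curve_def\<close>)
  fix c assume c: "c : A"
  have o: "open (ga -` cdom c)" by(rule curve_open[OF s c])
  have o2: "open ((%t. ga (a*t + b)) -` cdom c)"
   using open_vimage[OF o ca] by(simp add: vimage_def)
  show "smooth_on ((%t. ga (a*t + b)) -` cdom c) (cmap c o (%t. ga (a*t + b)))"
   unfolding smooth_on_def o_def
  proof(rule allI)
   fix k
   show "Ck_on k ((%t. ga (a*t + b)) -` cdom c) (%t. cmap c (ga (a*t + b)))"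
    by(rule Ck_on_compose[OF o2 o _ curve_smooth[OF s c]])
     (auto intro!: Ck_on_add o2 Ck_on_mult Ck_on_const Ck_on_id)
  qed
 qed
 show "vel (%t. ga (a*t + b)) t = (%c. a *R vel ga (a*t + b) c)"
 proof(rule ext)
  fix c
  show "vel (%t. ga (a*t + b)) t c = a *R vel ga (a*t + b) c"
  proof(cases "c : A & ga (a*t + b) : cdom c")
   case True
   thus ?thesis
    using vector_derivative_at[OF has_vector_derivative_shift[OF curve_deriv[OF s, of c "a*t + b"]]] 
    by(simp add: velocity_coord[of c "%t. ga (a*t + b)"])
  next
   case False
   thus ?thesis by(auto simp: velocity_def)
  qed
 qed
qed

lemma cov_diff_affine:
 assumes s: "smooth_curve A ga" and J: "cov_diff ga J (a*t + b) J'"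
 shows "cov_diff (%t. ga (a*t + b)) (%s. J (a * s + b)) t (%c. a *R J' c)"
 unfolding cov_diff_def
proof(intro ballI impI)
 fix c assume c: "c : A" "ga (a*t + b) : cdom c"
 hence l: "linear (%xi. Gam c (cmap c (ga (a*t + b))) xi (J (a*t + b) c))" by(intro Gam_l) auto
 have "((%s. J s c) hvd J' c - Gam c (cmap c (ga (a*t + b))) (vel ga (a*t + b) c) (J (a*t + b) c)) (at (a*t + b))"
  using J c by(simp add: cov_diff_def)
 from has_vector_derivative_shift[OF this]
 show "((%s. J (a * s + b) c) hvd a *R J' c
   - Gam c (cmap c (ga (a*t + b))) (vel (%t. ga (a*t + b)) t c) (J (a*t + b) c)) (at t)"
  by(simp add: curve_affine(2)[OF s] linear_scale[OF l] scaleR_diff_right)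
qed

lemma geodesic_affine:
 assumes geo: "geodesic A g ga" shows "geodesic A g (%t. ga (a*t + b))"
proof -
 note s = geodesic_curve[OF geo]
 let ?del = "%t. ga (a*t + b)"
 have "cov_diff ?del (vel ?del) t (%_. 0)" for t
 proof -
  have "cov_diff ?del (%s. vel ga (a * s + b)) t (%c. a *R 0)"
   by(rule cov_diff_affine[OF s geodesic_cov[OF geo]])
  from cov_diff_comb[of "{0::nat}" "%_ _. a" "%_. 0" t ?del "%_ s. vel ga (a * s + b)" "%_ _. 0"] this
  have "cov_diff ?del (%s c. a *R vel ga (a * s + b) c) t (%_. 0)" by simp
  moreover have "vel ?del = (%s c. a *R vel ga (a * s + b) c)"
   by(intro ext) (simp add: curve_affine(2)[OF s])
  ultimately show ?thesis by simp
 qed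
 hence "cov_deriv A g ?del (vel ?del) = (%_ _. 0)"
  by(intro cov_deriv_eq zero_tangent)
 thus ?thesis using curve_affine(1)[OF s] by(simp add: geodesic_def)
qed

definition Om :: "('a, 'n) chart => (real^('n + 'n)) set" where "Om c = lft -` V c"

text \<open>The geodesic field in bundle coordinates: the velocity of the position, and the
  acceleration that the geodesic equation prescribes.\<close>

definition XX :: "('a, 'n) chart => real^('n + 'n) => real^('n + 'n)" where
 "XX c z = join (rgt z) (- Gam c (lft z) (rgt z) (rgt z))"

definition state :: "('a, 'n) chart => (real => 'a) => real => real^('n + 'n)" where
 "state c ga t = join (cmap c (ga t)) (vel ga t c)"

lemma open_Om: "c : A ==> open (Om c)"
 unfolding Om_def by(intro open_vimage open_V linear_continuous_on bounded_linear_lft)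

lemma XX_smooth: "c : A ==> Ck_on k (Om c) (XX c)"
 unfolding XX_def
 by(intro Ck_on_join open_Om Ck_on_minus Gam_smooth Ck_on_bounded_linear_id bounded_linear_lft bounded_linear_rgt)
  (auto simp: Om_def)

lemma state_Om: "ga t : cdom c ==> state c ga t : Om c"
 by(simp add: state_def Om_def)

lemma state_deriv:
 assumes geo: "geodesic A g ga" and c: "c : A" "ga t : cdom c"
 shows "(state c ga hvd XX c (state c ga t)) (at t)"
proof -
 have "((%s. vel ga s c) hvd - Gam c (cmap c (ga t)) (vel ga t c) (vel ga t c)) (at t)"
  using geodesic_cov[OF geo, of t] c by(simp add: cov_diff_def)
 from has_vector_derivative_join[OF curve_deriv[OF geodesic_curve[OF geo] c] this]
 show ?thesis by(simp add: state_def[abs_def] XX_def)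
qed

lemma state_inj:
 assumes g1: "smooth_curve A ga" and g2: "smooth_curve A del" and c: "c : A" "ga t : cdom c" "del s : cdom c"
  and eq: "state c ga t = state c del s"
 shows "ga t = del s & vel ga t = vel del s"
proof -
 have e: "cmap c (ga t) = cmap c (del s)" "vel ga t c = vel del s c"
  using arg_cong[OF eq, of lft] arg_cong[OF eq, of rgt] by(simp_all add: state_def)
 have p: "ga t = del s" using e(1) inj_onD[OF cmap_inj[OF c(1)]] c by blast
 moreover have "vel ga t = vel del s"
  by(rule tangent_eqI[where p = "ga t" and c = c]) (use velocity_tangent[OF g1, of t] velocity_tangent[OF g2, of s] p c e in auto)
 ultimately show ?thesis by simp
qed

lemma geodesic_agree_forward:
 assumes g1: "geodesic A g ga" and g2: "geodesic A g del" and eq: "ga t = del t" "vel ga t = vel del t"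
 shows "EX e>0. ALL s:{0..e}. ga (t + s) = del (t + s) & vel ga (t + s) = vel del (t + s)"
proof -
 note s1 = geodesic_curve[OF g1] and s2 = geodesic_curve[OF g2]
 obtain c where c: "c : A" "ga t : cdom c" using curve_carrier[OF s1] by(rule carrierE)
 define G where "G = (%s. t + s) -` (ga -` cdom c Int del -` cdom c)"
 have G: "open G" unfolding G_def
  by(intro open_vimage open_Int curve_open[OF s1 c(1)] curve_open[OF s2 c(1)] continuous_intros)
 have "0 : G" using c eq by(simp add: G_def)
 then obtain d where d: "d > 0" "ball 0 d <= G" using G openE by blast
 define e where "e = d/2"
 have e: "e > 0" "{0..e} <= G" using d by(auto simp: e_def subset_iff)
 have D: "((%s. state c ga (t + s)) hvd XX c (state c ga (t + s))) (at s)"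
  if "geodesic A g ga" "ga (t + s) : cdom c" for ga s
  using has_vector_derivative_shift[of "state c ga" _ 1 s t] state_deriv[OF that(1) c(1) that(2)] by(simp add: add.commute)
 have "ga (t + s) = del (t + s) & vel ga (t + s) = vel del (t + s)" if s: "s : {0..e}" for s
 proof -
  have sG: "ga (t + s) : cdom c" "del (t + s) : cdom c" using s e(2) by(auto simp: G_def)
  have "state c ga (t + s) = state c del (t + s)"
  proof(rule ode_unique_forward[OF open_Om[OF c(1)] XX_smooth[OF c(1)] _ G e(2) _ _ _ _ s,
     of "%s. state c ga (t + s)" "%s. state c del (t + s)"])
   show "((%s. state c ga (t + s)) hvd XX c (state c ga (t + r))) (at r)"
    "((%s. state c del (t + s)) hvd XX c (state c del (t + r))) (at r)" if "r : G" for r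
    using that by(auto simp: G_def intro!: D g1 g2)
   show "(%s. state c del (t + s)) ` {0..e} <= Om c" using e(2) by(auto simp: G_def intro!: state_Om)
  qed (use e eq in \<open>simp_all add: state_def\<close>)
  thus ?thesis by(rule state_inj[OF s1 s2 c(1) sG])
 qed
 thus ?thesis using e(1) by blast
qed

text \<open>The forward statement is applied to both geodesics and to their reversals.\<close>

lemma geodesic_agree_local:
 assumes g1: "geodesic A g ga" and g2: "geodesic A g del" and eq: "ga t = del t" "vel ga t = vel del t"
 shows "EX e>0. ALL s. \<bar>s - t\<bar> < e --> ga s = del s & vel ga s = vel del s"
proof -
 note s1 = geodesic_curve[OF g1] and s2 = geodesic_curve[OF g2]
 obtain e1 where e1: "e1 > 0" "ALL s:{0..e1}. ga (t + s) = del (t + s) & vel ga (t + s) = vel del (t + s)"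
  using geodesic_agree_forward[OF assms] by(elim exE conjE) (rule that)
 define ga' del' where "ga' = (%t. ga (- 1*t + 0))" and "del' = (%t. del (- 1*t + 0))"
 have g': "geodesic A g ga'" "geodesic A g del'"
  unfolding ga'_def del'_def by(rule geodesic_affine[OF g1], rule geodesic_affine[OF g2])
 have v': "vel ga' s = (%c. - 1 *R vel ga (- s) c)" "vel del' s = (%c. - 1 *R vel del (- s) c)" for s
  using curve_affine(2)[OF s1, of "-1" 0 s] curve_affine(2)[OF s2, of "-1" 0 s] by(simp_all add: ga'_def del'_def)
 have "EX e>0. ALL s:{0..e}. ga' (- t + s) = del' (- t + s) & vel ga' (- t + s) = vel del' (- t + s)"
  by(rule geodesic_agree_forward[OF g']) (simp_all add: v' eq, simp add: ga'_def del'_def eq)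
 then obtain e2 where e2: "e2 > 0" "ALL s:{0..e2}. ga' (- t + s) = del' (- t + s) & vel ga' (- t + s) = vel del' (- t + s)"
  by(elim exE conjE) (rule that)
 have bw: "ga (t - s) = del (t - s) & vel ga (t - s) = vel del (t - s)" if s: "s : {0..e2}" for s
 proof -
  have "vel ga' (- t + s) c = vel del' (- t + s) c" for c using e2(2) s by simp
  hence "vel ga (t - s) c = vel del (t - s) c" for c by(simp add: v')
  moreover have "ga' (- t + s) = del' (- t + s)" using e2(2) s by blast
  ultimately show ?thesis by(auto simp: ga'_def del'_def)
 qed
 show ?thesis
 proof(intro exI[of _ "min e1 e2"] conjI allI impI)
  fix s assume s: "\<bar>s - t\<bar> < min e1 e2"
  have "ga s = del s & vel ga s = vel del s"
  proof(cases "s \<ge> t")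
   case True
   hence "s - t : {0..e1}" using s by auto
   from bspec[OF e1(2) this] show ?thesis by simp
  next
   case False
   hence "t - s : {0..e2}" using s by auto
   from bw[OF this] show ?thesis by simp
  qed
  thus "ga s = del s" "vel ga s = vel del s" by auto
 qed (use e1 e2 in simp)
qed

text \<open>The set of times at which position and velocity agree is open by local uniqueness. Its
  complement is open as well: different positions are separated by the Hausdorff property, and at a
  common position the velocities differ in the coordinates of a chart, where they are
  continuous.\<close>

lemma geodesic_unique:
 assumes g1: "geodesic A g ga" and g2: "geodesic A g del" and eq: "ga s = del s" "vel ga s = vel del s"
 shows "ga = del"
proof -
 note s1 = geodesic_curve[OF g1] and s2 = geodesic_curve[OF g2]
 define S where "S = {t. ga t = del t & vel ga t = vel del t}"
 have "open S" unfolding open_dist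
 proof
  fix t assume "t : S"
  hence "EX e>0. ALL s. \<bar>s - t\<bar> < e --> ga s = del s & vel ga s = vel del s"
   by(intro geodesic_agree_local[OF g1 g2]) (auto simp: S_def)
  thus "EX e>0. ALL y. dist y t < e --> y : S" by(auto simp: S_def dist_real_def)
 qed
 moreover have "open (- S)"
 proof(rule Topological_Spaces.openI)
  fix t assume t: "t : - S"
  show "EX T. open T & t : T & T <= - S"
  proof(cases "ga t = del t")
   case False
   then obtain U U' where U: "open U" "open U'" "ga t : U" "del t : U'" "U Int U' = {}"
    using hausdorff[OF False] by(elim exE conjE) (rule that)
   have "open (ga -` U Int del -` U')"
    using s1 s2 U by(intro open_Int open_vimage) (auto simp: smooth_curve_def)
   thus ?thesis using U by(intro exI[of _ "ga -` U Int del -` U'"]) (auto simp: S_def)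
  next
   case True
   obtain c where c: "c : A" "ga t : cdom c" using curve_carrier[OF s1] by(rule carrierE)
   define D where "D = ga -` cdom c Int del -` cdom c"
   have oD: "open D" unfolding D_def by(intro open_Int curve_open[OF s1 c(1)] curve_open[OF s2 c(1)])
   have "vel ga t c ~= vel del t c"
    using t True tangent_eqI[OF velocity_tangent[OF s1, of t] _ c] velocity_tangent[OF s2, of t] by(auto simp: S_def)
   moreover have cv: "cts D (%t. vel ga t c - vel del t c)"
    unfolding D_def by(intro continuous_on_diff)
     (use Ck_on_continuous[OF velocity_smooth[OF s1 c(1), of 0]] Ck_on_continuous[OF velocity_smooth[OF s2 c(1), of 0]] continuous_on_subset in blast)+
   have "open (D Int (%t. vel ga t c - vel del t c) -` (- {0}))"
    by(rule continuous_open_preimage[OF cv oD]) auto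
   ultimately show ?thesis
    using c True by(intro exI[of _ "D Int (%t. vel ga t c - vel del t c) -` (- {0})"]) (auto simp: S_def D_def)
  qed
 qed
 ultimately have "S = {} \<or> S = UNIV" using clopen[of S] by(simp add: closed_def)
 hence "S = UNIV" using eq by(auto simp: S_def)
 thus ?thesis by(auto simp: S_def)
qed

definition TM :: "('a \<times> ('a, 'n) tangent) set" where "TM = {(p, v). p : car & v : TS p}"

definition geo :: "'a \<times> ('a, 'n) tangent => real => 'a" where
 "geo z = (SOME ga. geodesic A g ga & ga 0 = fst z & vel ga 0 = snd z)"

definition flow :: "real => 'a \<times> ('a, 'n) tangent => 'a \<times> ('a, 'n) tangent" where
 "flow t z = (geo z t, vel (geo z) t)"

text \<open>Reversal of the direction. It conjugates the flow at time \<open>t\<close> with the flow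
  at time \<open>- t\<close>, so that the analysis of the flow can be confined to positive
  times.\<close>

definition flip :: "'a \<times> ('a, 'n) tangent => 'a \<times> ('a, 'n) tangent" where
 "flip z = (fst z, %c. - snd z c)"

lemma flip_flip[simp]: "flip (flip z) = z"
 by(simp add: flip_def)

lemma flip_TM: "z : TM ==> flip z : TM"
 using tangent_scale[of "snd z" "fst z" "-1"] by(auto simp: TM_def flip_def)

end

locale complete_riemannian = riemannian A g
 for A :: "('a::{t2_space, second_countable_topology}, 'n::finite) chart set" and g :: "('a, 'n) metric" +
 assumes complete: "geodesically_complete A g"
begin

lemma geo:
 assumes "z : TM" shows "geodesic A g (geo z)" "geo z 0 = fst z" "vel (geo z) 0 = snd z"
proof -
 have "EX ga. geodesic A g ga & ga 0 = fst z & vel ga 0 = snd z"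
  using assms complete unfolding geodesically_complete_def by(auto simp: TM_def)
 from someI_ex[OF this] show "geodesic A g (geo z)" "geo z 0 = fst z" "vel (geo z) 0 = snd z"
  by(simp_all add: geo_def)
qed

lemma flow_0: "z : TM ==> flow 0 z = z"
 using geo by(simp add: flow_def)

lemma flow_TM: "z : TM ==> flow t z : TM"
 using curve_carrier[OF geodesic_curve[OF geo(1)]] velocity_tangent[OF geodesic_curve[OF geo(1)]]
 by(simp add: flow_def TM_def)

lemma geodesic_TM: "geodesic A g ga ==> (ga t, vel ga t) : TM"
 using curve_carrier[OF geodesic_curve] velocity_tangent[OF geodesic_curve] by(simp add: TM_def)

lemma geo_eq: "geodesic A g ga ==> geo (ga 0, vel ga 0) = ga"
 by(rule geodesic_unique[of _ _ 0]) (use geo[OF geodesic_TM[of ga 0]] in auto)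

lemma flow_geodesic:
 assumes "geodesic A g ga" shows "flow t (ga s, vel ga s) = (ga (t + s), vel ga (t + s))"
proof -
 have "geo (ga s, vel ga s) = (%t. ga (1*t + s))"
  using geo_eq[OF geodesic_affine[OF assms, of 1 s]] curve_affine(2)[OF geodesic_curve[OF assms], of 1 s 0] by simp
 thus ?thesis
  using curve_affine(2)[OF geodesic_curve[OF assms], of 1 s t] by(simp add: flow_def)
qed

lemma flow_add: "z : TM ==> flow s (flow t z) = flow (s + t) z"
 using flow_geodesic[OF geo(1), of z s t] by(simp add: flow_def)

lemma flow_flip:
 assumes z: "z : TM" shows "flow (- t) z = flip (flow t (flip z))"
proof -
 have "geo (flip z) = (%t. geo z (- 1*t + 0))"
  using geo_eq[OF geodesic_affine[OF geo(1)[OF z], of "-1" 0]] curve_affine(2)[OF geodesic_curve[OF geo(1)[OF z]], of "-1" 0 0]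
   geo[OF z] by(simp add: flip_def)
 thus ?thesis
  using curve_affine(2)[OF geodesic_curve[OF geo(1)[OF z]], of "-1" 0 t] by(simp add: flow_def flip_def)
qed

lemma flow_minus: "z : TM ==> flow (- t) (flow t z) = z"
 using flow_add[of z "- t" t] flow_0 by simp

lemma flow_inj: "z : TM ==> w : TM ==> flow t z = flow t w ==> z = w"
 by(rule box_equals[OF arg_cong[of _ _ "flow (- t)"] flow_minus flow_minus])

end

section \<open>Index form of a disconjugate system\<close>

text \<open>Solutions of \<open>y'' = - R y\<close> that vanish at two times less than
  \<open>r\<close> apart are trivial. The first zero \<open>s\<close> is arbitrary because the
  comparison solution starts to the left of the interval on which the index form is taken.\<close>

definition disconjugate :: "(real => real^'n^'n) => real => bool" where
 "disconjugate R r \<longleftrightarrow> (ALL y y1 s t. (ALL u. (y hvd y1 u) (at u)) -->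
  (ALL u. (y1 hvd - (R u *v y u)) (at u)) --> y s = 0 --> y t = 0 -->
  s < t --> t < s + r --> (ALL u. y u = 0))"

lemma matrix_solution_exists:
 fixes R :: "real => real^'n::finite^'n"
 assumes R: "cts UNIV R"
 shows "EX A B. A s = 0 & B s = mat 1 & (ALL t. (A hvd B t) (at t)) &
  (ALL t. (B hvd - (R t ** A t)) (at t))"
proof -
 let ?B = "%t z. (snd z, - (R t ** fst z)) :: (real^'n^'n) \<times> (real^'n^'n)"
 have bl: "bounded_linear (%X. M ** X)" for M :: "real^'n^'n"
  using bounded_bilinear.bounded_linear_right[OF bounded_bilinear_mmult] .
 have "linear (?B t)" for t
  using bounded_linear.linear[OF bl[of "R t"]]
  by(auto simp: linear_iff algebra_simps)
 moreover have "cts UNIV (%t. ?B t b)" for b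
  by(intro continuous_on_Pair continuous_on_const continuous_on_minus
   bounded_bilinear.continuous_on[OF bounded_bilinear_mmult R])
 ultimately obtain y where y: "y s = (0, mat 1)" "ALL t. (y hvd ?B t (y t)) (at t)"
  using linear_ode_exists[of ?B s "(0, mat 1)"] by blast
 have "((%t. fst (y t)) hvd snd (y t)) (at t)"
  "((%t. snd (y t)) hvd - (R t ** fst (y t))) (at t)" for t
  using bounded_linear.has_vector_derivative[OF bounded_linear_fst y(2)[rule_format, of t]]
   bounded_linear.has_vector_derivative[OF bounded_linear_snd y(2)[rule_format, of t]] by simp_all
 thus ?thesis using y(1) by(intro exI[of _ "%t. fst (y t)"] exI[of _ "%t. snd (y t)"]) simp
qed

text \<open>Writing \<open>X = A W\<close> with the matrix solution \<open>A\<close> that vanishes slightly to the left of 0, and using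
 that \<open>A\<^sup>T A'\<close> is symmetric, the integrand of the index form is \<open>(X dot A' W)' + |A W'|\<^sup>2\<close>.\<close>

lemma index_form_nonneg:
 fixes R :: "real => real^'n::finite^'n"
 assumes R: "cts UNIV R" and sym: "!!t. transpose (R t) = R t" and nc: "disconjugate R r"
  and b: "0 < b" "b < r" and X: "!!t. (X hvd X' t) (at t)" "cts UNIV X'"
  and X0: "X 0 = 0" "X b = 0"
 shows "0 <= integral {0..b} (%t. X' t dot X' t - X t dot (R t *v X t))"
proof -
 \<comment> \<open>Half of the room between \<open>b\<close> and \<open>r\<close> goes to either
   side: \<open>s < 0\<close> and \<open>b < s + r\<close>. Hence \<open>A\<close> is invertible on
   all of \<open>{0..b}\<close>, end points included, and \<open>W\<close> causes no
   singularity.\<close>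
 define s where "s = (b - r)/2"
 have s: "s < 0" "b < s + r" using b by(simp_all add: s_def field_simps)
 obtain A B where AB: "A s = 0" "B s = mat 1" "ALL t. (A hvd B t) (at t)"
  "ALL t. (B hvd - (R t ** A t)) (at t)"
  using matrix_solution_exists[OF R, of s] by(elim exE conjE) (rule that)
 note blm = bounded_bilinear.bounded_linear_left[OF bounded_bilinear_mvmult]
 have yA: "((%t. A t *v v) hvd B t *v v) (at t)" for v t
  using bounded_linear.has_vector_derivative[OF blm AB(3)[rule_format]] .
 have yB: "((%t. B t *v v) hvd - (R t *v (A t *v v))) (at t)" for v t
  using bounded_linear.has_vector_derivative[OF blm AB(4)[rule_format, of t]]
  by(simp add: matrix_vector_mul_assoc bounded_bilinear.minus_left[OF bounded_bilinear_mvmult])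
 have nz: "A t *v v ~= 0" if "v ~= 0" "t : {s<..<s+r}" for t v
 proof
  assume z: "A t *v v = 0"
  have "ALL u. A u *v v = 0"
   using nc[unfolded disconjugate_def, rule_format, of "%t. A t *v v" "%t. B t *v v" s t] yA yB AB(1) z that(2)
   by simp
  hence "(%t. A t *v v) = (%_. 0)" by auto
  hence "((%_. 0::real^'n) hvd B s *v v) (at s)" using yA[of v s] by simp
  hence "B s *v v = 0" by(rule vector_derivative_unique_at) (rule has_vector_derivative_const)
  thus False using AB(2) that(1) by simp
 qed
 have det: "det (A t) ~= 0" if "t : {s<..<s+r}" for t
 proof -
  have "inj ((*v) (A t))"
  proof(rule linear_injective_0[THEN iffD2])
   show "linear ((*v) (A t))" by(rule matrix_vector_mul_linear)
   show "ALL x. A t *v x = 0 --> x = 0" using nz[OF _ that] by auto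
  qed
  thus ?thesis by(simp add: invertible_det_nz[symmetric] invertible_left_inverse matrix_left_invertible_injective)
 qed
 \<comment> \<open>The Wronskian of two columns of \<open>A\<close> is constant since
   \<open>R\<close> is symmetric, and it vanishes at \<open>s\<close>.\<close>
 have wr: "(A t *v v) dot (B t *v w) = (B t *v v) dot (A t *v w)" for v w t
 proof -
  let ?w = "%t. (A t *v v) dot (B t *v w) - (B t *v v) dot (A t *v w)"
  have sm: "x dot (R t *v y) = (R t *v x) dot y" for x y t
   using dot_lmul_matrix[of x "R t" y] transpose_matrix_vector[of "R t" x, unfolded sym] by simp
  have "(?w hvd 0) (at t)" for t
   using has_vector_derivative_diff[OF bounded_bilinear.has_vector_derivative[OF bounded_bilinear_inner yA[of v t] yB[of w t]]
    bounded_bilinear.has_vector_derivative[OF bounded_bilinear_inner yB[of v t] yA[of w t]]]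
   by(simp add: sm)
  hence "ALL t. (?w has_real_derivative 0) (at t)" by(simp add: has_real_derivative_iff_has_vector_derivative)
  hence "?w t = ?w s" by(rule DERIV_isconst_all)
  thus ?thesis using AB(1) by simp
 qed
 let ?U = "{s<..<s+r}"
 have cA: "cts UNIV A" and cB: "cts UNIV B"
  using has_vector_derivative_continuous[OF AB(3)[rule_format]] has_vector_derivative_continuous[OF AB(4)[rule_format]]
  by(simp_all add: continuous_at_imp_continuous_on)
 have "Ck_on (Suc 0) ?U A" "Ck_on (Suc 0) ?U X"
  by(rule Ck_on_vector_derivative[where f' = B], simp, rule AB(3)[rule_format], simp, rule continuous_on_subset[OF cB], simp,
   rule Ck_on_vector_derivative[where f' = X'], simp, rule X(1), simp, rule continuous_on_subset[OF X(2)], simp)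
 hence W: "Ck_on (Suc 0) ?U (%t. matrix_inv (A t) *v X t)"
  by(intro Ck_on_matrix_inv_mult det) auto
 define W where "W = (%t. matrix_inv (A t) *v X t)"
 define W' where "W' t = vector_derivative W (at t)" for t
 have W': "(W hvd W' t) (at t)" if "t : ?U" for t
  using Ck_on_vector_derivativeD(1)[OF W that] by(simp add: W_def W'_def)
 have XAW: "X t = A t *v W t" if "t : ?U" for t
  using matrix_inv_inverse(1)[OF det[OF that]] by(simp add: W_def matrix_vector_mul_assoc)
 have X': "X' t = B t *v W t + A t *v W' t" if t: "t : ?U" for t
 proof -
  have "((%t. A t *v W t) hvd B t *v W t + A t *v W' t) (at t)"
   using bounded_bilinear.has_vector_derivative[OF bounded_bilinear_mvmult AB(3)[rule_format] W'[OF t]] by(simp add: add.commute)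
  hence "(X hvd B t *v W t + A t *v W' t) (at t)"
   by(rule has_vector_derivative_transform_within_open[where S = ?U]) (use t XAW in auto)
  with X(1) show ?thesis by(rule vector_derivative_unique_at)
 qed
 define F where "F t = X t dot (B t *v W t)" for t
 define F' where "F' t = X' t dot (B t *v W t) + X t dot (B t *v W' t - R t *v X t)" for t
 have F: "(F hvd F' t) (at t)" if t: "t : ?U" for t
 proof -
  have "((%t. B t *v W t) hvd B t *v W' t - R t *v X t) (at t)"
   using bounded_bilinear.has_vector_derivative[OF bounded_bilinear_mvmult AB(4)[rule_format] W'[OF t]] 
   by(simp add: XAW[OF t] bounded_bilinear.minus_left[OF bounded_bilinear_mvmult] matrix_vector_mul_assoc)
  from bounded_bilinear.has_vector_derivative[OF bounded_bilinear_inner X(1) this]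
  show ?thesis by(simp add: F_def[abs_def] F'_def add.commute)
 qed
 have sub: "{0..b} <= ?U" using s by auto
 have le: "F' t <= X' t dot X' t - X t dot (R t *v X t)" if t: "t : ?U" for t
 proof -
  have "X' t dot X' t - X t dot (R t *v X t) - F' t = (A t *v W' t) dot (A t *v W' t)"
   using wr[of t "W t" "W' t"] by(simp add: F'_def X'[OF t] XAW[OF t] inner_simps inner_commute algebra_simps)
  thus ?thesis using inner_ge_zero[of "A t *v W' t"] by linarith
 qed
 have "(F' has_integral F b - F 0) {0..b}"
 proof(rule fundamental_theorem_of_calculus)
  fix t assume "t : {0..b}"
  hence "t : ?U" using sub by blast
  from has_vector_derivative_at_within[OF F[OF this]] show "(F hvd F' t) (at t within {0..b})" .
 qed (use b in simp)
 hence I: "(F' has_integral 0) {0..b}" by(simp add: F_def X0)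
 have cX: "cts UNIV X"
  using has_vector_derivative_continuous[OF X(1)] by(simp add: continuous_at_imp_continuous_on)
 have "cts {0..b} (%t. X' t dot X' t - X t dot (R t *v X t))"
  by(intro continuous_intros bounded_bilinear.continuous_on[OF bounded_bilinear_mvmult])
   (auto intro: continuous_on_subset[OF X(2)] continuous_on_subset[OF cX] continuous_on_subset[OF R])
 hence "(%t. X' t dot X' t - X t dot (R t *v X t)) integrable_on {0..b}" by(rule integrable_continuous_real)
 from I integrable_integral[OF this] show ?thesis
  by(rule has_integral_le) (rule le, use sub in blast)
qed

text \<open>If \<open>y\<close> solves the rescaled system then \<open>u \<mapsto> y (u/l)\<close>
  solves the original one, and its zeros are \<open>l\<close> times as far apart.\<close>

lemma disconjugate_rescale:
 fixes R :: "real => real^'n::finite^'n"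
 assumes nc: "disconjugate R r" and l: "0 < l"
 shows "disconjugate (%t. l\<^sup>2 *R R (l*t)) (r/l)"
 unfolding disconjugate_def
proof(intro allI impI)
 fix y y1 :: "real => real^'n" and s t u
 assume y: "ALL u. (y hvd y1 u) (at u)"
  "ALL u. (y1 hvd - (l\<^sup>2 *R R (l*u) *v y u)) (at u)"
  and st: "y s = 0" "y t = 0" "s < t" "t < s + r/l"
 let ?z = "%u. y (1/l*u + 0)" and ?z1 = "%u. (1/l) *R y1 (1/l*u + 0)"
 have 1: "(?z hvd ?z1 u) (at u)" for u
  by(rule has_vector_derivative_shift) (use y(1) in blast)
 have 2: "(?z1 hvd - (R u *v ?z u)) (at u)" for u
 proof -
  have "((%u. y1 (1/l*u + 0)) hvd (1/l) *R - (l\<^sup>2 *R R (l*(1/l*u + 0)) *v y (1/l*u + 0))) (at u)"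
   by(rule has_vector_derivative_shift) (use y(2) in blast)
  from has_vector_derivative_scaleR[OF DERIV_const this, of "1/l"]
  show ?thesis using l by(simp add: scaleR_matrix_vector_assoc[symmetric] power2_eq_square)
 qed
 have "?z u = 0" for u
  by(rule nc[unfolded disconjugate_def, rule_format, of ?z ?z1 "l * s" "l*t"])
   (use 1 2 st l in \<open>auto simp: field_simps\<close>)
 from this[of "l*u"] show "y u = 0" using l by simp
qed

text \<open>\<open>index_form_nonneg\<close> does not reach \<open>b = r\<close>. For
  \<open>l < 1\<close> the slowed system is disconjugate on the longer interval \<open>r/l\<close>,
  so its index form on \<open>{0..r}\<close> is nonnegative; the form is continuous in
  \<open>l\<close>, and \<open>l\<close> tends to 1.\<close>

lemma index_form_nonneg_limit:
 fixes R :: "real => real^'n::finite^'n"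
 assumes R: "cts UNIV R" and sym: "!!t. transpose (R t) = R t" and nc: "disconjugate R r"
  and r: "0 < r" and X: "!!t. (X hvd X' t) (at t)" "cts UNIV X'"
  and X0: "X 0 = 0" "X r = 0"
 shows "0 <= integral {0..r} (%t. X' t dot X' t - X t dot (R t *v X t))"
proof -
 define h where "h l = integral {0..r} (%t. X' t dot X' t - X t dot (l\<^sup>2 *R R (l*t) *v X t))" for l
 have cR: "cts UNIV (%t. l\<^sup>2 *R R (l*t))" for l
  by(intro continuous_intros continuous_on_compose2[OF R]) auto
 have pos: "0 <= h l" if l: "0 < l" "l < 1" for l
  unfolding h_def
  by(rule index_form_nonneg[OF cR _ disconjugate_rescale[OF nc l(1)] r _ X X0])
   (use l r in \<open>simp_all add: transpose_scalar sym field_simps\<close>)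
 have cX: "cts UNIV X"
  using has_vector_derivative_continuous[OF X(1)] by(simp add: continuous_at_imp_continuous_on)
 have "cts UNIV (%l. integral (cbox 0 r) (%t. X' t dot X' t - X t dot (l\<^sup>2 *R R (l*t) *v X t)))"
  by(rule integral_continuous_on_param)
   (simp add: case_prod_beta, intro continuous_intros bounded_bilinear.continuous_on[OF bounded_bilinear_mvmult]
    continuous_on_compose2[OF R] continuous_on_compose2[OF cX] continuous_on_compose2[OF X(2)]; auto)
 hence "cts UNIV h" by(simp add: h_def[abs_def])
 hence "(h \<longlongrightarrow> h 1) (at 1)" by(simp add: continuous_on_def)
 hence "(h \<longlongrightarrow> h 1) (at_left 1)" by(rule tendsto_within_subset) simp
 hence "0 <= h 1"
  by(rule tendsto_lowerbound)
   (use pos in \<open>auto simp: eventually_at_left_field intro!: exI[of _ 0]\<close>)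
 thus ?thesis by(simp add: h_def)
qed

lemma integral_cos_squared:
 assumes "0 < (r::real)" shows "((%t. (cos (pi*t/r))\<^sup>2) has_integral r/2) {0..r}"
  "((%t. (sin (pi*t/r))\<^sup>2) has_integral r/2) {0..r}"
proof -
 let ?F = "%t. t/2 + r/(2*pi)*(sin (pi*t/r)*cos (pi*t/r))"
 have "((%t. (cos (pi*t/r))\<^sup>2) has_integral ?F r - ?F 0) {0..r}"
 proof(rule fundamental_theorem_of_calculus)
  fix t
  have "(?F has_real_derivative 1/2 + r/(2*pi)*(pi/r*(cos (pi*t/r))\<^sup>2 - pi/r*(sin (pi*t/r))\<^sup>2)) (at t)"
   using assms by(auto intro!: derivative_eq_intros simp: power2_eq_square field_simps)
  moreover have "1/2 + r/(2*pi)*(pi/r*(cos (pi*t/r))\<^sup>2 - pi/r*(sin (pi*t/r))\<^sup>2) = (cos (pi*t/r))\<^sup>2"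
   using assms by(simp add: sin_squared_eq field_simps)
  ultimately have "(?F has_real_derivative (cos (pi*t/r))\<^sup>2) (at t)" by metis
  thus "(?F hvd (cos (pi*t/r))\<^sup>2) (at t within {0..r})"
   by(simp add: has_real_derivative_iff_has_vector_derivative has_vector_derivative_at_within)
 qed (use assms in simp)
 thus c: "((%t. (cos (pi*t/r))\<^sup>2) has_integral r/2) {0..r}" using assms by simp
 have "((%t. 1 - (cos (pi*t/r))\<^sup>2) has_integral r - r/2) {0..r}"
  using has_integral_diff[OF has_integral_const_real[of 1 0 r] c] assms by simp
 thus "((%t. (sin (pi*t/r))\<^sup>2) has_integral r/2) {0..r}" by(simp add: sin_squared_eq)
qed

lemma quadratic_nonneg_imp_linear_zero:
 fixes a b :: real assumes q: "!!x. 0 <= 2*x*a + x\<^sup>2*b" shows "a = 0"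
proof(rule ccontr)
 assume nz: "a ~= 0"
 define d where "d = 1 + \<bar>b\<bar>"
 have d: "0 < d" "b <= d" by(auto simp: d_def)
 \<comment> \<open>With the positive majorant \<open>d\<close> in place of \<open>b\<close>, this
   point minimises the parabola and has value \<open>- a\<^sup>2/d\<close>.\<close>
 define x where "x = - a/d"
 have "x\<^sup>2*b <= x\<^sup>2*d" using d by(intro mult_left_mono) auto
 moreover have "2*x*a + x\<^sup>2*d = - (a\<^sup>2/d)" using d by(simp add: x_def power2_eq_square field_simps)
 moreover have "0 < a\<^sup>2/d" using nz d by simp
 ultimately show False using q[of x] by linarith
qed

text \<open>The bound is the index form of \<open>sin (pi*t/r) *R e\<close>. In the equality case
  the form attains its minimum 0 there, so its first variation vanishes in every direction. The
  direction \<open>Y = f\<^sup>2 Z\<close> with \<open>Z = (pi/r)\<^sup>2 e - R e\<close> is chosen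
  such that integration by parts turns the variation into the integral of
  \<open>f\<^sup>3 |Z|\<^sup>2\<close>, whence \<open>Z = 0\<close>.\<close>

lemma sine_index:
 fixes R :: "real => real^'n::finite^'n"
 assumes R: "Ck_on 1 UNIV R" and sym: "!!t. transpose (R t) = R t" and nc: "disconjugate R r"
  and r: "0 < r" and e: "e dot e = 1"
 shows "integral {0..r} (%t. (sin (pi*t/r))\<^sup>2*(e dot (R t *v e))) <= pi\<^sup>2/(2*r)"
  and "integral {0..r} (%t. (sin (pi*t/r))\<^sup>2*(e dot (R t *v e))) = pi\<^sup>2/(2*r) ==>
   t : {0<..<r} ==> R t *v e = (pi/r)\<^sup>2 *R e"
proof -
 define k where "k = (pi/r)\<^sup>2"
 define f where "f t = sin (pi*t/r)" for t
 define f' where "f' t = pi/r*cos (pi*t/r)" for t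
 have f: "(f has_real_derivative f' t) (at t)" "(f' has_real_derivative - k*f t) (at t)" for t
  unfolding f_def f'_def k_def using r
  by(auto intro!: derivative_eq_intros simp: power2_eq_square)
 have fb: "f 0 = 0" "f r = 0" using r by(simp_all add: f_def)
 have fpos: "0 < f t" if "t : {0<..<r}" for t
  unfolding f_def using that r by(intro sin_gt_zero) (auto simp: field_simps)
 have cf: "cts S f" "cts S f'" for S
  unfolding f_def f'_def by(intro continuous_intros; use r in simp)+
 have cR: "cts UNIV R" by(rule Ck_on_continuous[OF R])
 hence cR': "cts S R" for S by(rule continuous_on_subset) simp
 note cmv = bounded_bilinear.continuous_on[OF bounded_bilinear_mvmult]
 have sm: "x dot (R t *v y) = (R t *v x) dot y" for x y t
  using dot_lmul_matrix[of x "R t" y] transpose_matrix_vector[of "R t" x, unfolded sym] by simp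
 have q: "(%t. (f t)\<^sup>2*(e dot (R t *v e))) integrable_on {0..r}"
  by(intro integrable_continuous_real continuous_intros cmv cf cR')
 have f2: "((%t. (f' t)\<^sup>2) has_integral pi\<^sup>2/(2*r)) {0..r}"
  using has_integral_mult_right[OF integral_cos_squared(1)[OF r], of "(pi/r)\<^sup>2"] r
  by(simp add: f'_def power_mult_distrib power2_eq_square ac_simps)
 define R' where "R' t = vector_derivative R (at t)" for t
 have R1: "Ck_on (Suc 0) UNIV R" using R by(simp only: One_nat_def)
 have R': "(R hvd R' t) (at t)" for t
  using Ck_on_vector_derivativeD(1)[OF R1, of t] by(simp add: R'_def)
 have cR1: "cts S R'" for S
  using Ck_on_continuous[OF Ck_on_vector_derivativeD(2)[OF R1]] unfolding R'_def
  by(rule continuous_on_subset) auto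
 define Z where "Z t = k *R e - R t *v e" for t
 define Z' where "Z' t = - (R' t *v e)" for t
 have Z: "(Z hvd Z' t) (at t)" for t
  unfolding Z_def Z'_def
  using has_vector_derivative_diff[OF has_vector_derivative_const
   bounded_linear.has_vector_derivative[OF bounded_bilinear.bounded_linear_left[OF bounded_bilinear_mvmult] R']] by simp
 have cZ: "cts S Z" "cts S Z'" for S
  unfolding Z_def Z'_def by(intro continuous_intros cmv cR' cR1)+
 \<comment> \<open>The power of \<open>f\<close> makes the variation vanish at both end
   points.\<close>
 define Y where "Y t = (f t)\<^sup>2 *R Z t" for t
 define Y' where "Y' t = (2*f t*f' t) *R Z t + (f t)\<^sup>2 *R Z' t" for t
 have Y: "(Y hvd Y' t) (at t)" for t
  unfolding Y_def Y'_def
  using has_vector_derivative_scaleR[OF DERIV_power[OF f(1), of 2] Z, of t] by(simp add: ac_simps)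
 have cY: "cts S Y" "cts S Y'" for S
  unfolding Y_def Y'_def by(intro continuous_intros cf cZ)+
 have I: "0 <= integral {0..r} (%t. (f' t *R e + x *R Y' t) dot (f' t *R e + x *R Y' t)
   - (f t *R e + x *R Y t) dot (R t *v (f t *R e + x *R Y t)))" for x
 proof(rule index_form_nonneg_limit[OF cR sym nc r])
  show "((%t. f t *R e + x *R Y t) hvd f' t *R e + x *R Y' t) (at t)" for t
   using has_vector_derivative_add[OF has_vector_derivative_scaleR[OF f(1) has_vector_derivative_const]
    has_vector_derivative_scaleR[OF DERIV_const Y]] by simp
  show "cts UNIV (%t. f' t *R e + x *R Y' t)" by(intro continuous_intros cf cY)
 qed (simp_all add: fb Y_def)
 \<comment> \<open>The integrand of the index form of \<open>f *R e + x *R Y\<close> is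
   \<open>a0 + 2 x a1 + x\<^sup>2 a2\<close>.\<close>
 define a0 where "a0 t = (f' t)\<^sup>2 - (f t)\<^sup>2*(e dot (R t *v e))" for t
 define a1 where "a1 t = f' t*(e dot Y' t) - f t*(Y t dot (R t *v e))" for t
 define a2 where "a2 t = Y' t dot Y' t - Y t dot (R t *v Y t)" for t
 have i0: "(a0 has_integral pi\<^sup>2/(2*r) - integral {0..r} (%t. (f t)\<^sup>2*(e dot (R t *v e)))) {0..r}"
  unfolding a0_def by(rule has_integral_diff[OF f2 integrable_integral[OF q]])
 have i1: "a1 integrable_on {0..r}" and i2: "a2 integrable_on {0..r}"
  unfolding a1_def a2_def by(intro integrable_continuous_real continuous_intros cmv cf cR' cY)+
 define c0 where "c0 = pi\<^sup>2/(2*r) - integral {0..r} (%t. (f t)\<^sup>2*(e dot (R t *v e)))"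
 have q2: "0 <= c0 + (2*x)*integral {0..r} a1 + x\<^sup>2*integral {0..r} a2" for x
 proof -
  have "((%t. a0 t + (2*x)*a1 t + x\<^sup>2*a2 t) has_integral
    c0 + (2*x)*integral {0..r} a1 + x\<^sup>2*integral {0..r} a2) {0..r}"
   unfolding c0_def by(intro has_integral_add i0 has_integral_mult_right integrable_integral i1 i2)
  moreover have "a0 t + (2*x)*a1 t + x\<^sup>2*a2 t = (f' t *R e + x *R Y' t) dot (f' t *R e + x *R Y' t)
   - (f t *R e + x *R Y t) dot (R t *v (f t *R e + x *R Y t))" for t
   using e sm[of e t "Y t"] 
   by(simp add: a0_def a1_def a2_def inner_simps matrix_vector_right_distrib matrix_vector_mult_scaleR
    power2_eq_square inner_commute algebra_simps)
  ultimately show ?thesis using I[of x] by(simp add: integral_unique)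
 qed
 show "integral {0..r} (%t. (sin (pi*t/r))\<^sup>2*(e dot (R t *v e))) <= pi\<^sup>2/(2*r)"
  using q2[of 0] by(simp add: c0_def f_def)
 assume eq: "integral {0..r} (%t. (sin (pi*t/r))\<^sup>2*(e dot (R t *v e))) = pi\<^sup>2/(2*r)"
  and t: "t : {0<..<r}"
 hence c0: "c0 = 0" by(simp add: c0_def f_def)
 have a10: "integral {0..r} a1 = 0"
  by(rule quadratic_nonneg_imp_linear_zero[of _ "integral {0..r} a2"]) (use q2 c0 in simp)
 have "((%t. a1 t - f t*(Z t dot Y t)) has_integral f' r*(e dot Y r) - f' 0*(e dot Y 0)) {0..r}"
 proof(rule fundamental_theorem_of_calculus)
  fix t
  have "((%t. f' t*(e dot Y t)) hvd (f' t*(e dot Y' t) + (- k*f t)*(e dot Y t))) (at t)"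
   using has_vector_derivative_scaleR[OF f(2) bounded_linear.has_vector_derivative[OF bounded_linear_inner_right Y]]
   by simp
  moreover have "f' t*(e dot Y' t) + (- k*f t)*(e dot Y t) = a1 t - f t*(Z t dot Y t)"
   by(simp add: a1_def Z_def inner_simps inner_commute[of "R t *v e"] algebra_simps)
  ultimately have "((%t. f' t*(e dot Y t)) hvd a1 t - f t*(Z t dot Y t)) (at t)" by metis
  thus "((%t. f' t*(e dot Y t)) hvd a1 t - f t*(Z t dot Y t)) (at t within {0..r})"
   by(rule has_vector_derivative_at_within)
 qed (use r in simp)
 from has_integral_diff[OF integrable_integral[OF i1] this] have "((%t. f t*(Z t dot Y t)) has_integral 0) {0..r}"
  by(simp add: a10 Y_def fb)
 hence "f t*(Z t dot Y t) = 0"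
 proof(rule has_integral_0_cbox_imp_0[of 0 r, unfolded cbox_interval box_real, rotated 2])
  show "cts {0..r} (%t. f t*(Z t dot Y t))" by(intro continuous_intros cf cZ cY)
  show "0 <= f t*(Z t dot Y t)" if "t : {0<..<r}" for t
   using fpos[OF that] by(simp add: Y_def)
 qed (use t r in auto)
 hence "Z t = 0" using fpos[OF t] by(simp add: Y_def)
 thus "R t *v e = (pi/r)\<^sup>2 *R e" by(simp add: Z_def k_def)
qed

section \<open>Ricci curvature along a geodesic without close conjugate points\<close>

context riemannian
begin

text \<open>A form of \<open>r \<le> conj\<close> that speaks about single geodesics. As the
  inequality is not strict, it is available at the conjugate radius itself, which the equality case
  needs.\<close>

definition no_conj :: "real => bool" where
 "no_conj r \<longleftrightarrow> (ALL ga a b. geodesic A g ga & unit_speed A g ga & conjugate_along A g ga a b --> r <= \<bar>a - b\<bar>)"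

lemma le_conjugate_radius_iff: "ereal r <= conjugate_radius A g \<longleftrightarrow> no_conj r"
proof
 assume r: "ereal r <= conjugate_radius A g"
 show "no_conj r"
  unfolding no_conj_def
 proof(intro allI impI)
  fix ga a b assume c: "geodesic A g ga & unit_speed A g ga & conjugate_along A g ga a b"
  have "conjugate_radius A g <= ereal \<bar>a - b\<bar>"
   unfolding conjugate_radius_def by(rule Sup_least) (use c in auto)
  with r have "ereal r <= ereal \<bar>a - b\<bar>" by(rule order_trans)
  thus "r <= \<bar>a - b\<bar>" by simp
 qed
next
 assume "no_conj r"
 thus "ereal r <= conjugate_radius A g"
  unfolding conjugate_radius_def no_conj_def by(intro Sup_upper) auto
qed

lemma orthonormal_tangent: "orthonormal p e ==> e i : TS p"
 by(simp add: orthonormal_def)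

lemma g_orthonormal_comb:
 assumes p: "p : car" and e: "orthonormal p e"
 shows "g p (%c. \<Sum>i\<in>UNIV. a i *R e i c) (e j) = a j"
proof -
 have "g p (%c. \<Sum>i\<in>UNIV. a i *R e i c) (e j) = (\<Sum>i\<in>UNIV. a i*g p (e i) (e j))"
  by(rule g_comb[OF p]) (simp_all add: orthonormal_tangent[OF e])
 also have "... = a j" using e by(simp add: orthonormal_def if_distrib[of "(*) _"] cong: if_cong)
 finally show ?thesis .
qed

lemma no_conj_disconjugate:
 assumes geo: "geodesic A g ga" and u: "unit_speed A g ga" and E: "par_frame ga E" and r: "no_conj r"
 shows "disconjugate (Rm ga E) r"
 unfolding disconjugate_def
proof(intro allI impI)
 fix y y1 s t u
 assume y: "ALL u. (y hvd y1 u) (at u)" "ALL u. (y1 hvd - (Rm ga E u *v y u)) (at u)"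
  and z: "y s = 0" "y t = 0" "s < t" "t < s + r"
 note s = geodesic_curve[OF geo]
 show "y u = 0"
 proof(rule ccontr)
  assume nz: "y u ~= 0"
  let ?J = "%t c. \<Sum>i\<in>UNIV. y t $ i *R E i t c"
  have J: "jacobi_field A g ga ?J" by(rule jacobi_of_frame[OF s E]) (use y in blast)+
  have "?J u ~= (%_. 0)"
  proof
   assume J0: "?J u = (%_. 0)"
   have o: "orthonormal (ga u) (%i. E i u)" using E by(simp add: par_frame_def)
   have "y u $ j = 0" for j
    using g_orthonormal_comb[OF curve_carrier[OF s] o, of "%i. y u $ i" j]
     g_zero[OF curve_carrier[OF s] orthonormal_tangent[OF o], of j] unfolding J0 by simp
   thus False using nz by(simp add: vec_eq_iff)
  qed
  moreover have "?J s = (%_. 0)" "?J t = (%_. 0)" using z by simp_all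
  ultimately have "conjugate_along A g ga s t"
   unfolding conjugate_along_def using J z(3) by blast
  hence "r <= \<bar>s - t\<bar>" using r geo assms(2) unfolding no_conj_def by blast
  thus False using z by simp
 qed
qed

lemma unit_tangent_exists:
 assumes p: "p : car" shows "EX u : TS p. g p u u = 1"
proof -
 obtain c where c: "c : A" "p : cdom c" using p by(rule carrierE)
 let ?v = "tvec A c p (axis undefined 1)"
 have v: "?v : TS p" by(rule tvec_tangent[OF c])
 have "?v c ~= 0" by(simp add: tvec_coord[OF c] axis_eq_0_iff)
 hence "?v ~= (%_. 0)" by auto
 hence pos: "0 < g p ?v ?v" by(rule g_pos[OF p v])
 define a where "a = 1/sqrt (g p ?v ?v)"
 have sv: "(%c. a *R ?v c) : TS p" by(rule tangent_scale[OF v])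
 have "g p (%c. a *R ?v c) (%c. a *R ?v c) = a*(a*g p ?v ?v)"
  using g_scale[OF p v sv, of a] g_sym[OF p v sv] g_scale[OF p v v, of a] by simp
 also have "... = 1" using pos by(simp add: a_def)
 finally show ?thesis using sv by blast
qed

text \<open>\<open>frame\<close> is a choice; the combinations of an orthonormal basis show that
  there is something to choose.\<close>

lemma frame:
 assumes p: "p : car"
 shows "fr p xi : TS p" "linear (%xi. fr p xi c)"
  "g p (fr p xi) (fr p eta) = xi dot eta"
proof -
 obtain u where u: "u : TS p" "g p u u = 1" using unit_tangent_exists[OF p] by blast
 obtain e where e: "orthonormal p e" using orthonormal_exists[OF p u] by blast
 define L where "L xi = (%c. \<Sum>i\<in>UNIV. xi $ i *R e i c)" for xi :: "real^'n"
 have t: "L xi : TS p" for xi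
  unfolding L_def by(rule tangent_comb) (rule orthonormal_tangent[OF e])
 have 1: "linear (%xi. L xi c)" for c
  unfolding L_def by(rule linearI) (simp_all add: sum.distrib scaleR_add_left scaleR_sum_right)
 have 2: "g p (L xi) (L eta) = xi dot eta" for xi eta
 proof -
  have "g p (L xi) (L eta) = (\<Sum>i\<in>UNIV. xi $ i*g p (e i) (L eta))"
   unfolding L_def[of xi] by(rule g_comb[OF p orthonormal_tangent[OF e] t])
  moreover have "g p (e i) (L eta) = eta $ i" for i
   using g_sym[OF p orthonormal_tangent[OF e] t, of i eta] g_orthonormal_comb[OF p e, of "%i. eta $ i" i]
   by(simp add: L_def)
  ultimately show ?thesis by(simp add: inner_vec_def)
 qed
 have "range L <= TS p & (ALL c. linear (%xi. L xi c)) & (ALL xi eta. g p (L xi) (L eta) = xi dot eta)"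
  using t 1 2 by auto
 from someI[of "%L. range L <= TS p & (ALL c. linear (%xi. L xi c)) & (ALL xi eta. g p (L xi) (L eta) = xi dot eta)", OF this]
 have F: "range (fr p) <= TS p & (ALL c. linear (%xi. fr p xi c)) &
  (ALL xi eta. g p (fr p xi) (fr p eta) = xi dot eta)"
  unfolding frame_def .
 show "fr p xi : TS p" using F by blast
 show "linear (%xi. fr p xi c)" using F by blast
 show "g p (fr p xi) (fr p eta) = xi dot eta" using F by blast
qed

lemma frame_orthonormal: "p : car ==> orthonormal p (%i. fr p (axis i 1))"
 by(simp add: orthonormal_def frame inner_axis_axis)

lemma g_curvature_comb:
 assumes p: "p : car" and e: "orthonormal p e" and v: "v : TS p"
  and u: "u : TS p" and w: "w : TS p"
 shows "g p (curv p u v v) w = (\<Sum>i\<in>UNIV. g p u (e i)*g p (curv p (e i) v v) w)"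
proof -
 have "curv p u v v = (%c. \<Sum>i\<in>UNIV. g p u (e i) *R curv p (e i) v v c)"
  using curvature_comb[OF p, where I = UNIV and a = "%i. g p u (e i)" and w = e and v = v] orthonormal_expand[OF p e u] by(intro ext) simp
 thus ?thesis
  by(simp add: g_comb[OF p curvature_tangent[OF p orthonormal_tangent[OF e] v v] w])
qed

text \<open>Independence of a trace from the orthonormal basis. Expanding each basis in the other
  gives the same double sum, because the curvature form is symmetric.\<close>

lemma ricci_orthonormal:
 assumes p: "p : car" and e: "orthonormal p e" and v: "v : TS p"
 shows "ricci A g p v v = (\<Sum>i\<in>UNIV. g p (curv p (e i) v v) (e i))"
proof -
 define f where "f i = fr p (axis i 1)" for i
 have f: "orthonormal p f" unfolding f_def by(rule frame_orthonormal[OF p])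
 note te = orthonormal_tangent[OF e] and tf = orthonormal_tangent[OF f]
 let ?B = "%u w. g p (curv p u v v) w"
 have sym: "?B u w = ?B w u" if "u : TS p" "w : TS p" for u w
  by(rule curvature_pair[OF p that(1) v that(2)])
 have "ricci A g p v v = (\<Sum>i\<in>UNIV. ?B (f i) (f i))" by(simp add: ricci_def f_def)
 also have "... = (\<Sum>i\<in>UNIV. \<Sum>j\<in>UNIV. g p (f i) (e j)*?B (e j) (f i))"
  by(rule sum.cong[OF refl]) (rule g_curvature_comb[OF p e v tf tf])
 also have "... = (\<Sum>j\<in>UNIV. \<Sum>i\<in>UNIV. g p (e j) (f i)*?B (f i) (e j))"
  by(subst sum.swap) (simp add: sym[OF te tf] g_sym[OF p te tf])
 also have "... = (\<Sum>j\<in>UNIV. ?B (e j) (e j))"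
  by(rule sum.cong[OF refl]) (rule g_curvature_comb[OF p f v te te, symmetric])
 finally show ?thesis .
qed

lemma curvature_same: "curv p v v w c = 0"
 by(simp add: curvature_def curv_coord_eq)

text \<open>The velocity of a geodesic is parallel. Its components in a parallel frame are constant,
  so a frame that contains it at time 0 contains it at all times.\<close>

lemma velocity_frame_exists:
 assumes geo: "geodesic A g ga" and u: "unit_speed A g ga"
 shows "EX E. par_frame ga E & E k = vel ga"
proof -
 note s = geodesic_curve[OF geo]
 obtain e where e: "e k = vel ga 0" "orthonormal (ga 0) e"
  using orthonormal_exists[OF curve_carrier[OF s] velocity_tangent[OF s], of 0 k] u[unfolded unit_speed_def] by blast
 obtain E where E: "par_frame ga E" "ALL i. E i 0 = e i" using par_frame_exists[OF s e(2)] by blast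
 have ET: "E i t : TS (ga t)" "cov_diff ga (E i) t (%_. 0)" "orthonormal (ga t) (%i. E i t)" for i t
  using E(1) by(simp_all add: par_frame_def)
 have "E k t = vel ga t" for t
 proof -
  have "g (ga t) (vel ga t) (E i t) = g (ga 0) (vel ga 0) (E i 0)" for i
   by(rule par_product_const[OF s velocity_tangent[OF s] geodesic_cov[OF geo] ET(1,2)])
  also have "g (ga 0) (vel ga 0) (E i 0) = (if k = i then 1 else 0)" for i
   using e E(2) by(simp add: orthonormal_def e(1)[symmetric])
  finally have "(%c. \<Sum>i\<in>UNIV. (if k = i then 1 else 0) *R E i t c) = vel ga t"
   using orthonormal_expand[OF curve_carrier[OF s] ET(3) velocity_tangent[OF s], of t] by simp
  moreover have "(%c. \<Sum>i\<in>UNIV. (if k = i then 1 else 0) *R E i t c) = E k t"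
   by(simp add: if_distrib if_distribR cong: if_cong)
  ultimately show ?thesis by simp
 qed
 thus ?thesis using E(1) by auto
qed

lemma ricci_frame:
 assumes geo: "geodesic A g ga" and E: "par_frame ga E"
 shows "ricci A g (ga t) (vel ga t) (vel ga t) = (\<Sum>i\<in>UNIV. Rm ga E t $ i $ i)"
 using ricci_orthonormal[OF curve_carrier[OF geodesic_curve[OF geo]] _ velocity_tangent[OF geodesic_curve[OF geo]], of t "%i. E i t"] E
 by(simp add: par_frame_def Rm_def)

text \<open>The sum of \<open>sine_index\<close> over the frame vectors other than the velocity,
  whose own curvature term is 0; hence the factor \<open>n - 1\<close>. If the sum attains its bound
  then so does every summand, which determines the curvature on the orthogonal complement of the
  velocity.\<close>

lemma ricci_geodesic_integral:
 assumes geo: "geodesic A g ga" and u: "unit_speed A g ga" and nc: "no_conj r" and r: "0 < r"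
 shows "integral {0..r} (%t. (sin (pi*t/r))\<^sup>2*ricci A g (ga t) (vel ga t) (vel ga t))
   <= (real CARD('n) - 1)*(pi\<^sup>2/(2*r))"
  and "integral {0..r} (%t. (sin (pi*t/r))\<^sup>2*ricci A g (ga t) (vel ga t) (vel ga t))
   = (real CARD('n) - 1)*(pi\<^sup>2/(2*r)) ==> t : {0<..<r} ==> w : TS (ga t) ==>
   g (ga t) w (vel ga t) = 0 ==>
   curv (ga t) w (vel ga t) (vel ga t) = (%c. (pi/r)\<^sup>2 *R w c)"
proof -
 note s = geodesic_curve[OF geo]
 obtain k :: 'n where True by blast
 obtain E where E: "par_frame ga E" "E k = vel ga" using velocity_frame_exists[OF geo u, of k] by blast
 have ET: "E i t : TS (ga t)" "orthonormal (ga t) (%i. E i t)" for i t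
  using E(1) by(simp_all add: par_frame_def)
 let ?R = "Rm ga E"
 note si = sine_index[OF Rm_smooth[OF s E(1)] Rm_sym[OF s E(1)] no_conj_disconjugate[OF geo u E(1) nc] r]
 have ax: "axis i 1 dot (M *v axis i 1) = M $ i $ i" for i and M :: "real^'n^'n"
  by(simp add: matrix_vector_mult_basis column_def inner_axis')
 define q where "q i = integral {0..r} (%t. (sin (pi*t/r))\<^sup>2*?R t $ i $ i)" for i
 have q: "q i <= pi\<^sup>2/(2*r)" for i
  using si(1)[of "axis i 1"] by(simp add: ax q_def inner_axis_axis)
 have qe: "?R t *v axis i 1 = (pi/r)\<^sup>2 *R axis i 1" if "q i = pi\<^sup>2/(2*r)" "t : {0<..<r}" for i t
  using si(2)[of "axis i 1" t] that by(simp add: ax q_def inner_axis_axis)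
 have cR: "cts S ?R" for S
  using Ck_on_continuous[OF Rm_smooth[OF s E(1), of 0]] by(rule continuous_on_subset) simp
 have "?R t $ k $ k = 0" for t
 proof -
  have "curv (ga t) (vel ga t) (vel ga t) (vel ga t) = (%_. 0)"
   by(rule ext) (rule curvature_same)
  thus ?thesis
   using g_zero[OF curve_carrier[OF s] velocity_tangent[OF s], of t] by(simp add: Rm_def E(2))
 qed
 hence ric: "ricci A g (ga t) (vel ga t) (vel ga t) = (\<Sum>i\<in>UNIV - {k}. ?R t $ i $ i)" for t
  unfolding ricci_frame[OF geo E(1)] by(subst sum.remove[of _ k]) auto
 have I: "integral {0..r} (%t. (sin (pi*t/r))\<^sup>2*ricci A g (ga t) (vel ga t) (vel ga t))
   = (\<Sum>i\<in>UNIV - {k}. q i)"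
  unfolding q_def ric sum_distrib_left
  by(rule integral_sum) (simp, intro integrable_continuous_real continuous_intros cR, use r in simp)
 have card: "(\<Sum>i\<in>UNIV - {k}. pi\<^sup>2/(2*r)) = (real CARD('n) - 1)*(pi\<^sup>2/(2*r))"
  using r by(simp add: card_Diff_singleton of_nat_diff)
 show "integral {0..r} (%t. (sin (pi*t/r))\<^sup>2*ricci A g (ga t) (vel ga t) (vel ga t))
   <= (real CARD('n) - 1)*(pi\<^sup>2/(2*r))"
  unfolding I card[symmetric] by(rule sum_mono) (rule q)
 assume eq: "integral {0..r} (%t. (sin (pi*t/r))\<^sup>2*ricci A g (ga t) (vel ga t) (vel ga t))
   = (real CARD('n) - 1)*(pi\<^sup>2/(2*r))" and t: "t : {0<..<r}"
  and w: "w : TS (ga t)" "g (ga t) w (vel ga t) = 0"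
 have "(\<Sum>i\<in>UNIV - {k}. pi\<^sup>2/(2*r) - q i) = 0"
  using eq unfolding I card[symmetric] by(simp add: sum_subtractf)
 hence qi: "q i = pi\<^sup>2/(2*r)" if "i ~= k" for i
  using sum_nonneg_eq_0_iff[of "UNIV - {k}" "%i. pi\<^sup>2/(2*r) - q i"] q that by simp
 let ?v = "vel ga t"
 have cE: "curv (ga t) (E i t) ?v ?v = (%c. (pi/r)\<^sup>2 *R E i t c)" if i: "i ~= k" for i
 proof -
  have "g (ga t) (curv (ga t) (E i t) ?v ?v) (E j t) = (if i = j then (pi/r)\<^sup>2 else 0)" for j
  proof -
   have "(?R t *v axis i 1) $ j = (if i = j then (pi/r)\<^sup>2 else 0)"
    using qe[OF qi[OF i] t] by(simp add: axis_def)
   thus ?thesis by(simp add: matrix_vector_mult_basis column_def Rm_def)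
  qed
  hence "(%c. \<Sum>j\<in>UNIV. (if i = j then (pi/r)\<^sup>2 else 0) *R E j t c) = curv (ga t) (E i t) ?v ?v"
   using orthonormal_expand[OF curve_carrier[OF s] ET(2) curvature_tangent[OF curve_carrier[OF s] ET(1)[of i t] velocity_tangent[OF s] velocity_tangent[OF s]]]
   by presburger
  moreover have "(\<Sum>j\<in>UNIV. (if i = j then (pi/r)\<^sup>2 else 0) *R E j t c) = (pi/r)\<^sup>2 *R E i t c" for c
   by(simp add: if_distrib if_distribR cong: if_cong)
  ultimately show ?thesis by auto
 qed
 have we: "(%c. \<Sum>i\<in>UNIV. g (ga t) w (E i t) *R E i t c) = w"
  by(rule orthonormal_expand[OF curve_carrier[OF s] ET(2) w(1)])
 show "curv (ga t) w ?v ?v = (%c. (pi/r)\<^sup>2 *R w c)"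
 proof
  fix c
  have "curv (ga t) w ?v ?v c = (\<Sum>i\<in>UNIV. g (ga t) w (E i t) *R curv (ga t) (E i t) ?v ?v c)"
   using curvature_comb[OF curve_carrier[OF s, of t], where I = UNIV and a = "%i. g (ga t) w (E i t)" and w = "%i. E i t" and v = ?v and c = c] unfolding we .
  also have "... = (\<Sum>i\<in>UNIV. (pi/r)\<^sup>2 *R (g (ga t) w (E i t) *R E i t c))"
  proof(rule sum.cong[OF refl])
   fix i
   show "g (ga t) w (E i t) *R curv (ga t) (E i t) ?v ?v c = (pi/r)\<^sup>2 *R (g (ga t) w (E i t) *R E i t c)"
    using w(2) cE[of i] E(2) by(cases "i = k") simp_all
  qed
  also have "... = (pi/r)\<^sup>2 *R w c"
   using fun_cong[OF we, of c] by(simp only: scaleR_sum_right[symmetric])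
  finally show "curv (ga t) w ?v ?v c = (pi/r)\<^sup>2 *R w c" .
 qed
qed

end

section \<open>The Riemannian volume measure\<close>

lemma disjointed_sets:
 assumes "!!i. C i : sets M" shows "disjointed C i : sets M"
 using sets.range_disjointed_sets[of C M] assms by blast

lemma emeasure_disjointed:
 fixes C :: "nat => 'b set"
 assumes C: "!!i. C i : sets mu" "(\<Union>i. C i) = space mu" and B: "B : sets mu"
 shows "em0 mu B = (\<Sum>i. em0 mu (B Int disjointed C i))"
proof -
 have "(\<Sum>i. em0 mu (B Int disjointed C i)) = em0 mu (\<Union>i. B Int disjointed C i)"
  by(rule suminf_emeasure)
   (use B disjointed_sets[where C = C, OF C(1)] disjoint_family_disjointed[of C] in \<open>auto simp: disjoint_family_on_def\<close>)
 also have "(\<Union>i. B Int disjointed C i) = B"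
  using UN_disjointed_eq[of C] C(2) sets.sets_into_space[OF B] by auto
 finally show ?thesis by simp
qed

lemma measure_eq_on_cover:
 fixes C :: "nat => 'b set"
 assumes sets: "sets mu = sets \<nu>" and C: "!!i. C i : sets mu" "(\<Union>i. C i) = space mu"
  and agree: "!!i B. B : sets mu ==> B <= C i ==> em0 mu B = em0 \<nu> B"
 shows "mu = \<nu>"
proof(rule measure_eqI[OF sets])
 fix B assume B: "B : sets mu"
 have D: "disjointed C i : sets mu" for i by(rule disjointed_sets[OF C(1)])
 have "em0 mu (B Int disjointed C i) = em0 \<nu> (B Int disjointed C i)" for i
  by(rule agree[of _ i]) (use B D disjointed_subset[of C i] in auto)
 thus "em0 mu B = em0 \<nu> B"
  using emeasure_disjointed[OF C B] emeasure_disjointed[of C \<nu> B] C B sets sets_eq_imp_space_eq[OF sets] by simp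
qed

lemma suminf_swap_ennreal:
 fixes f :: "nat => nat => ennreal" shows "(\<Sum>i. \<Sum>j. f i j) = (\<Sum>j. \<Sum>i. f i j)"
 using nn_integral_suminf[of "%j i. f i j" "count_space UNIV"] by(simp add: nn_integral_count_space_nat)

text \<open>The cover is made disjoint, and each piece of a set is measured by the local measure of
  its own chart. Agreement on overlaps makes the result coincide with every local measure, also with
  those of charts outside the sequence \<open>s\<close>.\<close>

lemma glue_measures:
 fixes M :: "'b measure" and C :: "'i => 'b set" and \<nu> :: "'i => 'b measure" and s :: "nat => 'i"
 assumes sets: "!!i. i : I ==> sets (\<nu> i) = sets M" and C: "!!i. i : I ==> C i : sets M"
  and s: "range s <= I" "(\<Union>n. C (s n)) = space M"
  and agree: "!!i j B. i : I ==> j : I ==> B : sets M ==> B <= C i ==> B <= C j ==> em0 (\<nu> i) B = em0 (\<nu> j) B"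
 shows "EX mu. sets mu = sets M & (ALL i:I. ALL B:sets M. B <= C i --> em0 mu B = em0 (\<nu> i) B)"
proof -
 define D where "D = disjointed (%n. C (s n))"
 have sI: "s n : I" for n using s(1) by auto
 have D: "D n : sets M" for n unfolding D_def by(rule disjointed_sets) (rule C[OF sI])
 have DC: "D n <= C (s n)" for n unfolding D_def by(rule disjointed_subset)
 let ?m = "%B. \<Sum>n. em0 (\<nu> (s n)) (B Int D n)"
 define mu where "mu = measure_of (space M) (sets M) ?m"
 have em: "em0 mu B = ?m B" if "B : sets M" for B
  unfolding mu_def
 proof(rule emeasure_measure_of_sigma[OF _ _ _ that])
  show "sigma_algebra (space M) (sets M)" ..
  show "positive (sets M) ?m" by(simp add: positive_def)
  show "countably_additive (sets M) ?m"
  proof(rule countably_additiveI)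
   fix F :: "nat => 'b set" assume F: "range F <= sets M" "disjoint_family F"
   have "(\<Sum>j. em0 (\<nu> (s n)) (F j Int D n)) = em0 (\<nu> (s n)) (\<Union>j. F j Int D n)" for n
    by(rule suminf_emeasure) (use F D sets[OF sI] in \<open>auto simp: disjoint_family_on_def\<close>)
   moreover have "(\<Union>j. F j Int D n) = (\<Union>j. F j) Int D n" for n by auto
   ultimately show "(\<Sum>j. ?m (F j)) = ?m (\<Union>j. F j)" by(subst suminf_swap_ennreal) simp
  qed
 qed
 have "em0 mu B = em0 (\<nu> i) B" if i: "i : I" and B: "B : sets M" "B <= C i" for i B
 proof -
  have "em0 (\<nu> (s n)) (B Int D n) = em0 (\<nu> i) (B Int D n)" for n
   by(rule agree[OF sI i]) (use B D DC in auto)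
  moreover have "em0 (\<nu> i) B = (\<Sum>n. em0 (\<nu> i) (B Int D n))"
   unfolding D_def
   by(rule emeasure_disjointed) (use B C[OF sI] s(2) sets[OF i] sets_eq_imp_space_eq[OF sets[OF i]] in auto)
  ultimately show ?thesis by(simp add: em[OF B(1)])
 qed
 moreover have "sets mu = sets M" by(simp add: mu_def)
 ultimately show ?thesis by blast
qed

lemma gram_congruence:
 fixes G H L :: "real^'n^'n"
 assumes "!!xi eta. xi dot (G *v eta) = (L *v xi) dot (H *v (L *v eta))"
 shows "G = transpose L ** H ** L"
proof -
 have eq: "xi dot (G *v eta) = xi dot ((transpose L ** H ** L) *v eta)" for xi eta
 proof -
  have "xi dot ((transpose L ** H ** L) *v eta) = xi dot ((H *v (L *v eta)) v* L)"
   by(simp only: matrix_vector_mul_assoc[symmetric] transpose_matrix_vector)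
  also have "... = (L *v xi) dot (H *v (L *v eta))"
   using dot_lmul_matrix[of "H *v (L *v eta)" L xi] by(simp only: inner_commute)
  finally show ?thesis using assms by simp
 qed
 show ?thesis by(rule matrix_eq[THEN iffD2, OF allI[OF vector_eq_ldot[THEN iffD1, OF allI[OF eq]]]])
qed

context riemannian
begin

text \<open>A sequence of charts that covers the manifold, obtained from the Lindelof property.
  Gluing of measures and of measurable functions requires a countable cover, while the atlas is
  arbitrary.\<close>

definition sq :: "nat => ('a, 'n) chart" where
 "sq = (SOME s. range s <= A & (\<Union>n. cdom (s n)) = car)"

lemma sq: "sq n : A" "(\<Union>n. cdom (sq n)) = car"
proof -
 have "!!S. S : cdom ` A ==> openin (top_of_set (car)) S" using cdom_openin by auto
 from Lindelof_openin[OF this] obtain F where F: "F <= cdom ` A" "countable F" "\<Union>F = \<Union>(cdom ` A)" by metis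
 obtain A' where A': "A' <= A" "countable A'" "F = cdom ` A'"
  using F(1,2) by(meson countable_subset_image)
 have un: "(\<Union>c\<in>A'. cdom c) = car" using F(3) A'(3) by(simp add: carrier_def)
 have "car ~= {}" using atlas by(simp add: oriented_smooth_atlas_def)
 hence ne: "A' ~= {}" using un by auto
 have "range (from_nat_into A') = A'" by(rule range_from_nat_into[OF ne A'(2)])
 hence "range (from_nat_into A') <= A & (\<Union>n. cdom (from_nat_into A' n)) = car"
  using A'(1) un by(metis image_image)
 from someI[of "%s. range s <= A & (\<Union>n. cdom (s n)) = car", OF this]
 show "sq n : A" "(\<Union>n. cdom (sq n)) = car" unfolding sq_def[symmetric] by auto
qed

abbreviation M0 :: "'a measure" where "M0 \<equiv> rsp borel (car)"

lemma space_M0: "space M0 = car" by(simp add: space_restrict_space)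

lemma cdom_sets: "c : A ==> cdom c : sets M0"
proof -
 assume "c : A"
 then obtain S where S: "open S" "cdom c = car Int S" using cdom_openin unfolding openin_open by metis
 show ?thesis unfolding sets_restrict_space S(2) by(rule imageI) (use S(1) in simp)
qed

lemma cinv_measurable: "c : A ==> cinv c : measurable (rsp borel (V c)) M0"
 using cinv_cdom[of c] cdom_carrier[of c]
 by(intro measurable_restrict_space2 borel_measurable_continuous_on_restrict cont_cinv) (auto simp: space_restrict_space)

lemma restrict_M0: "c : A ==> sets (rsp M0 (cdom c)) = sets (rsp borel (cdom c))"
 using cdom_carrier[of c] by(simp add: sets_restrict_restrict_space Int_absorb1)

lemma cmap_measurable: "c : A ==> cmap c : measurable (rsp M0 (cdom c)) (rsp borel (V c))"
 unfolding measurable_cong_sets[OF restrict_M0 refl]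
 by(intro measurable_restrict_space2 borel_measurable_continuous_on_restrict cont_cmap) (auto simp: space_restrict_space)

lemma cmap_image: 
 assumes c: "c : A" shows "x : cmap c ` (B Int cdom c) \<longleftrightarrow> x : V c & cinv c x : B"
 using cinv_cmap[OF c] cmap_cinv[OF c] cinv_cdom[OF c] by force

lemma cmap_image_sets:
 assumes c: "c : A" and B: "B : sets M0"
 shows "cmap c ` (B Int cdom c) : sets borel"
proof -
 have "cinv c -` B Int space (rsp borel (V c)) : sets (rsp borel (V c))"
  by(rule measurable_sets[OF cinv_measurable[OF c] B])
 moreover have "cinv c -` B Int space (rsp borel (V c)) = cmap c ` (B Int cdom c)"
  using cmap_image[OF c] by(auto simp: space_restrict_space)
 ultimately show ?thesis using open_V[OF c] by(simp add: sets_restrict_space_iff)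
qed

lemma M0_measurableI:
 assumes "!!c. c : A ==> (%x. f (cinv c x)) : measurable (rsp borel (V c)) N"
 shows "f : measurable M0 N"
proof(rule measurable_piecewise_restrict[of "range (%n. cdom (sq n))"])
 show "countable (range (%n. cdom (sq n)))" by simp
 show "space M0 <= \<Union>(range (%n. cdom (sq n)))" using sq(2) by(simp add: space_M0)
 fix \<Omega> assume "\<Omega> : range (%n. cdom (sq n))"
 then obtain n where "\<Omega> = cdom (sq n)" by blast
 hence "sq n : A & \<Omega> = cdom (sq n)" using sq(1) by simp
 then obtain c where c: "c : A" "\<Omega> = cdom c" by(elim conjE) (rule that)
 show "\<Omega> Int space M0 : sets M0" using cdom_sets[OF c(1)] c(2) by(simp add: sets.Int_space_eq2)
 have "(%p. f (cinv c (cmap c p))) : measurable (rsp M0 (cdom c)) N"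
  using measurable_comp[OF cmap_measurable[OF c(1)] assms[OF c(1)]] by(simp add: o_def)
 moreover have "f : measurable (rsp M0 \<Omega>) N \<longleftrightarrow> (%p. f (cinv c (cmap c p))) : measurable (rsp M0 (cdom c)) N"
  unfolding c(2) by(rule measurable_cong) (use c cinv_cmap in \<open>simp add: space_restrict_space\<close>)
 ultimately show "f : measurable (rsp M0 \<Omega>) N" by blast
qed

lemma det_gram_trans:
 assumes c: "c : A" and d: "d : A" and x: "x : W c d"
 shows "det (gr c x) = (det (matrix (T1 c d x)))\<^sup>2*det (gr d (transition c d x))"
proof -
 let ?T = "matrix (T1 c d x)"
 have T: "?T *v xi = T1 c d x xi" for xi by(rule fun_cong[OF matrix_vector_mul(2)[OF T1_linear[OF c d x]]])
 have "gr c x = transpose ?T ** gr d (transition c d x) ** ?T"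
  using Gm_trans[OF c d x] by(intro gram_congruence) (simp add: Gm_def T)
 thus ?thesis by(simp add: det_mul det_transpose power2_eq_square)
qed

text \<open>In an isometric frame the Gram matrix becomes the identity. Up to sign the frame has
  determinant \<open>1/sqrt (det (gr c x))\<close>, the factor between Euclidean and coordinate
  volume in a tangent space.\<close>

lemma frame_det:
 assumes c: "c : A" and p: "p : cdom c"
 shows "(det (matrix (%xi. fr p xi c)))\<^sup>2*det (gr c (cmap c p)) = 1"
proof -
 have pc: "p : car" using p cdom_carrier[OF c] by auto
 let ?L = "matrix (%xi. fr p xi c)"
 have T: "?L *v xi = fr p xi c" for xi by(rule fun_cong[OF matrix_vector_mul(2)[OF frame(2)[OF pc]]])
 have "mat 1 = transpose ?L ** gr c (cmap c p) ** ?L"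
  using frame(3)[OF pc] g_coord[OF c p frame(1)[OF pc] frame(1)[OF pc]] by(intro gram_congruence) (simp add: Gm_def T)
 from arg_cong[OF this, of det] show ?thesis by(simp add: det_mul det_transpose power2_eq_square mult_ac)
qed

lemma gram_det_pos: "c : A ==> x : V c ==> 0 < det (gr c x)"
 using frame_det[of c "cinv c x"] cinv_cdom[of c x] cmap_cinv[of c x]
 by(smt (verit) mult_nonneg_nonpos zero_le_power2)

definition vden :: "('a, 'n) chart => real^'n => ennreal" where
 "vden c x = ennreal (sqrt (det (gr c x)))*chi (V c) x"

lemma det_gram_continuous: "c : A ==> cts (V c) (%x. det (gr c x))"
 by(rule Ck_on_continuous[OF Ck_on_det[OF open_V gram_smooth[of c 0]]])

lemma det_gram_measurable: "c : A ==> (%x. ennreal (det (gr c x))*chi (V c) x) : bm borel"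
 using borel_measurable_continuous_on_restrict[OF det_gram_continuous, of c] open_V[of c]
 by(subst borel_measurable_restrict_space_iff_ennreal[symmetric]) (auto intro: measurable_compose[OF _ measurable_ennreal])

lemma vden_measurable: "c : A ==> vden c : bm borel"
 unfolding vden_def[abs_def]
 using borel_measurable_continuous_on_restrict[OF continuous_on_real_sqrt[OF det_gram_continuous], of c] borel_open[OF open_V, of c]
 by(subst borel_measurable_restrict_space_iff_ennreal[symmetric]) (auto intro: measurable_compose[OF _ measurable_ennreal])

definition nu :: "('a, 'n) chart => 'a measure" where
 "nu c = distr (rsp (density lborel (vden c)) (V c)) M0 (cinv c)"

lemma cinv_measurable': "c : A ==> cinv c : measurable (rsp (density lborel (vden c)) (V c)) M0"
 by(subst measurable_cong_sets[OF sets_restrict_space_cong[of _ borel] refl]) (simp_all add: cinv_measurable)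

lemma emeasure_nu:
 assumes c: "c : A" and B: "B : sets M0"
 shows "em0 (nu c) B = (LB x. vden c x*chi (cmap c ` (B Int cdom c)) x)"
proof -
 have "em0 (nu c) B = em0 (rsp (density lborel (vden c)) (V c)) (cmap c ` (B Int cdom c))"
  unfolding nu_def using cmap_image[OF c]
  by(subst emeasure_distr[OF cinv_measurable'[OF c] B]) (auto simp: space_restrict_space intro!: arg_cong2[where f = em0])
 also have "... = em0 (density lborel (vden c)) (cmap c ` (B Int cdom c))"
  by(rule emeasure_restrict_space) (use open_V[OF c] in auto)
 also have "... = (LB x. vden c x*chi (cmap c ` (B Int cdom c)) x)"
  by(rule emeasure_density) (use vden_measurable[OF c] cmap_image_sets[OF c B] in auto)
 finally show ?thesis .
qed

text \<open>The Jacobian of the transition map compensates the change of the Gram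
  determinant.\<close>

lemma nu_agree:
 assumes c: "c : A" and d: "d : A" and B: "B : sets M0" "B <= cdom c" "B <= cdom d"
 shows "em0 (nu c) B = em0 (nu d) B"
proof -
 have Bc: "B Int cdom c = B" "B Int cdom d = B" using B by auto
 have Vd: "cmap d ` B <= V d" using B by auto
 have tW: "transition c d ` W c d = W d c"
  using transition_cmap[OF c] by(auto simp: image_image image_iff) 
 have inj: "inj_on (transition c d) (W c d)"
 proof(rule inj_onI)
  fix x y assume "x : W c d" "y : W c d" and eq: "transition c d x = transition c d y"
  then obtain p q where p: "p : cdom c" "p : cdom d" "x = cmap c p" and q: "q : cdom c" "q : cdom d" "y = cmap c q" by auto
  have "cmap d p = cmap d q" using eq p q transition_cmap[OF c] by simp
  thus "x = y" using inj_onD[OF cmap_inj[OF d]] p q by blast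
 qed
 have img: "transition c d ` E : sets borel" if E: "E : sets borel" "E <= W c d" for E
 proof -
  have "transition c d ` E = {y : W d c. transition d c y : E}"
  proof -
   have "y : transition c d ` E \<longleftrightarrow> y : W d c & transition d c y : E" for y
   proof
    assume "y : transition c d ` E"
    then obtain p where p: "p : cdom c" "p : cdom d" "cmap c p : E" "y = transition c d (cmap c p)" using E(2) by auto
    thus "y : W d c & transition d c y : E" using transition_cmap[OF c] transition_cmap[OF d] by auto
   next
    assume "y : W d c & transition d c y : E"
    then obtain p where p: "p : cdom c" "p : cdom d" "y = cmap d p" "transition d c y : E" by auto
    hence "y = transition c d (cmap c p)" "cmap c p : E" using transition_cmap[OF c] transition_cmap[OF d] by auto
    thus "y : transition c d ` E" by blast
   qed
   thus ?thesis by blast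
  qed
  moreover have "transition d c -` E Int space (rsp borel (W d c)) : sets (rsp borel (W d c))"
   by(rule measurable_sets[OF borel_measurable_continuous_on_restrict[OF Ck_on_continuous[OF transition_smooth[OF d c, of 0]]] E(1)])
  moreover have "transition d c -` E Int space (rsp borel (W d c)) = {y : W d c. transition d c y : E}"
   by(auto simp: space_restrict_space)
  ultimately show ?thesis using open_W[OF d c] by(simp add: sets_restrict_space_iff)
 qed
 have dm: "(%x. det (matrix (T1 c d x))) : bm (rsp borel (W c d))"
  unfolding matrix_def
  by(intro borel_measurable_continuous_on_restrict Ck_on_continuous[where k = 0] Ck_on_det Ck_on_vec Ck_on_nth open_W[OF c d] T1_smooth[OF c d])
 have Fm: "(%y. vden d y*chi (cmap d ` B) y) : bm borel"
  using vden_measurable[OF d] cmap_image_sets[OF d B(1)] Bc(2) by simp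
 have "em0 (nu d) B = (LB y. (vden d y*chi (cmap d ` B) y)*chi (transition c d ` W c d) y)"
  unfolding emeasure_nu[OF d B(1)] Bc tW
  by(rule nn_integral_cong) (use B in \<open>auto split: split_indicator\<close>)
 also have "... = (LB x. (vden d (transition c d x)*chi (cmap d ` B) (transition c d x))*ennreal \<bar>det (matrix (T1 c d x))\<bar> * chi (W c d) x)"
  by(rule nn_integral_change_of_variables[OF open_W[OF c d] transition_deriv[OF c d] inj dm img Fm])
 also have "... = em0 (nu c) B"
  unfolding emeasure_nu[OF c B(1)] Bc
 proof(rule nn_integral_cong)
  fix x
  show "vden d (transition c d x)*chi (cmap d ` B) (transition c d x)*ennreal \<bar>det (matrix (T1 c d x))\<bar> * chi (W c d) x
   = vden c x*chi (cmap c ` B) x"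
  proof(cases "x : W c d")
   case False
   thus ?thesis using B by(auto split: split_indicator)
  next
   case True
   then obtain p where p: "p : cdom c" "p : cdom d" "x = cmap c p" by auto
   have t: "transition c d x = cmap d p" using p transition_cmap[OF c] by simp
   have i: "chi (cmap d ` B) (cmap d p) = (chi B p :: ennreal)" "chi (cmap c ` B) (cmap c p) = (chi B p :: ennreal)"
    using inj_on_image_mem_iff[OF cmap_inj[OF d] p(2) B(3)] inj_on_image_mem_iff[OF cmap_inj[OF c] p(1) B(2)]
    by(simp_all add: indicator_def)
   have "sqrt (det (gr c x)) = sqrt (det (gr d (cmap d p)))*\<bar>det (matrix (T1 c d x))\<bar>"
    using det_gram_trans[OF c d True] t by(simp add: real_sqrt_mult)
   hence "ennreal (sqrt (det (gr c x))) = ennreal (sqrt (det (gr d (cmap d p))))*ennreal \<bar>det (matrix (T1 c d x))\<bar>"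
    by(simp only: ennreal_mult''[OF abs_ge_zero])
   thus ?thesis using True p t i by(simp add: vden_def mult_ac)
  qed
 qed
 finally show ?thesis by simp
qed

definition vol :: "'a measure" where "vol = riemannian_volume A g"

lemma volume_exists:
 "EX mu. sets mu = sets M0 & (ALL c:A. ALL B:sets M0. B <= cdom c --> em0 mu B = em0 (nu c) B)"
 by(rule glue_measures[where s = sq]) (simp add: nu_def, erule cdom_sets, use sq(1) in blast, use sq(2) in \<open>simp add: space_M0\<close>, rule nu_agree)

text \<open>\<open>riemannian_volume\<close> is a definite description. Its value is accessible only
  after existence, by gluing the measures \<open>nu c\<close>, and uniqueness, by the countable
  cover.\<close>

lemma vol: "sets vol = sets M0" "c : A ==> B : sets M0 ==> B <= cdom c ==> em0 vol B = em0 (nu c) B"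
proof -
 let ?P = "%mu. sets mu = sets M0 & (ALL c:A. ALL B:sets mu. B <= cdom c -->
    em0 mu B = (LB x. ennreal (sqrt (det (gr c x)))*chi (cmap c ` B) x))"
 have nu': "em0 (nu c) B = (LB x. ennreal (sqrt (det (gr c x)))*chi (cmap c ` B) x)"
  if "c : A" "B : sets M0" "B <= cdom c" for c B
 proof -
  have "B Int cdom c = B" using that(3) by auto
  thus ?thesis unfolding emeasure_nu[OF that(1,2)]
   by(intro nn_integral_cong) (use that(3) in \<open>auto simp: vden_def split: split_indicator\<close>)
 qed
 obtain mu where mu: "sets mu = sets M0" "ALL c:A. ALL B:sets M0. B <= cdom c --> em0 mu B = em0 (nu c) B"
  using volume_exists by blast
 have P: "?P mu" using mu nu' by simp
 have "\<nu> = mu" if "?P \<nu>" for \<nu>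
 proof(rule measure_eq_on_cover[of _ _ "%n. cdom (sq n)"])
  show "sets \<nu> = sets mu" using that mu(1) by blast
  show "cdom (sq i) : sets \<nu>" for i using that cdom_sets[OF sq(1)] by blast
  have "space \<nu> = space M0" using that by(intro sets_eq_imp_space_eq) blast
  thus "(\<Union>i. cdom (sq i)) = space \<nu>" using sq(2) by(simp add: space_M0)
  show "em0 \<nu> B = em0 mu B" if B: "B : sets \<nu>" "B <= cdom (sq i)" for i B
  proof -
   have "em0 \<nu> B = (LB x. ennreal (sqrt (det (gr (sq i) x)))*chi (cmap (sq i) ` B) x)"
    using \<open>?P \<nu>\<close> sq(1)[of i] B by blast
   moreover have "B : sets mu" using \<open>?P \<nu>\<close> mu(1) B(1) by blast
   moreover have "em0 mu B = (LB x. ennreal (sqrt (det (gr (sq i) x)))*chi (cmap (sq i) ` B) x)"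
    using P[THEN conjunct2, rule_format, OF sq(1) \<open>B : sets mu\<close> B(2)] .
   ultimately show ?thesis by simp
  qed
 qed
 hence "vol = mu" unfolding vol_def riemannian_volume_def using P by(rule the_equality[rotated])
 thus "sets vol = sets M0" "c : A ==> B : sets M0 ==> B <= cdom c ==> em0 vol B = em0 (nu c) B"
  using mu by auto
qed

lemma space_vol: "space vol = car"
 using sets_eq_imp_space_eq[OF vol(1)] by(simp add: space_M0)

lemma measurable_vol: "measurable vol N = measurable M0 N"
 by(rule measurable_cong_sets[OF vol(1) refl])

lemma nu_density: "c : A ==> density vol (chi (cdom c)) = nu c"
proof(rule measure_eqI)
 assume c: "c : A"
 show "sets (density vol (chi (cdom c))) = sets (nu c)" by(simp add: nu_def vol(1))
 fix B assume "B : sets (density vol (chi (cdom c)))"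
 hence B: "B : sets M0" by(simp add: vol(1))
 have cs: "cdom c : sets vol" "B : sets vol" using cdom_sets[OF c] B by(simp_all add: vol(1))
 have "em0 (density vol (chi (cdom c))) B = em0 vol (cdom c Int B)"
  using cs by(subst emeasure_density) (auto simp: indicator_inter_arith[symmetric])
 also have "... = em0 (nu c) (cdom c Int B)"
  by(rule vol(2)[OF c]) (use cdom_sets[OF c] B in auto)
 also have "... = em0 (nu c) B"
  using cdom_sets[OF c] B by(simp add: emeasure_nu[OF c] Int_ac)
 finally show "em0 (density vol (chi (cdom c))) B = em0 (nu c) B" .
qed

lemma nn_integral_vol_chart:
 assumes c: "c : A" and f: "f : bm M0"
 shows "(\<integral>\<^sup>+p. f p*chi (cdom c) p \<partial>vol) = (LB x. f (cinv c x) * vden c x)"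
proof -
 have fv: "f : bm vol" using f by(simp add: measurable_vol)
 have cs: "cdom c : sets vol" using cdom_sets[OF c] by(simp add: vol(1))
 have "(\<integral>\<^sup>+p. f p*chi (cdom c) p \<partial>vol) = (\<integral>\<^sup>+p. f p \<partial>density vol (chi (cdom c)))"
  using fv cs by(subst nn_integral_density) (simp_all add: mult.commute)
 also have "... = (\<integral>\<^sup>+x. f (cinv c x) \<partial>rsp (density lborel (vden c)) (V c))"
  unfolding nu_density[OF c] nu_def
  by(rule nn_integral_distr[OF cinv_measurable'[OF c]]) (use f in simp)
 also have "... = (\<integral>\<^sup>+x. f (cinv c x)*chi (V c) x \<partial>density lborel (vden c))"
  using open_V[OF c] by(intro nn_integral_restrict_space) auto
 also have "... = (LB x. vden c x*(f (cinv c x)*chi (V c) x))"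
 proof(rule nn_integral_density)
  have "(%x. f (cinv c x)) : bm (rsp borel (V c))"
   using measurable_comp[OF cinv_measurable[OF c] f] by(simp add: o_def)
  thus "(%x. f (cinv c x)*chi (V c) x) : bm lborel"
   using open_V[OF c] by(subst borel_measurable_restrict_space_iff_ennreal[symmetric]) auto
 qed (use vden_measurable[OF c] in simp)
 also have "... = (LB x. f (cinv c x) * vden c x)"
  by(rule nn_integral_cong) (auto simp: vden_def mult_ac split: split_indicator)
 finally show ?thesis .
qed

end

section \<open>Lebesgue measure under \<open>join\<close> and under linear maps\<close>

lemma prod_Basis_vec:
 fixes f :: "real^'m::finite => 'c::comm_monoid_mult"
 shows "(\<Prod>b\<in>Basis. f b) = (\<Prod>i\<in>UNIV. f (axis i 1))"
proof -
 have B: "(Basis :: (real^'m) set) = (%i. axis i 1) ` UNIV" by(auto simp: Basis_vec_def)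
 show ?thesis unfolding B by(subst prod.reindex) (auto simp: inj_on_def axis_eq_axis)
qed

lemma emeasure_lborel_box_vec:
 fixes l u :: "real^'m::finite"
 assumes "!!i. l $ i <= u $ i"
 shows "em0 lborel (box l u) = ennreal (\<Prod>i\<in>UNIV. u $ i - l $ i)"
proof -
 have "em0 lborel (box l u) = ennreal (\<Prod>b\<in>Basis. (u - l) dot b)"
  by(rule emeasure_lborel_box) (use assms in \<open>auto simp: Basis_vec_def inner_axis\<close>)
 thus ?thesis by(simp only: prod_Basis_vec) (simp add: inner_axis)
qed

lemma join_measurable: "(%(x, v). join x v :: real^('n::finite + 'n)) : bm (borel \<Otimes>\<^sub>M borel)"
proof -
 have "cts UNIV (%z::(real^'n) \<times> (real^'n). join (fst z) 0 + join 0 (snd z))"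
  by(intro continuous_on_add linear_continuous_on_compose[OF _ bounded_linear.linear[OF bounded_linear_join(1)]]
   linear_continuous_on_compose[OF _ bounded_linear.linear[OF bounded_linear_join(2)]] continuous_intros)
 hence "(%z::(real^'n) \<times> (real^'n). join (fst z) 0 + join 0 (snd z)) : bm borel"
  by(rule borel_measurable_continuous_onI)
 moreover have "(%z::(real^'n) \<times> (real^'n). join (fst z) 0 + join 0 (snd z)) = (%(x, v). join x v)"
  using join_add[symmetric] by(auto simp only: fun_eq_iff fst_conv snd_conv case_prod_conv split_paired_all)
 ultimately show ?thesis by(simp add: borel_prod)
qed

lemma lborel_join: "distr (lborel \<Otimes>\<^sub>M lborel) borel (%(x, v). join x v) = (lborel :: (real^('n::finite + 'n)) measure)"
proof(rule lborel_eqI[symmetric])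
 have jm: "(%(x, v). join x v) : bm (lborel \<Otimes>\<^sub>M (lborel :: (real^'n) measure))"
  using join_measurable by(simp add: measurable_cong_sets[OF sets_pair_measure_cong[OF sets_lborel sets_lborel] refl])
 fix l u :: "real^('n + 'n)"
 assume le: "!!b. b : Basis ==> l dot b <= u dot b"
 have lu: "l $ i <= u $ i" for i using le[of "axis i 1"] by(simp add: inner_axis axis_in_Basis_iff)
 have box: "(%(x, v). join x v) -` box l u Int space (lborel \<Otimes>\<^sub>M lborel) = box (lft l) (lft u) \<times> box (rgt l) (rgt u)"
 proof -
  have "join x v : box l u \<longleftrightarrow> x : box (lft l) (lft u) & v : box (rgt l) (rgt u)" for x v
  proof -
   have "(ALL i. l $ i < join x v $ i & join x v $ i < u $ i) \<longleftrightarrow>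
    (ALL a. l $ Inl a < x $ a & x $ a < u $ Inl a) & (ALL a. l $ Inr a < v $ a & v $ a < u $ Inr a)"
    by(metis (no_types) join_nth sum.exhaust)
   thus ?thesis by(simp add: mem_box_cart lft_nth rgt_nth)
  qed
  thus ?thesis by(auto simp: space_pair_measure)
 qed
 have sum_prod: "(\<Prod>i\<in>UNIV. u $ i - l $ i) = (\<Prod>a\<in>UNIV. u $ Inl a - l $ Inl a)*(\<Prod>a\<in>UNIV. u $ Inr a - l $ Inr a)"
  by(subst UNIV_Plus_UNIV[symmetric], subst prod.Plus) auto
 have "em0 (distr (lborel \<Otimes>\<^sub>M lborel) borel (%(x, v). join x v)) (box l u)
   = em0 lborel (box (lft l) (lft u))*em0 lborel (box (rgt l) (rgt u))"
  by(subst emeasure_distr[OF jm]) (simp_all add: box lborel.emeasure_pair_measure_Times)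
 also have "em0 lborel (box (lft l) (lft u)) = ennreal (\<Prod>a\<in>UNIV. u $ Inl a - l $ Inl a)"
  using lu by(subst emeasure_lborel_box_vec) (simp_all add: lft_nth)
 also have "em0 lborel (box (rgt l) (rgt u)) = ennreal (\<Prod>a\<in>UNIV. u $ Inr a - l $ Inr a)"
  using lu by(subst emeasure_lborel_box_vec) (simp_all add: rgt_nth)
 also have "ennreal (\<Prod>a\<in>UNIV. u $ Inl a - l $ Inl a)*ennreal (\<Prod>a\<in>UNIV. u $ Inr a - l $ Inr a) = ennreal (\<Prod>i\<in>UNIV. u $ i - l $ i)"
  unfolding sum_prod using lu by(subst ennreal_mult[symmetric]) (simp_all add: prod_nonneg)
 also have "(\<Prod>i\<in>UNIV. u $ i - l $ i) = (\<Prod>b\<in>Basis. (u - l) dot b)"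
  by(simp only: prod_Basis_vec) (simp add: inner_axis)
 finally show "em0 (distr (lborel \<Otimes>\<^sub>M lborel) borel (%(x, v). join x v)) (box l u) = ennreal (\<Prod>b\<in>Basis. (u - l) dot b)" .
qed simp

lemma nn_integral_join:
 fixes F :: "real^('n::finite + 'n) => ennreal"
 assumes F: "F : bm borel"
 shows "(LB z. F z) = (LB x. \<integral>\<^sup>+v. F (join x v) \<partial>lborel)"
  and "(%x. \<integral>\<^sup>+v. F (join x v) \<partial>lborel) : bm borel"
proof -
 have jm: "(%(x, v). join x v) : bm (lborel \<Otimes>\<^sub>M (lborel :: (real^'n) measure))"
  using join_measurable by(simp add: measurable_cong_sets[OF sets_pair_measure_cong[OF sets_lborel sets_lborel] refl])
 have Fm: "(%(x, v). F (join x v)) : bm (lborel \<Otimes>\<^sub>M (lborel :: (real^'n) measure))"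
  using measurable_comp[OF jm F] by(simp add: o_def case_prod_beta')
 have "(LB z. F z) = (\<integral>\<^sup>+z. F z \<partial>distr (lborel \<Otimes>\<^sub>M lborel) borel (%(x, v). join x v))"
  by(simp add: lborel_join)
 also have "... = (\<integral>\<^sup>+z. F ((%(x, v). join x v) z) \<partial>(lborel \<Otimes>\<^sub>M lborel))"
  by(rule nn_integral_distr[OF jm]) (use F in simp)
 also have "... = (LB x. \<integral>\<^sup>+v. F (join x v) \<partial>lborel)"
  using lborel.nn_integral_fst[OF Fm] by(simp add: case_prod_beta')
 finally show "(LB z. F z) = (LB x. \<integral>\<^sup>+v. F (join x v) \<partial>lborel)" .
 show "(%x. \<integral>\<^sup>+v. F (join x v) \<partial>lborel) : bm borel"
  using lborel.borel_measurable_nn_integral_fst[OF Fm] by simp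
qed

lemma nn_integral_linear_image:
 fixes L :: "real^'n::finite => real^'n"
 assumes L: "linear L" and d: "det (matrix L) ~= 0" and F: "F : bm borel"
 shows "(LB y. F y) = ennreal \<bar>det (matrix L)\<bar> * (LB x. F (L x))"
proof -
 let ?M = "matrix L"
 have T: "L x = ?M *v x" for x by(rule fun_cong[OF matrix_vector_mul(2)[OF L], symmetric])
 have i1: "matrix_inv ?M *v L x = x" "L (matrix_inv ?M *v x) = x" for x
  using matrix_inv_inverse[OF d] by(simp_all add: T matrix_vector_mul_assoc)
 have surj: "range L = UNIV" by(rule surjI) (rule i1(2))
 have img: "L ` B : sets borel" if "B : sets borel" for B
 proof -
  have "L ` B = (%y. matrix_inv ?M *v y) -` B" using i1 by(auto simp: image_iff) (metis i1)
  moreover have "(%y. matrix_inv ?M *v y) : bm borel"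
   by(intro borel_measurable_continuous_onI linear_continuous_on matrix_vector_mul_bounded_linear)
  ultimately show ?thesis using that by(simp add: measurable_sets_borel)
 qed
 have Lm: "L : bm borel"
  using L by(intro borel_measurable_continuous_onI linear_continuous_on) (simp add: linear_conv_bounded_linear)
 have "(LB y. F y*chi (range L) y) = (LB x. F (L x)*ennreal \<bar>det ?M\<bar> * chi UNIV x)"
 proof(rule nn_integral_change_of_variables[OF open_UNIV])
  show "(L hfd L) (at x)" for x using L by(intro linear_imp_has_derivative)
  show "inj L" by(rule inj_on_inverseI) (rule i1(1))
 qed (use img F in auto)
 also have "... = ennreal \<bar>det ?M\<bar> * (LB x. F (L x))"
  using measurable_comp[OF Lm F] by(subst nn_integral_cmult[symmetric]) (auto simp: o_def mult.commute)
 finally show ?thesis by(simp add: surj)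
qed

section \<open>The Liouville measure on the tangent bundle\<close>

context riemannian
begin

definition unchart :: "('a, 'n) chart => real^('n + 'n) => 'a \<times> ('a, 'n) tangent" where
 "unchart c z = (cinv c (lft z), tvec A c (cinv c (lft z)) (rgt z))"

definition bchart :: "('a, 'n) chart => 'a \<times> ('a, 'n) tangent => real^('n + 'n)" where
 "bchart c w = join (cmap c (fst w)) (snd w c)"

definition tube :: "('a, 'n) chart => ('a \<times> ('a, 'n) tangent) set" where
 "tube c = {w : TM. fst w : cdom c}"

lemma unchart_tube: "c : A ==> z : Om c ==> unchart c z : tube c"
 using cinv_cdom[of c "lft z"] cdom_carrier[of c] tvec_tangent[of c "cinv c (lft z)" "rgt z"]
 by(auto simp: Om_def unchart_def tube_def TM_def)

lemma bchart_Om: "w : tube c ==> bchart c w : Om c"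
 by(simp add: tube_def bchart_def Om_def)

lemma unchart_bchart: "c : A ==> w : tube c ==> unchart c (bchart c w) = w"
 using tangent_eq[of "snd w" "fst w" c] by(auto simp: tube_def TM_def unchart_def bchart_def cinv_cmap)

lemma bchart_unchart: "c : A ==> z : Om c ==> bchart c (unchart c z) = z"
 using cinv_cdom[of c "lft z"] by(simp add: Om_def unchart_def bchart_def cmap_cinv tvec_coord)

text \<open>The measurable structure transported from bundle coordinates. The generating family
  tests a set in every chart and is already a \<sigma>-algebra (\<open>sets_TMs\<close>), whatever
  the size of the atlas.\<close>

definition TMs :: "('a \<times> ('a, 'n) tangent) measure" where
 "TMs = sigma TM {B. B <= TM & (ALL c:A. {z : Om c. unchart c z : B} : sets borel)}"

lemma space_TMs: "space TMs = TM"
 unfolding TMs_def by(rule space_measure_of) auto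

lemma unchart_TM: "c : A ==> z : Om c ==> unchart c z : TM"
 using unchart_tube[of c z] by(simp add: tube_def)

lemma sets_TMs: "B : sets TMs \<longleftrightarrow> B <= TM & (ALL c:A. {z : Om c. unchart c z : B} : sets borel)"
proof -
 let ?S = "{B. B <= TM & (ALL c:A. {z : Om c. unchart c z : B} : sets borel)}"
 have "sigma_algebra TM ?S"
  unfolding sigma_algebra_iff2
 proof(intro conjI ballI allI impI)
  show "?S <= Pow TM" by auto
  show "{} : ?S" by simp
  show "TM - B : ?S" if B: "B : ?S" for B
  proof -
   have "{z : Om c. unchart c z : TM - B} = Om c - {z : Om c. unchart c z : B}" if "c : A" for c
    using unchart_TM[OF that] by auto
   thus ?thesis using B open_Om by auto
  qed
  fix F :: "nat => _" assume F: "range F <= ?S"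
  have "{z : Om c. unchart c z : (\<Union>i. F i)} = (\<Union>i. {z : Om c. unchart c z : F i})" for c by auto
  moreover have "{z : Om c. unchart c z : F i} : sets borel" if "c : A" for c i using F that by blast
  moreover have "(\<Union>i. F i) <= TM" using F by blast
  ultimately show "(\<Union>i. F i) : ?S" by(simp add: sets.countable_UN)
 qed
 hence "sets TMs = ?S"
  unfolding TMs_def by(simp add: sigma_algebra.sets_measure_of_eq)
 thus ?thesis by simp
qed

lemma unchart_measurable: "c : A ==> unchart c : measurable (rsp borel (Om c)) TMs"
proof(rule measurableI)
 assume c: "c : A"
 show "unchart c z : space TMs" if "z : space (rsp borel (Om c))" for z
  using unchart_TM[OF c] that by(simp add: space_TMs space_restrict_space)
 fix B assume "B : sets TMs"
 hence "{z : Om c. unchart c z : B} : sets borel" using c by(simp add: sets_TMs)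
 moreover have "{z : Om c. unchart c z : B} = unchart c -` B Int space (rsp borel (Om c))"
  by(auto simp: space_restrict_space)
 ultimately show "unchart c -` B Int space (rsp borel (Om c)) : sets (rsp borel (Om c))"
  using open_Om[OF c] by(auto simp: sets_restrict_space_iff)
qed

lemma TMs_measurableI:
 assumes N: "!!w. w : TM ==> f w : space N"
  and f: "!!c. c : A ==> (%z. f (unchart c z)) : measurable (rsp borel (Om c)) N"
 shows "f : measurable TMs N"
proof(rule measurableI)
 show "f w : space N" if "w : space TMs" for w using N that by(simp add: space_TMs)
 fix E assume E: "E : sets N"
 have "{z : Om c. unchart c z : f -` E Int TM} : sets borel" if c: "c : A" for c
 proof -
  have "(%z. f (unchart c z)) -` E Int space (rsp borel (Om c)) : sets (rsp borel (Om c))"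
   by(rule measurable_sets[OF f[OF c] E])
  moreover have "(%z. f (unchart c z)) -` E Int space (rsp borel (Om c)) = {z : Om c. unchart c z : f -` E Int TM}"
   using unchart_TM[OF c] by(auto simp: space_restrict_space)
  ultimately show ?thesis using open_Om[OF c] by(auto simp: sets_restrict_space_iff)
 qed
 thus "f -` E Int space TMs : sets TMs" by(auto simp: sets_TMs space_TMs)
qed

text \<open>Measurability in one chart is enough for sets over that chart, because the change of
  bundle coordinates to any other chart is continuous.\<close>

lemma tube_sets_preimage:
 assumes c: "c : A" and E: "E : sets borel"
 shows "{w : tube c. bchart c w : E} : sets TMs"
proof -
 have "{z : Om d. unchart d z : {w : tube c. bchart c w : E}} : sets borel" if d: "d : A" for d
 proof -
  let ?U = "lft -` W d c :: (real^('n + 'n)) set"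
  let ?S = "%z. join (transition d c (lft z)) (T1 d c (lft z) (rgt z))"
  have oU: "open ?U" by(intro open_vimage open_W[OF d c] linear_continuous_on bounded_linear_lft)
  have "Ck_on 0 ?U ?S"
   unfolding T1_def
   by(intro Ck_on_join oU Ck_on_compose[OF oU open_W[OF d c] _ transition_smooth[OF d c]]
    Ck_on_frechet[OF oU open_W[OF d c] _ transition_smooth[OF d c]] Ck_on_bounded_linear_id bounded_linear_lft bounded_linear_rgt) auto
  hence Sm: "?S : bm (rsp borel ?U)"
   by(intro borel_measurable_continuous_on_restrict Ck_on_continuous)
  have "{z : Om d. unchart d z : {w : tube c. bchart c w : E}} = ?S -` E Int space (rsp borel ?U)"
  proof -
   have "z : {z : Om d. unchart d z : {w : tube c. bchart c w : E}} \<longleftrightarrow> z : ?S -` E Int space (rsp borel ?U)" for z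
   proof(cases "z : Om d")
    case False
    thus ?thesis by(auto simp: Om_def space_restrict_space)
   next
    case z: True
    hence x: "lft z : V d" by(simp add: Om_def)
    have W: "lft z : W d c \<longleftrightarrow> cinv d (lft z) : cdom c" using W_iff[OF d, of "lft z" c] x by simp
    show ?thesis
    proof(cases "cinv d (lft z) : cdom c")
     case False
     thus ?thesis using W by(simp add: space_restrict_space tube_def unchart_def)
    next
     case True
     have "bchart c (unchart d z) = ?S z"
      using True x c cmap_cinv[OF d x] by(simp add: bchart_def unchart_def tvec_T1 transition_def)
     thus ?thesis using True W z unchart_tube[OF d z]
      by(simp add: space_restrict_space tube_def unchart_def)
    qed
   qed
   thus ?thesis by blast
  qed
  moreover have "?S -` E Int space (rsp borel ?U) : sets (rsp borel ?U)"
   by(rule measurable_sets[OF Sm E])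
  ultimately show ?thesis using oU by(auto simp: sets_restrict_space_iff)
 qed
 moreover have "{w : tube c. bchart c w : E} <= TM" by(auto simp: tube_def)
 ultimately show ?thesis by(simp add: sets_TMs)
qed

lemma tube_sets: "c : A ==> tube c : sets TMs"
 using tube_sets_preimage[of c UNIV] by simp

lemma tube_subset_sets:
 assumes c: "c : A" and B: "B <= tube c" "{z : Om c. unchart c z : B} : sets borel"
 shows "B : sets TMs"
proof -
 have "B = {w : tube c. bchart c w : {z : Om c. unchart c z : B}}"
  using B(1) bchart_Om[of _ c] unchart_bchart[OF c] by(auto simp: subset_iff)
 thus ?thesis using tube_sets_preimage[OF c B(2)] by simp
qed

lemma frame_unchart:
 assumes c: "c : A" and p: "p : cdom c"
 shows "(p, fr p xi) = unchart c (join (cmap c p) (fr p xi c))" "join (cmap c p) v : Om c"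
 using tangent_eq[OF frame(1) c p, of xi] cdom_carrier[OF c] p by(auto simp: unchart_def cinv_cmap[OF c p] Om_def)

lemma frame_measurable:
 assumes p: "p : car" shows "(%xi. (p, fr p xi)) : measurable borel TMs"
proof -
 obtain c where c: "c : A" "p : cdom c" using p by(rule carrierE)
 have "cts UNIV (%xi. join (cmap c p) (fr p xi c))"
  by(rule Ck_on_continuous[where k = 0])
   (intro Ck_on_join Ck_on_const open_UNIV Ck_on_bounded_linear_id frame(2)[OF p, unfolded linear_conv_bounded_linear])
 hence "(%xi. join (cmap c p) (fr p xi c)) : measurable borel (rsp borel (Om c))"
  using frame_unchart(2)[OF c] by(intro measurable_restrict_space2 borel_measurable_continuous_onI) auto
 from measurable_comp[OF this unchart_measurable[OF c(1)]] show ?thesis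
  by(simp add: o_def frame_unchart(1)[OF c, symmetric])
qed

lemma unchart_borel:
 assumes c: "c : A" and F: "F : bm TMs"
 shows "(%z. (F (unchart c z) :: ennreal)*chi (Om c) z) : bm borel"
 using measurable_comp[OF unchart_measurable[OF c] F] open_Om[OF c]
 by(subst borel_measurable_restrict_space_iff_ennreal[symmetric]) (auto simp: o_def)

text \<open>A linear change of variables by the isometric frame, whose determinant is known from
  \<open>frame_det\<close>. The right-hand side no longer contains the choice of frame, which has no
  regularity in the base point.\<close>

lemma fibre_integral:
 assumes c: "c : A" and p: "p : cdom c" and F: "F : bm TMs"
 shows "(LB xi. F (p, fr p xi))
  = ennreal (sqrt (det (gr c (cmap c p))))*(LB v. F (unchart c (join (cmap c p) v)))"
proof -
 have pc: "p : car" using p cdom_carrier[OF c] by auto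
 let ?x = "cmap c p" and ?L = "%xi. fr p xi c"
 let ?d = "det (matrix ?L)" and ?G = "det (gr c (cmap c p))"
 have fd: "?d\<^sup>2*?G = 1" by(rule frame_det[OF c p])
 hence d: "?d ~= 0" by auto
 have G: "0 < ?G" by(rule gram_det_pos[OF c]) (use p in auto)
 have ds: "sqrt ?G*\<bar>?d\<bar> = 1" using arg_cong[OF fd, of sqrt] by(simp add: real_sqrt_mult mult.commute)
 have jm: "(%v. join ?x v) : bm borel"
  by(rule borel_measurable_continuous_onI, rule Ck_on_continuous[where k = 0])
   (intro Ck_on_join Ck_on_const open_UNIV Ck_on_id)
 have hm: "(%v. F (unchart c (join ?x v))) : bm borel"
  using measurable_comp[OF jm unchart_borel[OF c F]] frame_unchart(2)[OF c p] by(simp add: o_def)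
 have "(LB v. F (unchart c (join ?x v))) = ennreal \<bar>?d\<bar> * (LB xi. F (unchart c (join ?x (?L xi))))"
  by(rule nn_integral_linear_image[OF frame(2)[OF pc] d hm])
 hence "ennreal (sqrt ?G)*(LB v. F (unchart c (join ?x v)))
  = ennreal (sqrt ?G*\<bar>?d\<bar>)*(LB xi. F (unchart c (join ?x (?L xi))))"
  using G by(simp add: ennreal_mult mult.assoc)
 thus ?thesis by(simp add: ds frame_unchart(1)[OF c p, symmetric])
qed

lemma fibre_measurable:
 assumes F: "F : bm TMs"
 shows "(%p. \<integral>\<^sup>+xi. F (p, fr p xi) \<partial>lborel) : bm M0"
proof(rule M0_measurableI)
 fix c assume c: "c : A"
 have "(%x. \<integral>\<^sup>+v. F (unchart c (join x v))*chi (Om c) (join x v) \<partial>lborel) : bm borel"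
  by(rule nn_integral_join(2)[OF unchart_borel[OF c F]])
 hence "(%x. vden c x*(LB v. F (unchart c (join x v))*chi (Om c) (join x v))) : bm (rsp borel (V c))"
  using vden_measurable[OF c] by(intro measurable_restrict_space1 borel_measurable_times_ennreal)
 moreover have "vden c x*(LB v. F (unchart c (join x v))*chi (Om c) (join x v)) = (LB xi. F (cinv c x, fr (cinv c x) xi))"
  if "x : space (rsp borel (V c))" for x
 proof -
  have x: "x : V c" using that by(simp add: space_restrict_space)
  thus ?thesis
   using fibre_integral[OF c cinv_cdom[OF c x] F] by(simp add: cmap_cinv[OF c x] vden_def Om_def)
 qed
 ultimately show "(%x. \<integral>\<^sup>+xi. F (cinv c x, fr (cinv c x) xi) \<partial>lborel) : bm (rsp borel (V c))"
  by(simp cong: measurable_cong)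
qed

text \<open>The Liouville measure: Riemannian volume on the base and, in each fibre, the Lebesgue
  measure transported by an isometry.\<close>

definition Lam :: "('a \<times> ('a, 'n) tangent) measure" where
 "Lam = measure_of TM (sets TMs) (%B. \<integral>\<^sup>+p. \<integral>\<^sup>+xi. chi B (p, fr p xi) \<partial>lborel \<partial>vol)"

lemma sets_Lam: "sets Lam = sets TMs"
 unfolding Lam_def using sets.sigma_sets_eq[of TMs] sets.space_closed[of TMs] by(simp add: space_TMs)

lemma space_Lam: "space Lam = TM"
 using sets_eq_imp_space_eq[OF sets_Lam] by(simp add: space_TMs)

lemma measurable_Lam: "measurable Lam N = measurable TMs N"
 by(rule measurable_cong_sets[OF sets_Lam refl])

lemma frame_comp_measurable:
 assumes "F : measurable TMs N" "p : car" shows "(%xi. F (p, fr p xi)) : measurable lborel N"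
 using measurable_comp[OF frame_measurable[OF assms(2)] assms(1)] by(simp add: o_def)

lemma fibre_measurable_vol: "F : bm TMs ==> (%p. \<integral>\<^sup>+xi. F (p, fr p xi) \<partial>lborel) : bm vol"
 by(simp add: measurable_vol fibre_measurable)

lemma emeasure_Lam:
 assumes B: "B : sets TMs"
 shows "em0 Lam B = (\<integral>\<^sup>+p. \<integral>\<^sup>+xi. chi B (p, fr p xi) \<partial>lborel \<partial>vol)"
 unfolding Lam_def
proof(rule emeasure_measure_of_sigma[OF _ _ _ B])
 show "sigma_algebra TM (sets TMs)" using sets.sigma_algebra_axioms[of TMs] by(simp add: space_TMs)
 let ?m = "%B. \<integral>\<^sup>+p. \<integral>\<^sup>+xi. chi B (p, fr p xi) \<partial>lborel \<partial>vol"
 show "positive (sets TMs) ?m" by(simp add: positive_def)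
 show "countably_additive (sets TMs) ?m"
 proof(rule countably_additiveI)
  fix F :: "nat => _" assume F: "range F <= sets TMs" "disjoint_family F"
  have im: "(chi (F i) :: _ => ennreal) : bm TMs" for i
   using F(1) by(intro borel_measurable_indicator) auto
  have "?m (\<Union>i. F i) = (\<integral>\<^sup>+p. \<integral>\<^sup>+xi. (\<Sum>i. chi (F i) (p, fr p xi)) \<partial>lborel \<partial>vol)"
   using suminf_indicator[OF F(2)] by simp
  also have "... = (\<integral>\<^sup>+p. (\<Sum>i. \<integral>\<^sup>+xi. chi (F i) (p, fr p xi) \<partial>lborel) \<partial>vol)"
   by(intro nn_integral_cong nn_integral_suminf frame_comp_measurable[OF im]) (simp add: space_vol)
  also have "... = (\<Sum>i. ?m (F i))"
   by(rule nn_integral_suminf) (rule fibre_measurable_vol[OF im])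
  finally show "(\<Sum>i. ?m (F i)) = ?m (\<Union>i. F i)" by simp
 qed
qed

lemma nn_integral_Lam:
 assumes F: "F : bm TMs"
 shows "(\<integral>\<^sup>+w. F w \<partial>Lam) = (\<integral>\<^sup>+p. \<integral>\<^sup>+xi. F (p, fr p xi) \<partial>lborel \<partial>vol)"
 using F
proof(induction F rule: borel_measurable_induct)
 case (cong f h)
 have "(\<integral>\<^sup>+w. f w \<partial>Lam) = (\<integral>\<^sup>+w. h w \<partial>Lam)"
  by(rule nn_integral_cong) (use cong in \<open>simp add: space_Lam space_TMs\<close>)
 moreover have "(\<integral>\<^sup>+p. \<integral>\<^sup>+xi. f (p, fr p xi) \<partial>lborel \<partial>vol) = (\<integral>\<^sup>+p. \<integral>\<^sup>+xi. h (p, fr p xi) \<partial>lborel \<partial>vol)"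
  by(intro nn_integral_cong) (use cong frame(1) in \<open>simp add: space_vol space_TMs TM_def\<close>)
 ultimately show ?case using cong by simp
next
 case (set B)
 thus ?case by(simp add: sets_Lam emeasure_Lam)
next
 case (mult u c)
 have "(LB xi. c*u (p, fr p xi)) = c*(LB xi. u (p, fr p xi))" if "p : space vol" for p
  using that mult by(intro nn_integral_cmult frame_comp_measurable) (simp_all add: space_vol)
 thus ?case using mult
  by(simp add: nn_integral_cmult measurable_Lam fibre_measurable_vol cong: nn_integral_cong)
next
 case (add u v)
 have "(LB xi. v (p, fr p xi) + u (p, fr p xi))
   = (LB xi. v (p, fr p xi)) + (LB xi. u (p, fr p xi))" if "p : space vol" for p
  using that add by(intro nn_integral_add frame_comp_measurable) (simp_all add: space_vol)
 thus ?case using add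
  by(simp add: nn_integral_add measurable_Lam fibre_measurable_vol cong: nn_integral_cong)
next
 case (seq U)
 have inc: "incseq (%i. U i (p, w))" for p w using seq(3) by(auto simp: incseq_def le_fun_def)
 have m: "U i : bm TMs" for i using seq by simp
 have "(\<integral>\<^sup>+p. \<integral>\<^sup>+xi. (SUP i. U i) (p, fr p xi) \<partial>lborel \<partial>vol) = (\<integral>\<^sup>+p. (SUP i. \<integral>\<^sup>+xi. U i (p, fr p xi) \<partial>lborel) \<partial>vol)"
  unfolding SUP_apply
  by(intro nn_integral_cong nn_integral_monotone_convergence_SUP frame_comp_measurable m)
   (use inc in \<open>auto simp: incseq_def le_fun_def space_vol\<close>)
 also have "... = (SUP i. \<integral>\<^sup>+p. \<integral>\<^sup>+xi. U i (p, fr p xi) \<partial>lborel \<partial>vol)"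
  by(rule nn_integral_monotone_convergence_SUP)
   (use inc fibre_measurable_vol[OF m] in \<open>auto simp: incseq_def le_fun_def intro!: nn_integral_mono\<close>)
 also have "... = (SUP i. \<integral>\<^sup>+w. U i w \<partial>Lam)" using seq by simp
 also have "... = (\<integral>\<^sup>+w. (SUP i. U i) w \<partial>Lam)"
  unfolding SUP_apply
  by(rule nn_integral_monotone_convergence_SUP[symmetric]) (use seq m in \<open>auto simp: measurable_Lam\<close>)
 finally show ?case by simp
qed

text \<open>The density of \<open>Lam\<close> in bundle coordinates. One factor
  \<open>sqrt (det (gr c x))\<close> comes from the volume of the base, the other from the
  fibre.\<close>

definition mden :: "('a, 'n) chart => real^('n + 'n) => ennreal" where
 "mden c z = ennreal (det (gr c (lft z)))*chi (Om c) z"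

lemma mden_measurable: "c : A ==> mden c : bm borel"
proof -
 assume c: "c : A"
 have "lft : bm borel" by(intro borel_measurable_continuous_onI linear_continuous_on bounded_linear_lft)
 from measurable_comp[OF this det_gram_measurable[OF c]]
 have "(%z. ennreal (det (gr c (lft z)))*chi (V c) (lft z)) : bm borel" by(simp add: o_def)
 moreover have "(%z. ennreal (det (gr c (lft z)))*chi (V c) (lft z)) = mden c"
  by(auto simp: fun_eq_iff mden_def Om_def indicator_def)
 ultimately show ?thesis by simp
qed

lemma nn_integral_Lam_chart:
 assumes c: "c : A" and F: "F : bm TMs"
 shows "(\<integral>\<^sup>+w. F w*chi (tube c) w \<partial>Lam) = (LB z. F (unchart c z)*mden c z)"
proof -
 have Fm: "(%w. F w*chi (tube c) w) : bm TMs" using F tube_sets[OF c] by simp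
 have "(\<integral>\<^sup>+w. F w*chi (tube c) w \<partial>Lam) = (\<integral>\<^sup>+p. \<integral>\<^sup>+xi. F (p, fr p xi)*chi (tube c) (p, fr p xi) \<partial>lborel \<partial>vol)"
  by(rule nn_integral_Lam[OF Fm])
 also have "... = (\<integral>\<^sup>+p. (LB xi. F (p, fr p xi))*chi (cdom c) p \<partial>vol)"
  by(intro nn_integral_cong) (use frame(1) in \<open>auto simp: space_vol tube_def TM_def split: split_indicator\<close>)
 also have "... = (LB x. (LB xi. F (cinv c x, fr (cinv c x) xi)) * vden c x)"
  by(rule nn_integral_vol_chart[OF c fibre_measurable[OF F]])
 also have "... = (LB x. \<integral>\<^sup>+v. F (unchart c (join x v))*mden c (join x v) \<partial>lborel)"
 proof(rule nn_integral_cong)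
  fix x
  show "(LB xi. F (cinv c x, fr (cinv c x) xi)) * vden c x = (LB v. F (unchart c (join x v))*mden c (join x v))"
  proof(cases "x : V c")
   case False
   thus ?thesis by(simp add: vden_def mden_def Om_def)
  next
   case x: True
   have jm: "(%v. join x v) : bm borel"
    by(rule borel_measurable_continuous_onI, rule Ck_on_continuous[where k = 0])
     (intro Ck_on_join Ck_on_const open_UNIV Ck_on_id)
   have hm: "(%v. F (unchart c (join x v))) : bm lborel"
    using measurable_comp[OF jm unchart_borel[OF c F]] x by(simp add: o_def Om_def)
   have s: "ennreal (sqrt (det (gr c x)))*ennreal (sqrt (det (gr c x))) = ennreal (det (gr c x))"
    using gram_det_pos[OF c x] by(simp add: ennreal_mult[symmetric])
   have "(LB xi. F (cinv c x, fr (cinv c x) xi)) * vden c x = ennreal (det (gr c x))*(LB v. F (unchart c (join x v)))"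
    unfolding fibre_integral[OF c cinv_cdom[OF c x] F] using x s[symmetric] by(simp add: cmap_cinv[OF c x] vden_def ac_simps) 
   also have "... = (LB v. F (unchart c (join x v))*mden c (join x v))"
    using x hm by(subst nn_integral_cmult[symmetric]) (simp_all add: mden_def Om_def mult.commute)
   finally show ?thesis .
  qed
 qed
 also have "... = (LB z. F (unchart c z)*mden c z)"
 proof(rule nn_integral_join(1)[symmetric])
  have "(%z. F (unchart c z)*mden c z) = (%z. (F (unchart c z)*chi (Om c) z)*mden c z)"
   by(auto simp: fun_eq_iff mden_def split: split_indicator)
  thus "(%z. F (unchart c z)*mden c z) : bm borel"
   using unchart_borel[OF c F] mden_measurable[OF c] by simp
 qed
 finally show ?thesis .
qed

end

section \<open>The divergence of the geodesic field\<close>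

context riemannian
begin

text \<open>Metric compatibility in matrix form: with \<open>P\<close> the matrix of
  \<open>Gam c x ze\<close>, the derivative of the Gram matrix \<open>G\<close> is the sum of
  \<open>G ** P\<close> and its transpose. Factoring out \<open>G\<close> on the right prepares the
  use of Jacobi's formula, and both summands contribute the trace of \<open>P\<close>.\<close>

lemma gram_derivative_trace:
 assumes c: "c : A" and x: "x : V c"
 obtains Q where "Fd (gr c) (at x) ze = Q ** gr c x"
  "trace Q = 2*trace (matrix (Gam c x ze))"
proof -
 let ?G = "gr c x" and ?P = "matrix (Gam c x ze)" and ?D = "Fd (gr c) (at x) ze"
 have P: "Gam c x ze xi = ?P *v xi" for xi
  by(rule fun_cong[OF matrix_vector_mul(2)[OF Gam_l(2)[OF c x]], symmetric])
 note inv = matrix_inv_inverse[OF gram_det[OF c x]]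
 define Q where "Q = transpose ?P + ?G ** ?P ** matrix_inv ?G"
 have tv: "xi dot (transpose ?P *v y) = (?P *v xi) dot y" for xi y
  using dot_lmul_matrix[of y ?P xi] by(simp add: inner_commute)
 have "xi dot (?D *v eta) = xi dot ((transpose ?P ** ?G + ?G ** ?P) *v eta)" for xi eta
 proof -
  have "xi dot ((transpose ?P ** ?G + ?G ** ?P) *v eta) = xi dot (transpose ?P *v (?G *v eta)) + xi dot (?G *v (?P *v eta))"
   by(simp only: matrix_vector_mult_add_rdistrib inner_add_right matrix_vector_mul_assoc)
  also have "... = dGm c x ze xi eta"
   unfolding tv metric_compat[OF c x] by(simp only: Gm_def P)
  finally show ?thesis by(simp add: dGm_def)
 qed
 hence eq: "ALL xi. xi dot (?D *v eta) = xi dot ((transpose ?P ** ?G + ?G ** ?P) *v eta)" for eta by blast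
 have "?D = transpose ?P ** ?G + ?G ** ?P"
  by(rule matrix_eq[THEN iffD2, OF allI[OF vector_eq_ldot[THEN iffD1, OF eq]]])
 also have "... = Q ** ?G"
  by(simp add: Q_def bounded_bilinear.add_left[OF bounded_bilinear_mmult] matrix_mul_assoc[symmetric] inv)
 finally have 1: "?D = Q ** ?G" .
 have "trace (?G ** ?P ** matrix_inv ?G) = trace (matrix_inv ?G ** (?G ** ?P))" by(rule trace_mul_sym)
 also have "... = trace ?P" by(simp add: matrix_mul_assoc inv)
 finally have "trace Q = 2*trace ?P" by(simp add: Q_def trace_add) (simp add: trace_def transpose_def)
 with 1 show ?thesis by(rule that)
qed

text \<open>The position block of the derivative has zero diagonal, and the quadratic Christoffel
  term contributes twice by symmetry. The result is minus the trace found in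
  \<open>gram_derivative_trace\<close> for \<open>ze = rgt z\<close>.\<close>

lemma XX_derivative_trace:
 assumes c: "c : A" and z: "z : Om c" and D: "(XX c hfd D) (at z)"
 shows "trace (matrix D) = - 2*trace (matrix (Gam c (lft z) (rgt z)))"
proof -
 have x: "lft z : V c" using z by(simp add: Om_def)
 note bl = bounded_linear_imp_has_derivative[OF bounded_linear_lft] bounded_linear_imp_has_derivative[OF bounded_linear_rgt]
 have G: "((%z. Gam c (lft z) (rgt z) (rgt z)) hfd
   (%h. dGam c (lft z) (lft h) (rgt z) (rgt z) + Gam c (lft z) (rgt h) (rgt z) + Gam c (lft z) (rgt z) (rgt h))) (at z)"
  by(rule Gam_deriv[OF c x bl(1) bl(2) bl(2)])
 have "((%z. join (rgt z) 0 + join 0 (- Gam c (lft z) (rgt z) (rgt z))) hfd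
   (%h. join (rgt h) 0 + join 0 (- (dGam c (lft z) (lft h) (rgt z) (rgt z) + Gam c (lft z) (rgt h) (rgt z) + Gam c (lft z) (rgt z) (rgt h))))) (at z)"
  by(intro has_derivative_add bounded_linear.has_derivative[OF bounded_linear_join(1)] bounded_linear.has_derivative[OF bounded_linear_join(2)]
   has_derivative_minus G bl)
 hence X: "(XX c hfd
   (%h. join (rgt h) (- (dGam c (lft z) (lft h) (rgt z) (rgt z) + Gam c (lft z) (rgt h) (rgt z) + Gam c (lft z) (rgt z) (rgt h))))) (at z)"
  unfolding XX_def[abs_def] join_add[symmetric] .
 have Deq: "D = (%h. join (rgt h) (- (dGam c (lft z) (lft h) (rgt z) (rgt z) + Gam c (lft z) (rgt h) (rgt z) + Gam c (lft z) (rgt z) (rgt h))))"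
  by(rule has_derivative_unique[OF D X])
 have ax: "axis (Inl a) 1 = (join (axis a 1) 0 :: real^('n + 'n))" "axis (Inr a) 1 = (join 0 (axis a 1) :: real^('n + 'n))" for a :: 'n
  by(rule vec_sum_eqI; simp add: join_nth axis_def)+
 have dG0: "dGam c (lft z) 0 xi eta = 0" for xi eta by(rule linear_0[OF dGam_linear[OF c x]])
 have "trace (matrix D) = (\<Sum>a\<in>UNIV. D (axis (Inl a) 1) $ Inl a) + (\<Sum>a\<in>UNIV. D (axis (Inr a) 1) $ Inr a)"
  unfolding trace_def by(subst UNIV_Plus_UNIV[symmetric], subst sum.Plus) (simp_all add: matrix_def)
 also have "(\<Sum>a\<in>UNIV. D (axis (Inl a) 1) $ Inl a) = 0"
  by(simp add: ax Deq join_nth)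
 also have "(\<Sum>a\<in>UNIV. D (axis (Inr a) 1) $ Inr a) = - 2*trace (matrix (Gam c (lft z) (rgt z)))"
  unfolding trace_def sum_distrib_left
  by(rule sum.cong) (simp_all add: ax Deq join_nth dG0 matrix_def Gam_sym[OF c x, of "axis _ 1"])
 finally show ?thesis by simp
qed

definition vrefl :: "real^('n + 'n) => real^('n + 'n)" where "vrefl z = join (lft z) (- rgt z)"

lemma vrefl_vrefl[simp]: "vrefl (vrefl z) = z" by(simp add: vrefl_def)

lemma vrefl_Om[simp]: "vrefl z : Om c \<longleftrightarrow> z : Om c" by(simp add: vrefl_def Om_def)

lemma vrefl_smooth: "Ck_on k U vrefl"
 unfolding vrefl_def[abs_def]
 by(rule Ck_on_subset[of _ UNIV])
  (intro Ck_on_join Ck_on_minus open_UNIV Ck_on_bounded_linear_id bounded_linear_lft bounded_linear_rgt, simp)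

lemma unchart_vrefl:
 assumes c: "c : A" and z: "z : Om c" shows "unchart c (vrefl z) = flip (unchart c z)"
proof -
 have x: "lft z : V c" using z by(simp add: Om_def)
 have p: "cinv c (lft z) : cdom c" by(rule cinv_cdom[OF c x])
 have "T1 c d (lft z) (- rgt z) = - T1 c d (lft z) (rgt z)" if "d : A" "cinv c (lft z) : cdom d" for d
  by(rule linear_neg[OF T1_linear[OF c that(1)]]) (use W_iff[OF c, of "lft z" d] x that in simp)
 thus ?thesis by(auto simp: unchart_def vrefl_def flip_def tvec_T1 cmap_cinv[OF c x])
qed

end

section \<open>The flow inside one chart\<close>

context complete_riemannian
begin

definition stay :: "('a, 'n) chart => real => (real^('n + 'n)) set" where
 "stay c ta = {z : Om c. ALL s:{0..ta}. geo (unchart c z) s : cdom c}"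

text \<open>The flow at time \<open>ta\<close> in bundle coordinates; it represents the flow only on
  \<open>stay c ta\<close>.\<close>

definition psi :: "('a, 'n) chart => real => real^('n + 'n) => real^('n + 'n)" where
 "psi c ta z = state c (geo (unchart c z)) ta"

lemma psi_flow: "psi c ta z = bchart c (flow ta (unchart c z))"
 by(simp add: psi_def state_def bchart_def flow_def)

lemma psi_0: "c : A ==> z : Om c ==> psi c 0 z = z"
 by(simp add: psi_flow flow_0 unchart_TM bchart_unchart)

text \<open>Openness of \<open>stay\<close>, differentiability and the determinant identity rest on
  the same tube around the orbit of \<open>a\<close>, and are proved together. The identity is
  Liouville's formula: along the orbit the traces of the two linear equations, for the derivative of
  the flow and for the Gram matrix, cancel.\<close>

lemma psi_local:
 assumes c: "c : A" and T: "0 <= ta" and a: "a : stay c ta"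
 obtains d D where "0 < d" "ball a d <= stay c ta" "(psi c ta hfd (%h. D *v h)) (at a)"
  "det D*det (gr c (lft (psi c ta a))) = det (gr c (lft a))"
proof -
 let ?Z = "%w s. psi c s w"
 have aO: "a : Om c" using a by(simp add: stay_def)
 have gw: "geodesic A g (geo (unchart c w))" if "w : Om c" for w by(rule geo(1)[OF unchart_TM[OF c that]])
 have der: "(?Z w hvd XX c (?Z w s)) (at s)" if "w : Om c" "geo (unchart c w) s : cdom c" for w s
  using state_deriv[OF gw[OF that(1)] c that(2)] by(simp add: psi_def[abs_def])
 have inO: "?Z w s : Om c" if "geo (unchart c w) s : cdom c" for w s
  using state_Om[where ga = "geo (unchart c w)" and t = s and c = c] that by(simp add: psi_def)
 have as: "geo (unchart c a) s : cdom c" if "s : {0..ta}" for s using a that by(simp add: stay_def)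
 have za: "?Z a ` {0..ta} <= Om c" using as inO by blast
 have zd: "(?Z a hvd XX c (?Z a s)) (at s within {0..ta})" if "s : {0..ta}" for s
  by(rule has_vector_derivative_at_within[OF der[OF aO as[OF that]]])
 have zc: "cts {0..ta} (?Z a)"
  unfolding continuous_on_eq_continuous_within
  by(intro ballI has_vector_derivative_continuous[OF zd])
 obtain DX where DX: "ALL x:Om c. (XX c hfd blinfun_apply (DX x)) (at x)" "cts (Om c) DX"
  by(rule Ck_on_blinfun_derivative[OF open_Om[OF c] XX_smooth[OF c]])
 have DX1: "x : Om c ==> (XX c hfd blinfun_apply (DX x)) (at x)" for x using DX(1) by blast
 obtain r L where rL: "r > 0" "L > 0" "compact (\<Union>s\<in>{0..ta}. cball (?Z a s) r)" "(\<Union>s\<in>{0..ta}. cball (?Z a s) r) <= Om c"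
  "ALL s:{0..ta}. ALL u:cball (?Z a s) r. norm (XX c u - XX c (?Z a s)) <= L*norm (u - ?Z a s)"
  by(rule flow_tube[OF open_Om[OF c] DX1 DX(2) zc za T])
 let ?K = "\<Union>s\<in>{0..ta}. cball (?Z a s) r"
 \<comment> \<open>The positions belonging to the tube form a compact, hence closed, subset of the
   manifold inside the chart domain. A geodesic with coordinates in the tube up to time
   \<open>t\<close> therefore is still in the chart at time \<open>t\<close>, as
   \<open>flow_stay\<close> requires.\<close>
 let ?Q = "cinv c ` lft ` ?K"
 have lK: "lft ` ?K <= V c" using rL(4) by(auto simp: Om_def)
 have "compact ?Q"
  by(intro compact_continuous_image rL(3) linear_continuous_on bounded_linear_lft continuous_on_subset[OF cont_cinv[OF c] lK])
 hence clQ: "closed ?Q" by(rule compact_imp_closed)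
 have Qc: "?Q <= cdom c" using lK cinv_cdom[OF c] by blast
 obtain e where e: "e > 0" "ball a e <= Om c" using open_Om[OF c] aO openE by blast
 define d where "d = min e (r/exp (L*ta))"
 have d: "d > 0" "d <= e" "d*exp (L*ta) <= r" using e rL(1) by(simp_all add: d_def min_def field_simps)
 have main: "t : {s. geo (unchart c w) s : cdom c} & norm (?Z w t - ?Z a t) <= norm (?Z w 0 - ?Z a 0)*exp (L*t)"
  if w: "w : ball a d" and t: "t : {0..ta}" for w t
 proof -
  have wO: "w : Om c" using w d(2) e(2) by(auto simp: subset_iff)
  let ?G = "{s. geo (unchart c w) s : cdom c}"
  have sm: "smooth_curve A (geo (unchart c w))" by(rule geodesic_curve[OF gw[OF wO]])
  show ?thesis
  proof(rule flow_stay[OF rL(2) zd _ _ _ _ _ _ t, where r = r and G = ?G])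
   show "norm (XX c u - XX c (?Z a s)) <= L*norm (u - ?Z a s)" if "s : {0..ta}" "u : cball (?Z a s) r" for s u
    using rL(5) that by blast
   show "open ?G" using curve_open[OF sm c] by(simp add: vimage_def)
   show "0 : ?G" using unchart_tube[OF c wO] geo(2)[OF unchart_TM[OF c wO]] by(simp add: tube_def)
   show "(?Z w hvd XX c (?Z w s)) (at s)" if "s : ?G" for s
    using der[OF wO] that by simp
   show "norm (?Z w 0 - ?Z a 0)*exp (L*ta) < r"
   proof -
    have "norm (w - a)*exp (L*ta) < d*exp (L*ta)"
     using w by(intro mult_strict_right_mono) (auto simp: dist_norm norm_minus_commute)
    hence "norm (w - a)*exp (L*ta) < r" using d(3) by(rule less_le_trans)
    thus ?thesis by(simp add: psi_0[OF c wO] psi_0[OF c aO])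
   qed
   fix t assume t: "t : {0<..ta}" and st: "!!s. s : {0..<t} ==> s : ?G & ?Z w s : cball (?Z a s) r"
   have gQ: "geo (unchart c w) s : ?Q" if s: "s : {0<..<t}" for s
   proof -
    have s0: "s : {0..<t}" "s : {0..ta}" using s t by auto
    have "?Z w s : ?K" using st[OF s0(1)] s0(2) by blast
    hence Q: "cinv c (lft (?Z w s)) : ?Q" by(intro imageI)
    have eq: "cinv c (lft (?Z w s)) = geo (unchart c w) s"
     using st[OF s0(1)] cinv_cmap[OF c] by(simp add: psi_def state_def)
    from Q show ?thesis unfolding eq .
   qed
   have "{0<..<t} <= geo (unchart c w) -` ?Q" by(intro subsetI vimageI2 gQ)
   moreover have "closed (geo (unchart c w) -` ?Q)"
    using sm clQ by(intro closed_vimage) (auto simp: smooth_curve_def)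
   ultimately have "closure {0<..<t} <= geo (unchart c w) -` ?Q" by(rule closure_minimal)
   moreover have "t : closure {0<..<t}" using t by(simp add: closure_greaterThanLessThan)
   ultimately have "t : geo (unchart c w) -` ?Q" by(rule subsetD)
   thus "t : ?G" using Qc by auto
  qed
 qed
 have sub: "ball a d <= stay c ta"
 proof
  fix w assume w: "w : ball a d"
  hence "w : Om c" using d(2) e(2) by(auto simp: subset_iff)
  thus "w : stay c ta" using main[OF w] by(simp add: stay_def)
 qed
 have init: "?Z w 0 = w" if "w : ball a d" for w
  using psi_0[OF c] sub that by(auto simp: stay_def)
 have close: "norm (?Z w s - ?Z a s) <= norm (w - a)*exp (L * s)" if "w : ball a d" "s : {0..ta}" for w s
  using main[OF that] init[OF that(1)] init[of a] d(1) by simp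
 have sol: "(?Z w hvd XX c (?Z w s)) (at s within {0..ta})" if w: "w : ball a d" and s: "s : {0..ta}" for w s
  by(rule has_vector_derivative_at_within[OF der]) (use sub w main[OF w s] in \<open>auto simp: stay_def\<close>)
 obtain Y where Y: "Y 0 = mat 1"
  "!!s. s : {0..ta} ==> (Y hvd matrix (DX (?Z a s)) ** Y s) (at s within {0..ta})"
  "((%w. ?Z w ta) hfd (%h. Y ta *v h)) (at a)"
  using flow_has_derivative[OF open_Om[OF c] DX1 DX(2) T za d(1) sol init close rL(2)] by metis
 \<comment> \<open>The conserved quantity: derivative of the flow times density at the image
   point.\<close>
 define m where "m s = det (Y s)*det (gr c (lft (?Z a s)))" for s
 have "(m has_real_derivative 0) (at s within {0..ta})" if s: "s : {0..ta}" for s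
 proof -
  have zO: "?Z a s : Om c" using za s by blast
  hence x: "lft (?Z a s) : V c" by(simp add: Om_def)
  obtain Q where Q: "Fd (gr c) (at (lft (?Z a s))) (rgt (?Z a s)) = Q ** gr c (lft (?Z a s))"
   "trace Q = 2*trace (matrix (Gam c (lft (?Z a s)) (rgt (?Z a s))))"
   by(rule gram_derivative_trace[OF c x])
  have "((%s. lft (?Z a s)) hvd rgt (?Z a s)) (at s within {0..ta})"
   using bounded_linear.has_vector_derivative[OF bounded_linear_lft zd[OF s]] by(simp add: XX_def)
  from vector_derivative_diff_chain_within[OF this has_derivative_at_withinI[OF gram_deriv[OF c x]]]
  have "((%s. gr c (lft (?Z a s))) hvd Q ** gr c (lft (?Z a s))) (at s within {0..ta})"
   by(simp add: o_def Q(1))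
  from has_vector_derivative_det[OF this]
  have dG: "((%s. det (gr c (lft (?Z a s)))) hvd trace Q*det (gr c (lft (?Z a s)))) (at s within {0..ta})" .
  have dY: "((%s. det (Y s)) hvd trace (matrix (DX (?Z a s)))*det (Y s)) (at s within {0..ta})"
   by(rule has_vector_derivative_det[OF Y(2)[OF s]])
  have tr: "trace (matrix (DX (?Z a s))) = - trace Q"
   using XX_derivative_trace[OF c zO DX1[OF zO]] Q(2) by simp
  have "(m has_real_derivative (trace (matrix (DX (?Z a s)))*det (Y s))*det (gr c (lft (?Z a s)))
   + trace Q*det (gr c (lft (?Z a s)))*det (Y s)) (at s within {0..ta})"
   unfolding m_def[abs_def]
   by(rule DERIV_mult; use dY dG in \<open>simp add: has_real_derivative_iff_has_vector_derivative\<close>)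
  thus ?thesis by(simp add: tr mult_ac)
 qed
 hence "EX k. ALL s:{0..ta}. m s = k"
  by(intro has_field_derivative_zero_constant) auto
 hence "m ta = m 0" using T by auto
 hence "det (Y ta)*det (gr c (lft (?Z a ta))) = det (gr c (lft a))"
  by(simp add: m_def Y(1) psi_0[OF c aO])
 with d(1) sub Y(3) show ?thesis by(rule that)
qed

lemma open_stay:
 assumes "c : A" "0 <= ta" shows "open (stay c ta)"
 unfolding open_contains_ball
proof
 fix a assume "a : stay c ta"
 from psi_local[OF assms this] show "EX e>0. ball a e <= stay c ta" by metis
qed

lemma psi_continuous:
 assumes "c : A" "0 <= ta" shows "cts (stay c ta) (psi c ta)"
proof(rule continuous_at_imp_continuous_on, rule ballI)
 fix a assume "a : stay c ta"
 from psi_local[OF assms this] show "isCont (psi c ta) a" by(metis has_derivative_continuous)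
qed

lemma unchart_psi:
 assumes c: "c : A" and T: "0 <= ta" and z: "z : stay c ta"
 shows "unchart c (psi c ta z) = flow ta (unchart c z)" "psi c ta z : Om c"
proof -
 have "z : Om c" using z by(simp add: stay_def)
 hence "flow ta (unchart c z) : TM" by(intro flow_TM unchart_TM[OF c])
 moreover have "fst (flow ta (unchart c z)) : cdom c" using z T by(simp add: stay_def flow_def)
 ultimately have t: "flow ta (unchart c z) : tube c" by(simp add: tube_def)
 show "unchart c (psi c ta z) = flow ta (unchart c z)" unfolding psi_flow by(rule unchart_bchart[OF c t])
 show "psi c ta z : Om c" unfolding psi_flow by(rule bchart_Om[OF t])
qed

text \<open>Reversing the velocity, flowing and reversing again undoes the flow. This gives an
  explicit inverse of \<open>psi\<close>, from which injectivity and measurability of images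
  follow.\<close>

lemma psi_back:
 assumes c: "c : A" and T: "0 <= ta" and z: "z : stay c ta"
 shows "vrefl (psi c ta z) : stay c ta" "psi c ta (vrefl (psi c ta z)) = vrefl z"
proof -
 let ?u = "unchart c z"
 have zO: "z : Om c" using z by(simp add: stay_def)
 have u: "?u : TM" by(rule unchart_TM[OF c zO])
 have pO: "psi c ta z : Om c" by(rule unchart_psi(2)[OF c T z])
 have fl: "flow s (unchart c (vrefl (psi c ta z))) = flip (flow (ta - s) ?u)" for s
 proof -
  have "flow s (flip (flow ta ?u)) = flip (flow (- s) (flow ta ?u))"
   using flow_flip[OF flow_TM[OF u, of ta], of s] by simp
  also have "... = flip (flow (ta - s) ?u)" by(simp add: flow_add[OF u])
  finally show ?thesis by(simp add: unchart_vrefl[OF c pO] unchart_psi(1)[OF c T z])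
 qed
 have "geo (unchart c (vrefl (psi c ta z))) s = geo ?u (ta - s)" for s
  using arg_cong[OF fl[of s], of fst] by(simp add: flow_def flip_def)
 thus "vrefl (psi c ta z) : stay c ta" using z pO by(auto simp: stay_def)
 have "psi c ta (vrefl (psi c ta z)) = bchart c (flip ?u)"
  unfolding psi_flow[of _ _ "vrefl _"] fl by(simp add: flow_0[OF u])
 also have "... = vrefl z"
  using bchart_unchart[OF c, of "vrefl z"] zO unchart_vrefl[OF c zO] by simp
 finally show "psi c ta (vrefl (psi c ta z)) = vrefl z" .
qed

lemma psi_image_iff:
 assumes c: "c : A" and T: "0 <= ta" and E: "E <= stay c ta"
 shows "w : psi c ta ` E \<longleftrightarrow> vrefl w : stay c ta & vrefl (psi c ta (vrefl w)) : E"
proof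
 assume "w : psi c ta ` E"
 then obtain z where "z : E" "w = psi c ta z" by blast
 thus "vrefl w : stay c ta & vrefl (psi c ta (vrefl w)) : E" using psi_back[OF c T, of z] E by auto
next
 assume w: "vrefl w : stay c ta & vrefl (psi c ta (vrefl w)) : E"
 hence "psi c ta (vrefl (psi c ta (vrefl w))) = w" using psi_back(2)[OF c T, of "vrefl w"] by simp
 thus "w : psi c ta ` E" using w by(metis imageI)
qed

lemma psi_inj: "c : A ==> 0 <= ta ==> inj_on (psi c ta) (stay c ta)"
 by(rule inj_on_inverseI[where g = "%w. vrefl (psi c ta (vrefl w))"]) (simp add: psi_back)

lemma psi_image_sets:
 assumes c: "c : A" and T: "0 <= ta" and E: "E : sets borel" "E <= stay c ta"
 shows "psi c ta ` E : sets borel"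
proof -
 have rc: "cts S vrefl" for S by(rule Ck_on_continuous[OF vrefl_smooth[of 0]])
 define U where "U = vrefl -` stay c ta"
 have oU: "open U" unfolding U_def by(intro open_vimage open_stay[OF c T] rc)
 have "cts U (%w. vrefl (psi c ta (vrefl w)))"
  by(intro continuous_on_compose2[OF rc[of UNIV]] continuous_on_compose2[OF psi_continuous[OF c T]] rc) (auto simp: U_def)
 from measurable_sets[OF borel_measurable_continuous_on_restrict[OF this] E(1)]
 have "{w : U. vrefl (psi c ta (vrefl w)) : E} : sets borel"
  using borel_open[OF oU] by(simp add: sets_restrict_space_iff space_restrict_space Int_def conj_commute)
 moreover have "psi c ta ` E = {w : U. vrefl (psi c ta (vrefl w)) : E}"
  using psi_image_iff[OF c T E(2)] unfolding U_def by blast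
 ultimately show ?thesis by simp
qed

text \<open>By \<open>psi_local\<close> the Jacobian of \<open>psi\<close> is the density at the
  starting point divided by that at the image point, so the change of variables reproduces the
  density.\<close>

lemma psi_preserves:
 assumes c: "c : A" and T: "0 <= ta" and E: "E : sets borel" "E <= stay c ta"
 shows "(LB w. mden c w*chi (psi c ta ` E) w) = (LB z. mden c z*chi E z)"
proof -
 let ?U = "stay c ta" and ?g = "%z. det (gr c (lft z))"
 have "ALL a:?U. EX D. (psi c ta hfd (%h. D *v h)) (at a) & det D*?g (psi c ta a) = ?g a"
  using psi_local[OF c T] by metis
 then obtain D where D: "ALL a:?U. (psi c ta hfd (%h. D a *v h)) (at a) & det (D a)*?g (psi c ta a) = ?g a"
  by(rule bchoice[THEN exE])
 have gpos: "0 < ?g z" if "z : Om c" for z using gram_det_pos[OF c] that by(simp add: Om_def)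
 have UO: "?U <= Om c" by(auto simp: stay_def)
 have pO: "psi c ta z : Om c" if "z : ?U" for z by(rule unchart_psi(2)[OF c T that])
 have detD: "det (D z) = ?g z / ?g (psi c ta z)" if "z : ?U" for z
  using D that gpos[OF pO[OF that]] by(simp add: field_simps)
 have gc: "cts (Om c) ?g"
  by(rule continuous_on_compose2[OF det_gram_continuous[OF c] linear_continuous_on[OF bounded_linear_lft]]) (auto simp: Om_def)
 have "cts ?U (%z. ?g z / ?g (psi c ta z))"
  by(intro continuous_on_divide continuous_on_subset[OF gc UO] continuous_on_compose2[OF gc psi_continuous[OF c T]] ballI)
   (use pO gpos in \<open>auto dest: less_imp_neq\<close>, metis pO gpos less_irrefl)
 hence "(%z. ?g z / ?g (psi c ta z)) : bm (rsp borel ?U)"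
  by(rule borel_measurable_continuous_on_restrict)
 moreover have "det (matrix ((*v) (D z))) = ?g z / ?g (psi c ta z)" if "z : space (rsp borel ?U)" for z
  using detD that by(simp add: space_restrict_space)
 ultimately have dm: "(%z. det (matrix ((*v) (D z)))) : bm (rsp borel ?U)"
  by(simp cong: measurable_cong)
 have Fm: "(%w. mden c w*chi (psi c ta ` E) w) : bm borel"
  using mden_measurable[OF c] psi_image_sets[OF c T E] by simp
 have "(LB w. mden c w*chi (psi c ta ` E) w)
  = (LB w. (mden c w*chi (psi c ta ` E) w)*chi (psi c ta ` ?U) w)"
  by(rule nn_integral_cong) (use E(2) in \<open>auto split: split_indicator\<close>)
 also have "... = (LB z. (mden c (psi c ta z)*chi (psi c ta ` E) (psi c ta z))*ennreal \<bar>det (matrix ((*v) (D z)))\<bar> * chi ?U z)"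
  by(rule nn_integral_change_of_variables[OF open_stay[OF c T] _ psi_inj[OF c T] dm psi_image_sets[OF c T] Fm]) (use D in blast)
 also have "... = (LB z. mden c z*chi E z)"
 proof(rule nn_integral_cong)
  fix z
  show "(mden c (psi c ta z)*chi (psi c ta ` E) (psi c ta z))*ennreal \<bar>det (matrix ((*v) (D z)))\<bar> * chi ?U z = mden c z*chi E z"
  proof(cases "z : ?U")
   case False
   thus ?thesis using E(2) by(auto split: split_indicator)
  next
   case True
   have i: "chi (psi c ta ` E) (psi c ta z) = (chi E z :: ennreal)"
    using inj_on_image_mem_iff[OF psi_inj[OF c T] True E(2)] by(simp add: indicator_def)
   have p: "0 < ?g (psi c ta z)" "0 < ?g z" using gpos pO True UO by auto
   have "ennreal (?g (psi c ta z))*ennreal \<bar>det (D z)\<bar> = ennreal (?g z)"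
    using p by(subst ennreal_mult[symmetric]) (simp_all add: detD[OF True])
   thus ?thesis using True UO pO[OF True] i by(auto simp: mden_def subset_iff mult_ac)
  qed
 qed
 finally show ?thesis .
qed

definition good :: "('a, 'n) chart => real => ('a \<times> ('a, 'n) tangent) set" where
 "good c ta = {w : TM. ALL s:{0..ta}. geo w s : cdom c}"

lemma good_tube: "0 <= ta ==> good c ta <= tube c"
 using geo(2) by(force simp: good_def tube_def)

lemma unchart_good: "c : A ==> z : Om c ==> unchart c z : good c ta \<longleftrightarrow> z : stay c ta"
 by(simp add: good_def stay_def unchart_TM)

lemma flow_good_preimage:
 assumes c: "c : A" and T: "0 <= ta" and B: "B : sets TMs"
 shows "{w : good c ta. flow ta w : B} : sets TMs"
proof(rule tube_subset_sets[OF c])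
 show "{w : good c ta. flow ta w : B} <= tube c" using good_tube[OF T] by blast
 have m: "psi c ta : bm (rsp borel (stay c ta))"
  by(rule borel_measurable_continuous_on_restrict[OF psi_continuous[OF c T]])
 have "{z : Om c. unchart c z : B} : sets borel" using B c by(simp add: sets_TMs)
 from measurable_sets[OF m this]
 have "{z : stay c ta. psi c ta z : {z : Om c. unchart c z : B}} : sets borel"
  using open_stay[OF c T] by(auto simp: sets_restrict_space_iff space_restrict_space Int_def conj_commute)
 moreover have "{z : Om c. unchart c z : {w : good c ta. flow ta w : B}} = {z : stay c ta. psi c ta z : {z : Om c. unchart c z : B}}"
  using unchart_good[OF c] unchart_psi[OF c T] by(auto simp: stay_def)
 ultimately show "{z : Om c. unchart c z : {w : good c ta. flow ta w : B}} : sets borel" by simp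
qed

lemma flow_good_image:
 assumes c: "c : A" and T: "0 <= ta" and B: "B : sets TMs" "B <= good c ta"
 shows "flow ta ` B : sets TMs" "em0 Lam (flow ta ` B) = em0 Lam B"
proof -
 let ?E = "{z : Om c. unchart c z : B}"
 have E: "?E : sets borel" "?E <= stay c ta" using B c unchart_good[OF c] by(auto simp: sets_TMs)
 have Bt: "B <= tube c" using B(2) good_tube[OF T] by blast
 have im: "{z : Om c. unchart c z : flow ta ` B} = psi c ta ` ?E"
 proof -
  have "z : psi c ta ` ?E" if z: "z : Om c" "unchart c z = flow ta b" "b : B" for z b
  proof -
   have b: "b : tube c" using Bt z(3) by blast
   have eq: "z = psi c ta (bchart c b)" using z bchart_unchart[OF c z(1)] unchart_bchart[OF c b] by(simp add: psi_flow)
   have "bchart c b : ?E" using bchart_Om[OF b] unchart_bchart[OF c b] z(3) by simp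
   thus ?thesis by(rule image_eqI[where f = "psi c ta", OF eq])
  qed
  moreover have "psi c ta z : Om c & unchart c (psi c ta z) : flow ta ` B" if "z : ?E" for z
   using unchart_psi[OF c T, of z] E(2) that by auto
  ultimately show ?thesis by auto
 qed
 have ft: "flow ta ` B <= tube c"
 proof
  fix w assume "w : flow ta ` B"
  then obtain b where b: "b : B" "w = flow ta b" by blast
  hence "b : good c ta" using B(2) by blast
  thus "w : tube c" using b flow_TM[of b ta] T by(simp add: good_def tube_def flow_def)
 qed
 show fs: "flow ta ` B : sets TMs"
  by(rule tube_subset_sets[OF c ft]) (simp only: im psi_image_sets[OF c T E])
 have em: "em0 Lam X = (LB z. mden c z*chi {z : Om c. unchart c z : X} z)"
  if X: "X : sets TMs" "X <= tube c" for X
 proof -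
  have "em0 Lam X = (\<integral>\<^sup>+w. chi X w*chi (tube c) w \<partial>Lam)"
   using X by(simp add: indicator_inter_arith[symmetric] Int_absorb2 sets_Lam)
  also have "... = (LB z. chi X (unchart c z)*mden c z)"
   by(rule nn_integral_Lam_chart[OF c]) (use X in simp)
  also have "... = (LB z. mden c z*chi {z : Om c. unchart c z : X} z)"
   by(rule nn_integral_cong) (auto simp: mden_def split: split_indicator)
  finally show ?thesis .
 qed
 show "em0 Lam (flow ta ` B) = em0 Lam B"
  unfolding em[OF fs ft] em[OF B(1) Bt] im by(rule psi_preserves[OF c T E])
qed

end

section \<open>Global invariance of the Liouville measure\<close>

context complete_riemannian
begin

definition short :: "real => ('a \<times> ('a, 'n) tangent) set" where "short ta = (\<Union>n. good (sq n) ta)"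

text \<open>The preimage is cut into disjoint pieces, each treated in a single chart. The flow is
  injective, so the images are disjoint subsets of \<open>B\<close> and their measures add up; they
  need not exhaust \<open>B\<close>, hence only an inequality.\<close>

lemma flow_short:
 assumes T: "0 <= ta" and B: "B : sets TMs"
 shows "{w : short ta. flow ta w : B} : sets TMs" "em0 Lam {w : short ta. flow ta w : B} <= em0 Lam B"
proof -
 define P where "P n = {w : good (sq n) ta. flow ta w : B}" for n
 have P: "P n : sets TMs" for n unfolding P_def by(rule flow_good_preimage[OF sq(1) T B])
 have U: "{w : short ta. flow ta w : B} = (\<Union>n. P n)" by(auto simp: short_def P_def)
 show "{w : short ta. flow ta w : B} : sets TMs" unfolding U using P by auto
 let ?D = "disjointed P"
 have D: "?D n : sets TMs" for n by(rule disjointed_sets) (rule P)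
 have DP: "?D n <= good (sq n) ta" "?D n <= P n" for n using disjointed_subset[of P n] by(auto simp: P_def)
 note im = flow_good_image[OF sq(1) T D DP(1)]
 have dj: "disjoint_family (%n. flow ta ` ?D n)"
  unfolding disjoint_family_on_def
 proof(intro ballI impI)
  fix m n :: nat assume mn: "m ~= n"
  have "?D m Int ?D n = {}" using disjoint_family_disjointed[of P] mn by(auto simp: disjoint_family_on_def)
  moreover have "inj_on (flow ta) TM" by(rule inj_onI) (rule flow_inj)
  moreover have "?D m <= TM" "?D n <= TM" using DP by(auto simp: good_def)
  ultimately show "flow ta ` ?D m Int flow ta ` ?D n = {}"
   using inj_on_image_Int[of "flow ta" TM "?D m" "?D n"] by simp
 qed
 have "em0 Lam (\<Union>n. P n) = em0 Lam (\<Union>n. ?D n)" by(simp add: UN_disjointed_eq)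
 also have "... = (\<Sum>n. em0 Lam (?D n))"
  by(rule suminf_emeasure[symmetric]) (use D disjoint_family_disjointed in \<open>auto simp: sets_Lam\<close>)
 also have "... = (\<Sum>n. em0 Lam (flow ta ` ?D n))" by(simp add: im(2))
 also have "... = em0 Lam (\<Union>n. flow ta ` ?D n)"
  by(rule suminf_emeasure) (use im(1) dj in \<open>auto simp: sets_Lam\<close>)
 also have "... <= em0 Lam B"
 proof(rule emeasure_mono)
  show "(\<Union>n. flow ta ` ?D n) <= B"
  proof
   fix x assume "x : (\<Union>n. flow ta ` ?D n)"
   then obtain n w where w: "w : ?D n" "x = flow ta w" by blast
   hence "w : P n" using DP(2) by blast
   thus "x : B" by(simp add: P_def w(2))
  qed
 qed (use B in \<open>simp add: sets_Lam\<close>)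
 finally show "em0 Lam {w : short ta. flow ta w : B} <= em0 Lam B" unfolding U .
qed

text \<open>Vectors that reach \<open>B\<close> after \<open>j\<close> steps of length
  \<open>ta\<close>, each step taken inside one chart of the sequence.\<close>

primrec iter :: "real => ('a \<times> ('a, 'n) tangent) set => nat => ('a \<times> ('a, 'n) tangent) set" where
 "iter ta B 0 = B"
| "iter ta B (Suc j) = {w : short ta. flow ta w : iter ta B j}"

lemma iter_sets:
 assumes "0 <= ta" "B : sets TMs"
 shows "iter ta B j : sets TMs & em0 Lam (iter ta B j) <= em0 Lam B"
proof(induction j)
 case 0
 thus ?case using assms by simp
next
 case (Suc j)
 thus ?case using flow_short[OF assms(1), of "iter ta B j"] by(auto intro: order_trans)
qed

lemma iter_mem:
 assumes w: "w : TM"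
 shows "w : iter ta B j \<longleftrightarrow> (ALL i<j. flow (real i*ta) w : short ta) & flow (real j*ta) w : B"
 using w
proof(induction j arbitrary: w)
 case 0
 thus ?case by(simp add: flow_0)
next
 case (Suc j)
 have f: "flow (real i*ta) (flow ta w) = flow (real (Suc i)*ta) w" for i
  by(simp add: flow_add[OF Suc.prems] algebra_simps)
 have "w : iter ta B (Suc j) \<longleftrightarrow> w : short ta & (ALL i<j. flow (real (Suc i)*ta) w : short ta) & flow (real (Suc j)*ta) w : B"
  using Suc.IH[OF flow_TM[OF Suc.prems], of ta] by(simp add: f del: of_nat_Suc)
 also have "... \<longleftrightarrow> (ALL i<Suc j. flow (real i*ta) w : short ta) & flow (real (Suc j)*ta) w : B"
  unfolding All_less_Suc2 by(simp add: flow_0[OF Suc.prems] del: of_nat_Suc)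
 finally show ?case .
qed

text \<open>A Lebesgue number of the cover of \<open>{0..t}\<close> by the times spent in the charts
  bounds the admissible length of a step.\<close>

lemma eventually_short:
 assumes w: "w : TM" and t: "0 < t"
 shows "EX N0. \<forall>N\<ge>N0. ALL i<Suc N. flow (real i*(t/Suc N)) w : short (t/Suc N)"
proof -
 let ?G = "range (%n. geo w -` cdom (sq n))"
 have sm: "smooth_curve A (geo w)" by(rule geodesic_curve[OF geo(1)[OF w]])
 have op: "open G" if G: "G : ?G" for G
 proof -
  obtain n where n: "G = geo w -` cdom (sq n)" using G by(elim rangeE)
  show ?thesis unfolding n by(rule curve_open[OF sm sq(1)])
 qed
 have cov: "{0..t} <= \<Union>?G"
 proof
  fix x assume "x : {0..t}"
  have "geo w x : (\<Union>n. cdom (sq n))" using curve_carrier[OF sm] sq(2) by simp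
  thus "x : \<Union>?G" by blast
 qed
 obtain e where e: "e > 0" "ALL x:{0..t}. EX G:?G. ball x e <= G"
  using Heine_Borel_lemma[OF compact_Icc cov op] by metis
 obtain N0 where N0: "t/Suc N0 < e"
  using reals_Archimedean2[of "t/e"] e(1) t
  by(metis Suc_n_not_le_n divide_less_eq le_less_Suc_eq mult.commute not_le of_nat_0_less_iff of_nat_less_iff order_less_trans zero_less_Suc)
 show ?thesis
 proof(intro exI[of _ N0] allI impI)
  fix N i assume N: "N0 <= N" and i: "i < Suc N"
  define ta where "ta = t/Suc N"
  have "ta <= t/Suc N0" unfolding ta_def using N t by(intro divide_left_mono) auto
  hence ta: "0 < ta" "ta < e" using N0 t by(auto simp: ta_def)
  have "real i*ta <= real (Suc N)*ta" using i ta(1) by(intro mult_right_mono) auto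
  also have "... = t" by(simp add: ta_def)
  finally have "real i*ta : {0..t}" using ta(1) by simp
  from e(2)[rule_format, OF this] obtain n where n: "ball (real i*ta) e <= geo w -` cdom (sq n)" by blast
  have "geo (flow (real i*ta) w) s : cdom (sq n)" if s: "s : {0..ta}" for s
  proof -
   have "real i*ta + s : ball (real i*ta) e" using s ta by(simp add: dist_real_def)
   hence "geo w (real i*ta + s) : cdom (sq n)" using n by blast
   moreover have "geo (flow (real i*ta) w) s = geo w (real i*ta + s)"
    using arg_cong[OF flow_add[OF w, of s "real i*ta"], of fst] by(simp add: flow_def[of s] flow_def[of "s + _"] add.commute)
   ultimately show ?thesis by simp
  qed
  hence "flow (real i*ta) w : good (sq n) ta" by(simp add: good_def flow_TM[OF w])
  thus "flow (real i*(t/Suc N)) w : short (t/Suc N)" unfolding short_def ta_def by blast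
 qed
qed

text \<open>How fine the steps must be depends on the vector. \<open>Q m\<close> collects the
  vectors for which all subdivisions from \<open>m\<close> on work. These sets increase to the full
  preimage, and each lies in \<open>R m\<close>, whose measure is already bounded by that of
  \<open>B\<close>.\<close>

lemma flow_pos_preimage:
 assumes t: "0 < t" and B: "B : sets TMs"
 shows "{w : TM. flow t w : B} : sets TMs & em0 Lam {w : TM. flow t w : B} <= em0 Lam B"
proof -
 define R where "R N = iter (t/Suc N) B (Suc N)" for N
 have R: "R N : sets TMs" "em0 Lam (R N) <= em0 Lam B" for N
  unfolding R_def using iter_sets[OF _ B, of "t/Suc N" "Suc N"] t by simp_all
 have RT: "R N <= TM" for N using sets.sets_into_space[OF R(1)] by(simp add: space_TMs)
 have mem: "w : R N \<longleftrightarrow> (ALL i<Suc N. flow (real i*(t/Suc N)) w : short (t/Suc N)) & flow t w : B" if "w : TM" for w N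
  unfolding R_def iter_mem[OF that] by simp
 define Q where "Q m = (\<Inter>N\<in>{m..}. R N)" for m
 have Q: "Q m : sets TMs" for m
  unfolding Q_def by(rule sets.countable_INT') (use R(1) in auto)
 have QR: "Q m <= R m" for m by(auto simp: Q_def)
 have inc: "incseq Q" unfolding incseq_def Q_def by fastforce
 have U: "{w : TM. flow t w : B} = (\<Union>m. Q m)"
 proof
  show "{w : TM. flow t w : B} <= (\<Union>m. Q m)"
  proof
   fix w assume "w : {w : TM. flow t w : B}"
   hence w: "w : TM" "flow t w : B" by auto
   obtain N0 where N0: "\<forall>N\<ge>N0. ALL i<Suc N. flow (real i*(t/Suc N)) w : short (t/Suc N)"
    using eventually_short[OF w(1) t] by(elim exE)
   have "w : R N" if "N \<ge> N0" for N unfolding mem[OF w(1)] using N0 that w(2) by blast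
   hence "w : Q N0" by(simp add: Q_def)
   thus "w : (\<Union>m. Q m)" by blast
  qed
  show "(\<Union>m. Q m) <= {w : TM. flow t w : B}"
  proof
   fix w assume "w : (\<Union>m. Q m)"
   then obtain m where "w : R m" using QR by blast
   thus "w : {w : TM. flow t w : B}" using RT mem by blast
  qed
 qed
 have "em0 Lam (\<Union>m. Q m) = (SUP m. em0 Lam (Q m))"
  by(rule SUP_emeasure_incseq[symmetric]) (use Q inc in \<open>auto simp: sets_Lam\<close>)
 also have "... <= em0 Lam B"
 proof(rule SUP_least)
  fix m
  have "em0 Lam (Q m) <= em0 Lam (R m)" by(rule emeasure_mono[OF QR]) (simp add: sets_Lam R(1))
  thus "em0 Lam (Q m) <= em0 Lam B" using R(2) by(rule order_trans)
 qed
 finally show ?thesis unfolding U using Q by auto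
qed

lemma flip_preimage:
 assumes B: "B : sets TMs"
 shows "{w : TM. flip w : B} : sets TMs" "em0 Lam {w : TM. flip w : B} = em0 Lam B"
proof -
 have rm: "vrefl : bm borel"
  by(intro borel_measurable_continuous_onI Ck_on_continuous[OF vrefl_smooth[of 0]])
 have "{z : Om c. unchart c z : {w : TM. flip w : B}} : sets borel" if c: "c : A" for c
 proof -
  have "{z : Om c. unchart c z : {w : TM. flip w : B}} = vrefl -` {z : Om c. unchart c z : B}"
   using unchart_TM[OF c] unchart_vrefl[OF c] by auto
  moreover have "vrefl -` {z : Om c. unchart c z : B} : sets borel"
   by(rule measurable_sets_borel[OF rm]) (use B c in \<open>simp add: sets_TMs\<close>)
  ultimately show ?thesis by(rule ssubst)
 qed
 thus s: "{w : TM. flip w : B} : sets TMs" by(simp add: sets_TMs)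
 have "em0 Lam {w : TM. flip w : B} = (\<integral>\<^sup>+p. \<integral>\<^sup>+xi. chi {w : TM. flip w : B} (p, fr p xi) \<partial>lborel \<partial>vol)"
  by(rule emeasure_Lam[OF s])
 also have "... = (\<integral>\<^sup>+p. \<integral>\<^sup>+xi. chi B (p, fr p xi) \<partial>lborel \<partial>vol)"
 proof(rule nn_integral_cong)
  fix p assume "p : space vol"
  hence p: "p : car" by(simp add: space_vol)
  have fl: "flip (p, fr p xi) = (p, fr p (- xi))" for xi
   by(auto simp: flip_def linear_neg[OF frame(2)[OF p]])
  have m: "(%xi. chi B (p, fr p xi) :: ennreal) : bm borel"
   using frame_comp_measurable[OF borel_measurable_indicator[OF B] p] by simp
  have "(LB xi. chi {w : TM. flip w : B} (p, fr p xi)) = (LB xi. chi B (p, fr p (- xi)))"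
   using frame(1)[OF p] p by(intro nn_integral_cong) (simp add: indicator_def fl TM_def)
  also have "... = (LB xi. chi B (p, fr p xi))"
  proof -
   have "orthogonal_transformation (uminus :: real^'n => real^'n)"
    by(simp add: orthogonal_transformation_def linear_uminus)
   hence d: "\<bar>det (matrix (uminus :: real^'n => real^'n))\<bar> = 1" by(rule orthogonal_transformation_det)
   thus ?thesis using nn_integral_linear_image[OF linear_uminus _ m] by fastforce
  qed
  finally show "(LB xi. chi {w : TM. flip w : B} (p, fr p xi)) = (LB xi. chi B (p, fr p xi))" .
 qed
 also have "... = em0 Lam B" by(rule emeasure_Lam[OF B, symmetric])
 finally show "em0 Lam {w : TM. flip w : B} = em0 Lam B" .
qed

text \<open>A negative time becomes positive on conjugation with \<open>flip\<close>, which
  preserves the measure.\<close>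

lemma flow_preimage_le:
 assumes B: "B : sets TMs"
 shows "{w : TM. flow t w : B} : sets TMs & em0 Lam {w : TM. flow t w : B} <= em0 Lam B"
proof -
 consider "t = 0" | "0 < t" | "t < 0" by linarith
 thus ?thesis
 proof cases
  case 1
  have "{w : TM. flow t w : B} = B" using 1 flow_0 B by(auto simp: sets_TMs)
  thus ?thesis using B by simp
 next
  case 2
  thus ?thesis by(rule flow_pos_preimage[OF _ B])
 next
  case 3
  let ?F = "%B. {w : TM. flip w : B}" and ?T = "%B. {w : TM. flow (- t) w : B}"
  have "{w : TM. flow t w : B} = ?F (?T (?F B))"
  proof -
   have "flip w : TM & flow (- t) (flip w) : TM & flow t w = flip (flow (- t) (flip w))" if "w : TM" for w
    using flow_flip[OF that, of "- t"] flip_TM[OF that] flow_TM[OF flip_TM[OF that]] by simp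
   thus ?thesis by(simp add: set_eq_iff) metis
  qed
  moreover have 1: "?F B : sets TMs" "em0 Lam (?F B) = em0 Lam B" by(rule flip_preimage[OF B])+
  moreover have 2: "?T (?F B) : sets TMs & em0 Lam (?T (?F B)) <= em0 Lam (?F B)"
   by(rule flow_pos_preimage[OF _ 1(1)]) (use 3 in simp)
  ultimately show ?thesis using flip_preimage[OF 2[THEN conjunct1]] by simp
 qed
qed

lemma flow_measurable: "flow t : measurable TMs TMs"
proof(rule measurableI)
 show "flow t w : space TMs" if "w : space TMs" for w using that flow_TM by(simp add: space_TMs)
 show "flow t -` B Int space TMs : sets TMs" if "B : sets TMs" for B
 proof -
  have "flow t -` B Int space TMs = {w : TM. flow t w : B}" by(auto simp: space_TMs)
  thus ?thesis using flow_preimage_le[OF that] by simp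
 qed
qed

text \<open>The inequality for time \<open>- t\<close>, applied to the preimage of \<open>B\<close>,
  is the reverse of the inequality for time \<open>t\<close>.\<close>

lemma Liouville:
 assumes h: "h : bm TMs"
 shows "(\<integral>\<^sup>+w. h (flow t w) \<partial>Lam) = (\<integral>\<^sup>+w. h w \<partial>Lam)"
proof -
 have fm: "flow t : measurable Lam TMs" by(simp add: measurable_Lam flow_measurable)
 have "distr Lam TMs (flow t) = Lam"
 proof(rule measure_eqI)
  show "sets (distr Lam TMs (flow t)) = sets Lam" by(simp add: sets_Lam)
  fix B assume "B : sets (distr Lam TMs (flow t))"
  hence B: "B : sets TMs" by simp
  let ?P = "%t B. {w : TM. flow t w : B}"
  have "?P (- t) (?P t B) = B"
   using flow_minus[of _ "- t"] flow_TM B by(auto simp: sets_TMs)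
  hence "em0 Lam B <= em0 Lam (?P t B)"
   using flow_preimage_le[of "?P t B" "- t"] flow_preimage_le[OF B, of t] by simp
  moreover have "em0 (distr Lam TMs (flow t)) B = em0 Lam (?P t B)"
   by(subst emeasure_distr[OF fm B]) (auto simp: space_Lam intro!: arg_cong2[where f = em0])
  ultimately show "em0 (distr Lam TMs (flow t)) B = em0 Lam B"
   using flow_preimage_le[OF B, of t] by simp
 qed
 hence "(\<integral>\<^sup>+w. h w \<partial>Lam) = (\<integral>\<^sup>+w. h w \<partial>distr Lam TMs (flow t))" by simp
 also have "... = (\<integral>\<^sup>+w. h (flow t w) \<partial>Lam)" by(rule nn_integral_distr[OF fm]) (use h in simp)
 finally show ?thesis by simp
qed

end

section \<open>Ricci curvature on the tangent bundle and its averages along the flow\<close>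

text \<open>Rounding the time down to multiples of \<open>1/real (Suc N)\<close> gives functions
  with countably many time values, which are jointly measurable and converge by continuity in
  time.\<close>

lemma borel_measurable_caratheodory:
 fixes f :: "real => 'b => real"
 assumes f: "!!t. f t : bm M" and c: "!!w. w : space M ==> cts UNIV (%t. f t w)"
 shows "(%(t, w). f t w) : bm (borel \<Otimes>\<^sub>M M)"
proof(rule borel_measurable_LIMSEQ_real)
 let ?a = "%N t. real_of_int \<lfloor>real (Suc N)*t\<rfloor> / real (Suc N)"
 show "(%z. f (?a N (fst z)) (snd z)) : bm (borel \<Otimes>\<^sub>M M)" for N
 proof(rule measurable_compose_countable[of "%i z. f (real_of_int i/real (Suc N)) (snd z)" _ _ "%z. \<lfloor>real (Suc N)*fst z\<rfloor>"])
  show "(%z. f (real_of_int i/real (Suc N)) (snd z)) : bm (borel \<Otimes>\<^sub>M M)" for i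
   using measurable_comp[OF measurable_snd f] by(simp add: o_def)
  show "(%z. \<lfloor>real (Suc N)*fst z\<rfloor>) : measurable (borel \<Otimes>\<^sub>M M) (count_space UNIV)"
   by measurable
 qed
 fix z assume z: "z : space ((borel :: real measure) \<Otimes>\<^sub>M M)"
 have "(%N. ?a N (fst z)) \<longlonglongrightarrow> fst z"
 proof(rule tendsto_sandwich[of "%N. fst z - 1/real (Suc N)" _ _ "%N. fst z"])
  show "\<forall>\<^sub>F N in sequentially. fst z - 1/real (Suc N) <= ?a N (fst z)"
  proof(rule always_eventually, rule allI)
   fix N
   have "real (Suc N)*fst z - 1 <= real_of_int \<lfloor>real (Suc N)*fst z\<rfloor>" by linarith
   hence "(real (Suc N)*fst z - 1)/real (Suc N) <= ?a N (fst z)" by(rule divide_right_mono) simp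
   thus "fst z - 1/real (Suc N) <= ?a N (fst z)" by(simp add: diff_divide_distrib del: of_nat_Suc)
  qed
  show "\<forall>\<^sub>F N in sequentially. ?a N (fst z) <= fst z"
  proof(rule always_eventually, rule allI)
   fix N
   have "real_of_int \<lfloor>real (Suc N)*fst z\<rfloor> <= real (Suc N)*fst z" by linarith
   hence "?a N (fst z) <= (real (Suc N)*fst z)/real (Suc N)" by(rule divide_right_mono) simp
   thus "?a N (fst z) <= fst z" by(simp del: of_nat_Suc)
  qed
  show "(%N. fst z - 1/real (Suc N)) \<longlonglongrightarrow> fst z"
   using tendsto_diff[OF tendsto_const LIMSEQ_inverse_real_of_nat, of "fst z"] by(simp add: inverse_eq_divide)
 qed simp
 moreover have "isCont (%t. f t (snd z)) (fst z)"
  using c[of "snd z"] z by(simp add: space_pair_measure continuous_on_eq_continuous_at mem_Times_iff)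
 ultimately have "(%N. f (?a N (fst z)) (snd z)) \<longlonglongrightarrow> f (fst z) (snd z)"
  by(rule isCont_tendsto_compose[rotated])
 thus "(%N. f (?a N (fst z)) (snd z)) \<longlonglongrightarrow> (case z of (t, w) => f t w)" by(simp add: case_prod_beta)
qed

context riemannian
begin

definition Ric :: "'a \<times> ('a, 'n) tangent => real" where "Ric w = ricci A g (fst w) (snd w) (snd w)"

definition speed :: "'a \<times> ('a, 'n) tangent => real" where "speed w = sqrt (g (fst w) (snd w) (snd w))"

text \<open>The Ricci curvature is the trace of an endomorphism and may be computed in the
  coordinate basis. This replaces \<open>frame\<close>, a choice without regularity in
  \<open>p\<close>, and shows that \<open>Ric\<close> is smooth in bundle coordinates.\<close>

lemma ricci_trace:
 assumes c: "c : A" and p: "p : cdom c" and v: "v : TS p"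
 shows "ricci A g p v v = (\<Sum>a\<in>UNIV. cc c (cmap c p) (axis a 1) (v c) (v c) $ a)"
proof -
 have pc: "p : car" using p cdom_carrier[OF c] by auto
 have x: "cmap c p : V c" using p by simp
 define e where "e i = fr p (axis i 1)" for i
 have e: "orthonormal p e" unfolding e_def by(rule frame_orthonormal[OF pc])
 note te = orthonormal_tangent[OF e]
 let ?G = "gr c (cmap c p)"
 define M where "M = matrix (%ze. cc c (cmap c p) ze (v c) (v c))"
 have M: "cc c (cmap c p) ze (v c) (v c) = M *v ze" for ze
  unfolding M_def by(rule fun_cong[OF matrix_vector_mul(2)[OF curv_linear(1)[OF c x]], symmetric])
 define L where "L = matrix (%xi. fr p xi c)"
 have L: "L *v xi = fr p xi c" for xi unfolding L_def by(rule fun_cong[OF matrix_vector_mul(2)[OF frame(2)[OF pc]]])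
 have I: "mat 1 = transpose L ** ?G ** L"
  using frame(3)[OF pc] g_coord[OF c p frame(1)[OF pc] frame(1)[OF pc]] by(intro gram_congruence) (simp add: Gm_def L)
 have I2: "L ** (transpose L ** ?G) = mat 1"
  using I matrix_left_right_inverse[of "transpose L ** ?G" L] by simp
 have nn: "axis i 1 dot (N *v axis i 1) = N $ i $ i" for i and N :: "real^'n^'n"
  by(simp add: matrix_vector_mult_basis column_def inner_axis')
 have tv: "xi dot (transpose L *v y) = (L *v xi) dot y" for xi y
  using dot_lmul_matrix[of y L xi] by(simp add: inner_commute)
 have "g p (curv p (e i) v v) (e i) = (transpose L ** ?G ** M ** L) $ i $ i" for i
 proof -
  have "g p (curv p (e i) v v) (e i) = g p (e i) (curv p (e i) v v)"
   by(rule g_sym[OF pc curvature_tangent[OF pc te v v] te])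
  also have "... = (L *v axis i 1) dot (?G *v (M *v (L *v axis i 1)))"
   using g_coord[OF c p te curvature_tangent[OF pc te v v], of i i]
   by(simp add: Gm_def curvature_coord[OF c p] M L e_def)
  also have "... = axis i 1 dot ((transpose L ** ?G ** M ** L) *v axis i 1)"
   by(simp only: tv matrix_vector_mul_assoc[symmetric])
  finally show ?thesis by(simp only: nn)
 qed
 hence "ricci A g p v v = trace (transpose L ** ?G ** M ** L)"
  by(simp add: ricci_orthonormal[OF pc e v] trace_def)
 also have "... = trace (L ** (transpose L ** ?G ** M))" by(rule trace_mul_sym)
 also have "L ** (transpose L ** ?G ** M) = M" using I2 by(metis matrix_mul_assoc matrix_mul_lid)
 finally show ?thesis by(simp add: trace_def M_def matrix_def)
qed

lemma Ric_unchart: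
 assumes c: "c : A" and z: "z : Om c"
 shows "Ric (unchart c z) = (\<Sum>a\<in>UNIV. cc c (lft z) (axis a 1) (rgt z) (rgt z) $ a)"
proof -
 have x: "lft z : V c" using z by(simp add: Om_def)
 show ?thesis
  unfolding Ric_def unchart_def fst_conv snd_conv
  using ricci_trace[OF c cinv_cdom[OF c x] tvec_tangent[OF c cinv_cdom[OF c x]]]
  by(simp add: tvec_coord[OF c cinv_cdom[OF c x]] cmap_cinv[OF c x])
qed

lemma Ric_smooth: "c : A ==> Ck_on k (Om c) (%z. Ric (unchart c z))"
proof -
 assume c: "c : A"
 have "Ck_on k (Om c) (%z. \<Sum>a\<in>UNIV. cc c (lft z) (axis a 1) (rgt z) (rgt z) $ a)"
  by(intro Ck_on_sum Ck_on_nth open_Om[OF c] curv_smooth[OF c] Ck_on_bounded_linear_id bounded_linear_lft bounded_linear_rgt Ck_on_const)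
   (simp add: Om_def)
 thus ?thesis by(rule Ck_on_cong[OF open_Om[OF c]]) (simp add: Ric_unchart[OF c])
qed

lemma speed_unchart: "c : A ==> z : Om c ==> speed (unchart c z) = sqrt (Gm c (lft z) (rgt z) (rgt z))"
 using Gm_tvec[of c "cinv c (lft z)"] cinv_cdom[of c "lft z"] cmap_cinv[of c "lft z"]
 by(simp add: speed_def unchart_def Om_def)

lemma Gm_smooth: "c : A ==> Ck_on k (Om c) (%z. Gm c (lft z) (rgt z) (rgt z))"
 unfolding Gm_def
 by(intro Ck_on_inner Ck_on_mvmult open_Om Ck_on_compose[OF open_Om open_V _ gram_smooth] Ck_on_bounded_linear_id bounded_linear_lft bounded_linear_rgt)
  (auto simp: Om_def)

lemma Ric_measurable: "Ric : bm TMs"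
 by(rule TMs_measurableI) (auto intro: borel_measurable_continuous_on_restrict[OF Ck_on_continuous[OF Ric_smooth[of _ 0]]])

lemma speed_measurable: "speed : bm TMs"
proof(rule TMs_measurableI)
 fix c assume c: "c : A"
 have "cts (Om c) (%z. sqrt (Gm c (lft z) (rgt z) (rgt z)))"
  by(intro continuous_intros Ck_on_continuous[OF Gm_smooth[OF c, of 0]])
 hence "cts (Om c) (%z. speed (unchart c z))"
  by(rule continuous_on_cong[THEN iffD1, OF refl, rotated]) (simp add: speed_unchart[OF c])
 thus "(%z. speed (unchart c z)) : bm (rsp borel (Om c))"
  by(rule borel_measurable_continuous_on_restrict)
qed simp

lemma speed_frame: "p : car ==> speed (p, fr p xi) = norm xi"
 by(simp add: speed_def frame(3) norm_eq_sqrt_inner)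

text \<open>The closed unit ball bundle without the zero vectors, by whose speed one divides. It is
  invariant since the flow preserves the speed.\<close>

definition punctured :: "('a \<times> ('a, 'n) tangent) set" where
 "punctured = {w : TM. 0 < speed w & speed w <= 1}"

lemma punctured_sets: "punctured : sets TMs"
proof -
 have "punctured = {w : space TMs. 0 < speed w & speed w <= 1}" by(simp add: punctured_def space_TMs)
 also have "... : sets TMs" using speed_measurable by measurable
 finally show ?thesis .
qed

lemma nn_integral_punctured:
 assumes F: "F : bm TMs"
 shows "(\<integral>\<^sup>+w. F w*chi punctured w \<partial>Lam)
  = (\<integral>\<^sup>+p. \<integral>\<^sup>+xi. F (p, fr p xi)*chi (cball 0 1 - {0}) xi \<partial>lborel \<partial>vol)"
proof -
 have "(%w. F w*chi punctured w) : bm TMs" using F punctured_sets by simp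
 from nn_integral_Lam[OF this] show ?thesis
  by(simp cong: nn_integral_cong add: space_vol)
   (intro nn_integral_cong, use frame(1) in \<open>auto simp: space_vol punctured_def speed_frame TM_def split: split_indicator\<close>)
qed

definition ballvol :: real where "ballvol = measure lborel (cball 0 1 - {0} :: (real^'n) set)"

lemma emeasure_ball: "em0 lborel (cball 0 1 - {0} :: (real^'n) set) = ennreal ballvol" "0 < ballvol"
proof -
 have b: "bounded (cball 0 1 - {0} :: (real^'n) set)" by(rule bounded_subset[OF bounded_cball]) auto
 have fin: "em0 lborel (cball 0 1 - {0} :: (real^'n) set) < \<infinity>" by(rule emeasure_bounded_finite[OF b])
 thus 1: "em0 lborel (cball 0 1 - {0} :: (real^'n) set) = ennreal ballvol"
  unfolding ballvol_def by(intro emeasure_eq_ennreal_measure) simp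
 have "0 < em0 lborel (ball 0 1 - {0} :: (real^'n) set)"
 proof -
  have "open (ball 0 1 - {0} :: (real^'n) set)" by(intro open_Diff) auto
  moreover have "(1/2) *R axis undefined 1 : (ball 0 1 - {0} :: (real^'n) set)" by(simp add: axis_eq_0_iff)
  ultimately have "em0 lborel (ball 0 1 - {0} :: (real^'n) set) ~= 0"
   by(metis empty_iff open_not_negligible negligible_iff_null_sets null_sets_completionI null_setsI sets_lborel borel_open)
  thus ?thesis by(simp add: zero_less_iff_neq_zero)
 qed
 also have "... <= em0 lborel (cball 0 1 - {0} :: (real^'n) set)" by(rule emeasure_mono) auto
 finally show "0 < ballvol" unfolding 1 by simp
qed

lemma Lam_punctured: "em0 Lam punctured = ennreal ballvol*em0 vol (car)"
proof -
 have "em0 Lam punctured = (\<integral>\<^sup>+w. 1*chi punctured w \<partial>Lam)"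
  using punctured_sets by(simp add: sets_Lam)
 also have "... = (\<integral>\<^sup>+p. \<integral>\<^sup>+xi. 1*chi (cball 0 1 - {0}) xi \<partial>(lborel :: (real^'n) measure) \<partial>vol)"
  by(rule nn_integral_punctured) simp
 also have "... = (\<integral>\<^sup>+p. ennreal ballvol \<partial>vol)" by(simp add: emeasure_ball)
 also have "... = ennreal ballvol*em0 vol (car)" by(simp add: space_vol)
 finally show ?thesis .
qed

end

context complete_riemannian
begin

lemma speed_flow: "w : TM ==> speed (flow t w) = speed w"
 using geodesic_speed[OF geo(1), of w t] geo[of w] by(simp add: speed_def flow_def)

lemma punctured_flow: "w : TM ==> flow t w : punctured \<longleftrightarrow> w : punctured"
 by(simp add: punctured_def speed_flow flow_TM)

lemma flow_chart_continuous:
 assumes w: "w : TM" and f: "!!c. c : A ==> cts (Om c) (%z. f (unchart c z))"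
 shows "cts UNIV (%t. f (flow t w) :: 'b::topological_space)"
proof(rule continuous_at_imp_continuous_on, rule ballI)
 fix t :: real
 note gd = geo(1)[OF w]
 obtain c where c: "c : A" "geo w t : cdom c" using curve_carrier[OF geodesic_curve[OF gd]] by(rule carrierE)
 let ?S = "geo w -` cdom c"
 have oS: "open ?S" by(rule curve_open[OF geodesic_curve[OF gd] c(1)])
 have sc: "cts ?S (state c (geo w))"
  by(rule continuous_at_imp_continuous_on, rule ballI, rule has_vector_derivative_continuous[OF state_deriv[OF gd c(1)]]) simp
 have "cts ?S (%t. f (unchart c (state c (geo w) t)))"
  by(rule continuous_on_compose2[OF f[OF c(1)] sc]) (use state_Om in blast)
 moreover have "unchart c (state c (geo w) s) = flow s w" if "s : ?S" for s
 proof -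
  have "flow s w : tube c" using flow_TM[OF w, of s] that by(simp add: tube_def flow_def)
  from unchart_bchart[OF c(1) this] show ?thesis by(simp add: bchart_def state_def flow_def)
 qed
 ultimately have "cts ?S (%t. f (flow t w))" by(simp cong: continuous_on_cong_simp)
 thus "isCont (%t. f (flow t w)) t" using oS c(2) by(simp add: continuous_on_eq_continuous_at)
qed

lemma Ric_flow_continuous: "w : TM ==> cts UNIV (%t. Ric (flow t w))"
 by(rule flow_chart_continuous) (simp_all add: Ck_on_continuous[OF Ric_smooth[of _ 0]])

text \<open>The substitution \<open>u = |w| t\<close> turns the average of \<open>sin\<^sup>2\<close>-weighted values of \<open>f\<close> along the unit speed geodesic into an
 integral over the flow, whose time slices are handled by Liouville's theorem.\<close>

lemma mean_along_flow:
 fixes f :: "'a \<times> ('a, 'n) tangent => real"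
 assumes fin: "em0 vol (car) < \<infinity>" and f: "f : bm TMs" "!!w. 0 <= f w"
  and fc: "!!w. w : TM ==> cts UNIV (%t. f (flow t w))" and r: "0 < r"
 shows "(%w. ennreal (integral {0..r} (%u. (sin (pi*u/r))\<^sup>2*(f (flow (u/speed w) w)/(speed w)\<^sup>2)))*chi punctured w)
   : bm TMs" (is "?I : _")
  and "(\<integral>\<^sup>+w. ennreal (integral {0..r} (%u. (sin (pi*u/r))\<^sup>2*(f (flow (u/speed w) w)/(speed w)\<^sup>2)))*chi punctured w \<partial>Lam)
  = ennreal (r/2)*(\<integral>\<^sup>+w. ennreal (f w/(speed w)\<^sup>2)*chi punctured w \<partial>Lam)"
proof -
 define L1 where "L1 = density Lam (chi punctured)"
 have ps: "punctured : sets Lam" using punctured_sets by(simp add: sets_Lam)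
 have mL1: "measurable L1 N = measurable TMs N" for N :: "'z measure"
  by(rule measurable_cong_sets) (simp_all add: L1_def sets_Lam)
 have iL1: "(\<integral>\<^sup>+w. h w \<partial>L1) = (\<integral>\<^sup>+w. h w*chi punctured w \<partial>Lam)" if "h : bm TMs" for h
  unfolding L1_def using that ps punctured_sets by(subst nn_integral_density) (simp_all add: measurable_Lam mult.commute)
 have sL1: "space L1 = TM" by(simp add: L1_def space_Lam)
 have "em0 L1 (space L1) = em0 Lam punctured"
  using ps sets.sets_into_space[OF ps] by(simp add: L1_def emeasure_density Int_absorb1)
 also have "... < \<infinity>" unfolding Lam_punctured using fin by(simp add: ennreal_mult_less_top)
 finally interpret L1: finite_measure L1 by(intro finite_measureI) auto
 interpret P: pair_sigma_finite lborel L1 ..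
 \<comment> \<open>The weight after the substitution: \<open>u\<close> in \<open>{0..r}\<close>
   corresponds to \<open>t * s \<le> r\<close>. One factor \<open>1/s\<close> of
   \<open>1/s\<^sup>2\<close> is the Jacobian, the other stays in \<open>q\<close>. As
   \<open>q\<close> depends on the vector through its speed alone, it is constant along orbits, and
   Liouville's theorem applies to each \<open>t\<close> separately.\<close>
 define q where "q t s = (if 0 <= t & t * s <= r then (sin (pi * s*t/r))\<^sup>2/s else 0)" for t s :: real
 define H where "H t w = ennreal (q t (speed w)*f (flow t w))" for t w
 define h where "h t w = ennreal (q t (speed w)*f w)" for t w
 have qm: "(%z. q (fst z) (speed (snd z))) : bm (borel \<Otimes>\<^sub>M TMs)"
  unfolding q_def using speed_measurable by measurable
 have fm: "(%z. f (flow (fst z) (snd z))) : bm (borel \<Otimes>\<^sub>M TMs)"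
  using borel_measurable_caratheodory[of "%t w. f (flow t w)" TMs] measurable_comp[OF flow_measurable f(1)] fc
  by(simp add: o_def space_TMs case_prod_beta')
 have fm2: "(%z. f (snd z)) : bm ((borel :: real measure) \<Otimes>\<^sub>M TMs)"
  using measurable_comp[OF measurable_snd f(1)] by(simp add: o_def)
 have sp: "sets (lborel \<Otimes>\<^sub>M L1) = sets (borel \<Otimes>\<^sub>M TMs)"
  by(rule sets_pair_measure_cong) (simp_all add: L1_def sets_Lam)
 have Hm: "(%(t, w). H t w) : bm (lborel \<Otimes>\<^sub>M L1)" "(%(t, w). h t w) : bm (lborel \<Otimes>\<^sub>M L1)"
  unfolding H_def h_def measurable_cong_sets[OF sp refl] case_prod_beta' using qm fm fm2 by measurable
 have slice: "(\<integral>\<^sup>+w. H t w \<partial>L1) = (\<integral>\<^sup>+w. h t w \<partial>L1)" for t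
 proof -
  have qt: "(%w. q t (speed w)) : bm TMs" unfolding q_def using speed_measurable by measurable
  have hm: "h t : bm TMs" unfolding h_def using qt f(1) by measurable
  have Ht: "H t w = h t (flow t w)" if "w : TM" for w using that by(simp add: H_def h_def speed_flow)
  have Hm': "H t : bm TMs"
   using measurable_comp[OF flow_measurable hm, of t] by(rule measurable_cong[THEN iffD1, rotated]) (simp add: Ht space_TMs)
  have "(\<integral>\<^sup>+w. H t w \<partial>L1) = (\<integral>\<^sup>+w. h t (flow t w)*chi punctured (flow t w) \<partial>Lam)"
   unfolding iL1[OF Hm'] by(rule nn_integral_cong) (simp add: space_Lam Ht indicator_def punctured_flow)
  also have "... = (\<integral>\<^sup>+w. h t w*chi punctured w \<partial>Lam)"
   by(rule Liouville) (use hm punctured_sets in simp)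
  finally show ?thesis unfolding iL1[OF hm] .
 qed
 \<comment> \<open>Used twice: with the values of \<open>f\<close> along an orbit, and with the
   constant \<open>f w\<close>, where the integral of the squared sine evaluates to
   \<open>r/2\<close>.\<close>
 have inner: "(LB t. ennreal (q t s*ph t)) = ennreal (integral {0..r} (%u. (sin (pi*u/r))\<^sup>2*(ph (u/s)/s\<^sup>2)))"
  if s: "0 < s" and phi: "cts UNIV ph" "!!t. 0 <= ph t" for s and ph :: "real => real"
 proof -
  let ?k = "%u. (sin (pi*u/r))\<^sup>2*(ph (u/s)/s\<^sup>2)"
  have qs: "(%t. q t s) : bm borel" unfolding q_def by measurable
  have pm: "ph : bm borel" by(rule borel_measurable_continuous_onI[OF phi(1)])
  have "(LB t. ennreal (q t s*ph t)) = ennreal \<bar>1/s\<bar> * (LB u. ennreal (q (0 + 1/s*u) s*ph (0 + 1/s*u)))"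
   by(rule nn_integral_real_affine) (use qs pm s in \<open>simp_all\<close>)
  also have "... = (LB u. ennreal \<bar>1/s\<bar> * ennreal (q (0 + 1/s*u) s*ph (0 + 1/s*u)))"
   using qs pm by(intro nn_integral_cmult[symmetric]) simp
  also have "... = (LB u. ennreal (?k u)*chi {0..r} u)"
  proof(rule nn_integral_cong)
   fix u
   have "ennreal \<bar>1/s\<bar> * ennreal (q (u/s) s*ph (u/s)) = ennreal (1/s*(q (u/s) s*ph (u/s)))"
    using s by(subst ennreal_mult'[symmetric]) simp_all
   moreover have "1/s*(q (u/s) s*ph (u/s)) = (if u : {0..r} then ?k u else 0)"
    using s by(simp add: q_def field_simps power2_eq_square)
   ultimately show "ennreal \<bar>1/s\<bar> * ennreal (q (0 + 1/s*u) s*ph (0 + 1/s*u)) = ennreal (?k u)*chi {0..r} u"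
    by(simp split: split_indicator)
  qed
  also have "... = ennreal (integral {0..r} ?k)"
  proof -
   have "cts {0..r} ?k"
    using s r by(intro continuous_intros continuous_on_compose2[OF phi(1)]) auto
   hence "(?k has_integral integral {0..r} ?k) {0..r}"
    by(intro integrable_integral integrable_continuous_real)
   thus ?thesis
    by(intro nn_integral_has_integral_lebesgue'[where \<Omega> = "{0..r}" and f = ?k]) (use phi(2) in auto)
  qed
  finally show ?thesis .
 qed
 have HI: "?I w = (LB t. H t w)*chi punctured w" if w: "w : TM" for w
  using inner[of "speed w" "%t. f (flow t w)"] fc[OF w] f(2) by(simp add: H_def punctured_def split: split_indicator)
 have Hint: "(%w. \<integral>\<^sup>+t. H t w \<partial>lborel) : bm TMs"
 proof -
  have "(%w. \<integral>\<^sup>+t. H t w \<partial>lborel) : bm L1"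
   using lborel.borel_measurable_nn_integral[of "%w t. H t w" L1] measurable_pair_swap[OF Hm(1)] by simp
  thus ?thesis by(simp add: mL1)
 qed
 hence "(%w. (LB t. H t w)*chi punctured w) : bm TMs" using punctured_sets by simp
 thus "?I : bm TMs"
  by(rule measurable_cong[THEN iffD1, rotated]) (simp only: HI space_TMs)
 have "(\<integral>\<^sup>+w. ?I w \<partial>Lam) = (\<integral>\<^sup>+w. (LB t. H t w)*chi punctured w \<partial>Lam)"
  by(rule nn_integral_cong) (simp only: space_Lam HI)
 also have "... = (\<integral>\<^sup>+w. \<integral>\<^sup>+t. H t w \<partial>lborel \<partial>L1)"
  by(rule iL1[symmetric, OF Hint])
 also have "... = (LB t. \<integral>\<^sup>+w. H t w \<partial>L1)" by(rule P.Fubini'[OF Hm(1)])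
 also have "... = (LB t. \<integral>\<^sup>+w. h t w \<partial>L1)" by(simp add: slice)
 also have "... = (\<integral>\<^sup>+w. \<integral>\<^sup>+t. h t w \<partial>lborel \<partial>L1)" by(rule P.Fubini'[OF Hm(2), symmetric])
 also have "... = (\<integral>\<^sup>+w. (LB t. h t w)*chi punctured w \<partial>Lam)"
 proof(rule iL1)
  have "(%w. \<integral>\<^sup>+t. h t w \<partial>lborel) : bm L1"
   using lborel.borel_measurable_nn_integral[of "%w t. h t w" L1] measurable_pair_swap[OF Hm(2)] by simp
  thus "(%w. \<integral>\<^sup>+t. h t w \<partial>lborel) : bm TMs" by(simp add: mL1)
 qed
 also have "... = (\<integral>\<^sup>+w. ennreal (r/2)*(ennreal (f w/(speed w)\<^sup>2)*chi punctured w) \<partial>Lam)"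
 proof(rule nn_integral_cong)
  fix w
  have "(LB t. h t w) = ennreal (r/2)*ennreal (f w/(speed w)\<^sup>2)" if w: "w : punctured"
  proof -
   have "(LB t. h t w) = ennreal (integral {0..r} (%u. (sin (pi*u/r))\<^sup>2*(f w/(speed w)\<^sup>2)))"
    unfolding h_def by(rule inner) (use w f(2) in \<open>auto simp: punctured_def\<close>)
   also have "integral {0..r} (%u. (sin (pi*u/r))\<^sup>2*(f w/(speed w)\<^sup>2)) = r/2*(f w/(speed w)\<^sup>2)"
    using has_integral_mult_left[OF integral_cos_squared(2)[OF r], of "f w/(speed w)\<^sup>2"] by(rule integral_unique)
   finally show ?thesis using r by(simp only: ennreal_mult'[of "r/2"] less_imp_le half_gt_zero)
  qed
  thus "(LB t. h t w)*chi punctured w = ennreal (r/2)*(ennreal (f w/(speed w)\<^sup>2)*chi punctured w)"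
   by(simp split: split_indicator)
 qed
 also have "... = ennreal (r/2)*(\<integral>\<^sup>+w. ennreal (f w/(speed w)\<^sup>2)*chi punctured w \<partial>Lam)"
  by(rule nn_integral_cmult) (use f(1) speed_measurable punctured_sets in \<open>simp add: measurable_Lam\<close>)
 finally show "(\<integral>\<^sup>+w. ?I w \<partial>Lam) = ennreal (r/2)*(\<integral>\<^sup>+w. ennreal (f w/(speed w)\<^sup>2)*chi punctured w \<partial>Lam)" .
qed

end

section \<open>Quadratic moments of the ball and the measure on the unit sphere bundle\<close>

lemma distr_orthogonal_transformation:
 fixes L :: "real^'n::finite => real^'n"
 assumes L: "orthogonal_transformation L"
 shows "distr lborel borel L = lborel"
proof(rule measure_eqI)
 have lin: "linear L" by(rule orthogonal_transformation_linear[OF L])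
 hence Lm: "L : bm lborel"
  by(simp add: borel_measurable_continuous_onI linear_continuous_on linear_conv_bounded_linear)
 fix X assume "X : sets (distr lborel borel L)"
 hence X: "X : sets borel" by simp
 have d: "\<bar>det (matrix L)\<bar> = 1" by(rule orthogonal_transformation_det[OF L])
 hence nz: "det (matrix L) ~= 0" by auto
 have "em0 (distr lborel borel L) X = (\<integral>\<^sup>+x. chi X x \<partial>distr lborel borel L)" using X by simp
 also have "... = (LB x. chi X (L x))" by(rule nn_integral_distr[OF Lm]) (use X in simp)
 also have "... = (LB x. chi X x)"
  using nn_integral_linear_image[OF lin nz, of "chi X"] X d by simp
 finally show "em0 (distr lborel borel L) X = em0 lborel X" using X by simp
qed simp

definition ball_quotient :: "'n => 'n => real^'n::finite => real" where
 "ball_quotient i j xi = chi (cball 0 1 - {0}) xi*(xi $ i*xi $ j/(norm xi)\<^sup>2)"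

text \<open>Orthogonal invariance of Lebesgue measure. Reflecting one coordinate changes the sign of
  the mixed moments; exchanging two coordinates shows that the diagonal ones are equal, and they add
  up to the volume because the quotients add up to 1.\<close>

lemma ball_moments:
 fixes i j :: "'n::finite"
 shows "integrable lborel (ball_quotient i j)"
  and "integral\<^sup>L lborel (ball_quotient i j) = (if i = j then measure lborel (cball 0 1 - {0} :: (real^'n) set)/CARD('n) else 0)"
proof -
 let ?q = "ball_quotient :: 'n => 'n => real^'n => real"
 note q_def = ball_quotient_def
 let ?B = "cball 0 1 - {0} :: (real^'n) set"
 have fin: "em0 lborel ?B < \<infinity>" by(rule emeasure_bounded_finite) (rule bounded_subset[OF bounded_cball], auto)
 have ind: "integrable lborel (chi ?B :: _ => real)"
  using fin by(intro integrable_real_indicator) auto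
 have qm: "?q i j : bm borel" for i j unfolding q_def[abs_def]
  by(intro borel_measurable_times borel_measurable_indicator borel_measurable_divide borel_measurable_power borel_measurable_norm
   borel_measurable_continuous_onI continuous_intros) simp
 have int: "integrable lborel (?q i j)" for i j
 proof(rule Bochner_Integration.integrable_bound[OF ind])
  show "?q i j : bm lborel" using qm by simp
  have "norm (?q i j xi) <= norm (chi ?B xi :: real)" for xi
  proof(cases "xi : ?B")
   case True
   hence p: "0 < norm xi" by simp
   have "\<bar>xi $ i*xi $ j\<bar> <= norm xi*norm xi"
    unfolding abs_mult by(intro mult_mono component_le_norm_cart) auto
   hence "\<bar>xi $ i*xi $ j/(norm xi)\<^sup>2\<bar> <= 1" using p by(simp add: abs_divide power2_eq_square)
   thus ?thesis using True by(simp add: q_def)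
  qed (simp add: q_def)
  thus "AE xi in lborel. norm (?q i j xi) <= norm (chi ?B xi :: real)" by simp
 qed
 thus "integrable lborel (?q i j)" .
 have inv: "integral\<^sup>L lborel (?q i j) = integral\<^sup>L lborel (%xi. ?q i j (L xi))" if L: "orthogonal_transformation L" for L :: "real^'n => real^'n" and i j
 proof -
  have "L : bm lborel"
   using orthogonal_transformation_linear[OF L] by(simp add: borel_measurable_continuous_onI linear_continuous_on linear_conv_bounded_linear)
  from integral_distr[OF this qm[of i j]] show ?thesis by(simp add: distr_orthogonal_transformation[OF L])
 qed
 have wL: "chi ?B (L xi) = (chi ?B xi :: real) & norm (L xi) = norm xi"
  if L: "orthogonal_transformation L" for L :: "real^'n => real^'n" and xi
  using orthogonal_transformation_norm[OF L, of xi] by(simp add: indicator_def) (metis norm_eq_zero)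
 have off: "integral\<^sup>L lborel (?q i j) = 0" if ij: "i ~= j" for i j
 proof -
  let ?L = "%xi :: real^'n. \<chi> k. if k = i then - xi $ k else xi $ k"
  have L: "orthogonal_transformation ?L"
   unfolding orthogonal_transformation_def
   by(auto simp: linear_iff vec_eq_iff inner_vec_def intro!: sum.cong)
  have "?q i j (?L xi) = - ?q i j xi" for xi using wL[OF L, of xi] ij by(simp add: q_def)
  hence "integral\<^sup>L lborel (?q i j) = - integral\<^sup>L lborel (?q i j)" using inv[OF L, of i j] by simp
  thus ?thesis by simp
 qed
 have eq: "integral\<^sup>L lborel (?q i i) = integral\<^sup>L lborel (?q j j)" for i j
 proof -
  let ?p = "%k. if k = i then j else if k = j then i else k"
  let ?L = "%xi :: real^'n. \<chi> k. xi $ ?p k"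
  have pp: "bij ?p" by(rule involuntory_imp_bij) simp
  have L: "orthogonal_transformation ?L"
   unfolding orthogonal_transformation_def
  proof(intro conjI allI)
   show "linear ?L" by(simp add: linear_iff vec_eq_iff)
   fix v w :: "real^'n"
   show "?L v dot ?L w = v dot w"
    unfolding inner_vec_def vec_lambda_beta
    by(rule sum.reindex_bij_betw[of ?p UNIV UNIV "%k. v $ k dot w $ k"]) (rule pp)
  qed
  have "?q i i (?L xi) = ?q j j xi" for xi using wL[OF L, of xi] by(simp add: q_def)
  thus ?thesis using inv[OF L, of i i] by simp
 qed
 have "(\<Sum>k\<in>UNIV. integral\<^sup>L lborel (?q k k)) = integral\<^sup>L lborel (%xi. \<Sum>k\<in>UNIV. ?q k k xi)"
  by(rule Bochner_Integration.integral_sum[symmetric]) (rule int)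
 also have "(%xi. \<Sum>k\<in>UNIV. ?q k k xi) = chi ?B"
 proof
  fix xi :: "real^'n"
  have "(norm xi)\<^sup>2 = (\<Sum>k\<in>UNIV. xi $ k*xi $ k)" by(simp add: power2_norm_eq_inner inner_vec_def)
  hence "(\<Sum>k\<in>UNIV. ?q k k xi) = chi ?B xi*((norm xi)\<^sup>2/(norm xi)\<^sup>2)"
   by(simp only: q_def sum_distrib_left[symmetric] sum_divide_distrib[symmetric])
  thus "(\<Sum>k\<in>UNIV. ?q k k xi) = chi ?B xi" by(simp split: split_indicator)
 qed
 also have "integral\<^sup>L lborel (chi ?B) = measure lborel ?B" by simp
 finally have "(\<Sum>k\<in>UNIV. integral\<^sup>L lborel (?q k k)) = measure lborel ?B" .
 moreover have "(\<Sum>k\<in>(UNIV :: 'n set). integral\<^sup>L lborel (?q k k)) = (\<Sum>k\<in>(UNIV :: 'n set). integral\<^sup>L lborel (?q i i))"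
  by(intro sum.cong refl eq)
 ultimately have "real CARD('n)*integral\<^sup>L lborel (?q i i) = measure lborel ?B" by simp
 thus "integral\<^sup>L lborel (?q i j) = (if i = j then measure lborel ?B/CARD('n) else 0)"
  using off by(auto simp: field_simps)
qed

lemma continuous_on_join: "cts S (%(x, v). join x v :: real^('n::finite + 'n))"
proof -
 have "cts S (%z::(real^'n) \<times> (real^'n). join (fst z) 0 + join 0 (snd z))"
  by(intro continuous_on_add linear_continuous_on_compose[OF _ bounded_linear.linear[OF bounded_linear_join(1)]]
   linear_continuous_on_compose[OF _ bounded_linear.linear[OF bounded_linear_join(2)]] continuous_intros)
 thus ?thesis by(simp only: join_add[symmetric] case_prod_beta')
qed

context riemannian
begin

lemma Ric_scale:
 assumes w: "(p, v) : TM" shows "Ric (p, %c. a *R v c) = a\<^sup>2 * Ric (p, v)"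
proof -
 have p: "p : car" "v : TS p" using w by(auto simp: TM_def)
 obtain c where c: "c : A" "p : cdom c" using p(1) by(rule carrierE)
 have x: "cmap c p : V c" using c(2) by simp
 show ?thesis
  using ricci_trace[OF c p(2)] ricci_trace[OF c tangent_scale[OF p(2), of a]]
  by(simp add: Ric_def linear_scale[OF curv_linear(2)[OF c(1) x]] linear_scale[OF curv_linear(3)[OF c(1) x]]
   sum_distrib_left power2_eq_square mult.assoc)
qed

lemma speed_scale: 
 assumes w: "(p, v) : TM" shows "speed (p, %c. a *R v c) = \<bar>a\<bar> * speed (p, v)"
proof -
 have p: "p : car" "v : TS p" using w by(auto simp: TM_def)
 note s = tangent_scale[OF p(2), of a]
 have "g p (%c. a *R v c) (%c. a *R v c) = a\<^sup>2*g p v v"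
  using g_scale[OF p(1,2) s, of a] g_sym[OF p(1,2) s] g_scale[OF p(1,2,2), of a] by(simp add: power2_eq_square)
 thus ?thesis by(simp add: speed_def real_sqrt_mult)
qed

lemma ricci_frame_bilinear:
 assumes p: "p : car"
 shows "bilinear (%xi eta. ricci A g p (fr p xi) (fr p eta))"
proof -
 obtain c where c: "c : A" "p : cdom c" using p by(rule carrierE)
 have x: "cmap c p : V c" using c(2) by simp
 let ?e = "%i. fr p (axis i 1)"
 note cl = curv_linear[OF c(1) x]
 have eq: "ricci A g p (fr p xi) (fr p eta) =
  (\<Sum>i\<in>UNIV. Gm c (cmap c p) (cc c (cmap c p) (?e i c) (fr p xi c) (fr p eta c)) (?e i c))" for xi eta
  unfolding ricci_def
  by(intro sum.cong refl) (simp add: g_coord[OF c curvature_tangent[OF p frame(1)[OF p] frame(1)[OF p] frame(1)[OF p]] frame(1)[OF p]] curvature_coord[OF c])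
 have Gl: "linear (%ze. Gm c (cmap c p) ze eta)" for eta using Gm_bilinear by(simp add: bilinear_def)
 show ?thesis
  unfolding bilinear_def eq
  by(auto simp: linear_iff linear_add[OF frame(2)[OF p]] linear_scale[OF frame(2)[OF p]] linear_add[OF cl(2)] linear_scale[OF cl(2)]
   linear_add[OF cl(3)] linear_scale[OF cl(3)] linear_add[OF Gl] linear_scale[OF Gl] sum.distrib sum_distrib_left)
qed

text \<open>The mean of a quadratic form over directions is its trace divided by \<open>n\<close>;
  the trace of the Ricci form is the scalar curvature.\<close>

lemma fibre_scalar:
 assumes p: "p : car"
 defines "f \<equiv> %xi. chi (cball 0 1 - {0}) xi*(Ric (p, fr p xi)/(norm xi)\<^sup>2) :: real"
 shows "integrable lborel f" "integral\<^sup>L lborel f = ballvol/CARD('n) * scalar_curvature A g p"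
proof -
 let ?b = "%xi eta. ricci A g p (fr p xi) (fr p eta)"
 let ?q = "ball_quotient :: 'n => 'n => real^'n => real"
 have B: "(\<Sum>b\<in>Basis. h b) = (\<Sum>i\<in>UNIV. h (axis i 1))" for h :: "real^'n => real"
 proof -
  have B: "(Basis :: (real^'n) set) = (%i. axis i 1) ` UNIV" by(auto simp: Basis_vec_def)
  show ?thesis unfolding B by(subst sum.reindex) (auto simp: inj_on_def axis_eq_axis)
 qed
 have ex: "Ric (p, fr p xi) = (\<Sum>i\<in>UNIV. \<Sum>j\<in>UNIV. (xi $ i*xi $ j)*?b (axis i 1) (axis j 1))" for xi
  using bilinear_expand[OF ricci_frame_bilinear[OF p], of xi xi] by(simp add: Ric_def B inner_axis)
 have f: "f = (%xi. \<Sum>i\<in>UNIV. \<Sum>j\<in>UNIV. ?q i j xi*?b (axis i 1) (axis j 1))"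
  unfolding f_def ex by(simp add: fun_eq_iff ball_quotient_def sum_distrib_left sum_divide_distrib mult.assoc)
 show "integrable lborel f"
  unfolding f by(intro Bochner_Integration.integrable_sum integrable_mult_left ball_moments(1))
 have "integral\<^sup>L lborel f = (\<Sum>i\<in>UNIV. \<Sum>j\<in>UNIV. integral\<^sup>L lborel (?q i j)*?b (axis i 1) (axis j 1))"
  unfolding f
  by(simp add: Bochner_Integration.integral_sum integrable_mult_left ball_moments(1))
 also have "... = (\<Sum>i\<in>UNIV. \<Sum>j\<in>UNIV. (if i = j then ballvol/CARD('n) else 0)*?b (axis i 1) (axis j 1))"
  unfolding ball_moments(2) ballvol_def ..
 also have "... = ballvol/CARD('n) * scalar_curvature A g p"
  by(simp add: scalar_curvature_def if_distrib[of "%x. x*_"] sum_distrib_left cong: if_cong)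
 finally show "integral\<^sup>L lborel f = ballvol/CARD('n) * scalar_curvature A g p" .
qed

definition nz :: "'a \<times> ('a, 'n) tangent => 'a \<times> ('a, 'n) tangent" where
 "nz w = (fst w, %c. snd w c /\<^sub>R speed w)"

lemma nz_TM: "w : TM ==> nz w : TM"
 using tangent_scale[of "snd w" "fst w"] by(auto simp: TM_def nz_def)

lemma nz_speed: "w : punctured ==> speed (nz w) = 1"
 using speed_scale[of "fst w" "snd w"] by(simp add: nz_def punctured_def)

lemma Ric_nz: "w : TM ==> Ric (nz w) = Ric w/(speed w)\<^sup>2"
 using Ric_scale[of "fst w" "snd w"] by(simp add: nz_def power_inverse field_simps)

lemma nz_measurable: "nz : measurable TMs TMs"
proof(rule TMs_measurableI)
 show "nz w : space TMs" if "w : TM" for w using nz_TM[OF that] by(simp add: space_TMs)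
 fix c assume c: "c : A"
 let ?k = "%z. join (lft z) (rgt z /\<^sub>R speed (unchart c z))"
 have sm: "(%z. speed (unchart c z)) : bm (rsp borel (Om c))"
  using measurable_comp[OF unchart_measurable[OF c] speed_measurable] by(simp add: o_def)
 have lr: "lft : bm (rsp borel (Om c))" "rgt : bm (rsp borel (Om c))"
  by(intro measurable_restrict_space1 borel_measurable_continuous_onI linear_continuous_on bounded_linear_lft bounded_linear_rgt)+
 have "(%z. (lft z, rgt z /\<^sub>R speed (unchart c z))) : measurable (rsp borel (Om c)) (borel \<Otimes>\<^sub>M borel)"
  using sm lr by measurable
 from measurable_comp[OF this join_measurable]
 have "?k : measurable (rsp borel (Om c)) (rsp borel (Om c))"
  by(intro measurable_restrict_space2) (auto simp: o_def space_restrict_space Om_def)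
 from measurable_comp[OF this unchart_measurable[OF c]]
 have "(%z. unchart c (?k z)) : measurable (rsp borel (Om c)) TMs" by(simp add: o_def)
 moreover have "nz (unchart c z) = unchart c (?k z)" if z: "z : space (rsp borel (Om c))" for z
 proof -
  have x: "lft z : V c" using z by(simp add: space_restrict_space Om_def)
  have "T1 c d (lft z) (rgt z /\<^sub>R a) = T1 c d (lft z) (rgt z) /\<^sub>R a" if "d : A" "cinv c (lft z) : cdom d" for d a
   by(rule linear_scale[OF T1_linear[OF c that(1)]]) (use W_iff[OF c, of "lft z" d] x that in simp)
  thus ?thesis by(auto simp: unchart_def nz_def tvec_T1 cmap_cinv[OF c x])
 qed
 ultimately show "(%z. nz (unchart c z)) : measurable (rsp borel (Om c)) TMs"
  by(simp cong: measurable_cong)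
qed

abbreviation SB :: "('a \<times> ('a, 'n) tangent) set" where "SB \<equiv> unit_sphere_bundle A g"

lemma SB_speed: "w : SB \<longleftrightarrow> w : TM & speed w = 1"
 by(auto simp: unit_sphere_bundle_def TM_def speed_def)

lemma SB_sets: "SB : sets TMs"
proof -
 have "SB = {w : space TMs. speed w = 1}" by(auto simp: SB_speed space_TMs)
 also have "... : sets TMs" using speed_measurable by measurable
 finally show ?thesis .
qed

abbreviation SBgen :: "('a \<times> ('a, 'n) tangent) set set" where
 "SBgen \<equiv> {{(p, v) : SB. p : cdom c & (cmap c p, v c) : W} | c W. c : A & open W}"

lemma SBgen_sets: "SBgen <= sets (rsp TMs SB)"
proof
 fix X assume "X : SBgen"
 then obtain c W where c: "c : A" and W: "open W" and X: "X = {(p, v) : SB. p : cdom c & (cmap c p, v c) : W}" by auto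
 let ?E = "(%z. (lft z, rgt z)) -` W"
 have "open ?E"
  by(intro open_vimage W continuous_on_Pair linear_continuous_on bounded_linear_lft bounded_linear_rgt)
 hence "{w : tube c. bchart c w : ?E} : sets TMs" by(intro tube_sets_preimage[OF c]) simp
 moreover have "X = SB Int {w : tube c. bchart c w : ?E}"
  unfolding X by(auto simp: SB_speed tube_def bchart_def)
 ultimately show "X : sets (rsp TMs SB)" by(auto simp: sets_restrict_space)
qed

text \<open>The sphere bundle measure as the image of Liouville measure under radial projection. The
  factor is that of \<open>sphere_measure\<close>: a cone in the unit ball has \<open>1/n\<close>
  times the area of its base on the sphere.\<close>

definition SM :: "('a \<times> ('a, 'n) tangent) measure" where
 "SM = scale_measure (of_nat CARD('n)) (distr (rsp Lam punctured) (rsp TMs SB) nz)"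

lemma nz_measurable': "nz : measurable (rsp Lam punctured) (rsp TMs SB)"
proof(rule measurable_restrict_space2)
 show "nz : space (rsp Lam punctured) \<rightarrow> SB"
  using nz_TM nz_speed by(auto simp: space_restrict_space SB_speed space_Lam)
 show "nz : measurable (rsp Lam punctured) TMs"
  by(rule measurable_restrict_space1) (simp add: measurable_Lam nz_measurable)
qed

lemma sgn_measurable: "sgn : measurable (rsp lborel (cball 0 1 - {0} :: (real^'n) set)) (rsp borel (sphere 0 1))"
proof(rule measurable_restrict_space2)
 show "sgn : space (rsp lborel (cball 0 1 - {0} :: (real^'n) set)) \<rightarrow> sphere 0 1"
  by(auto simp: space_restrict_space norm_sgn)
 have "(%x :: real^'n. x /\<^sub>R norm x) : bm lborel" by measurable
 thus "sgn : bm (rsp lborel (cball 0 1 - {0} :: (real^'n) set))"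
  by(intro measurable_restrict_space1) (simp add: sgn_div_norm[abs_def])
qed

lemma emeasure_sphere_measure:
 assumes X: "X : sets (rsp borel (sphere 0 1))"
 shows "em0 (sphere_measure :: (real^'n) measure) X = of_nat CARD('n)*(LB xi. chi X (sgn xi)*chi (cball 0 1 - {0}) xi)"
proof -
 let ?B = "cball 0 1 - {0} :: (real^'n) set"
 have "em0 (distr (rsp lborel ?B) (rsp borel (sphere 0 1)) sgn) X
  = (\<integral>\<^sup>+x. chi X x \<partial>distr (rsp lborel ?B) (rsp borel (sphere 0 1)) sgn)"
  using X by simp
 also have "... = (\<integral>\<^sup>+xi. chi X (sgn xi) \<partial>rsp lborel ?B)"
  by(rule nn_integral_distr[OF sgn_measurable]) (use X in simp)
 also have "... = (LB xi. chi X (sgn xi)*chi ?B xi)"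
  by(rule nn_integral_restrict_space) simp
 finally show ?thesis by(simp add: sphere_measure_def)
qed

lemma emeasure_SM:
 assumes B: "B : sets (rsp TMs SB)"
 shows "em0 SM B = (\<integral>\<^sup>+p. em0 sphere_measure {xi : sphere 0 1. (p, fr p xi) : B} \<partial>vol)"
proof -
 have Bs: "B <= SB" "B : sets TMs" using B SB_sets by(auto simp: sets_restrict_space_iff)
 have ps: "punctured : sets Lam" using punctured_sets by(simp add: sets_Lam)
 have im: "(%w. chi B (nz w) :: ennreal) : bm TMs"
  using measurable_comp[OF nz_measurable borel_measurable_indicator[OF Bs(2)]] by(simp add: o_def)
 have fm: "(%p. \<integral>\<^sup>+xi. (chi B (nz (p, fr p xi))*chi punctured (p, fr p xi)) \<partial>lborel) : bm vol"
  by(rule fibre_measurable_vol) (use im punctured_sets in simp)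
 have feq: "(LB xi. chi B (nz (p, fr p xi))*chi (cball 0 1 - {0}) xi)
   = (LB xi. (chi B (nz (p, fr p xi))*chi punctured (p, fr p xi)))" if "p : space vol" for p
  using that frame(1) by(intro nn_integral_cong) (auto simp: space_vol punctured_def speed_frame TM_def split: split_indicator)
 have "em0 (distr (rsp Lam punctured) (rsp TMs SB) nz) B
  = (\<integral>\<^sup>+x. chi B x \<partial>distr (rsp Lam punctured) (rsp TMs SB) nz)" using B by simp
 also have "... = (\<integral>\<^sup>+w. chi B (nz w) \<partial>rsp Lam punctured)"
  by(rule nn_integral_distr[OF nz_measurable']) (use B in simp)
 also have "... = (\<integral>\<^sup>+w. chi B (nz w)*chi punctured w \<partial>Lam)"
  by(rule nn_integral_restrict_space) (use ps in simp)
 also have "... = (\<integral>\<^sup>+p. \<integral>\<^sup>+xi. chi B (nz (p, fr p xi))*chi (cball 0 1 - {0}) xi \<partial>lborel \<partial>vol)"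
  by(rule nn_integral_punctured[OF im])
 finally have "em0 SM B = of_nat CARD('n)*(\<integral>\<^sup>+p. \<integral>\<^sup>+xi. chi B (nz (p, fr p xi))*chi (cball 0 1 - {0}) xi \<partial>lborel \<partial>vol)"
  by(simp add: SM_def)
 also have "... = (\<integral>\<^sup>+p. of_nat CARD('n)*(LB xi. chi B (nz (p, fr p xi))*chi (cball 0 1 - {0}) xi) \<partial>vol)"
  using fm by(intro nn_integral_cmult[symmetric]) (simp add: feq cong: measurable_cong)
 also have "... = (\<integral>\<^sup>+p. em0 sphere_measure {xi : sphere 0 1. (p, fr p xi) : B} \<partial>vol)"
 proof(rule nn_integral_cong)
  fix p assume "p : space vol"
  hence p: "p : car" by(simp add: space_vol)
  let ?X = "{xi : sphere 0 1. (p, fr p xi) : B}"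
  have "{xi. (p, fr p xi) : B} : sets borel"
   using measurable_sets[OF frame_measurable[OF p] Bs(2)] by(simp add: vimage_def)
  hence X: "?X : sets (rsp borel (sphere 0 1))"
   by(auto simp: sets_restrict_space Int_def)
  have nf: "nz (p, fr p xi) = (p, fr p (sgn xi))" for xi
   by(simp add: nz_def speed_frame[OF p] sgn_div_norm fun_eq_iff linear_scale[OF frame(2)[OF p]])
  show "of_nat CARD('n)*(LB xi. chi B (nz (p, fr p xi))*chi (cball 0 1 - {0}) xi) = em0 sphere_measure ?X"
   unfolding emeasure_sphere_measure[OF X] nf
   by(rule arg_cong[where f = "(*) _"], rule nn_integral_cong) (auto simp: norm_sgn split: split_indicator)
 qed
 finally show ?thesis .
qed

lemma SM_space: "space SM = SB" "sets SM = sets (rsp TMs SB)"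
proof -
 show s: "sets SM = sets (rsp TMs SB)" by(simp add: SM_def)
 show "space SM = SB"
  using sets_eq_imp_space_eq[OF s] sets.sets_into_space[OF SB_sets] by(simp add: space_restrict_space Int_absorb2)
qed

text \<open>\<open>measure_of\<close> returns the prescribed values only where they define a measure
  on the generated \<sigma>-algebra. They agree with \<open>SM\<close>, a genuine measure on the
  possibly larger \<sigma>-algebra induced by \<open>TMs\<close>.\<close>

lemma SBM:
 shows "sets (sphere_bundle_measure A g) = sigma_sets SB SBgen" "space (sphere_bundle_measure A g) = SB"
  "B : sigma_sets SB SBgen ==> em0 (sphere_bundle_measure A g) B = em0 SM B"
  "sigma_sets SB SBgen <= sets SM"
proof -
 have gp: "SBgen <= Pow SB" by auto
 note spSM = SM_space
 show sub: "sigma_sets SB SBgen <= sets SM"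
  using sets.sigma_sets_subset[OF SBgen_sets] SM_space sets_eq_imp_space_eq[OF SM_space(2)] by simp
 have eq: "sphere_bundle_measure A g = measure_of SB SBgen (em0 SM)"
  unfolding sphere_bundle_measure_def
  by(rule measure_of_eq[OF gp]) (use sub spSM(2) emeasure_SM in \<open>auto simp: vol_def\<close>)
 show st: "sets (sphere_bundle_measure A g) = sigma_sets SB SBgen" "space (sphere_bundle_measure A g) = SB"
  unfolding eq using gp by(simp_all add: sets_measure_of space_measure_of)
 show "B : sigma_sets SB SBgen ==> em0 (sphere_bundle_measure A g) B = em0 SM B"
 proof(rule emeasure_measure_of[OF eq gp])
  assume "B : sigma_sets SB SBgen" thus "B : sets (sphere_bundle_measure A g)" by(simp add: st)
  show "positive (sets (sphere_bundle_measure A g)) (em0 SM)" by(simp add: positive_def)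
  show "countably_additive (sets (sphere_bundle_measure A g)) (em0 SM)"
   unfolding st using sub by(auto simp: countably_additive_def intro!: suminf_emeasure)
 qed
qed

text \<open>Measurability is wanted for the \<sigma>-algebra generated by \<open>SBgen\<close>, not
  merely for that of \<open>SM\<close>. A sublevel set of \<open>Ric\<close> is open in each bundle
  chart, hence a countable union of generators.\<close>

lemma ricci_neg_measurable: "ricci_neg A g : bm (sphere_bundle_measure A g)"
proof -
 have "Ric : bm (sphere_bundle_measure A g)"
  unfolding borel_measurable_iff_less
 proof
  fix al
  have "{w : SB. Ric w < al} = (\<Union>n. {(p, v) : SB. p : cdom (sq n) &
   (cmap (sq n) p, v (sq n)) : (%(x, v). join x v) -` {z : Om (sq n). Ric (unchart (sq n) z) < al}})"
  proof -
   have "w : {w : SB. Ric w < al} \<longleftrightarrow> w : (\<Union>n. {(p, v) : SB. p : cdom (sq n) &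
    (cmap (sq n) p, v (sq n)) : (%(x, v). join x v) -` {z : Om (sq n). Ric (unchart (sq n) z) < al}})" for w
   proof(cases "w : SB")
    case True
    hence w: "w : TM" by(simp add: SB_speed)
    have "Ric (unchart (sq n) (bchart (sq n) w)) = Ric w & bchart (sq n) w : Om (sq n)" if "fst w : cdom (sq n)" for n
    proof -
     have "w : tube (sq n)" using w that by(simp add: tube_def)
     thus ?thesis using unchart_bchart[OF sq(1)] bchart_Om by simp
    qed
    moreover have "fst w : (\<Union>n. cdom (sq n))" using w sq(2) by(auto simp: TM_def)
    ultimately show ?thesis using True by(force simp: bchart_def case_prod_beta)
   qed auto
   thus ?thesis by blast
  qed
  moreover have "{(p, v) : SB. p : cdom (sq n) &
   (cmap (sq n) p, v (sq n)) : (%(x, v). join x v) -` {z : Om (sq n). Ric (unchart (sq n) z) < al}} : sigma_sets SB SBgen" for n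
  proof(rule sigma_sets.Basic)
   have "open {z : Om (sq n). Ric (unchart (sq n) z) < al}"
   proof -
    have "open (Om (sq n) Int (%z. Ric (unchart (sq n) z)) -` {..<al})"
     by(rule continuous_open_preimage[OF Ck_on_continuous[OF Ric_smooth[OF sq(1), of 0]] open_Om[OF sq(1)]]) simp
    moreover have "Om (sq n) Int (%z. Ric (unchart (sq n) z)) -` {..<al} = {z : Om (sq n). Ric (unchart (sq n) z) < al}" by auto
    ultimately show ?thesis by simp
   qed
   hence "open ((%(x, v). join x v) -` {z : Om (sq n). Ric (unchart (sq n) z) < al})"
    by(rule open_vimage) (rule continuous_on_join)
   thus "{(p, v) : SB. p : cdom (sq n) &
    (cmap (sq n) p, v (sq n)) : (%(x, v). join x v) -` {z : Om (sq n). Ric (unchart (sq n) z) < al}} : SBgen"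
    using sq(1) by blast
  qed
  ultimately have "{w : SB. Ric w < al} : sigma_sets SB SBgen" by(simp only:) (intro sigma_sets.Union)
  thus "{w : space (sphere_bundle_measure A g). Ric w < al} : sets (sphere_bundle_measure A g)" by(simp add: SBM)
 qed
 moreover have "ricci_neg A g = (%w. max (- Ric w) 0)" by(auto simp: ricci_neg_def Ric_def)
 ultimately show ?thesis by simp
qed

text \<open>Transfers the hypothesis on the sphere bundle to the ball bundle. \<open>Ric\<close> is
  homogeneous of degree 2, so its value at the normalised vector is
  \<open>Ric w/(speed w)\<^sup>2\<close>.\<close>

lemma nn_integral_ricci_neg:
 "(\<integral>\<^sup>+z. ennreal (ricci_neg A g z) \<partial>sphere_bundle_measure A g)
  = of_nat CARD('n)*(\<integral>\<^sup>+w. ennreal (max (- Ric w) 0/(speed w)\<^sup>2)*chi punctured w \<partial>Lam)"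
proof -
 have rn: "ricci_neg A g = (%w. max (- Ric w) 0)" by(auto simp: ricci_neg_def Ric_def)
 have ps: "punctured : sets Lam" using punctured_sets by(simp add: sets_Lam)
 have rm: "(%w. ennreal (ricci_neg A g w)) : bm TMs" unfolding rn using Ric_measurable by measurable
 have "(\<integral>\<^sup>+z. ennreal (ricci_neg A g z) \<partial>sphere_bundle_measure A g) = (\<integral>\<^sup>+z. ennreal (ricci_neg A g z) \<partial>SM)"
 proof(rule nn_integral_subalgebra)
  show "(%z. ennreal (ricci_neg A g z)) : bm (sphere_bundle_measure A g)"
   using ricci_neg_measurable by simp
  show "sets (sphere_bundle_measure A g) <= sets SM" using SBM(1,4) by simp
  show "space (sphere_bundle_measure A g) = space SM"
   using SBM(2) SM_space by simp
  show "em0 (sphere_bundle_measure A g) X = em0 SM X" if "X : sets (sphere_bundle_measure A g)" for X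
   using SBM(1,3) that by simp
 qed
 also have "... = of_nat CARD('n)*(\<integral>\<^sup>+z. ennreal (ricci_neg A g z) \<partial>distr (rsp Lam punctured) (rsp TMs SB) nz)"
  unfolding SM_def by(rule nn_integral_scale_measure) (use rm in \<open>simp add: measurable_restrict_space1\<close>)
 also have "(\<integral>\<^sup>+z. ennreal (ricci_neg A g z) \<partial>distr (rsp Lam punctured) (rsp TMs SB) nz)
  = (\<integral>\<^sup>+w. ennreal (ricci_neg A g (nz w)) \<partial>rsp Lam punctured)"
  by(rule nn_integral_distr[OF nz_measurable']) (use rm in \<open>simp add: measurable_restrict_space1\<close>)
 also have "... = (\<integral>\<^sup>+w. ennreal (ricci_neg A g (nz w))*chi punctured w \<partial>Lam)"
  by(rule nn_integral_restrict_space) (use ps in simp)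
 also have "... = (\<integral>\<^sup>+w. ennreal (max (- Ric w) 0/(speed w)\<^sup>2)*chi punctured w \<partial>Lam)"
  by(rule nn_integral_cong) (auto simp: rn Ric_nz space_Lam max_divide_distrib_right split: split_indicator)
 finally show ?thesis .
qed

end

section \<open>The integrated Ricci inequality\<close>

context riemannian
begin

definition Ricp :: "'a \<times> ('a, 'n) tangent => real" where "Ricp w = max (Ric w) 0"
definition Ricm :: "'a \<times> ('a, 'n) tangent => real" where "Ricm w = max (- Ric w) 0"

definition Jp :: ennreal where "Jp = (\<integral>\<^sup>+w. ennreal (Ricp w/(speed w)\<^sup>2)*chi punctured w \<partial>Lam)"
definition Jm :: ennreal where "Jm = (\<integral>\<^sup>+w. ennreal (Ricm w/(speed w)\<^sup>2)*chi punctured w \<partial>Lam)"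

lemma Ricpm_measurable: "Ricp : bm TMs" "Ricm : bm TMs"
 unfolding Ricp_def[abs_def] Ricm_def[abs_def] using Ric_measurable by measurable

text \<open>In each fibre the two parts differ by \<open>ballvol/n\<close> times the scalar
  curvature. Once both total integrals are finite, the fibre integrals are integrable over the base,
  and so is the scalar curvature.\<close>

lemma scalar_integral:
 assumes Jp: "Jp < \<infinity>" and Jm: "Jm < \<infinity>"
 shows "extended_integral vol (scalar_curvature A g) = ereal (CARD('n)/ballvol*(enn2real Jp - enn2real Jm))"
proof -
 let ?B = "cball 0 1 - {0} :: (real^'n) set"
 let ?a = "%p. \<integral>\<^sup>+xi. ennreal (Ricp (p, fr p xi)/(speed (p, fr p xi))\<^sup>2)*chi ?B xi \<partial>lborel"
 let ?b = "%p. \<integral>\<^sup>+xi. ennreal (Ricm (p, fr p xi)/(speed (p, fr p xi))\<^sup>2)*chi ?B xi \<partial>lborel"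
 have mm: "(%w. ennreal (Ricp w/(speed w)\<^sup>2)) : bm TMs" "(%w. ennreal (Ricm w/(speed w)\<^sup>2)) : bm TMs"
  using Ricpm_measurable speed_measurable by measurable
 have AB: "Jp = (\<integral>\<^sup>+p. ?a p \<partial>vol)" "Jm = (\<integral>\<^sup>+p. ?b p \<partial>vol)"
  unfolding Jp_def Jm_def by(rule nn_integral_punctured[OF mm(1)], rule nn_integral_punctured[OF mm(2)])
 have feq: "(LB xi. F (p, fr p xi)*chi ?B xi) = (LB xi. (F (p, fr p xi)*chi punctured (p, fr p xi)))"
  if "p : space vol" for p and F :: "_ => ennreal"
  using that frame(1) by(intro nn_integral_cong) (auto simp: space_vol punctured_def speed_frame TM_def split: split_indicator)
 have fibm: "(%p. \<integral>\<^sup>+xi. F (p, fr p xi)*chi ?B xi \<partial>lborel) : bm vol"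
  if F: "F : bm TMs" for F :: "_ => ennreal"
 proof -
  have "(%p. \<integral>\<^sup>+xi. (F (p, fr p xi)*chi punctured (p, fr p xi)) \<partial>lborel) : bm vol"
   by(rule fibre_measurable_vol) (use F punctured_sets in simp)
  thus ?thesis by(rule measurable_cong[THEN iffD1, rotated]) (simp add: feq)
 qed
 note abm = fibm[OF mm(1)] fibm[OF mm(2)]
 have fib: "EX x y. 0 <= x & 0 <= y & ?a p = ennreal x & ?b p = ennreal y & ballvol/CARD('n) * scalar_curvature A g p = x - y"
  if "p : space vol" for p
 proof -
  have p: "p : car" using that by(simp add: space_vol)
  let ?f = "%xi. chi ?B xi*(Ric (p, fr p xi)/(norm xi)\<^sup>2) :: real"
  obtain x y where xy: "0 <= x" "0 <= y" "(LB xi. ennreal (?f xi)) = ennreal x"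
   "(LB xi. ennreal (- ?f xi)) = ennreal y" "integral\<^sup>L lborel ?f = x - y"
   by(rule integrableE[OF fibre_scalar(1)[OF p]])
  \<comment> \<open>\<open>ennreal\<close> already sends negative numbers to 0, so taking the
    positive part first changes nothing.\<close>
  have pn: "ennreal (max z 0/s\<^sup>2) = ennreal (z/s\<^sup>2)" for z s :: real
   by(cases "0 <= z") (auto simp: max_def ennreal_neg divide_nonpos_nonneg)
  have "?a p = ennreal x" unfolding xy(3)[symmetric]
   by(rule nn_integral_cong) (auto simp: Ricp_def speed_frame[OF p] pn split: split_indicator)
  moreover have "?b p = ennreal y" unfolding xy(4)[symmetric]
   by(rule nn_integral_cong) (auto simp: Ricm_def speed_frame[OF p] pn minus_divide_left simp del: minus_divide_left[symmetric] split: split_indicator)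
  ultimately show ?thesis using xy(1,2,5) fibre_scalar(2)[OF p]
   by(intro exI[of _ x] exI[of _ y] conjI) simp_all
 qed
 define al where "al p = enn2real (?a p)" for p
 define be where "be p = enn2real (?b p)" for p
 have ab: "?a p = ennreal (al p)" "?b p = ennreal (be p)" "scalar_curvature A g p = CARD('n)/ballvol*(al p - be p)"
  if "p : space vol" for p
  using fib[OF that] emeasure_ball(2) by(auto simp: al_def be_def field_simps)
 have m: "al : bm vol" "be : bm vol"
  unfolding al_def[abs_def] be_def[abs_def] using abm by(auto intro: borel_measurable_enn2real)
 have I: "(\<integral>\<^sup>+p. ennreal (al p) \<partial>vol) = Jp" "(\<integral>\<^sup>+p. ennreal (be p) \<partial>vol) = Jm"
  unfolding AB using ab by(auto intro!: nn_integral_cong)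
 have int: "integrable vol al" "integrable vol be"
  using I Jp Jm m by(auto intro!: integrableI_nonneg simp: al_def be_def)
 have L: "integral\<^sup>L vol al = enn2real Jp" "integral\<^sup>L vol be = enn2real Jm"
  using integral_eq_nn_integral[OF m(1)] integral_eq_nn_integral[OF m(2)] by(simp_all add: I) (simp_all add: al_def be_def)
 let ?h = "%p. CARD('n)/ballvol*(al p - be p)"
 have hint: "integrable vol ?h" using int by simp
 obtain x y where xy: "0 <= x" "0 <= y" "(\<integral>\<^sup>+p. ennreal (?h p) \<partial>vol) = ennreal x" "(\<integral>\<^sup>+p. ennreal (- ?h p) \<partial>vol) = ennreal y"
  "integral\<^sup>L vol ?h = x - y"
  by(rule integrableE[OF hint])
 have mx: "ennreal (max z 0) = ennreal z" for z by(cases "0 <= z") (auto simp: max_def ennreal_neg)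
 have "(\<integral>\<^sup>+p. ennreal (max (scalar_curvature A g p) 0) \<partial>vol) = ennreal x"
  unfolding xy(3)[symmetric] mx by(rule nn_integral_cong) (simp add: ab(3))
 moreover have "(\<integral>\<^sup>+p. ennreal (max (- scalar_curvature A g p) 0) \<partial>vol) = ennreal y"
  unfolding xy(4)[symmetric] mx by(rule nn_integral_cong) (simp add: ab(3))
 ultimately have "extended_integral vol (scalar_curvature A g) = ereal (x - y)"
  using xy(1,2) by(simp add: extended_integral_def)
 moreover have "x - y = CARD('n)/ballvol*(enn2real Jp - enn2real Jm)"
  using xy(5) int by(simp add: L)
 ultimately show ?thesis by simp
qed

end

context complete_riemannian
begin

text \<open>The sine-weighted Ricci integral over a unit speed geodesic of length \<open>r\<close>
  in constant curvature \<open>(pi/r)\<^sup>2\<close>: \<open>(n - 1) (pi/r)\<^sup>2\<close> times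
  \<open>r/2\<close>.\<close>

definition cst :: "real => real" where "cst r = (real CARD('n) - 1)*(pi\<^sup>2/(2*r))"

definition mean :: "real => ('a \<times> ('a, 'n) tangent => real) => 'a \<times> ('a, 'n) tangent => real" where
 "mean r f w = integral {0..r} (%u. (sin (pi*u/r))\<^sup>2*(f (flow (u/speed w) w)/(speed w)\<^sup>2))"

lemma unit_speed_reparametrization:
 assumes w: "w : TM" and s: "0 < speed w"
 defines "ga \<equiv> %u. geo w (1/speed w*u + 0)"
 shows "geodesic A g ga" "unit_speed A g ga"
  and "(ga u, vel ga u) = (fst (flow (u/speed w) w), %c. (1/speed w) *R snd (flow (u/speed w) w) c)"
proof -
 show gd: "geodesic A g ga" unfolding ga_def by(rule geodesic_affine[OF geo(1)[OF w]])
 have v: "(ga u, vel ga u) = (fst (flow (u/speed w) w), %c. (1/speed w) *R snd (flow (u/speed w) w) c)" for u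
  using curve_affine(2)[OF geodesic_curve[OF geo(1)[OF w]], of "1/speed w" 0 u] by(simp add: ga_def flow_def)
 thus "(ga u, vel ga u) = (fst (flow (u/speed w) w), %c. (1/speed w) *R snd (flow (u/speed w) w) c)" .
 show "unit_speed A g ga"
  unfolding unit_speed_def
 proof
  fix u
  have "speed (ga u, vel ga u) = 1"
   unfolding v using speed_scale[of "fst (flow (u/speed w) w)" "snd (flow (u/speed w) w)" "1/speed w"]
    flow_TM[OF w] speed_flow[OF w] s by simp
  thus "g (ga u) (vel ga u) (vel ga u) = 1" by(simp add: speed_def)
 qed
qed

lemma Ric_reparametrization:
 assumes w: "w : TM" and s: "0 < speed w"
 shows "ricci A g (geo w (1/speed w*u + 0)) (vel (%u. geo w (1/speed w*u + 0)) u) (vel (%u. geo w (1/speed w*u + 0)) u)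
  = Ric (flow (u/speed w) w)/(speed w)\<^sup>2"
proof -
 have "ricci A g (geo w (1/speed w*u + 0)) (vel (%u. geo w (1/speed w*u + 0)) u) (vel (%u. geo w (1/speed w*u + 0)) u)
  = Ric (geo w (1/speed w*u + 0), vel (%u. geo w (1/speed w*u + 0)) u)" by(simp add: Ric_def)
 also have "... = (1/speed w)\<^sup>2 * Ric (flow (u/speed w) w)"
  unfolding unit_speed_reparametrization(3)[OF w s] by(subst Ric_scale) (use flow_TM[OF w] in simp_all)
 finally show ?thesis by(simp add: power_divide)
qed

lemma mean_nonneg:
 assumes "!!z. 0 <= f z" shows "0 <= mean r f w"
proof(cases "(%u. (sin (pi*u/r))\<^sup>2*(f (flow (u/speed w) w)/(speed w)\<^sup>2)) integrable_on {0..r}")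
 case True
 thus ?thesis unfolding mean_def by(rule Henstock_Kurzweil_Integration.integral_nonneg) (simp add: assms)
next
 \<comment> \<open>Without integrability the integral has the default value 0.\<close>
 case False
 thus ?thesis unfolding mean_def not_integrable_integral[OF False] by simp
qed

lemma mean_difference:
 assumes w: "w : punctured" and r: "0 < r"
 shows "mean r Ricp w - mean r Ricm w = mean r Ric w"
proof -
 have tm: "w : TM" "0 < speed w" using w by(auto simp: punctured_def)
 have c: "cts S (%u. Ric (flow (u/speed w) w))" for S
  by(rule continuous_on_compose2[OF Ric_flow_continuous[OF tm(1)]]) (use tm in \<open>auto intro!: continuous_intros\<close>)
 have i: "(%u. (sin (pi*u/r))\<^sup>2*(Ricp (flow (u/speed w) w)/(speed w)\<^sup>2)) integrable_on {0..r}"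
  "(%u. (sin (pi*u/r))\<^sup>2*(Ricm (flow (u/speed w) w)/(speed w)\<^sup>2)) integrable_on {0..r}"
  unfolding Ricp_def Ricm_def
  by(intro integrable_continuous_real continuous_intros c; use tm r in auto)+
 have "mean r Ricp w - mean r Ricm w = integral {0..r} (%u. (sin (pi*u/r))\<^sup>2*(Ricp (flow (u/speed w) w)/(speed w)\<^sup>2)
   - (sin (pi*u/r))\<^sup>2*(Ricm (flow (u/speed w) w)/(speed w)\<^sup>2))"
  unfolding mean_def by(rule Henstock_Kurzweil_Integration.integral_diff[OF i, symmetric])
 also have "... = mean r Ric w"
  unfolding mean_def
 proof(rule Henstock_Kurzweil_Integration.integral_cong)
  fix u
  have "Ricp z - Ricm z = Ric z" for z by(auto simp: Ricp_def Ricm_def)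
  thus "(sin (pi*u/r))\<^sup>2*(Ricp (flow (u/speed w) w)/(speed w)\<^sup>2) - (sin (pi*u/r))\<^sup>2*(Ricm (flow (u/speed w) w)/(speed w)\<^sup>2)
   = (sin (pi*u/r))\<^sup>2*(Ric (flow (u/speed w) w)/(speed w)\<^sup>2)"
   by(simp only: right_diff_distrib[symmetric] diff_divide_distrib[symmetric])
 qed
 finally show ?thesis .
qed

text \<open>\<open>ricci_geodesic_integral\<close> for vectors of arbitrary speed. The negative part
  is moved to the other side, so that the inequality is between nonnegative functions and can be
  integrated before the positive part is known to be integrable.\<close>

lemma mean_le:
 assumes w: "w : punctured" and nc: "no_conj r" and r: "0 < r"
 shows "mean r Ricp w <= mean r Ricm w + cst r"
  and "mean r Ricp w = mean r Ricm w + cst r ==> u : {0<..<r} ==>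
   (p, v) = flow (u/speed w) w ==> xi : TS p ==> g p xi v = 0 ==>
   curv p xi v v = (%c. ((pi/r)\<^sup>2*g p v v) *R xi c)"
proof -
 have tm: "w : TM" "0 < speed w" using w by(auto simp: punctured_def)
 let ?ga = "%u. geo w (1/speed w*u + 0)"
 note us = unit_speed_reparametrization[OF tm]
 note m = ricci_geodesic_integral[OF us(1,2) nc r, unfolded Ric_reparametrization[OF tm], folded mean_def[of r Ric] cst_def]
 show "mean r Ricp w <= mean r Ricm w + cst r"
  using m(1) mean_difference[OF w r] by simp
 assume eq: "mean r Ricp w = mean r Ricm w + cst r" and u: "u : {0<..<r}"
  and pv: "(p, v) = flow (u/speed w) w" and x: "xi : TS p" "g p xi v = 0"
 have eq': "mean r Ric w = cst r" using eq mean_difference[OF w r] by simp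
 have pT: "p : car" "v : TS p" using flow_TM[OF tm(1), of "u/speed w"] pv by(auto simp: TM_def)
 let ?s = "speed w"
 have gu: "?ga u = p" "vel ?ga u = (%c. (1 / ?s) *R v c)"
  using us(3)[of u] pv[symmetric] by simp_all
 have gv: "g p v v = ?s\<^sup>2"
  using speed_flow[OF tm(1), of "u/speed w"] tm(2) pv[symmetric]
  by(simp add: speed_def)
 have sv: "(%c. (1 / ?s) *R v c) : TS p" by(rule tangent_scale[OF pT(2)])
 have "g p xi (%c. (1 / ?s) *R v c) = 0"
  using g_sym[OF pT(1) x(1) sv] g_scale[OF pT(1,2) x(1), of "1 / ?s"] g_sym[OF pT(1) x(1) pT(2)] x(2) by simp
 hence cv: "curv p xi (%c. (1 / ?s) *R v c) (%c. (1 / ?s) *R v c) = (%c. (pi/r)\<^sup>2 *R xi c)"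
  using m(2)[OF eq' u, of xi] x(1) unfolding gu by simp
 show "curv p xi v v = (%c. ((pi/r)\<^sup>2*g p v v) *R xi c)"
 proof
  fix c
  show "curv p xi v v c = ((pi/r)\<^sup>2*g p v v) *R xi c"
  proof(cases "c : A & p : cdom c")
   case True
   hence xc: "cmap c p : V c" by simp
   have "(1 / ?s*(1 / ?s)) *R curv p xi v v c = (pi/r)\<^sup>2 *R xi c"
    using fun_cong[OF cv, of c] True
    by(simp add: curvature_coord linear_scale[OF curv_linear(2)[OF _ xc]] linear_scale[OF curv_linear(3)[OF _ xc]])
   hence "?s\<^sup>2 *R ((1 / ?s*(1 / ?s)) *R curv p xi v v c) = ?s\<^sup>2 *R ((pi/r)\<^sup>2 *R xi c)" by simp
   thus ?thesis using tm(2) by(simp add: gv power2_eq_square mult.commute)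
  next
   case False
   thus ?thesis using tangent_zero[OF x(1), of c] by(auto simp: curvature_def)
  qed
 qed
qed

text \<open>This is \<open>2/r\<close> times \<open>cst r\<close> times the Liouville measure of the
  punctured ball bundle; the factor \<open>r/2\<close> is the one produced by
  \<open>mean_along_flow\<close>.\<close>

definition bound :: "real => real" where
 "bound r = (real CARD('n) - 1)*(pi/r)\<^sup>2*ballvol*enn2real (em0 vol (car))"

text \<open>\<open>mean_le\<close> is integrated over the ball bundle, where
  \<open>mean_along_flow\<close> turns the means into \<open>r/2\<close> times \<open>Jp\<close> and
  \<open>Jm\<close>. The right-hand side is finite, so \<open>Jp\<close> is. In the equality case a
  nonnegative difference has integral 0 and vanishes almost everywhere.\<close>

lemma J_bound:
 assumes fin: "em0 vol (car) < \<infinity>" and Jm: "Jm < \<infinity>" and nc: "no_conj r" and r: "0 < r"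
 shows "Jp < \<infinity>" "enn2real Jp - enn2real Jm <= bound r"
  and "enn2real Jp - enn2real Jm = bound r ==>
   AE w in Lam. w : punctured --> mean r Ricp w = mean r Ricm w + cst r"
proof -
 define C where "C = cst r"
 let ?C = C and ?vol = "enn2real (em0 vol (car))"
 have C: "0 <= ?C" using r by(simp add: C_def cst_def)
 have cont: "cts UNIV (%t. Ricp (flow t w))" "cts UNIV (%t. Ricm (flow t w))" if "w : TM" for w
  unfolding Ricp_def Ricm_def by(intro continuous_intros Ric_flow_continuous[OF that])+
 have pos: "0 <= Ricp w" "0 <= Ricm w" for w by(simp_all add: Ricp_def Ricm_def)
 have Mp: "(%w. ennreal (mean r Ricp w)*chi punctured w) : bm TMs"
  "(\<integral>\<^sup>+w. ennreal (mean r Ricp w)*chi punctured w \<partial>Lam) = ennreal (r/2)*Jp"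
  unfolding mean_def Jp_def by(rule mean_along_flow[OF fin Ricpm_measurable(1) pos(1) cont(1) r]; assumption)+
 have Mm: "(%w. ennreal (mean r Ricm w)*chi punctured w) : bm TMs"
  "(\<integral>\<^sup>+w. ennreal (mean r Ricm w)*chi punctured w \<partial>Lam) = ennreal (r/2)*Jm"
  unfolding mean_def Jm_def by(rule mean_along_flow[OF fin Ricpm_measurable(2) pos(2) cont(2) r]; assumption)+
 note mean0 = mean_nonneg[where f = Ricm, OF pos(2), of r]
 let ?P = "%w. ennreal (mean r Ricp w)*chi punctured w" and ?M = "%w. ennreal (mean r Ricm w)*chi punctured w"
 let ?G = "%w. ?M w + ennreal ?C*chi punctured w"
 have pm: "?P : bm Lam" "?M : bm Lam" using Mp(1) Mm(1) by(simp_all add: measurable_Lam)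
 have ps: "punctured : sets Lam" using punctured_sets by(simp add: sets_Lam)
 have gm: "?G : bm Lam" using pm(2) ps by simp
 have vol: "em0 vol (car) = ennreal ?vol" using fin by simp
 have b0: "0 <= ballvol" using emeasure_ball(2) by simp
 have IG: "(\<integral>\<^sup>+w. ?G w \<partial>Lam) = ennreal (r/2)*Jm + ennreal (?C*ballvol*?vol)"
 proof -
  have "(\<integral>\<^sup>+w. ?G w \<partial>Lam) = (\<integral>\<^sup>+w. ?M w \<partial>Lam) + (\<integral>\<^sup>+w. ennreal ?C*chi punctured w \<partial>Lam)"
   by(rule nn_integral_add) (use pm ps in auto)
  also have "(\<integral>\<^sup>+w. ennreal ?C*chi punctured w \<partial>Lam) = ennreal ?C*(ennreal ballvol*ennreal ?vol)"
   using ps by(simp add: nn_integral_cmult_indicator Lam_punctured vol[symmetric])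
  also have "... = ennreal (?C*ballvol*?vol)" by(simp only: mult.assoc ennreal_mult'[OF C] ennreal_mult'[OF b0])
  finally show ?thesis unfolding Mm(2) .
 qed
 have le: "?P w <= ?G w" for w
 proof(cases "w : punctured")
  case True
  thus ?thesis using ennreal_leI[OF mean_le(1)[OF True nc r, folded C_def]] C mean0[of w] by(simp add: ennreal_plus)
 qed simp
 define K where "K = ?C*ballvol*?vol"
 have K: "0 <= K" using C b0 by(simp add: K_def)
 have r2: "0 <= r/2" using r by simp
 have "(\<integral>\<^sup>+w. ?P w \<partial>Lam) <= (\<integral>\<^sup>+w. ?G w \<partial>Lam)" by(rule nn_integral_mono) (rule le)
 hence "ennreal (r/2)*Jp <= ennreal (r/2)*Jm + ennreal K"
  unfolding IG Mp(2) K_def .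
 moreover obtain jm where jm: "Jm = ennreal jm" "0 <= jm" using Jm by(cases Jm) auto
 moreover have GK: "ennreal (r/2)*Jm + ennreal K = ennreal (r/2*jm + K)"
  unfolding jm(1) ennreal_mult'[OF r2, symmetric] by(rule ennreal_plus[symmetric]) (use r2 jm(2) K in simp_all)
 ultimately have le2: "ennreal (r/2)*Jp <= ennreal (r/2*jm + K)" by simp
 show Jpf: "Jp < \<infinity>"
 proof(rule ccontr)
  assume "~ Jp < \<infinity>"
  hence "Jp = top" using less_top[of Jp] by auto
  thus False using le2 r by(simp add: ennreal_mult_top top_unique)
 qed
 then obtain jp where jp: "Jp = ennreal jp" "0 <= jp" by(cases Jp) auto
 have bd: "K = r/2*bound r"
  using r by(simp add: K_def C_def cst_def bound_def power2_eq_square field_simps)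
 have "ennreal (r/2*jp) <= ennreal (r/2*jm + K)"
  using le2 unfolding jp(1) ennreal_mult'[OF r2] .
 hence "r/2*jp <= r/2*jm + K"
  by(rule ennreal_le_iff[THEN iffD1, rotated]) (use r2 jm(2) K in simp)
 hence "r/2*(jp - jm) <= r/2*bound r" unfolding bd by(simp add: right_diff_distrib)
 hence "jp - jm <= bound r" using r by simp
 thus "enn2real Jp - enn2real Jm <= bound r" using jp jm by simp
 assume "enn2real Jp - enn2real Jm = bound r"
 hence "jp = jm + bound r" using jp jm by simp
 hence "r/2*jp = r/2*jm + K" unfolding bd by(simp add: distrib_left)
 hence eqI: "(\<integral>\<^sup>+w. ?P w \<partial>Lam) = (\<integral>\<^sup>+w. ?G w \<partial>Lam)"
  unfolding Mp(2) IG K_def[symmetric] GK by(simp only: jp(1) ennreal_mult'[OF r2, symmetric])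
 have fin2: "(\<integral>\<^sup>+w. ?P w \<partial>Lam) ~= \<infinity>" unfolding Mp(2) using jp r by(simp add: ennreal_mult'[symmetric])
 \<comment> \<open>Subtraction is legitimate because the integral of the smaller function is
   finite.\<close>
 have "(\<integral>\<^sup>+w. ?G w - ?P w \<partial>Lam) = (\<integral>\<^sup>+w. ?G w \<partial>Lam) - (\<integral>\<^sup>+w. ?P w \<partial>Lam)"
  by(rule nn_integral_diff[OF gm pm(1) fin2]) (use le in simp)
 hence "(\<integral>\<^sup>+w. ?G w - ?P w \<partial>Lam) = 0" using eqI fin2 by(simp add: diff_eq_0_iff_ennreal less_top)
 hence "AE w in Lam. ?G w - ?P w = 0"
  using gm pm(1) by(subst nn_integral_0_iff_AE[symmetric]) simp_all
 thus "AE w in Lam. w : punctured --> mean r Ricp w = mean r Ricm w + cst r"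
  unfolding C_def[symmetric]
 proof(rule AE_mp, intro AE_I2 impI)
  fix w assume "?G w - ?P w = 0" and w: "w : punctured"
  hence "ennreal (mean r Ricm w) + ennreal ?C <= ennreal (mean r Ricp w)" by(simp add: diff_eq_0_iff_ennreal)
  hence "ennreal (mean r Ricm w + ?C) <= ennreal (mean r Ricp w)"
   unfolding ennreal_plus[OF mean0 C] .
  hence "mean r Ricm w + ?C <= mean r Ricp w"
   by(rule ennreal_le_iff[THEN iffD1, rotated]) (rule mean_nonneg, rule pos)
  thus "mean r Ricp w = mean r Ricm w + ?C" using mean_le(1)[OF w nc r] by(simp add: C_def)
 qed
qed

end

section \<open>Constant curvature in coordinates and in parallel frames\<close>

context riemannian
begin

text \<open>The deviation of the Jacobi operator from that of constant curvature \<open>kap\<close>,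
  which is \<open>kap\<close> times \<open>|v|\<^sup>2 xi - <xi, v> v\<close>. It is a continuous
  function of the bundle coordinates and homogeneous of degree 2 in the velocity.\<close>

definition defect :: "real => ('a, 'n) chart => real^'n => real^('n + 'n) => real^'n" where
 "defect kap c xi z = cc c (lft z) xi (rgt z) (rgt z)
  - kap *R (Gm c (lft z) (rgt z) (rgt z) *R xi - Gm c (lft z) xi (rgt z) *R rgt z)"

lemma defect_continuous:
 assumes c: "c : A" shows "cts (Om c) (defect kap c xi)"
proof -
 have 1: "Ck_on 0 (Om c) (%z. cc c (lft z) xi (rgt z) (rgt z))"
  by(intro curv_smooth[OF c] open_Om[OF c] Ck_on_bounded_linear_id bounded_linear_lft bounded_linear_rgt Ck_on_const) (simp add: Om_def)
 have 2: "Ck_on 0 (Om c) (%z. Gm c (lft z) xi (rgt z))"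
  unfolding Gm_def
  by(intro Ck_on_inner Ck_on_mvmult open_Om Ck_on_compose[OF open_Om open_V _ gram_smooth] Ck_on_bounded_linear_id bounded_linear_lft bounded_linear_rgt Ck_on_const c)
   (auto simp: Om_def)
 show ?thesis
  unfolding defect_def[abs_def]
  by(intro continuous_intros Ck_on_continuous[OF 1] Ck_on_continuous[OF 2] Ck_on_continuous[OF Gm_smooth[OF c, of 0]]
   linear_continuous_on bounded_linear_rgt)
qed

lemma defect_scale:
 assumes c: "c : A" and x: "x : V c"
 shows "defect kap c xi (join x (a *R v)) = a\<^sup>2 *R defect kap c xi (join x v)"
 using linear_scale[OF curv_linear(2)[OF c x]] linear_scale[OF curv_linear(3)[OF c x]]
 by(simp add: defect_def Gm_def matrix_vector_mult_scaleR scaleR_right_diff_distrib power2_eq_square mult_ac)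

lemma constant_curvature_of_defect:
 assumes "!!c xi z. c : A ==> z : Om c ==> defect kap c xi z = 0"
 shows "constant_sectional_curvature A g kap"
 unfolding constant_sectional_curvature_def
proof(intro ballI impI)
 fix p u v assume p: "p : car" and u: "u : TS p" and v: "v : TS p"
  and nz: "g p u u*g p v v - (g p u v)\<^sup>2 ~= 0"
 obtain c where c: "c : A" "p : cdom c" using p by(rule carrierE)
 have "join (cmap c p) (v c) : Om c" using c(2) by(simp add: Om_def)
 from assms[OF c(1) this, of "u c"]
 have R: "cc c (cmap c p) (u c) (v c) (v c) = kap *R (Gm c (cmap c p) (v c) (v c) *R u c - Gm c (cmap c p) (u c) (v c) *R v c)"
  by(simp add: defect_def)
 have x: "cmap c p : V c" using c(2) by simp
 have gl: "linear (%ze. Gm c (cmap c p) ze (u c))" using Gm_bilinear by(simp add: bilinear_def)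
 have "g p (curv p u v v) u = kap*(g p v v * g p u u - g p u v * g p v u)"
  using g_coord[OF c curvature_tangent[OF p u v v] u] g_coord[OF c v v] g_coord[OF c u u] g_coord[OF c u v] g_coord[OF c v u]
  by(simp add: curvature_coord[OF c] R linear_scale[OF gl] linear_diff[OF gl])
 also have "... = kap*(g p u u*g p v v - (g p u v)\<^sup>2)"
  using g_sym[OF p u v] by(simp add: power2_eq_square mult.commute)
 finally show "sectional_curvature A g p u v = kap" using nz by(simp add: sectional_curvature_def)
qed

lemma polarization:
 fixes M N :: "real^'m::finite^'m"
 assumes sym: "transpose M = M" "transpose N = N" and q: "!!xi. xi dot (M *v xi) = xi dot (N *v xi)"
 shows "M = N"
proof -
 have s: "x dot (M *v y) = y dot (M *v x)" "x dot (N *v y) = y dot (N *v x)" for x y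
  using dot_lmul_matrix[of x M y] transpose_matrix_vector[of M x, unfolded sym(1)]
   dot_lmul_matrix[of x N y] transpose_matrix_vector[of N x, unfolded sym(2)] by(simp_all add: inner_commute)
 have "x dot (M *v y) = x dot (N *v y)" for x y
  using q[of "x + y"] q[of x] q[of y] s[of y x]
  by(simp add: matrix_vector_right_distrib inner_add_left inner_add_right)
 hence eq: "ALL x. x dot (M *v y) = x dot (N *v y)" for y by blast
 show ?thesis by(rule matrix_eq[THEN iffD2, OF allI[OF vector_eq_ldot[THEN iffD1, OF eq]]])
qed

text \<open>Constant sectional curvature fixes the quadratic form of \<open>Rm\<close> on vectors
  that are not multiples of the velocity; on multiples of the velocity both forms vanish.
  Polarization then gives the matrix: \<open>kap\<close> times the projection along the
  velocity.\<close>

lemma constant_curvature_Rm: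
 assumes geo: "geodesic A g ga" and u: "unit_speed A g ga" and E: "par_frame ga E" "E k = vel ga"
  and cc: "constant_sectional_curvature A g kap"
 shows "Rm ga E t *v y = kap *R (y - y $ k *R axis k 1)"
proof -
 note s = geodesic_curve[OF geo]
 have p: "ga t : car" by(rule curve_carrier[OF s])
 have o: "orthonormal (ga t) (%i. E i t)" using E(1) by(simp add: par_frame_def)
 let ?v = "vel ga t" and ?e = "%i. E i t"
 have v: "?v : TS (ga t)" "g (ga t) ?v ?v = 1" using velocity_tangent[OF s] u by(simp_all add: unit_speed_def)
 define N :: "real^'n^'n" where "N = (\<chi> i j. if i = j & i ~= k then kap else 0)"
 have Nv: "N *v xi = kap *R (xi - xi $ k *R axis k 1)" for xi
  by(simp add: vec_eq_iff N_def matrix_vector_mult_def axis_def if_distrib[of "%x. x*_"] cong: if_cong)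
 have "Rm ga E t = N"
 proof(rule polarization)
  show "transpose (Rm ga E t) = Rm ga E t" by(rule Rm_sym[OF s E(1)])
  show "transpose N = N" by(auto simp: N_def vec_eq_iff Finite_Cartesian_Product.transpose_def)
  fix xi :: "real^'n"
  let ?u = "%c. \<Sum>i\<in>UNIV. xi $ i *R ?e i c"
  have ut: "?u : TS (ga t)" by(rule tangent_comb) (rule orthonormal_tangent[OF o])
  have ue: "g (ga t) ?u (?e i) = xi $ i" for i by(rule g_orthonormal_comb[OF p o])
  have uv: "g (ga t) ?u ?v = xi $ k" using ue[of k] E(2) by simp
  have uu: "g (ga t) ?u ?u = xi dot xi"
  proof -
   have "g (ga t) ?u ?u = (\<Sum>i\<in>UNIV. xi $ i*g (ga t) (?e i) ?u)"
    by(rule g_comb[OF p orthonormal_tangent[OF o] ut])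
   also have "... = (\<Sum>i\<in>UNIV. xi $ i*xi $ i)"
    by(rule sum.cong[OF refl]) (simp only: g_sym[OF p orthonormal_tangent[OF o] ut] ue)
   finally show ?thesis by(simp add: inner_vec_def)
  qed
  have Q: "g (ga t) (curv (ga t) ?u ?v ?v) ?u = xi dot (Rm ga E t *v xi)"
  proof -
   have ct: "curv (ga t) ?u ?v ?v : TS (ga t)" by(rule curvature_tangent[OF p ut v(1) v(1)])
   have "g (ga t) (curv (ga t) ?u ?v ?v) (?e i) = (Rm ga E t *v xi) $ i" for i
    using g_curvature_comb[OF p o v(1) ut orthonormal_tangent[OF o], of i] ue
    by(simp add: matrix_vector_mult_def Rm_def mult.commute)
   thus ?thesis
    using g_comb[OF p orthonormal_tangent[OF o] ct, where I = UNIV and a = "%i. xi $ i"] g_sym[OF p ct ut] g_sym[OF p ct orthonormal_tangent[OF o]]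
    by(simp add: inner_vec_def)
  qed
  show "xi dot (Rm ga E t *v xi) = xi dot (N *v xi)"
  proof(cases "xi dot xi - (xi $ k)\<^sup>2 = 0")
   case False
   hence "sectional_curvature A g (ga t) ?u ?v = kap"
    using cc p ut v unfolding constant_sectional_curvature_def by(simp add: uu uv)
   hence "xi dot (Rm ga E t *v xi) = kap*(xi dot xi - (xi $ k)\<^sup>2)"
    using False by(simp add: sectional_curvature_def uu uv v(2) Q field_simps)
   also have "... = xi dot (N *v xi)" unfolding Nv by(simp add: inner_diff_right inner_axis power2_eq_square)
   finally show ?thesis .
  next
   case True
   have "(xi - xi $ k *R axis k 1) dot (xi - xi $ k *R axis k 1) = 0"
    using True by(simp add: inner_diff_left inner_diff_right inner_axis inner_axis' power2_eq_square)
   hence x: "xi = xi $ k *R axis k 1" by simp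
   have "?u = (%c. xi $ k *R ?v c)"
   proof
    fix c
    have "(\<Sum>i\<in>UNIV. xi $ i *R ?e i c) = (\<Sum>i\<in>UNIV. (xi $ k *R axis k 1) $ i *R ?e i c)" using x by simp
    also have "... = xi $ k *R ?v c"
     by(simp add: axis_def E(2)[symmetric] if_distrib[of "%x. _*x"] if_distribR if_distrib[of "%x. x *R _"] cong: if_cong)
    finally show "?u c = xi $ k *R ?v c" .
   qed
   hence "curv (ga t) ?u ?v ?v = (%_. 0)"
   proof(intro ext)
    fix c
    have "curv (ga t) (%c. xi $ k *R ?v c) ?v ?v c = 0"
    proof(cases "c : A & ga t : cdom c")
     case True
     thus ?thesis
      using linear_scale[OF curv_linear(1)[of c "cmap c (ga t)"]] by(simp add: curvature_def) (simp add: curv_coord_eq)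
    qed (auto simp: curvature_def)
    thus "curv (ga t) ?u ?v ?v c = 0" using \<open>?u = (%c. xi $ k *R ?v c)\<close> by simp
   qed
   hence "xi dot (Rm ga E t *v xi) = 0" unfolding Q[symmetric] using g_zero[OF p ut] by simp
   moreover have "xi dot (N *v xi) = 0" unfolding Nv using x by simp
   ultimately show ?thesis by simp
  qed
 qed
 thus ?thesis by(simp add: Nv)
qed

end

text \<open>The pair of \<open>y'\<close> and \<open>s*y\<close> rotates with angular speed
  \<open>s\<close>. Its coordinates in a frame rotating along are the constants \<open>?c1\<close>
  and \<open>?c2\<close>, from which \<open>y\<close> is recovered.\<close>

lemma harmonic_solution:
 fixes y y' :: "real => real"
 assumes s: "0 < s" and y: "!!t. (y has_real_derivative y' t) (at t)" "!!t. (y' has_real_derivative - (s\<^sup>2*y t)) (at t)"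
  and a: "y a = 0"
 shows "y t = y' a/s * sin (s*(t - a))"
proof -
 let ?c1 = "%t. y' t*cos (s*(t - a)) + s*y t * sin (s*(t - a))"
 let ?c2 = "%t. y' t * sin (s*(t - a)) - s*y t*cos (s*(t - a))"
 have dc: "ALL t. (?c1 has_real_derivative 0) (at t)" "ALL t. (?c2 has_real_derivative 0) (at t)"
  by(auto intro!: derivative_eq_intros y simp: algebra_simps power2_eq_square)
 have 1: "?c1 t = ?c1 a" "?c2 t = ?c2 a"
  by(rule DERIV_isconst_all[OF dc(1)], rule DERIV_isconst_all[OF dc(2)])
 define P Q where "P = sin (s*(t - a))" and "Q = cos (s*(t - a))"
 have PQ: "P\<^sup>2 + Q\<^sup>2 = 1" by(simp add: P_def Q_def)
 have "s*y t = s*y t*(P\<^sup>2 + Q\<^sup>2)" by(simp add: PQ)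
 also have "... = (y' t*Q + s*y t*P)*P - (y' t*P - s*y t*Q)*Q"
  by(simp add: power2_eq_square algebra_simps)
 also have "... = y' a*P" using 1 by(simp add: P_def[symmetric] Q_def[symmetric] a)
 finally have "s*y t = y' a * sin (s*(t - a))" by(simp add: P_def)
 thus ?thesis using s by(simp add: field_simps)
qed

section \<open>The equality case and the conjugate radius in constant curvature\<close>

context complete_riemannian
begin

text \<open>Equality gives the curvature at interior times of the geodesic only, while
  \<open>w\<close> sits at time 0; continuity of the defect along the orbit closes the gap. For a
  general \<open>xi\<close> the part along the velocity is split off, as it contributes nothing to
  the curvature.\<close>

lemma mean_equality_defect:
 assumes w: "w : punctured" and nc: "no_conj r" and r: "0 < r" and c: "c : A" "w : tube c"
  and eq: "mean r Ricp w = mean r Ricm w + cst r"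
 shows "defect ((pi/r)\<^sup>2) c xi (bchart c w) = 0"
proof -
 have tm: "w : TM" "0 < speed w" using w by(auto simp: punctured_def)
 let ?kap = "(pi/r)\<^sup>2" and ?S = "geo w -` cdom c"
 let ?h = "%t. defect ?kap c xi (state c (geo w) t)"
 note gd = geo(1)[OF tm(1)]
 have oS: "open ?S" by(rule curve_open[OF geodesic_curve[OF gd] c(1)])
 have S0: "0 : ?S" using c(2) geo(2)[OF tm(1)] by(simp add: tube_def)
 have sc: "cts ?S (state c (geo w))"
  by(rule continuous_at_imp_continuous_on, rule ballI, rule has_vector_derivative_continuous[OF state_deriv[OF gd c(1)]]) simp
 have "cts ?S ?h"
  by(rule continuous_on_compose2[OF defect_continuous[OF c(1)] sc]) (use state_Om in blast)
 hence "isCont ?h 0" using oS S0 by(simp add: continuous_on_eq_continuous_at)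
 hence "(?h \<longlongrightarrow> ?h 0) (at 0)" by(simp add: isCont_def)
 hence lim: "(?h \<longlongrightarrow> ?h 0) (at_right 0)" by(rule tendsto_within_subset) simp
 have z: "?h t = 0" if t: "t : ?S" "0 < t" "t < r/speed w" for t
 proof -
  let ?u = "t * speed w"
  obtain p v where pv: "(p, v) = flow t w" by(metis surj_pair)
  have p: "p : car" "v : TS p" using flow_TM[OF tm(1), of t] pv by(auto simp: TM_def)
  have cp: "p : cdom c" using t(1) pv by(simp add: flow_def)
  have x: "cmap c p : V c" using cp by simp
  have st: "state c (geo w) t = join (cmap c p) (v c)" using pv by(simp add: state_def flow_def)
  let ?x = "tvec A c p xi"
  have xt: "?x : TS p" by(rule tvec_tangent[OF c(1) cp])
  have "speed (p, v) = speed w" unfolding pv by(rule speed_flow[OF tm(1)])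
  hence vv: "g p v v ~= 0" using tm(2) by(auto simp: speed_def)
  \<comment> \<open>The coefficient of the orthogonal projection onto \<open>v\<close>.\<close>
  define a where "a = g p ?x v/g p v v"
  have avt: "(%c. a *R v c) : TS p" by(rule tangent_scale[OF p(2)])
  define e where "e = (%c. ?x c - a *R v c)"
  have et: "e : TS p" unfolding e_def by(rule tangent_diff[OF xt avt])
  have gl: "linear (%ze. Gm c (cmap c p) ze (v c))" using Gm_bilinear by(simp add: bilinear_def)
  have gx: "g p ?x v = Gm c (cmap c p) xi (v c)" using g_coord[OF c(1) cp xt p(2)] by(simp add: tvec_coord[OF c(1) cp])
  have gv: "g p v v = Gm c (cmap c p) (v c) (v c)" by(rule g_coord[OF c(1) cp p(2) p(2)])
  have ec: "e c = xi - a *R v c" by(simp add: e_def tvec_coord[OF c(1) cp])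
  have "g p e v = g p ?x v - a*g p v v"
   unfolding g_coord[OF c(1) cp et p(2)] ec linear_diff[OF gl] linear_scale[OF gl] gx gv by simp
  hence "g p e v = 0" using vv by(simp add: a_def)
  moreover have "?u : {0<..<r}" using t(2,3) tm(2) by(simp add: field_simps)
  moreover have "(p, v) = flow (?u/speed w) w" using pv tm(2) by simp
  ultimately have cv: "curv p e v v = (%c. (?kap*g p v v) *R e c)"
   using mean_le(2)[OF w nc r eq _ _ et] by blast
  have "cc c (cmap c p) (xi - a *R v c) (v c) (v c) = (?kap*g p v v) *R (xi - a *R v c)"
   using fun_cong[OF cv, of c] unfolding curvature_coord[OF c(1) cp] ec .
  moreover have "cc c (cmap c p) (v c) (v c) (v c) = 0" by(simp add: curv_coord_eq)
  ultimately have "cc c (cmap c p) xi (v c) (v c) = (?kap*g p v v) *R (xi - a *R v c)"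
   by(simp add: linear_diff[OF curv_linear(1)[OF c(1) x]] linear_scale[OF curv_linear(1)[OF c(1) x]])
  also have "... = ?kap *R (g p v v *R xi - g p ?x v *R v c)"
   using vv by(simp add: a_def scaleR_right_diff_distrib)
  finally show ?thesis unfolding st defect_def by(simp add: gx gv)
 qed
 have "\<forall>\<^sub>F t in at_right 0. ?h t = 0"
 proof -
  obtain d where d: "d > 0" "ball 0 d <= ?S" using oS S0 openE by blast
  have "\<forall>\<^sub>F t in at_right 0. t : {0<..<min d (r/speed w)}"
   by(rule eventually_at_right_real) (use d r tm in simp)
  thus ?thesis
  proof(rule eventually_mono)
   fix t assume t: "t : {0<..<min d (r/speed w)}"
   hence "t : ball 0 d" by(simp add: dist_real_def)
   hence "t : ?S" using d(2) by blast
   thus "?h t = 0" using z[of t] t by simp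
  qed
 qed
 hence "(?h \<longlongrightarrow> 0) (at_right 0)" by(rule tendsto_eventually)
 with lim have "?h 0 = 0" by(intro tendsto_unique[OF _ lim]) simp_all
 moreover have "state c (geo w) 0 = bchart c w" using geo[OF tm(1)] by(simp add: state_def bchart_def)
 ultimately show ?thesis by simp
qed

text \<open>The vectors in the open ball with nonzero defect form an open set in bundle coordinates.
  It is a null set because equality holds almost everywhere and the density is positive, so it is
  empty. Homogeneity extends this to vectors of any length.\<close>

lemma constant_curvature_of_equality:
 assumes nc: "no_conj r" and r: "0 < r"
  and ae: "AE w in Lam. w : punctured --> mean r Ricp w = mean r Ricm w + cst r"
 shows "constant_sectional_curvature A g ((pi/r)\<^sup>2)"
proof(rule constant_curvature_of_defect)
 let ?kap = "(pi/r)\<^sup>2"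
 fix c xi z assume c: "c : A" and z: "z : Om c"
 \<comment> \<open>The strict bounds on the squared length make \<open>N\<close> open and its
   vectors punctured.\<close>
 define N where "N = {z : Om c. Gm c (lft z) (rgt z) (rgt z) : {0<..<1} & defect ?kap c xi z ~= 0}"
 have "open ((Om c Int (%z. Gm c (lft z) (rgt z) (rgt z)) -` {0<..<1}) Int (Om c Int defect ?kap c xi -` (- {0})))"
  by(intro open_Int continuous_open_preimage[OF Ck_on_continuous[OF Gm_smooth[OF c, of 0]] open_Om[OF c]]
   continuous_open_preimage[OF defect_continuous[OF c] open_Om[OF c]]) auto
 moreover have "(Om c Int (%z. Gm c (lft z) (rgt z) (rgt z)) -` {0<..<1}) Int (Om c Int defect ?kap c xi -` (- {0})) = N"
  by(auto simp: N_def)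
 ultimately have oN: "open N" by simp
 let ?B = "{w : tube c. bchart c w : N}"
 have B: "?B : sets TMs" by(rule tube_sets_preimage[OF c]) (use oN in simp)
 have "w \<notin> ?B" if w: "w : punctured --> mean r Ricp w = mean r Ricm w + cst r" for w
 proof
  assume wB: "w : ?B"
  hence t: "w : tube c" "bchart c w : Om c" and N: "bchart c w : N" by(auto simp: N_def)
  have "speed w = sqrt (Gm c (lft (bchart c w)) (rgt (bchart c w)) (rgt (bchart c w)))"
   using speed_unchart[OF c t(2)] by(simp add: unchart_bchart[OF c t(1)])
  hence "w : punctured" using N t(1) by(simp add: punctured_def N_def tube_def)
  hence "defect ?kap c xi (bchart c w) = 0" using mean_equality_defect[OF _ nc r c t(1)] w by blast
  thus False using N by(simp add: N_def)
 qed
 hence "AE w in Lam. w \<notin> ?B" using ae by(rule_tac AE_mp[OF ae]) (auto intro!: AE_I2)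
 hence "(\<integral>\<^sup>+w. chi ?B w*chi (tube c) w \<partial>Lam) = 0"
  using B tube_sets[OF c] by(subst nn_integral_0_iff_AE) (auto simp: measurable_Lam elim!: eventually_mono split: split_indicator)
 hence "(LB z. chi ?B (unchart c z)*mden c z) = 0"
  by(subst (asm) nn_integral_Lam_chart[OF c]) (use B in simp_all)
 moreover have "chi ?B (unchart c z)*mden c z = chi N z*mden c z" for z
  using unchart_tube[OF c] bchart_unchart[OF c] by(auto simp: mden_def split: split_indicator)
 ultimately have "(LB z. chi N z*mden c z) = 0" by simp
 hence "AE z in lborel. chi N z*mden c z = 0"
  using oN mden_measurable[OF c] by(subst (asm) nn_integral_0_iff_AE) simp_all
 hence "AE z in lborel. z \<notin> N"
 proof(rule AE_mp, intro AE_I2 impI notI)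
  fix z assume "chi N z*mden c z = 0" and zN: "z : N"
  moreover have "0 < det (gr c (lft z))" using gram_det_pos[OF c] zN by(simp add: N_def Om_def)
  ultimately show False by(simp add: mden_def N_def)
 qed
 hence "N : null_sets lborel" using oN by(simp add: AE_iff_null_sets)
 hence "negligible N" by(simp add: negligible_iff_null_sets null_sets_completionI)
 hence Ne: "N = {}" using oN open_not_negligible by blast
 have x: "lft z : V c" using z by(simp add: Om_def)
 let ?v = "rgt z" and ?x = "lft z"
 show "defect ?kap c xi z = 0"
 proof(cases "?v = 0")
  case True
  thus ?thesis
   using linear_0[OF curv_linear(2)[OF c x]] by(simp add: defect_def Gm_def)
 next
  case False
  have q: "0 < Gm c ?x ?v ?v" by(rule Gm_pos[OF c x False])
  define a where "a = 1/sqrt (2*Gm c ?x ?v ?v)"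
  have a: "a ~= 0" using q by(simp add: a_def)
  have "Gm c ?x (a *R ?v) (a *R ?v) = a\<^sup>2*Gm c ?x ?v ?v"
   by(simp add: Gm_def matrix_vector_mult_scaleR power2_eq_square)
  also have "... = 1/2" using q by(simp add: a_def power_divide)
  finally have "defect ?kap c xi (join ?x (a *R ?v)) = 0"
   using Ne x by(auto simp: N_def Om_def)
  thus ?thesis using a by(simp add: defect_scale[OF c x])
 qed
qed

text \<open>In a parallel frame the Jacobi equation decouples: the component along the velocity is
  affine in time, the others are sines of frequency \<open>sqrt kap\<close>. A nonzero component
  with two zeros must be of the second kind, and its zeros are at least \<open>pi/sqrt kap\<close>
  apart.\<close>

lemma constant_curvature_no_conj:
 assumes cc: "constant_sectional_curvature A g kap" and k: "0 < kap"
 shows "no_conj (pi/sqrt kap)"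
 unfolding no_conj_def
proof(intro allI impI, elim conjE)
 fix ga a b assume geo: "geodesic A g ga" and u: "unit_speed A g ga" and cj: "conjugate_along A g ga a b"
 note s = geodesic_curve[OF geo]
 let ?s = "sqrt kap"
 have s0: "0 < ?s" using k by simp
 obtain J where J: "jacobi_field A g ga J" "J a = (%_. 0)" "J b = (%_. 0)" "EX t. J t ~= (%_. 0)" and ab: "a ~= b"
  using cj unfolding conjugate_along_def by blast
 obtain t0 where t0: "J t0 ~= (%_. 0)" using J(4) by blast
 obtain i0 :: 'n where True by blast
 obtain E where E: "par_frame ga E" "E i0 = vel ga" using velocity_frame_exists[OF geo u, of i0] by blast
 let ?y = "%t. \<chi> i. g (ga t) (J t) (E i t)"
 obtain y1 where y: "ALL t. (?y hvd y1 t) (at t)" "ALL t. (y1 hvd - (Rm ga E t *v ?y t)) (at t)"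
  using frame_of_jacobi[OF s E(1) J(1)] by blast
 have o: "orthonormal (ga t) (%i. E i t)" for t using E(1) by(simp add: par_frame_def)
 have Jt: "J t : TS (ga t)" for t using J(1) by(simp add: jacobi_field_def smooth_field_along_def)
 have "EX i. ?y t0 $ i ~= 0"
 proof(rule ccontr)
  assume "~ (EX i. ?y t0 $ i ~= 0)"
  hence "J t0 = (%_. 0)" using orthonormal_expand[OF curve_carrier[OF s] o Jt, of t0] by simp
  thus False using t0 by simp
 qed
 then obtain i where i: "?y t0 $ i ~= 0" by blast
 have z: "?y a $ i = 0" "?y b $ i = 0"
  using J(2,3) g_zero[OF curve_carrier[OF s] orthonormal_tangent[OF o]] by simp_all
 have d1: "((%t. ?y t $ i) has_real_derivative y1 t $ i) (at t)" for t
  using bounded_linear.has_vector_derivative[OF bounded_linear_vec_nth y(1)[rule_format]]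
  by(simp add: has_real_derivative_iff_has_vector_derivative)
 have d2: "((%t. y1 t $ i) has_real_derivative - (kap *R (?y t - ?y t $ i0 *R axis i0 1)) $ i) (at t)" for t
  using bounded_linear.has_vector_derivative[OF bounded_linear_vec_nth y(2)[rule_format, of t], of i]
  unfolding constant_curvature_Rm[OF geo u E cc] by(simp add: has_real_derivative_iff_has_vector_derivative)
 show "pi / ?s <= \<bar>a - b\<bar>"
 proof(cases "i = i0")
  case True
  have "((%t. y1 t $ i) has_real_derivative 0) (at t)" for t using d2[of t] True by simp
  hence c: "y1 t $ i = y1 a $ i" for t by(intro DERIV_isconst_all) simp
  have "((%t. ?y t $ i - y1 a $ i*(t - a)) has_real_derivative 0) (at t)" for t
   using d1[of t] c[of t] by(auto intro!: derivative_eq_intros)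
  hence "?y t $ i - y1 a $ i*(t - a) = ?y a $ i - y1 a $ i*(a - a)" for t
   by(intro DERIV_isconst_all) simp
  hence l: "?y t $ i = y1 a $ i*(t - a)" for t using z(1) by simp
  hence "y1 a $ i = 0" using z(2) ab by simp
  thus ?thesis using l[of t0] i by simp
 next
  case False
  have d2': "((%t. y1 t $ i) has_real_derivative - (?s\<^sup>2*?y t $ i)) (at t)" for t
   using d2[of t] False k by(simp add: axis_def)
  have sol: "?y t $ i = y1 a $ i / ?s * sin (?s*(t - a))" for t
   by(rule harmonic_solution[OF s0 d1 d2' z(1)])
  have "y1 a $ i ~= 0" using sol[of t0] i by auto
  hence "sin (?s*(b - a)) = 0" using sol[of b] z(2) s0 by simp
  then obtain m :: int where m: "?s*(b - a) = real_of_int m*pi" by(auto simp: sin_zero_iff_int2)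
  have "m ~= 0" using m ab s0 by auto
  hence "1*pi <= \<bar>real_of_int m\<bar> * pi" by(intro mult_right_mono) auto
  also have "... = ?s*\<bar>a - b\<bar>" using arg_cong[OF m, of abs] s0 by(simp add: abs_mult abs_minus_commute)
  finally show ?thesis using s0 by(simp add: field_simps)
 qed
qed

text \<open>The upper bound comes from the Jacobi field \<open>sin (sqrt kap * t)\<close> times a
  parallel field orthogonal to the velocity; such a field exists because the dimension is at least
  2.\<close>

lemma constant_curvature_conjugate_radius:
 assumes cc: "constant_sectional_curvature A g kap" and k: "0 < kap" and dim: "2 <= CARD('n)"
 shows "conjugate_radius A g = ereal (pi/sqrt kap)"
proof(rule antisym)
 show "ereal (pi/sqrt kap) <= conjugate_radius A g"
  unfolding le_conjugate_radius_iff by(rule constant_curvature_no_conj[OF cc k])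
 let ?s = "sqrt kap"
 have s0: "0 < ?s" using k by simp
 obtain p where p: "p : car" using atlas by(auto simp: oriented_smooth_atlas_def)
 obtain v where v: "v : TS p" "g p v v = 1" using unit_tangent_exists[OF p] by blast
 have w: "(p, v) : TM" using p v by(simp add: TM_def)
 let ?ga = "geo (p, v)"
 note gd = geo[OF w]
 note s = geodesic_curve[OF gd(1)]
 have u: "unit_speed A g ?ga" unfolding unit_speed_def using geodesic_speed[OF gd(1)] gd v by simp
 obtain i0 i1 :: 'n where i: "i1 ~= i0"
  by(metis (full_types) UNIV_I card_2_iff' card_le_Suc0_iff_eq dim finite numeral_2_eq_2 not_less_eq_eq)
 obtain E where E: "par_frame ?ga E" "E i0 = vel ?ga" using velocity_frame_exists[OF gd(1) u, of i0] by blast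
 let ?y = "%t. sin (?s*t) *R (axis i1 1 :: real^'n)" and ?y1 = "%t. (?s*cos (?s*t)) *R (axis i1 1 :: real^'n)"
 have y: "(?y hvd ?y1 t) (at t)" for t
 proof -
  have "((%t. sin (?s*t)) has_real_derivative ?s*cos (?s*t)) (at t)" by(auto intro!: derivative_eq_intros)
  from has_vector_derivative_scaleR[OF this has_vector_derivative_const[of "axis i1 1 :: real^'n"]] show ?thesis by simp
 qed
 have y1: "(?y1 hvd - (Rm ?ga E t *v ?y t)) (at t)" for t
 proof -
  have "((%t. ?s*cos (?s*t)) has_real_derivative - (kap * sin (?s*t))) (at t)"
   using k by(auto intro!: derivative_eq_intros)
  from has_vector_derivative_scaleR[OF this has_vector_derivative_const[of "axis i1 1 :: real^'n"]]
  show ?thesis unfolding constant_curvature_Rm[OF gd(1) u E cc] using i by(simp add: axis_def)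
 qed
 let ?J = "%t c. \<Sum>i\<in>UNIV. ?y t $ i *R E i t c"
 have J: "jacobi_field A g ?ga ?J" by(rule jacobi_of_frame[OF s E(1) y y1])
 have Jv: "?J t = (%c. sin (?s*t) *R E i1 t c)" for t
  by(simp add: axis_def fun_eq_iff if_distrib[of "%x. _*x"] if_distribR if_distrib[of "%x. x *R _"] cong: if_cong)
 have o: "orthonormal (?ga t) (%i. E i t)" for t using E(1) by(simp add: par_frame_def)
 have "EX t. ?J t ~= (%_. 0)"
 proof(rule exI[of _ "pi/(2*?s)"], rule notI)
  assume "?J (pi/(2*?s)) = (%_. 0)"
  moreover have "sin (?s*(pi/(2*?s))) = 1" using s0 by simp
  ultimately have "E i1 (pi/(2*?s)) = (%_. 0)" unfolding Jv by(simp add: fun_eq_iff)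
  hence "g (?ga (pi/(2*?s))) (E i1 (pi/(2*?s))) (E i1 (pi/(2*?s))) = 0"
   using g_zero[OF curve_carrier[OF s] zero_tangent] by simp
  thus False using o[of "pi/(2*?s)"] by(simp add: orthonormal_def)
 qed
 moreover have "?J 0 = (%_. 0)" "?J (pi / ?s) = (%_. 0)" unfolding Jv using s0 by simp_all
 moreover have "0 ~= pi / ?s" using s0 by simp
 ultimately have cj: "conjugate_along A g ?ga 0 (pi / ?s)"
  unfolding conjugate_along_def using J by blast
 show "conjugate_radius A g <= ereal (pi / ?s)"
  unfolding conjugate_radius_def
 proof(rule Sup_least)
  fix x assume "x : {ereal r | r. ALL ga a b. geodesic A g ga & unit_speed A g ga & conjugate_along A g ga a b --> r <= \<bar>a - b\<bar>}"
  then obtain r where r: "x = ereal r" "ALL ga a b. geodesic A g ga & unit_speed A g ga & conjugate_along A g ga a b --> r <= \<bar>a - b\<bar>" by blast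
  have "r <= \<bar>0 - pi / ?s\<bar>" using r(2) gd(1) u cj by blast
  thus "x <= ereal (pi / ?s)" using r(1) s0 by simp
 qed
qed

text \<open>\<open>J_bound\<close> is converted by the factor \<open>n/ballvol\<close> of
  \<open>scalar_integral\<close> and divided by the volume. Equality is handed back to
  \<open>J_bound\<close> in the form in which its last part expects it.\<close>

lemma average_bound:
 assumes fin: "em0 vol (car) < \<infinity>" and Jm: "Jm < \<infinity>" and nc: "no_conj r" and r: "0 < r"
 defines "b \<equiv> real CARD('n)*(real CARD('n) - 1)*(pi/r)\<^sup>2"
 assumes pos: "0 < average_scalar_curvature A g"
 shows "average_scalar_curvature A g <= ereal b"
  and "average_scalar_curvature A g = ereal b ==> enn2real Jp - enn2real Jm = bound r"
proof -
 let ?\<nu> = "enn2real (em0 vol (car))"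
 note JB = J_bound[OF fin Jm nc r]
 define S where "S = CARD('n)/ballvol*(enn2real Jp - enn2real Jm)"
 have b0: "0 < ballvol" by(rule emeasure_ball(2))
 have "enn2ereal (em0 vol (car)) = ereal ?\<nu>"
  using fin by(metis enn2ereal_ennreal enn2real_nonneg ennreal_enn2real infinity_ennreal_def)
 hence av: "average_scalar_curvature A g = ereal S/ereal ?\<nu>"
  using scalar_integral[OF JB(1) Jm] by(simp add: average_scalar_curvature_def S_def vol_def[symmetric])
 have Sb: "S <= b*?\<nu>"
 proof -
  have "S <= CARD('n)/ballvol*bound r" unfolding S_def using JB(2) b0 by(intro mult_left_mono) auto
  also have "... = b*?\<nu>" using b0 by(simp add: bound_def b_def)
  finally show ?thesis .
 qed
 \<comment> \<open>For volume 0 the bound forces \<open>S \<le> 0\<close>, and the quotient in the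
   extended reals would be 0 or \<open>-\<infinity>\<close>; \<open>pos\<close> excludes
   both.\<close>
 have nu: "?\<nu> ~= 0"
 proof
  assume 0: "?\<nu> = 0"
  hence "S <= 0" using Sb by simp
  thus False using pos unfolding av 0 by(cases "S = 0") (auto simp: divide_ereal_def zero_ereal_def[symmetric])
 qed
 hence nu0: "0 < ?\<nu>" using enn2real_nonneg[of "em0 vol (car)"] by linarith
 have av': "average_scalar_curvature A g = ereal (S / ?\<nu>)" unfolding av using nu0 by simp
 show "average_scalar_curvature A g <= ereal b" unfolding av' using Sb nu0 by(simp add: field_simps)
 assume "average_scalar_curvature A g = ereal b"
 hence "S = b*?\<nu>" unfolding av' using nu0 by(simp add: field_simps)
 hence "CARD('n)/ballvol*(enn2real Jp - enn2real Jm) = CARD('n)/ballvol*bound r"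
  using b0 by(simp add: S_def bound_def b_def)
 thus "enn2real Jp - enn2real Jm = bound r" using b0 by simp
qed

end

theorem theorem6:
  fixes A :: "('a::{t2_space, second_countable_topology}, 'n::finite) chart set"
    and g :: "('a, 'n) metric"
    and k :: ereal
  assumes dim: "2 \<le> CARD('n)"
    and manifold: "oriented_smooth_atlas A"
    and metric: "riemannian_metric A g"
    and complete: "geodesically_complete A g"
    and finite_volume: "emeasure (riemannian_volume A g) (carrier A) < \<infinity>"
    and ricci_neg_finite: "(\<integral>\<^sup>+z. ennreal (ricci_neg A g z) \<partial>sphere_bundle_measure A g) < \<infinity>"
    and k_pos: "0 < k"
    and average_ge:
      "ereal (real CARD('n) * (real CARD('n) - 1)) * k \<le> average_scalar_curvature A g"
  shows
    "(conjugate_radius A g = 0 \<or>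
       (\<bar>average_scalar_curvature A g\<bar> \<noteq> \<infinity> \<and> \<bar>k\<bar> \<noteq> \<infinity> \<and>
        0 < conjugate_radius A g \<and>
        conjugate_radius A g \<le> ereal (pi / sqrt (real_of_ereal k)))) \<and>
     (\<bar>k\<bar> \<noteq> \<infinity> \<longrightarrow>
       (conjugate_radius A g = ereal (pi / sqrt (real_of_ereal k)) \<longleftrightarrow>
        constant_sectional_curvature A g (real_of_ereal k)))"
proof -
 interpret complete_riemannian A g
  by unfold_locales (rule manifold, rule metric, rule complete)
 define N where "N = real CARD('n)*(real CARD('n) - 1)"
 let ?av = "average_scalar_curvature A g" and ?c = "conjugate_radius A g"
 note average_ge = average_ge[folded N_def]
 have N: "0 < N" unfolding N_def using dim by(intro mult_pos_pos) auto
 have fin: "em0 vol (car) < \<infinity>" using finite_volume by(simp add: vol_def)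
 have Jm: "Jm < \<infinity>"
 proof(rule ccontr)
  assume "~ Jm < \<infinity>"
  hence "Jm = top" using less_top[of Jm] by auto
  thus False
   using ricci_neg_finite nn_integral_ricci_neg by(simp add: Jm_def[symmetric] Ricm_def[symmetric] ennreal_mult_top)
 qed
 have "0 < ereal N*k" using N k_pos by(simp add: ereal_zero_less_0_iff)
 hence av0: "0 < ?av" using average_ge by(rule less_le_trans)
 have up: "?av <= ereal (N*(pi/r)\<^sup>2)" if "0 < r" "ereal r <= ?c" for r
  using average_bound(1)[OF fin Jm _ that(1) av0, folded N_def] that(2) by(simp add: le_conjugate_radius_iff)
 have c0: "0 <= ?c"
  using le_conjugate_radius_iff[of 0] by(simp add: no_conj_def zero_ereal_def)
 have main: "\<bar>?av\<bar> ~= \<infinity> & \<bar>k\<bar> ~= \<infinity> & ?c <= ereal (pi/sqrt (real_of_ereal k))" if cp: "0 < ?c"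
 proof -
  \<comment> \<open>The conjugate radius may still be infinite at this point. All bounds are
    therefore derived for real numbers \<open>r\<close> below it, and density of the reals gives the
    bound for the supremum.\<close>
  obtain r0 where r0: "0 < r0" "ereal r0 <= ?c"
   using ereal_dense2[OF cp] by(auto simp: zero_ereal_def intro: less_imp_le)
  have avf: "\<bar>?av\<bar> ~= \<infinity>" using up[OF r0] av0 by auto
  have kf: "\<bar>k\<bar> ~= \<infinity>"
  proof
   assume "\<bar>k\<bar> = \<infinity>"
   hence "k = \<infinity>" using k_pos by auto
   hence "ereal N*k = \<infinity>" using N by simp
   thus False using average_ge avf by auto
  qed
  then obtain kr where kr: "k = ereal kr" "0 < kr" using k_pos by(cases k) auto
  have le: "r <= pi/sqrt kr" if r: "0 < r" "ereal r <= ?c" for r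
  proof -
   have "ereal (N*kr) <= ?av" using average_ge unfolding kr(1) by simp
   from order_trans[OF this up[OF r]] have "ereal (N*kr) <= ereal (N*(pi/r)\<^sup>2)" .
   hence "kr <= (pi/r)\<^sup>2" using N by simp
   hence "sqrt kr <= pi/r" using r(1) by(intro real_le_lsqrt) auto
   thus ?thesis using r(1) kr(2) by(simp add: field_simps)
  qed
  have "?c <= ereal (pi/sqrt kr)"
  proof(rule ccontr)
   assume "~ ?c <= ereal (pi/sqrt kr)"
   then obtain r where r: "ereal (pi/sqrt kr) < ereal r" "ereal r < ?c" using ereal_dense2 by(metis not_le)
   have "0 < pi/sqrt kr" using kr(2) by simp
   hence "0 < r" using r(1) by simp
   thus False using le[of r] r(1) less_imp_le[OF r(2)] by simp
  qed
  thus ?thesis using avf kf kr by simp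
 qed
 have "?c = ereal (pi/sqrt (real_of_ereal k)) \<longleftrightarrow> constant_sectional_curvature A g (real_of_ereal k)" if kf: "\<bar>k\<bar> ~= \<infinity>"
 proof -
  obtain kr where kr: "k = ereal kr" "0 < kr" using k_pos kf by(cases k) auto
  show ?thesis
  proof
   assume eq: "?c = ereal (pi/sqrt (real_of_ereal k))"
   define r where "r = pi/sqrt kr"
   have r: "0 < r" "ereal r <= ?c" using kr eq by(simp_all add: r_def)
   have k2: "(pi/r)\<^sup>2 = kr" using kr(2) by(simp add: r_def)
   have nc: "no_conj r" using r(2) by(simp add: le_conjugate_radius_iff)
   \<comment> \<open>At \<open>r = pi/sqrt kr\<close> the upper bound for the average is
     \<open>n (n - 1) kr\<close>, which is also the assumed lower bound; the chain of inequalities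
     is one of equalities.\<close>
   have "?av = ereal (N*(pi/r)\<^sup>2)"
    using up[OF r] average_ge unfolding k2 kr(1) by(intro antisym) simp_all
   hence "enn2real Jp - enn2real Jm = bound r" by(rule average_bound(2)[OF fin Jm nc r(1) av0, folded N_def])
   hence "constant_sectional_curvature A g ((pi/r)\<^sup>2)"
    by(intro constant_curvature_of_equality[OF nc r(1)] J_bound(3)[OF fin Jm nc r(1)])
   thus "constant_sectional_curvature A g (real_of_ereal k)" by(simp only: k2 kr(1) real_of_ereal.simps)
  next
   assume "constant_sectional_curvature A g (real_of_ereal k)"
   thus "?c = ereal (pi/sqrt (real_of_ereal k))"
    by(intro constant_curvature_conjugate_radius dim) (use kr in simp_all)
  qed
 qed
 thus ?thesis using main c0 by(cases "?c = 0") (auto simp: less_le)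
qed

end
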